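(* Let $d\ge 1$, $m>0$, $T>0$, and let $V\equiv V(x)$ be a real-valued continuous function defined on $\mathbb R^d$. Let $\{R_\hbar : \hbar\in(0,1]\}$ be a family of time-dependent density operators $t\mapsto R_\hbar(t)$ on $L^2(\mathbb R^d)$, defined for all $t\in[-T,T]$, continuous in $t$ for the weak operator topology, which are weak solutions of the von Neumann equation \[ i\hbar\,\partial_t R_\hbar(t)=\left[-\tfrac{\hbar^2}{2m}\Delta+V,\,R_\hbar(t)\right], \] and which satisfy, for some constant $C>0$ and all $\hbar\in(0,1]$, the bound \[ \sup_{|t|\le T}\mathrm{tr}_{L^2(\mathbb R^d)}\left(R_\hbar(t)^2\right)\le C^2(2\pi\hbar)^d . \] For each $\psi\in\mathcal S(\mathbb R^d)$ set \[ \rho_\psi[R_\hbar](t,x):=\int_{\mathbb R^d}W_\hbar[R_\hbar](t,x,\xi)\,\psi(\xi)\,d\xi . \] Then, for each $\psi\in\mathcal S(\mathbb R^d)$: (1) If $V\in L^\infty(\mathbb R^d)$, there exists $C'_T>0$ such that, for all $\hbar\in(0,1]$, \[ \|\rho_\psi[R_\hbar]\|_{H^{1/2}((-T,T)\times\mathbb R^d)}\le C'_T\,\|V\|_{L^\infty(\mathbb R^d)}\,\hbar^{-1/2}. \] (2) If $V$ is Lipschitz-continuous on $\mathbb R^d$, then \[ \sup_{0<\hbar\le 1}\|\rho_\psi[R_\hbar]\|_{H^{1/4}((-T,T)\times\mathbb R^d)}<\infty . \]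
   Context: A density operator on $L^2(\mathbb R^d)$ is a trace-class operator $R=R^*\ge 0$ with $\mathrm{tr}\,R=1$; its integral kernel in $L^2(\mathbb R^d\times\mathbb R^d)$ is denoted $R(X,Y)$. The Wigner transform of $R$ is \[ W_\hbar[R](x,\xi):=\tfrac1{(2\pi)^d}\int_{\mathbb R^d}e^{-i\xi\cdot y}\,R\left(x+\tfrac\hbar2y,\,x-\tfrac\hbar2y\right)dy \] (partial Fourier transform in $y$, in the $L^2$ sense), and $W_\hbar[R_\hbar](t,x,\xi):=W_\hbar[R_\hbar(t)](x,\xi)$. The Hamiltonian $-\tfrac{\hbar^2}{2m}\Delta+V$, where $V$ acts by multiplication, is assumed self-adjoint on $L^2(\mathbb R^d)$. That $R_\hbar$ is a weak solution of the von Neumann equation means that its integral kernel $R_\hbar(t,X,Y)$ satisfies \[ i\hbar\,\partial_tR_\hbar=-\tfrac{\hbar^2}{2m}(\Delta_X-\Delta_Y)R_\hbar+(V(X)-V(Y))R_\hbar \] in the sense of distributions on $(-T,T)\times\mathbb R^d\times\mathbb R^d$. $\mathcal S(\mathbb R^d)$ is the Schwartz space and $H^s$ is the $L^2$-based Sobolev space in the variables $(t,x)$.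
   Formalization: Part (1) is stated for V not identically zero: for V = 0 the bound would force ρ_ψ = 0, which fails for freely evolving Gaussian mixed states satisfying all assumptions. *)

theory Defs
  imports "HOL-Analysis.Analysis" "HOL-Probability.Essential_Supremum"
begin

section \<open>The space L2\<close>

text \<open>
  Elements of L2 are represented by Borel functions, and identities between them are
  understood almost everywhere; no quotient is taken.
\<close>

definition L2 :: "('a::euclidean_space \<Rightarrow> complex) set" where
  "L2 = {f. f \<in> borel_measurable borel \<and> integrable lborel (\<lambda>x. (cmod (f x))\<^sup>2)}"

definition L2_inner :: "('a::euclidean_space \<Rightarrow> complex) \<Rightarrow> ('a \<Rightarrow> complex) \<Rightarrow> complex" where
  "L2_inner f g = (\<integral>x. cnj (f x) * g x \<partial>lborel)"

definition L2_norm :: "('a::euclidean_space \<Rightarrow> complex) \<Rightarrow> real" where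
  "L2_norm f = sqrt (\<integral>x. (cmod (f x))\<^sup>2 \<partial>lborel)"

text \<open>Limit in L2 (unspecified if the sequence diverges, unique up to null sets otherwise).\<close>

definition L2_lim :: "(nat \<Rightarrow> 'a::euclidean_space \<Rightarrow> complex) \<Rightarrow> 'a \<Rightarrow> complex" where
  "L2_lim F = (SOME g. g \<in> L2 \<and> (\<forall>n. F n \<in> L2) \<and>
     (\<lambda>n. L2_norm (\<lambda>x. F n x - g x)) \<longlonglongrightarrow> 0)"

text \<open>The index set \<open>nat\<close> is no restriction, as L2 is separable and infinite-dimensional.\<close>

definition orthonormal_basis :: "(nat \<Rightarrow> 'a::euclidean_space \<Rightarrow> complex) \<Rightarrow> bool" where
  "orthonormal_basis e \<longleftrightarrow>
     (\<forall>n. e n \<in> L2) \<and>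
     (\<forall>j k. L2_inner (e j) (e k) = (if j = k then 1 else 0)) \<and>
     (\<forall>f\<in>L2. (\<forall>n. L2_inner (e n) f = 0) \<longrightarrow> (AE x in lborel. f x = 0))"


section \<open>Bounded operators, trace, density operators\<close>

text \<open>
  Only the values on L2 of a function of the following type matter.  Linearity and boundedness
  force it to respect almost everywhere equality.
\<close>

type_synonym 'a L2_op = "('a \<Rightarrow> complex) \<Rightarrow> 'a \<Rightarrow> complex"

definition bounded_op :: "'a::euclidean_space L2_op \<Rightarrow> bool" where
  "bounded_op A \<longleftrightarrow>
     (\<forall>f\<in>L2. A f \<in> L2) \<and>
     (\<forall>f\<in>L2. \<forall>g\<in>L2. \<forall>a b. AE x in lborel. A (\<lambda>y. a * f y + b * g y) x = a * A f x + b * A g x) \<and>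
     (\<exists>K. \<forall>f\<in>L2. L2_norm (A f) \<le> K * L2_norm f)"

definition hermitian_op :: "'a::euclidean_space L2_op \<Rightarrow> bool" where
  "hermitian_op A \<longleftrightarrow> (\<forall>f\<in>L2. \<forall>g\<in>L2. L2_inner f (A g) = L2_inner (A f) g)"

definition nonneg_op :: "'a::euclidean_space L2_op \<Rightarrow> bool" where
  "nonneg_op A \<longleftrightarrow> hermitian_op A \<and> (\<forall>f\<in>L2. 0 \<le> Re (L2_inner f (A f)))"

text \<open>\<open>B\<close> is the absolute value of \<open>A\<close>: \<open>B \<ge> 0\<close> and \<open>B * B = A\<^sup>* * A\<close>.\<close>

definition is_modulus :: "'a::euclidean_space L2_op \<Rightarrow> 'a L2_op \<Rightarrow> bool" where
  "is_modulus A B \<longleftrightarrow> bounded_op B \<and> nonneg_op B \<and>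
     (\<forall>f\<in>L2. \<forall>g\<in>L2. L2_inner (B f) (B g) = L2_inner (A f) (A g))"

definition trace_class :: "'a::euclidean_space L2_op \<Rightarrow> bool" where
  "trace_class A \<longleftrightarrow> bounded_op A \<and>
     (\<exists>B e. is_modulus A B \<and> orthonormal_basis e \<and>
        summable (\<lambda>n. Re (L2_inner (e n) (B (e n)))))"

text \<open>Meant for trace class operators, where the choice of the basis is immaterial.\<close>

definition op_trace :: "'a::euclidean_space L2_op \<Rightarrow> complex" where
  "op_trace A = (let e = (SOME e. orthonormal_basis e) in \<Sum>n. L2_inner (e n) (A (e n)))"

definition density_operator :: "'a::euclidean_space L2_op \<Rightarrow> bool" where
  "density_operator R \<longleftrightarrow> trace_class R \<and> nonneg_op R \<and> op_trace R = 1"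

definition wot_continuous_on :: "real set \<Rightarrow> (real \<Rightarrow> 'a::euclidean_space L2_op) \<Rightarrow> bool" where
  "wot_continuous_on I R \<longleftrightarrow>
     (\<forall>f\<in>L2. \<forall>g\<in>L2. continuous_on I (\<lambda>t. L2_inner f (R t g)))"

text \<open>The L2 integral kernel of a Hilbert-Schmidt operator, unique up to null sets.\<close>

definition integral_kernel :: "'a::euclidean_space L2_op \<Rightarrow> 'a \<times> 'a \<Rightarrow> complex" where
  "integral_kernel A = (SOME k. k \<in> L2 \<and>
     (\<forall>f\<in>L2. AE X in lborel. A f X = (\<integral>Y. k (X, Y) * f Y \<partial>lborel)))"


section \<open>Smooth functions, test functions, Schwartz functions\<close>

text \<open>\<open>pderivs [v\<^sub>1, \<dots>, v\<^sub>k] f\<close> is the iterated directional derivative of \<open>f\<close>.\<close>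

fun pderivs :: "'a::euclidean_space list \<Rightarrow> ('a \<Rightarrow> complex) \<Rightarrow> 'a \<Rightarrow> complex" where
  "pderivs [] f = f"
| "pderivs (v # vs) f = (\<lambda>x. frechet_derivative (pderivs vs f) (at x) v)"

definition smooth :: "('a::euclidean_space \<Rightarrow> complex) \<Rightarrow> bool" where
  "smooth f \<longleftrightarrow> (\<forall>vs. set vs \<subseteq> Basis \<longrightarrow> pderivs vs f differentiable_on UNIV)"

definition test_functions :: "'a::euclidean_space set \<Rightarrow> ('a \<Rightarrow> complex) set" where
  "test_functions \<Omega> = {\<phi>. smooth \<phi> \<and> (\<exists>K. compact K \<and> K \<subseteq> \<Omega> \<and> (\<forall>x. x \<notin> K \<longrightarrow> \<phi> x = 0))}"

definition schwartz :: "('a::euclidean_space \<Rightarrow> complex) set" where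
  "schwartz = {\<psi>. smooth \<psi> \<and>
     (\<forall>(k::nat) vs. set vs \<subseteq> Basis \<longrightarrow> (\<exists>B. \<forall>x. (1 + norm x) ^ k * cmod (pderivs vs \<psi> x) \<le> B))}"


section \<open>The Hamiltonian and the von Neumann equation\<close>

text \<open>
  An unbounded operator is identified with its graph.  The Hamiltonian has its natural
  (maximal) domain: all \<open>u\<close> in L2 such that the distribution
  \<open>- (h\<^sup>2 / 2m) \<Delta> u + V u\<close> is again in L2.
\<close>

definition hamiltonian ::
  "real \<Rightarrow> real \<Rightarrow> ('a::euclidean_space \<Rightarrow> real) \<Rightarrow> (('a \<Rightarrow> complex) \<times> ('a \<Rightarrow> complex)) set" where
  "hamiltonian h m V = {(u, v). u \<in> L2 \<and> v \<in> L2 \<and>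
     (\<forall>\<phi>\<in>test_functions UNIV.
        (\<integral>x. u x * (- complex_of_real (h\<^sup>2 / (2 * m)) * (\<Sum>b\<in>Basis. pderivs [b, b] \<phi> x)
                      + complex_of_real (V x) * \<phi> x) \<partial>lborel)
        = (\<integral>x. v x * \<phi> x \<partial>lborel))}"

definition graph_adjoint ::
  "(('a::euclidean_space \<Rightarrow> complex) \<times> ('a \<Rightarrow> complex)) set \<Rightarrow> (('a \<Rightarrow> complex) \<times> ('a \<Rightarrow> complex)) set" where
  "graph_adjoint G = {(u, w). u \<in> L2 \<and> w \<in> L2 \<and> (\<forall>(f, g)\<in>G. L2_inner u g = L2_inner w f)}"

definition self_adjoint ::
  "(('a::euclidean_space \<Rightarrow> complex) \<times> ('a \<Rightarrow> complex)) set \<Rightarrow> bool" where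
  "self_adjoint G \<longleftrightarrow>
     (\<forall>f\<in>L2. \<forall>\<epsilon>>0. \<exists>(u, v)\<in>G. L2_norm (\<lambda>x. f x - u x) < \<epsilon>) \<and> graph_adjoint G = G"

text \<open>
  Test functions depend on \<open>(t, X, Y)\<close> in the open set \<open>(-T, T) \<times> R\<^sup>d \<times> R\<^sup>d\<close>.
  The pairing is written as an iterated integral because kernels are chosen for each \<open>t\<close>
  separately; the inner integral does not depend on that choice.  The sign of the
  \<open>t\<close>-derivative comes from integration by parts.
\<close>

definition weak_von_neumann_solution ::
  "real \<Rightarrow> real \<Rightarrow> ('a::euclidean_space \<Rightarrow> real) \<Rightarrow> real \<Rightarrow> (real \<Rightarrow> 'a L2_op) \<Rightarrow> bool" where
  "weak_von_neumann_solution h m V T R \<longleftrightarrow>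
     (\<forall>\<phi>\<in>test_functions ({-T<..<T} \<times> UNIV).
        (LINT t:{-T<..<T}|lborel. \<integral>z. integral_kernel (R t) z *
            (- \<i> * complex_of_real h * pderivs [(1, 0)] \<phi> (t, z)) \<partial>lborel)
        = (LINT t:{-T<..<T}|lborel. \<integral>z. integral_kernel (R t) z *
            (- complex_of_real (h\<^sup>2 / (2 * m)) *
                 ((\<Sum>b\<in>Basis. pderivs [(0, b, 0), (0, b, 0)] \<phi> (t, z))
                  - (\<Sum>b\<in>Basis. pderivs [(0, 0, b), (0, 0, b)] \<phi> (t, z)))
             + complex_of_real (V (fst z) - V (snd z)) * \<phi> (t, z)) \<partial>lborel))"


section \<open>The Wigner transform\<close>

text \<open>
  The Fourier transforms below are extended to L2 as limits of the integrals over
  the balls of radius \<open>n\<close>.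
\<close>

definition wigner :: "real \<Rightarrow> 'a::euclidean_space L2_op \<Rightarrow> 'a \<times> 'a \<Rightarrow> complex" where
  "wigner h R = L2_lim (\<lambda>n (x, \<xi>).
     1 / complex_of_real ((2 * pi) ^ DIM('a)) *
     (LINT y:cball 0 (real n)|lborel.
        cis (- (\<xi> \<bullet> y)) * integral_kernel R (x + (h / 2) *\<^sub>R y, x - (h / 2) *\<^sub>R y)))"

definition rho :: "('a::euclidean_space \<Rightarrow> complex) \<Rightarrow> real \<Rightarrow> 'a L2_op \<Rightarrow> 'a \<Rightarrow> complex" where
  "rho \<psi> h R x = (\<integral>\<xi>. wigner h R (x, \<xi>) * \<psi> \<xi> \<partial>lborel)"


section \<open>Sobolev spaces of nonnegative order\<close>

definition fourier :: "('a::euclidean_space \<Rightarrow> complex) \<Rightarrow> 'a \<Rightarrow> complex" where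
  "fourier f = L2_lim (\<lambda>n \<zeta>. complex_of_real ((2 * pi) powr (- (real DIM('a) / 2))) *
     (LINT z:cball 0 (real n)|lborel. cis (- (\<zeta> \<bullet> z)) * f z))"

definition Hs :: "real \<Rightarrow> ('a::euclidean_space \<Rightarrow> complex) set" where
  "Hs s = {U \<in> L2. integrable lborel (\<lambda>\<zeta>. (1 + (norm \<zeta>)\<^sup>2) powr s * (cmod (fourier U \<zeta>))\<^sup>2)}"

definition Hs_norm :: "real \<Rightarrow> ('a::euclidean_space \<Rightarrow> complex) \<Rightarrow> real" where
  "Hs_norm s U = sqrt (\<integral>\<zeta>. (1 + (norm \<zeta>)\<^sup>2) powr s * (cmod (fourier U \<zeta>))\<^sup>2 \<partial>lborel)"

text \<open>
  The norm of \<open>u\<close> in \<open>H\<^sup>s(\<Omega>)\<close>, for \<open>\<Omega>\<close> open in time-space, is the infimum of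
  the norms of its extensions to the whole space; it is \<open>\<infinity>\<close> if \<open>u\<close> is not in
  \<open>H\<^sup>s(\<Omega>)\<close>.  Being an extension is expressed by an iterated almost everywhere
  quantifier, so that \<open>u\<close> may be given by an L2 class in \<open>x\<close> for every \<open>t\<close>, without
  a choice of jointly measurable representatives.
\<close>

definition sobolev_norm ::
  "real \<Rightarrow> (real \<times> 'a::euclidean_space) set \<Rightarrow> (real \<Rightarrow> 'a \<Rightarrow> complex) \<Rightarrow> ennreal" where
  "sobolev_norm s \<Omega> u =
     (INF U\<in>{U \<in> Hs s. AE t in lborel. AE x in lborel. (t, x) \<in> \<Omega> \<longrightarrow> U (t, x) = u t x}.
        ennreal (Hs_norm s U))"

definition Linf_norm :: "('a::euclidean_space \<Rightarrow> real) \<Rightarrow> ennreal" where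
  "Linf_norm V = esssup lborel (\<lambda>x. ennreal \<bar>V x\<bar>)"

end

theory Submission
  imports Defs "HOL-Probability.Characteristic_Functions" "HOL-Real_Asymp.Real_Asymp"
begin

text \<open>
  In the coordinates \<open>x = (X + Y) / 2\<close>, \<open>y = (X - Y) / h\<close> of \<open>wcoord\<close> the Wigner transform is the Fourier
  transform of the kernel in \<open>y\<close>; hence \<open>rho\<close> is, up to a constant, the pairing of the kernel with \<open>FT \<psi>\<close> in
  \<open>y\<close> (\<open>rho_eq\<close>), and the von Neumann equation becomes a transport equation with velocity \<open>v / m\<close> and source
  \<open>(V X - V Y) / h\<close> times the kernel.  So \<open>rho\<close> is a velocity average of a solution of a transport equation.

  In the frequencies \<open>\<tau>\<close>, \<open>k\<close> of time and space add \<open>a\<close> times the kernel to both sides and divide by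
  \<open>a + \<i> (\<tau> + k \<cdot> v / m)\<close> (\<open>averaged_identity\<close>).  By Cauchy-Schwarz the average of the kernel is then at most the
  square root of \<open>resolvent_weight\<close>, the integral of a decaying weight over \<open>a\<^sup>2 + (\<tau> + k \<cdot> v / m)\<^sup>2\<close>, times the L2 norm
  in \<open>v\<close> of \<open>a\<close> times the kernel plus the source.  The velocities that are resonant with \<open>(\<tau>, k)\<close> fill a slab of width
  \<open>a / |k|\<close>, which makes the weight of order \<open>1 / (a |k|)\<close> (\<open>resolvent_weight_bounds\<close>): this is the gain of regularity.
  The bound on the trace of \<open>R\<^sup>2\<close> is a bound on the Hilbert-Schmidt norm, that is, on the L2 norm of the kernel, and the
  factor \<open>h ^ d\<close> is the Jacobian of \<open>wcoord\<close>, so all L2 norms are bounded uniformly in \<open>h\<close>.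

  If \<open>V\<close> is bounded, the source is of order \<open>1 / h\<close>, and \<open>a = 1 / h\<close> yields half a derivative at the price
  \<open>h powr (-1/2)\<close> (\<open>regular_half\<close>); beyond the ends of the time interval the average is continued by damped
  free transport, which cancels the boundary terms.  If \<open>V\<close> is Lipschitz, \<open>(V X - V Y) / h\<close> is of order
  \<open>|y|\<close>; a factor \<open>y\<close> is a derivative in \<open>v\<close>, which falls on the multiplier and costs \<open>|k| / a\<close>.  Balancing with
  \<open>a\<^sup>2 = max 1 |k|\<close> leaves a quarter of a derivative uniformly in \<open>h\<close> (\<open>regular_quarter\<close>).

  The equation is known only in the sense of distributions.  It is tested against plane waves truncated at
  radius \<open>1 / sqrt c\<close> (\<open>von_Neumann_tested\<close>); the commutator with the truncation is of order \<open>sqrt c\<close> with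
  polynomial growth in the frequencies, and disappears when \<open>c\<close> tends to \<open>0\<close> (\<open>Sobolev_closure\<close>).
\<close>

text \<open>Integrals, integrability and measurability refer to Lebesgue measure and Borel sets throughout.\<close>

abbreviation (input) lebesgue_integral :: "('a::euclidean_space => 'b::{banach, second_countable_topology}) => 'b" (binder "LI " 10) where
 "LI x. f x == integral\<^sup>L lborel f"

abbreviation (input) nonneg_integral :: "('a::euclidean_space => ennreal) => ennreal" (binder "NI " 10) where
 "NI x. f x == nn_integral lborel f"

abbreviation (input) L1 :: "('a::euclidean_space => 'b::{banach, second_countable_topology}) => bool" where
 "L1 == integrable lborel"

abbreviation (input) BM :: "('a::topological_space => 'b::topological_space) set" where
 "BM == borel_measurable borel"

abbreviation (input) cor :: "real => complex" where
 "cor == complex_of_real"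

abbreviation (input) tends_to :: "(nat => 'a::topological_space) => 'a => bool" (infix "---->" 60) where
 "f ----> a == (f \<longlongrightarrow> a) sequentially"

abbreviation (input) enn :: "real => ennreal" where
 "enn == ennreal"

notation (input) inner (infix "\<cdot>" 70)

section \<open>Square-integrable functions\<close>

definition N2 :: "('a::euclidean_space => complex) => ennreal" where
 "N2 f = (NI x. enn ((cmod (f x))^2))"

lemma L2_iff: "f \<in> L2 \<longleftrightarrow> f \<in> BM \<and> N2 f < \<infinity>" unfolding L2_def N2_def integrable_iff_bounded by (auto simp: measurable_lborel1)

lemma L2_measurable [measurable_dest]: "f \<in> L2 ==> f \<in> BM" by (simp add: L2_def)

lemma L2_N2_finite: "f \<in> L2 ==> N2 f < \<infinity>" by (simp add: L2_iff)

lemma N2_L2_norm: "f \<in> L2 ==> N2 f = enn ((L2_norm f)^2)" unfolding L2_def L2_norm_def N2_def by (auto simp: nn_integral_eq_integral)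

lemma L2_norm_nonneg [simp]: "0 <= L2_norm f" by (simp add: L2_norm_def)

lemma N2_cong_AE: "(AE x in lborel. f x = g x) ==> N2 f = N2 g" unfolding N2_def by (rule nn_integral_cong_AE) auto

lemma N2_mono: "(!!x. cmod (f x) <= cmod (g x)) ==> N2 f <= N2 g" unfolding N2_def by (intro nn_integral_mono ennreal_leI power_mono) auto

lemma N2_cmult: "f \<in> BM ==> N2 (%x. c * f x) = enn ((cmod c)^2) * N2 f" unfolding N2_def by (subst nn_integral_cmult[symmetric])
   (auto simp: norm_mult power_mult_distrib ennreal_mult[symmetric])

lemma N2_bound:
 assumes "f \<in> BM" and "!!x. cmod (g x) <= B * cmod (f x)"
 shows "N2 g <= enn (B^2) * N2 f"
proof -
 have "N2 g <= N2 (%x. cor B * f x)"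
 proof (rule N2_mono)
  fix x
  have "B * cmod (f x) <= \<bar>B\<bar> * cmod (f x)" by (intro mult_right_mono) auto
  then show "cmod (g x) <= cmod (cor B * f x)" using assms(2)[of x] by (simp add: norm_mult)
 qed
 then show ?thesis using assms(1) by (simp add: N2_cmult)
qed

lemma cmod_add_sq: "(cmod (a + b))^2 <= 2 * (cmod a)^2 + 2 * (cmod b)^2"
proof -
 have "(cmod (a + b))^2 <= (cmod a + cmod b)^2" by (intro power_mono norm_triangle_ineq) auto
 also have "... <= 2 * (cmod a)^2 + 2 * (cmod b)^2" using zero_le_power2[of "cmod a - cmod b"] by (simp add: power2_eq_square algebra_simps)
 finally show ?thesis .
qed

lemma N2_add:
 assumes [measurable]: "f \<in> BM" "g \<in> BM"
 shows "N2 (%x. f x + g x) <= 2 * N2 f + 2 * N2 g"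
proof -
 have "N2 (%x. f x + g x) <= (NI x. 2 * enn ((cmod (f x))^2) + 2 * enn ((cmod (g x))^2))" unfolding N2_def
 proof (intro nn_integral_mono)
  fix x
  have "enn ((cmod (f x + g x))^2) <= enn (2 * (cmod (f x))^2 + 2 * (cmod (g x))^2)" by (intro ennreal_leI cmod_add_sq)
  then show "enn ((cmod (f x + g x))^2) <= 2 * enn ((cmod (f x))^2) + 2 * enn ((cmod (g x))^2)" by (simp add: ennreal_plus ennreal_mult)
 qed
 also have "... = 2 * N2 f + 2 * N2 g" unfolding N2_def by (subst nn_integral_add) (auto simp: nn_integral_cmult)
 finally show ?thesis .
qed

lemma N2_diff_commute: "N2 (%x. f x - g x) = N2 (%x. g x - f x)" unfolding N2_def by (simp add: norm_minus_commute)

lemma N2_triangle: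
 assumes [measurable]: "f \<in> BM" "g \<in> BM" "h \<in> BM"
 shows "N2 (%x. f x - h x) <= 2 * N2 (%x. f x - g x) + 2 * N2 (%x. g x - h x)" using N2_add[of "%x. f x - g x" "%x. g x - h x"] by simp

lemma N2_0_AE: "f \<in> BM ==> N2 f = 0 \<longleftrightarrow> (AE x in lborel. f x = 0)" unfolding N2_def by (subst nn_integral_0_iff_AE) auto

lemma L2_cmult: "f \<in> L2 ==> (%x. c * f x) \<in> L2" by (auto simp: L2_iff N2_cmult ennreal_mult_less_top)

lemma L2_add: assumes "f \<in> L2" "g \<in> L2" shows "(%x. f x + g x) \<in> L2"
proof -
 have "N2 (%x. f x + g x) <= 2 * N2 f + 2 * N2 g" using assms by (intro N2_add) auto
 also have "... < \<infinity>" using assms by (auto simp: L2_iff ennreal_mult_less_top)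
 finally show ?thesis using assms by (auto simp: L2_iff)
qed

lemma L2_diff: assumes "f \<in> L2" "g \<in> L2" shows "(%x. f x - g x) \<in> L2" using L2_add[OF assms(1) L2_cmult[OF assms(2), of "-1"]] by simp

lemma L2_zero: "(%x. 0) \<in> L2" by (simp add: L2_iff N2_def)

lemma L2_sum: "finite I ==> (!!i. i \<in> I ==> f i \<in> L2) ==> (%x. \<Sum>i\<in>I. f i x) \<in> L2" by (induction rule: finite_induct) (auto simp: L2_zero intro: L2_add)

lemma L2_cnj: "f \<in> L2 ==> (%x. cnj (f x)) \<in> L2" unfolding L2_def by (auto intro: borel_measurable_continuous_on[OF continuous_on_cnj[OF continuous_on_id]])

lemma L2_bound:
 assumes "f \<in> L2" and "g \<in> BM" and "!!x. cmod (g x) <= B * cmod (f x)"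
 shows "g \<in> L2"
proof -
 have "N2 g <= enn (B^2) * N2 f" using assms by (intro N2_bound) auto
 also have "... < \<infinity>" using assms(1) by (auto simp: L2_iff ennreal_mult_less_top)
 finally show ?thesis using assms(2) by (simp add: L2_iff)
qed

text \<open>Proved by scaling \<open>2ab \<le> l a\<^sup>2 + b\<^sup>2 / l\<close> optimally.\<close>

lemma Cauchy_Schwarz_nn:
 fixes f g :: "'b => real"
 assumes [measurable]: "f \<in> borel_measurable M" "g \<in> borel_measurable M"
 shows "(\<integral>\<^sup>+x. enn (\<bar>f x\<bar> * \<bar>g x\<bar>) \<partial>M)^2 <= (\<integral>\<^sup>+x. enn ((f x)^2) \<partial>M) * (\<integral>\<^sup>+x. enn ((g x)^2) \<partial>M)"
proof -
 define A where "A = (\<integral>\<^sup>+x. enn ((f x)^2) \<partial>M)"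
 define B where "B = (\<integral>\<^sup>+x. enn ((g x)^2) \<partial>M)"
 define I where "I = (\<integral>\<^sup>+x. enn (\<bar>f x\<bar> * \<bar>g x\<bar>) \<partial>M)"
 have zero: "I = 0" if "A = 0 \<or> B = 0"
 proof -
  have "AE x in M. f x * g x = 0" using that unfolding A_def B_def by (auto simp: nn_integral_0_iff_AE elim!: eventually_mono)
  then show ?thesis unfolding I_def by (subst nn_integral_0_iff_AE) (auto simp: abs_mult[symmetric])
 qed
 have "I^2 <= A * B"
 proof (cases "A = 0 \<or> B = 0")
  case True then show ?thesis using zero by auto
 next
  case False
  show ?thesis
  proof (cases "A = \<infinity> \<or> B = \<infinity>")
   case True then show ?thesis using False by (auto simp: ennreal_mult_top ennreal_top_mult)
  next
   case fin: False
   obtain a b where ab: "A = enn a" "B = enn b" "a > 0" "b > 0" using False fin by (cases A; cases B) (auto simp: less_le)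
   define l where "l = sqrt (b / a)"
   have l: "l > 0" "l^2 = b / a" using ab by (auto simp: l_def)
   have "I <= (\<integral>\<^sup>+x. enn (l / 2) * enn ((f x)^2) + enn (1 / (2 * l)) * enn ((g x)^2) \<partial>M)" unfolding I_def
   proof (intro nn_integral_mono)
    fix x
    have "0 <= (l * \<bar>f x\<bar> - \<bar>g x\<bar>)^2 / (2 * l)" using l by simp
    also have "... = l / 2 * (f x)^2 + 1 / (2 * l) * (g x)^2 - \<bar>f x\<bar> * \<bar>g x\<bar>" using l by (simp add: power2_eq_square field_simps)
    finally have "\<bar>f x\<bar> * \<bar>g x\<bar> <= l / 2 * (f x)^2 + 1 / (2 * l) * (g x)^2" by simp
    then have "enn (\<bar>f x\<bar> * \<bar>g x\<bar>) <= enn (l / 2 * (f x)^2 + 1 / (2 * l) * (g x)^2)" by (rule ennreal_leI)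
    also have "... = enn (l / 2) * enn ((f x)^2) + enn (1 / (2 * l)) * enn ((g x)^2)" using l by (simp add: ennreal_plus ennreal_mult[symmetric])
    finally show "enn (\<bar>f x\<bar> * \<bar>g x\<bar>) <= enn (l / 2) * enn ((f x)^2) + enn (1 / (2 * l)) * enn ((g x)^2)" .
   qed
   also have "... = enn (l / 2) * A + enn (1 / (2 * l)) * B" unfolding A_def B_def by (subst nn_integral_add) (auto simp: nn_integral_cmult)
   also have "... = enn (l / 2 * a + 1 / (2 * l) * b)" using ab l by (simp add: ennreal_plus ennreal_mult[symmetric])
   also have "l / 2 * a + 1 / (2 * l) * b = l * a"
   proof -
    have "l^2 * a = b" using l(2) ab by simp
    then have "l * (l * a) = b" by (simp only: power2_eq_square mult.assoc)
    then show ?thesis using l(1) by (simp add: field_simps)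
   qed
   finally have "I^2 <= (enn (l * a))^2" by (rule power_mono) simp
   also have "... = enn ((l * a)^2)" using l ab by (simp add: ennreal_power)
   also have "(l * a)^2 = a * b" 
   proof -
    have "(l * a)^2 = l^2 * a * a" by (simp add: power2_eq_square)
    then show ?thesis using l(2) ab by simp
   qed
   finally show ?thesis using ab by (simp add: ennreal_mult)
  qed
 qed
 then show ?thesis unfolding I_def A_def B_def .
qed

lemma Cauchy_Schwarz_L2_nn:
 assumes [measurable]: "f \<in> BM" "g \<in> BM"
 shows "(NI x. enn (cmod (f x * g x)))^2 <= N2 f * N2 g" using Cauchy_Schwarz_nn[of "%x. cmod (f x)" lborel "%x. cmod (g x)"] by (simp add: N2_def norm_mult)

lemma L2_mult_integrable:
 assumes "f \<in> L2" "g \<in> L2"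
 shows "L1 (%x. f x * g x)"
proof -
 have "(NI x. enn (cmod (f x * g x)))^2 < \<infinity>" using Cauchy_Schwarz_L2_nn[of f g] assms by (auto simp: L2_iff ennreal_mult_less_top intro: le_less_trans)
 then have "(NI x. enn (cmod (f x * g x))) < \<infinity>" by (auto simp: power_less_top_ennreal)
 then show ?thesis using assms by (auto simp: integrable_iff_bounded)
qed

lemma Cauchy_Schwarz_L2:
 assumes "f \<in> BM" "g \<in> BM"
 shows "enn ((cmod (LI x. f x * g x))^2) <= N2 f * N2 g"
proof (cases "L1 (%x. f x * g x)")
 case True
 have "enn (cmod (LI x. f x * g x)) <= (NI x. enn (cmod (f x * g x)))" by (rule integral_norm_bound_ennreal[OF True])
 then have "(enn (cmod (LI x. f x * g x)))^2 <= (NI x. enn (cmod (f x * g x)))^2" by (rule power_mono) simp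
 then show ?thesis using Cauchy_Schwarz_L2_nn[OF assms] by (simp add: ennreal_power)
qed (simp add: not_integrable_integral_eq)

lemma Cauchy_Schwarz_L2_norm:
 assumes "f \<in> L2" "g \<in> L2"
 shows "cmod (LI x. f x * g x) <= L2_norm f * L2_norm g"
proof -
 have "enn ((cmod (LI x. f x * g x))^2) <= enn ((L2_norm f * L2_norm g)^2)" using Cauchy_Schwarz_L2[of f g] assms by (auto simp: N2_L2_norm power_mult_distrib ennreal_mult)
 then have "(cmod (LI x. f x * g x))^2 <= (L2_norm f * L2_norm g)^2" by (subst (asm) ennreal_le_iff) auto
 then show ?thesis by (rule power2_le_imp_le) auto
qed

lemma L2_norm_cnj: "L2_norm (%x. cnj (f x)) = L2_norm f" by (simp add: L2_norm_def)

lemma Cauchy_Schwarz_L2_inner: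
 "f \<in> L2 ==> g \<in> L2 ==> cmod (L2_inner f g) <= L2_norm f * L2_norm g" using Cauchy_Schwarz_L2_norm[OF L2_cnj] by (simp add: L2_inner_def L2_norm_cnj)

text \<open>Fatou's lemma in the form used to recognise limits almost everywhere.\<close>

lemma nn_integral_tendsto_0_subseq_AE:
 fixes f :: "nat => 'b => ennreal"
 assumes [measurable]: "!!n. f n \<in> borel_measurable M" and lim: "(%n. \<integral>\<^sup>+x. f n x \<partial>M) ----> 0"
 obtains r :: "nat => nat" where "strict_mono r" "AE x in M. (%n. f (r n) x) ----> 0"
proof -
 have ex: "\<exists>n>k. (\<integral>\<^sup>+x. f n x \<partial>M) < enn ((1/2)^j)" for k j :: nat
 proof -
  have "eventually (%n. (\<integral>\<^sup>+x. f n x \<partial>M) < enn ((1/2)^j)) sequentially" using lim by (rule order_tendstoD) (simp add: ennreal_zero_less_one)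
  then have "eventually (%n. n > k \<and> (\<integral>\<^sup>+x. f n x \<partial>M) < enn ((1/2)^j)) sequentially" using eventually_gt_at_top[of k] by eventually_elim auto
  then show ?thesis by (auto simp: eventually_sequentially)
 qed
 define r where "r = rec_nat (SOME n. (\<integral>\<^sup>+x. f n x \<partial>M) < enn 1)
   (%j k. SOME n. n > k \<and> (\<integral>\<^sup>+x. f n x \<partial>M) < enn ((1/2)^(Suc j)))"
 have r0: "(\<integral>\<^sup>+x. f (r 0) x \<partial>M) < enn ((1/2)^0)" unfolding r_def using someI_ex[of "%n. (\<integral>\<^sup>+x. f n x \<partial>M) < enn 1"] ex[of 0 0] by auto
 have rS: "r (Suc j) > r j \<and> (\<integral>\<^sup>+x. f (r (Suc j)) x \<partial>M) < enn ((1/2)^(Suc j))" for j using someI_ex[OF ex[of "r j" "Suc j"]] by (simp add: r_def)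
 have bd: "(\<integral>\<^sup>+x. f (r j) x \<partial>M) <= enn ((1/2)^j)" for j using r0 rS by (cases j) (auto intro: less_imp_le)
 have "(\<integral>\<^sup>+x. (\<Sum>j. f (r j) x) \<partial>M) = (\<Sum>j. \<integral>\<^sup>+x. f (r j) x \<partial>M)" by (rule nn_integral_suminf) simp
 also have "... <= (\<Sum>j. enn ((1/2)^j))" by (intro suminf_le bd) auto
 also have "... = enn (\<Sum>j. (1/2)^j)" by (intro suminf_ennreal2 summable_geometric) auto
 also have "... < \<infinity>" by simp
 finally have "AE x in M. (\<Sum>j. f (r j) x) ~= \<infinity>" by (intro nn_integral_PInf_AE) auto
 then have "AE x in M. (%j. f (r j) x) ----> 0"
 proof eventually_elim
  case (elim x)
  then have fin: "f (r j) x ~= \<infinity>" for j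
  proof -
   have "f (r j) x <= (\<Sum>j. f (r j) x)" using sum_le_suminf[of "%j. f (r j) x" "{j}"] by simp
   then show ?thesis using elim by (auto simp: top_unique)
  qed
  then have eq: "enn (enn2real (f (r j) x)) = f (r j) x" for j by (simp add: less_top)
  have "summable (%j. enn2real (f (r j) x))" by (intro summable_suminf_not_top) (auto simp: eq elim[simplified])
  then have "(%j. enn (enn2real (f (r j) x))) ----> enn 0" by (intro tendsto_ennrealI summable_LIMSEQ_zero)
  then show ?case by (simp add: eq)
 qed
 moreover have "strict_mono r" using rS by (simp add: strict_mono_Suc_iff)
 ultimately show ?thesis using that by blast
qed

text \<open>
 Riesz-Fischer.  Along a subsequence with \<open>N2\<close>-increments below \<open>4\<^sup>-\<^sup>j\<close>, the weighted sum
 \<open>\<Sum> 2\<^sup>j |increment|\<^sup>2\<close> is integrable, hence finite almost everywhere, so the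
 increments are eventually dominated by a geometric sequence.
\<close>

lemma L2_complete:
 fixes F :: "nat => 'a::euclidean_space => complex"
 assumes F: "!!n. F n \<in> L2"
  and Cauchy: "!!\<epsilon>::real. \<epsilon> > 0 ==> \<exists>N. \<forall>m\<ge>N. \<forall>n\<ge>N. N2 (%x. F m x - F n x) <= enn \<epsilon>"
 shows "\<exists>g\<in>L2. (%n. N2 (%x. F n x - g x)) ----> 0"
proof -
 note [measurable] = L2_measurable[OF F]
 have "\<forall>j. \<exists>N. \<forall>m\<ge>N. \<forall>n\<ge>N. N2 (%x. F m x - F n x) <= enn ((1/4)^j)" using Cauchy by simp
 then obtain N where N: "!!j m n. m >= N j ==> n >= N j ==> N2 (%x. F m x - F n x) <= enn ((1/4)^j)" by metis
 define r where "r j = (\<Sum>i\<le>j. N i) + j" for j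
 have Nsum: "N j <= sum N {..j}" for j by (rule member_le_sum) auto
 have rN: "r j >= N j" "r (Suc j) >= N j" for j using Nsum[of j] by (auto simp: r_def)
 define d where "d j x = F (r (Suc j)) x - F (r j) x" for j x
 have [measurable]: "d j \<in> BM" for j unfolding d_def by simp
 have "(NI x. (\<Sum>j. enn (2^j) * enn ((cmod (d j x))^2))) = (\<Sum>j. enn (2^j) * N2 (d j))" unfolding N2_def by (subst nn_integral_suminf) (auto simp: nn_integral_cmult)
 also have "... <= (\<Sum>j. enn ((1/2)^j))"
 proof (intro suminf_le)
  fix j
  have "enn (2^j) * N2 (d j) <= enn (2^j) * enn ((1/4)^j)" unfolding d_def by (intro mult_left_mono N rN) auto
  also have "... = enn ((1/2)^j)" by (simp add: ennreal_mult[symmetric] power_mult_distrib[symmetric])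
  finally show "enn (2^j) * N2 (d j) <= enn ((1/2)^j)" .
 qed auto
 also have "... = enn (\<Sum>j. (1/2)^j)" by (intro suminf_ennreal2 summable_geometric) auto
 also have "... < \<infinity>" by simp
 finally have "AE x in lborel. (\<Sum>j. enn (2^j) * enn ((cmod (d j x))^2)) ~= \<infinity>" by (intro nn_integral_PInf_AE) auto
 then have conv: "AE x in lborel. convergent (%j. F (r j) x)"
 proof eventually_elim
  case (elim x)
  obtain K where K: "(\<Sum>j. enn (2^j) * enn ((cmod (d j x))^2)) = enn K" "K >= 0" using elim by (cases "(\<Sum>j. enn (2^j) * enn ((cmod (d j x))^2))") auto
  have bd: "cmod (d j x) <= sqrt K * (sqrt (1/2))^j" for j
  proof -
   have "enn (2^j) * enn ((cmod (d j x))^2) <= enn K" using sum_le_suminf[of "%j. enn (2^j) * enn ((cmod (d j x))^2)" "{j}"] K by simp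
   then have "2^j * (cmod (d j x))^2 <= K" using K(2) by (simp add: ennreal_mult[symmetric])
   then have "(cmod (d j x))^2 <= K * (1/2)^j" by (simp add: field_simps power_divide)
   also have "... = (sqrt K * (sqrt (1/2))^j)^2" using K(2) by (simp add: power_mult_distrib power_even_eq[symmetric] power_mult[symmetric] mult.commute[of j] power_mult)
   finally show ?thesis by (rule power2_le_imp_le) (simp add: K(2))
  qed
  have "summable (%j. sqrt K * (sqrt (1/2))^j)" by (intro summable_mult summable_geometric) (auto simp: real_sqrt_less_iff)
  then have "summable (%j. d j x)" by (rule summable_comparison_test[rotated]) (use bd in auto)
  then have "convergent (%n. \<Sum>j<n. d j x)" by (simp add: summable_iff_convergent)
  moreover have "(\<Sum>j<n. d j x) = F (r n) x - F (r 0) x" for n unfolding d_def using sum_lessThan_telescope[of "%j. F (r j) x" n] by simp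
  ultimately have "convergent (%n. F (r n) x - F (r 0) x)" by simp
  then have "convergent (%n. F (r n) x - F (r 0) x + F (r 0) x)" by (intro convergent_add convergent_const)
  then show ?case by simp
 qed
 define g where "g x = lim (%j. F (r j) x)" for x
 have [measurable]: "g \<in> BM" unfolding g_def by measurable
 have glim: "AE x in lborel. (%j. F (r j) x) ----> g x" using conv by eventually_elim (simp add: g_def convergent_LIMSEQ_iff)
 have bound: "N2 (%x. F n x - g x) <= enn ((1/4)^i)" if n: "n >= N i" for n i
 proof -
  have "N2 (%x. F n x - g x) = (NI x. liminf (%j. enn ((cmod (F n x - F (r j) x))^2)))" unfolding N2_def
  proof (rule nn_integral_cong_AE)
   show "AE x in lborel. enn ((cmod (F n x - g x))^2) = liminf (%j. enn ((cmod (F n x - F (r j) x))^2))" using glim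
   proof eventually_elim
    case (elim x)
    then have "(%j. enn ((cmod (F n x - F (r j) x))^2)) ----> enn ((cmod (F n x - g x))^2)" by (intro tendsto_ennrealI tendsto_intros)
    then show ?case by (intro lim_imp_Liminf[symmetric]) auto
   qed
  qed
  also have "... <= liminf (%j. N2 (%x. F n x - F (r j) x))" unfolding N2_def by (rule nn_integral_liminf) simp
  also have "... <= liminf (%j. enn ((1/4)^i))"
  proof (rule Liminf_mono)
   show "eventually (%j. N2 (%x. F n x - F (r j) x) <= enn ((1/4)^i)) sequentially" using eventually_ge_at_top[of i]
   proof eventually_elim
    case (elim j)
    then have "r j >= N i" unfolding r_def by (simp add: member_le_sum trans_le_add1)
    then show ?case using N n by blast
   qed
  qed
  also have "... = enn ((1/4)^i)" by (simp add: Liminf_const)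
  finally show ?thesis .
 qed
 have "g \<in> L2"
 proof -
  have "(%x. F (N 0) x - g x) \<in> L2" using bound[of 0 "N 0"] by (auto simp: L2_iff intro: le_less_trans)
  from L2_diff[OF F this, of "N 0"] show ?thesis by simp
 qed
 moreover have "(%n. N2 (%x. F n x - g x)) ----> 0"
 proof (rule tendsto_0_if_Limsup_eq_0_ennreal, rule antisym)
  show "limsup (%n. N2 (%x. F n x - g x)) <= 0"
  proof (rule ennreal_le_epsilon)
   fix e :: real assume "e > 0"
   obtain i where i: "(1/4::real)^i < e" using \<open>e > 0\<close> real_arch_pow_inv[of e "1/4"] by auto
   have "limsup (%n. N2 (%x. F n x - g x)) <= enn ((1/4)^i)" by (intro Limsup_bounded eventually_mono[OF eventually_ge_at_top[of "N i"]] bound)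
   then show "limsup (%n. N2 (%x. F n x - g x)) <= 0 + enn e" using order_trans[OF _ ennreal_leI[OF less_imp_le[OF i]]] by simp
  qed
 qed simp
 ultimately show ?thesis by blast
qed


section \<open>Integration over product spaces\<close>

lemma nn_integral_prod_fst:
 fixes f :: "'a::euclidean_space \<times> 'b::euclidean_space => ennreal"
 assumes "f \<in> BM"
 shows "(NI z. f z) = (NI x. NI y. f (x, y))" using lborel.nn_integral_fst[of f lborel] assms by (simp add: lborel_prod)

lemma nn_integral_prod_snd:
 fixes f :: "'a::euclidean_space \<times> 'b::euclidean_space => ennreal"
 assumes "f \<in> BM"
 shows "(NI z. f z) = (NI y. NI x. f (x, y))" using lborel_pair.nn_integral_snd[of f] assms by (simp add: lborel_prod)

lemma borel_prod_eq: "(borel :: ('a::euclidean_space \<times> 'b::euclidean_space) measure) = borel \<Otimes>\<^sub>M borel" by (simp add: borel_prod)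

lemma borel_measurable_fst [measurable]:
  "fst \<in> borel_measurable (borel :: ('a::euclidean_space \<times> 'b::euclidean_space) measure)"
 and borel_measurable_snd [measurable]:
  "snd \<in> borel_measurable (borel :: ('a::euclidean_space \<times> 'b::euclidean_space) measure)" unfolding borel_prod_eq by auto

lemma measurable_pair_sections [measurable (raw)]:
 fixes f :: "'a::euclidean_space \<times> 'b::euclidean_space => 'c::topological_space"
 assumes f: "f \<in> BM" and "g \<in> borel_measurable M" "h \<in> borel_measurable M"
 shows "(%x. f (g x, h x)) \<in> borel_measurable M"
proof -
 have "(%x. (g x, h x)) \<in> M \<rightarrow>\<^sub>M borel" unfolding borel_prod_eq using assms by simp
 from measurable_compose[OF this f] show ?thesis .
qed

lemma integral_prod_fst:
 fixes f :: "'a::euclidean_space \<times> 'b::euclidean_space => complex"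
 assumes "L1 f"
 shows "(LI z. f z) = (LI x. LI y. f (x, y))" using lborel_pair.integral_fst'[of f] assms by (simp add: lborel_prod)

lemma integral_prod_snd:
 fixes f :: "'a::euclidean_space \<times> 'b::euclidean_space => complex"
 assumes "L1 f"
 shows "(LI z. f z) = (LI y. LI x. f (x, y))" using lborel_pair.integral_snd[of "%x y. f (x, y)"] assms by (simp add: lborel_prod)

lemma integral_prod_swap:
 fixes f :: "'a::euclidean_space \<times> 'b::euclidean_space => complex"
 assumes "L1 f"
 shows "(LI x. LI y. f (x, y)) = (LI y. LI x. f (x, y))" using integral_prod_fst[OF assms] integral_prod_snd[OF assms] by simp

lemma AE_integrable_section_fst:
 fixes f :: "'a::euclidean_space \<times> 'b::euclidean_space => complex"
 assumes "L1 f"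
 shows "AE x in lborel. L1 (%y. f (x, y))" using lborel_pair.AE_integrable_fst'[of f] assms by (simp add: lborel_prod)

lemma integrable_section_integral_fst:
 fixes f :: "'a::euclidean_space \<times> 'b::euclidean_space => complex"
 assumes "L1 f"
 shows "L1 (%x. LI y. f (x, y))" using lborel_pair.integrable_fst'[of f] assms by (simp add: lborel_prod)

lemma nn_integral_tensor:
 fixes f :: "'a::euclidean_space => ennreal" and g :: "'b::euclidean_space => ennreal"
 assumes [measurable]: "f \<in> BM" "g \<in> BM"
 shows "(NI z. f (fst z) * g (snd z)) = (NI x. f x) * (NI y. g y)" by (subst nn_integral_prod_fst) (auto simp: nn_integral_cmult nn_integral_multc)

lemma integrable_tensor:
 fixes f :: "'a::euclidean_space => complex" and g :: "'b::euclidean_space => complex"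
 assumes "L1 f" "L1 g"
 shows "L1 (%z. f (fst z) * g (snd z))"
proof -
 have [measurable]: "f \<in> BM" "g \<in> BM" using assms by (auto dest: borel_measurable_integrable)
 have "(NI z. enn (cmod (f (fst z) * g (snd z))))
   = (NI x. enn (cmod (f x))) * (NI y. enn (cmod (g y)))" by (subst nn_integral_tensor[symmetric]) (auto simp: norm_mult ennreal_mult)
 also have "... < \<infinity>" using assms by (auto simp: integrable_iff_bounded ennreal_mult_less_top)
 finally show ?thesis by (auto simp: integrable_iff_bounded)
qed

lemma nn_integral_shift:
 fixes f :: "'a::euclidean_space => ennreal"
 assumes "f \<in> BM"
 shows "(NI x. f (a + x)) = (NI x. f x)"
proof -
 have "(NI x. f x) = (\<integral>\<^sup>+x. f x \<partial>distr lborel borel ((+) a))" by (simp add: lborel_distr_plus)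
 also have "... = (NI x. f (a + x))" using assms by (subst nn_integral_distr) auto
 finally show ?thesis by simp
qed

lemma integral_shift:
 fixes f :: "'a::euclidean_space => complex"
 assumes "f \<in> BM"
 shows "(LI x. f (a + x)) = (LI x. f x)"
proof -
 have "(LI x. f x) = (\<integral>x. f x \<partial>distr lborel borel ((+) a))" by (simp add: lborel_distr_plus)
 also have "... = (LI x. f (a + x))" using assms by (subst integral_distr) auto
 finally show ?thesis by simp
qed

lemma nn_integral_affine:
 fixes f :: "'a::euclidean_space => ennreal"
 assumes [measurable]: "f \<in> BM" and "c ~= 0"
 shows "(NI x. f x) = enn (\<bar>c\<bar> ^ DIM('a)) * (NI x. f (a + c *\<^sub>R x))" by (subst lborel_affine[OF assms(2), of a])
   (simp add: nn_integral_density nn_integral_distr nn_integral_cmult)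

lemma nn_integral_reflect:
 fixes f :: "'a::euclidean_space => ennreal"
 assumes "f \<in> BM"
 shows "(NI x. f (a - x)) = (NI x. f x)" using nn_integral_affine[OF assms, of "-1" a] by simp


section \<open>The Plancherel inequality\<close>

definition FT :: "('a::euclidean_space => complex) => 'a => complex" where
 "FT f \<zeta> = (LI x. cis (- (\<zeta> \<cdot> x)) * f x)"

lemma cis_measurable [measurable]: "cis \<in> BM" unfolding cis_conv_exp by measurable

lemma FT_integrable:
 "L1 f ==> L1 (%x. cis (- (\<zeta> \<cdot> x)) * f x)" by (rule Bochner_Integration.integrable_bound[of _ f]) (auto simp: norm_mult dest: borel_measurable_integrable)

lemma FT_measurable [measurable]:
 assumes [measurable]: "f \<in> BM"
 shows "FT f \<in> BM" unfolding FT_def by measurable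

lemma FT_bound: "L1 f ==> cmod (FT f \<zeta>) <= (LI x. cmod (f x))" unfolding FT_def by (rule order_trans[OF integral_norm_bound]) (simp add: norm_mult)

lemma FT_add: "L1 f ==> L1 g ==> FT (%x. f x + g x) \<zeta> = FT f \<zeta> + FT g \<zeta>" unfolding FT_def by (simp add: distrib_left FT_integrable)

lemma FT_diff: "L1 f ==> L1 g ==> FT (%x. f x - g x) \<zeta> = FT f \<zeta> - FT g \<zeta>" unfolding FT_def by (simp add: right_diff_distrib FT_integrable)

lemma FT_cmult: "FT (%x. c * f x) \<zeta> = c * FT f \<zeta>" unfolding FT_def by (simp add: mult.left_commute)

lemma gauss_transform_real:
 assumes "\<epsilon> > 0"
 shows "(LI x. cis (t * x) * cor (exp (- (\<epsilon> * x)\<^sup>2 / 2)))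
    = cor (2 * pi * normal_density 0 \<epsilon> t)" (is "?L = _")
  and "L1 (%x. cis (t * x) * cor (exp (- (\<epsilon> * x)\<^sup>2 / 2)))"
proof -
 define f where "f u = cis ((t / \<epsilon>) * u) * cor (exp (- u\<^sup>2 / 2))" for u :: real
 have int_exp: "L1 (%u::real. exp (- u\<^sup>2 / 2))" using integrable_normal_density[of 1 0, THEN integrable_mult_right, of "sqrt (2 * pi)"] by (simp add: normal_density_def field_simps)
 have [measurable]: "f \<in> BM" unfolding f_def by measurable
 have int_f: "L1 f" by (rule Bochner_Integration.integrable_bound[OF int_exp]) (auto simp: f_def norm_mult)
 have "cor (exp (- ((t / \<epsilon>)^2) / 2)) = char std_normal_distribution (t / \<epsilon>)" by (simp add: char_std_normal_distribution)
 also have "... = (LI x. std_normal_density x *\<^sub>R cis ((t / \<epsilon>) * x))" unfolding char_def by (subst integral_density) (auto simp: cis_conv_exp normal_density_nonneg)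
 also have "... = (LI x. cor (1 / sqrt (2 * pi)) * f x)" by (intro Bochner_Integration.integral_cong)
    (auto simp: f_def std_normal_density_def scaleR_conv_of_real)
 also have "... = cor (1 / sqrt (2 * pi)) * (LI x. f x)" by simp
 finally have 1: "(LI x. f x) = cor (sqrt (2 * pi) * exp (- ((t / \<epsilon>)^2) / 2))" by (simp add: field_simps)
 have f_eps: "f (0 + \<epsilon> * x) = cis (t * x) * cor (exp (- (\<epsilon> * x)\<^sup>2 / 2))" for x using assms by (simp add: f_def)
 have "(LI x. f x) = \<epsilon> *\<^sub>R (LI x. f (0 + \<epsilon> * x))" using assms lborel_integral_real_affine[of \<epsilon> f 0] by simp
 then have 2: "(LI x. f x) = cor \<epsilon> * ?L" by (simp only: f_eps scaleR_conv_of_real)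
 have "?L = cor (sqrt (2 * pi) * exp (- ((t / \<epsilon>)^2) / 2)) / cor \<epsilon>" using 1 2 assms by (simp add: field_simps)
 also have "sqrt (2 * pi) * exp (- ((t / \<epsilon>)^2) / 2) / \<epsilon> = 2 * pi * normal_density 0 \<epsilon> t"
 proof -
  have "sqrt (2 * pi) * sqrt (2 * pi) = 2 * pi" by simp
  then have "2 * pi / (sqrt (2 * pi) * \<epsilon>) = sqrt (2 * pi) / \<epsilon>" using assms by (simp add: field_simps)
  then show ?thesis using assms by (simp add: normal_density_def real_sqrt_mult power_divide field_simps)
 qed
 then have "cor (sqrt (2 * pi) * exp (- ((t / \<epsilon>)^2) / 2)) / cor \<epsilon> = cor (2 * pi * normal_density 0 \<epsilon> t)" by (metis of_real_divide)
 finally show "?L = cor (2 * pi * normal_density 0 \<epsilon> t)" .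
 have "L1 (%x. f (0 + \<epsilon> * x))" using assms by (intro lborel_integrable_real_affine int_f) auto
 then show "L1 (%x. cis (t * x) * cor (exp (- (\<epsilon> * x)\<^sup>2 / 2)))" by (simp only: f_eps)
qed

text \<open>The Fourier transform of the Gaussian \<open>exp (-\<epsilon>\<^sup>2 |\<zeta>|\<^sup>2 / 2)\<close> factorises over the coordinates.\<close>

definition heat_kernel :: "real => 'a::euclidean_space => real" where
 "heat_kernel \<epsilon> u = (\<Prod>b\<in>Basis. 2 * pi * normal_density 0 \<epsilon> (u \<cdot> b))"

lemma heat_kernel_nonneg: "0 <= heat_kernel \<epsilon> u" unfolding heat_kernel_def by (intro prod_nonneg) (auto intro: normal_density_nonneg)

lemma heat_kernel_measurable [measurable]: "heat_kernel \<epsilon> \<in> BM" unfolding heat_kernel_def normal_density_def by measurable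

lemma nn_integral_heat_kernel:
 assumes "\<epsilon> > 0"
 shows "(\<integral>\<^sup>+u. enn (heat_kernel \<epsilon> u) \<partial>(lborel :: 'a::euclidean_space measure)) = enn ((2 * pi) ^ DIM('a))"
proof -
 interpret prob_space "density lborel (normal_density 0 \<epsilon>)" using assms by (rule prob_space_normal_density)
 have 1: "(NI u. enn (normal_density 0 \<epsilon> u)) = 1" using emeasure_space_1 by (simp add: emeasure_density)
 have "(NI (u::'a). enn (heat_kernel \<epsilon> u))
   = (NI (u::'a). (\<Prod>b\<in>Basis. enn (2 * pi) * enn (normal_density 0 \<epsilon> (u \<cdot> b))))" unfolding heat_kernel_def
  by (intro nn_integral_cong) (simp add: prod_ennreal normal_density_nonneg ennreal_mult[symmetric])
 also have "... = (\<Prod>b\<in>(Basis::'a set). NI x. enn (2 * pi) * enn (normal_density 0 \<epsilon> x))" by (rule nn_integral_lborel_prod) auto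
 also have "... = (\<Prod>b\<in>(Basis::'a set). enn (2 * pi))" by (intro prod.cong refl) (simp add: nn_integral_cmult 1)
 finally show ?thesis by (simp add: ennreal_power)
qed

lemma gauss_transform:
 fixes u :: "'a::euclidean_space"
 assumes "\<epsilon> > 0"
 shows "(LI \<zeta>. cis (\<zeta> \<cdot> u) * cor (exp (- (\<epsilon> * norm \<zeta>)\<^sup>2 / 2))) = cor (heat_kernel \<epsilon> u)"
  and "L1 (%\<zeta>::'a. cor (exp (- (\<epsilon> * norm \<zeta>)\<^sup>2 / 2)))"
proof -
 interpret P: product_sigma_finite "%b::'a. lborel :: real measure" ..
 define F where "F v b x = cis ((v \<cdot> b) * x) * cor (exp (- (\<epsilon> * x)\<^sup>2 / 2))" for v b :: 'a and x :: real
 have [measurable]: "F v b \<in> BM" for v b unfolding F_def by measurable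
 have int: "L1 (F v b)" for v b unfolding F_def using gauss_transform_real(2)[OF assms] by simp
 have eq: "cis (\<zeta> \<cdot> v) * cor (exp (- (\<epsilon> * norm \<zeta>)\<^sup>2 / 2)) = (\<Prod>b\<in>Basis. F v b (\<zeta> \<cdot> b))" for \<zeta> v :: 'a
 proof -
  have 1: "cis (\<zeta> \<cdot> v) = (\<Prod>b\<in>Basis. cis ((v \<cdot> b) * (\<zeta> \<cdot> b)))" by (subst euclidean_inner) (simp add: cis_conv_exp exp_sum[symmetric] sum_distrib_left mult.commute)
  have "- (\<epsilon> * norm \<zeta>)\<^sup>2 / 2 = (\<Sum>b\<in>Basis. - (\<epsilon> * (\<zeta> \<cdot> b))\<^sup>2 / 2)"
   by (simp add: power_mult_distrib power2_norm_eq_inner euclidean_inner[of \<zeta> \<zeta>]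
     power2_eq_square[of "\<zeta> \<cdot> _"] sum_distrib_left sum_negf sum_divide_distrib)
  then have 2: "exp (- (\<epsilon> * norm \<zeta>)\<^sup>2 / 2) = (\<Prod>b\<in>Basis. exp (- (\<epsilon> * (\<zeta> \<cdot> b))\<^sup>2 / 2))" by (simp only: exp_sum[OF finite_Basis])
  show ?thesis unfolding F_def 1 2 by (simp add: prod.distrib)
 qed
 have [measurable]: "(%f. \<Sum>b\<in>Basis. f b *\<^sub>R b) \<in> (\<Pi>\<^sub>M b\<in>(Basis::'a set). (lborel :: real measure)) \<rightarrow>\<^sub>M borel" by measurable
 have coord: "(\<Sum>b\<in>Basis. f b *\<^sub>R b) \<cdot> c = f c" if "c \<in> Basis" for f :: "'a => real" and c using that by simp
 have meas: "(%\<zeta>::'a. cis (\<zeta> \<cdot> v) * cor (exp (- (\<epsilon> * norm \<zeta>)\<^sup>2 / 2))) \<in> BM" for v by measurable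
 have "(LI \<zeta>. cis (\<zeta> \<cdot> u) * cor (exp (- (\<epsilon> * norm \<zeta>)\<^sup>2 / 2)))
   = (\<integral>f. (\<Prod>b\<in>Basis. F u b (f b)) \<partial>(\<Pi>\<^sub>M b\<in>(Basis::'a set). lborel))" by (subst lborel_eq, subst integral_distr[OF _ meas], simp)
    (auto simp only: eq coord intro!: Bochner_Integration.integral_cong prod.cong)
 also have "... = (\<Prod>b\<in>Basis. LI x. F u b x)" by (rule P.product_integral_prod) (auto intro: int)
 also have "... = (\<Prod>b\<in>Basis. cor (2 * pi * normal_density 0 \<epsilon> (u \<cdot> b)))" unfolding F_def by (intro prod.cong refl gauss_transform_real(1)[OF assms])
 finally show "(LI \<zeta>. cis (\<zeta> \<cdot> u) * cor (exp (- (\<epsilon> * norm \<zeta>)\<^sup>2 / 2))) = cor (heat_kernel \<epsilon> u)" by (simp add: heat_kernel_def)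
 have "integrable (\<Pi>\<^sub>M b\<in>(Basis::'a set). lborel) (%f. \<Prod>b\<in>Basis. F 0 b (f b))" by (rule P.product_integrable_prod) (auto intro: int)
 also have "(%f. \<Prod>b\<in>Basis. F 0 b (f b)) = (%f. \<Prod>b\<in>(Basis::'a set). F 0 b ((\<Sum>b\<in>Basis. f b *\<^sub>R b) \<cdot> b))" by (auto simp only: coord intro!: ext prod.cong)
 finally have "integrable (distr (\<Pi>\<^sub>M b\<in>(Basis::'a set). lborel) borel (%f. \<Sum>b\<in>Basis. f b *\<^sub>R b)) (%\<zeta>. \<Prod>b\<in>(Basis::'a set). F 0 b (\<zeta> \<cdot> b))"
  using meas[of 0] by (subst integrable_distr_eq) (auto simp: eq)
 then show "L1 (%\<zeta>::'a. cor (exp (- (\<epsilon> * norm \<zeta>)\<^sup>2 / 2)))" using eq[of _ 0] by (subst lborel_eq) simp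
qed


text \<open>
 Weighted by a Gaussian, the left-hand side becomes a double integral of \<open>f\<close> against a positive
 convolution kernel of total mass \<open>(2 \<pi>)\<^sup>d\<close>; Young's inequality bounds it uniformly in the weight.
\<close>

lemma Plancherel_gauss:
 fixes f :: "'a::euclidean_space => complex"
 assumes f: "L1 f" and "\<epsilon> > 0"
 shows "(NI \<zeta>. enn (exp (- (\<epsilon> * norm \<zeta>)\<^sup>2 / 2) * (cmod (FT f \<zeta>))^2)) <= enn ((2 * pi) ^ DIM('a)) * N2 f"
proof -
 have [measurable]: "f \<in> BM" using f by (auto dest: borel_measurable_integrable)
 define w :: "'a => real" where "w \<zeta> = exp (- (\<epsilon> * norm \<zeta>)\<^sup>2 / 2)" for \<zeta>
 have [measurable]: "w \<in> BM" unfolding w_def by measurable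
 have w: "L1 (%\<zeta>. cor (w \<zeta>))" "w \<zeta> > 0" for \<zeta> using gauss_transform(2)[OF assms(2), where 'a='a] by (auto simp: w_def)
 define P :: "'a \<times> 'a => complex" where "P z = f (fst z) * cnj (f (snd z))" for z
 have [measurable]: "(%x. cnj (f x)) \<in> BM" by (rule measurable_compose[of f]) (auto intro: borel_measurable_continuous_onI continuous_intros)
 have [measurable]: "P \<in> BM" unfolding P_def by measurable
 have P: "L1 P" unfolding P_def by (rule integrable_tensor) (use f in auto)
 define H :: "'a \<times> ('a \<times> 'a) => complex"
  where "H p = cis (fst p \<cdot> (snd (snd p) - fst (snd p))) * (cor (w (fst p)) * P (snd p))" for p
 have [measurable]: "H \<in> BM" unfolding H_def by measurable
 have H: "L1 H" by (rule Bochner_Integration.integrable_bound[OF integrable_tensor[OF w(1) P]]) (auto simp: H_def norm_mult)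
 have sq: "(LI z. H (\<zeta>, z)) = cor (w \<zeta> * (cmod (FT f \<zeta>))^2)" for \<zeta>
 proof -
  have i: "L1 (%z::'a\<times>'a. (cis (- (\<zeta> \<cdot> fst z)) * f (fst z)) * cnj (cis (- (\<zeta> \<cdot> snd z)) * f (snd z)))"
   by (rule integrable_tensor) (auto intro: FT_integrable f integrable_cnj simp del: complex_cnj_mult)
  have c: "cis (\<zeta> \<cdot> (y - x)) = cis (- (\<zeta> \<cdot> x)) * cnj (cis (- (\<zeta> \<cdot> y)))" for x y by (simp add: cis_cnj cis_mult inner_diff_right)
  have "(LI z. H (\<zeta>, z)) = (\<integral>z. cor (w \<zeta>) * ((cis (- (\<zeta> \<cdot> fst z)) * f (fst z)) * cnj (cis (- (\<zeta> \<cdot> snd z)) * f (snd z))) \<partial>(lborel :: ('a\<times>'a) measure))"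
   by (intro Bochner_Integration.integral_cong refl)
     (simp only: H_def P_def c fst_conv snd_conv complex_cnj_mult mult_ac)
  also have "... = cor (w \<zeta>) * (LI x. LI y. (cis (- (\<zeta> \<cdot> x)) * f x) * cnj (cis (- (\<zeta> \<cdot> y)) * f y))" using integral_prod_fst[OF i] by simp
  also have "... = cor (w \<zeta>) * (FT f \<zeta> * cnj (FT f \<zeta>))" unfolding FT_def by (simp del: complex_cnj_mult)
  also have "FT f \<zeta> * cnj (FT f \<zeta>) = cor ((cmod (FT f \<zeta>))^2)" by (rule complex_norm_square[symmetric])
  finally show ?thesis by simp
 qed
 have gauss: "(LI \<zeta>. H (\<zeta>, z)) = cor (heat_kernel \<epsilon> (snd z - fst z)) * P z" for z using gauss_transform(1)[OF assms(2), of "snd z - fst z"]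
  by (simp add: H_def w_def mult.assoc[symmetric])
 have int: "L1 (%\<zeta>. w \<zeta> * (cmod (FT f \<zeta>))^2)" using integrable_section_integral_fst[OF H] unfolding sq by (simp only: complex_of_real_integrable_eq)
 have "enn (LI \<zeta>. w \<zeta> * (cmod (FT f \<zeta>))^2) = enn (cmod (LI \<zeta>. cor (w \<zeta> * (cmod (FT f \<zeta>))^2)))"
  using w(2) by (simp only: integral_complex_of_real norm_of_real) (simp add: less_imp_le)
 also have "(LI \<zeta>. cor (w \<zeta> * (cmod (FT f \<zeta>))^2)) = (LI z. cor (heat_kernel \<epsilon> (snd z - fst z)) * P z)" using integral_prod_swap[OF H] unfolding sq gauss .
 also have "enn (cmod ...) <= (NI z. enn (cmod (cor (heat_kernel \<epsilon> (snd z - fst z)) * P z)))" by (cases "L1 (%z. cor (heat_kernel \<epsilon> (snd z - fst z)) * P z)")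
    (auto intro: integral_norm_bound_ennreal simp: not_integrable_integral_eq)
 also have "... <= (NI z. enn (heat_kernel \<epsilon> (snd z - fst z)) * enn ((cmod (f (fst z)))^2 / 2)
    + enn (heat_kernel \<epsilon> (snd z - fst z)) * enn ((cmod (f (snd z)))^2 / 2))"
 proof (intro nn_integral_mono)
  fix z :: "'a \<times> 'a"
  let ?g = "heat_kernel \<epsilon> (snd z - fst z)" and ?a = "cmod (f (fst z))" and ?b = "cmod (f (snd z))"
  have g: "?g >= 0" by (rule heat_kernel_nonneg)
  have "?a * ?b <= ?a^2 / 2 + ?b^2 / 2" using zero_le_power2[of "?a - ?b"] by (simp add: power2_eq_square algebra_simps)
  then have "?g * (?a * ?b) <= ?g * (?a^2 / 2) + ?g * (?b^2 / 2)" using g by (metis distrib_left mult_left_mono)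
  then show "enn (cmod (cor ?g * P z)) <= enn ?g * enn (?a^2 / 2) + enn ?g * enn (?b^2 / 2)" using g by (simp add: P_def norm_mult ennreal_mult[symmetric] ennreal_plus[symmetric] del: ennreal_plus)
 qed
 also have "... = (\<integral>\<^sup>+z. enn (heat_kernel \<epsilon> (snd z - fst z)) * enn ((cmod (f (fst z)))^2 / 2) \<partial>(lborel :: ('a\<times>'a) measure))
    + (\<integral>\<^sup>+z. enn (heat_kernel \<epsilon> (snd z - fst z)) * enn ((cmod (f (snd z)))^2 / 2) \<partial>(lborel :: ('a\<times>'a) measure))" by (rule nn_integral_add) auto
 also have "(\<integral>\<^sup>+z. enn (heat_kernel \<epsilon> (snd z - fst z)) * enn ((cmod (f (fst z)))^2 / 2) \<partial>(lborel :: ('a\<times>'a) measure))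
   = enn ((2 * pi) ^ DIM('a)) * (NI x. enn ((cmod (f x))^2 / 2))"
 proof -
  have "(NI y. enn (heat_kernel \<epsilon> (y - x))) = enn ((2 * pi) ^ DIM('a))" for x :: 'a
   using nn_integral_shift[of "%u. enn (heat_kernel \<epsilon> u)" "- x"] nn_integral_heat_kernel[OF assms(2), where 'a='a] by simp
  then show ?thesis by (subst nn_integral_prod_fst) (auto simp: nn_integral_multc nn_integral_cmult)
 qed
 also have "(\<integral>\<^sup>+z. enn (heat_kernel \<epsilon> (snd z - fst z)) * enn ((cmod (f (snd z)))^2 / 2) \<partial>(lborel :: ('a\<times>'a) measure))
   = enn ((2 * pi) ^ DIM('a)) * (NI x. enn ((cmod (f x))^2 / 2))"
 proof -
  have "(NI x. enn (heat_kernel \<epsilon> (y - x))) = enn ((2 * pi) ^ DIM('a))" for y :: 'a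
   using nn_integral_reflect[of "%u. enn (heat_kernel \<epsilon> u)" y] nn_integral_heat_kernel[OF assms(2), where 'a='a] by simp
  then show ?thesis by (subst nn_integral_prod_snd) (auto simp: nn_integral_multc nn_integral_cmult)
 qed
 also have "enn ((2 * pi) ^ DIM('a)) * (NI x. enn ((cmod (f x))^2 / 2)) + enn ((2 * pi) ^ DIM('a)) * (NI x. enn ((cmod (f x))^2 / 2))
   = enn ((2 * pi) ^ DIM('a)) * N2 f" unfolding N2_def distrib_left[symmetric] by (subst nn_integral_add[symmetric]) (auto simp: ennreal_plus[symmetric] simp del: ennreal_plus)
 finally show ?thesis using int w(2) unfolding w_def by (subst nn_integral_eq_integral) auto
qed

theorem Plancherel_inequality:
 fixes f :: "'a::euclidean_space => complex"
 assumes f: "L1 f"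
 shows "N2 (FT f) <= enn ((2 * pi) ^ DIM('a)) * N2 f"
proof -
 have [measurable]: "f \<in> BM" using f by (auto dest: borel_measurable_integrable)
 let ?w = "%n \<zeta>. enn (exp (- (1 / real (Suc n) * norm \<zeta>)\<^sup>2 / 2) * (cmod (FT f \<zeta>))^2)"
 have "N2 (FT f) = (NI \<zeta>. liminf (%n. ?w n \<zeta>))" unfolding N2_def
 proof (intro nn_integral_cong)
  fix \<zeta> :: 'a
  have "(%n. exp (- (1 / real (Suc n) * norm \<zeta>)\<^sup>2 / 2) * (cmod (FT f \<zeta>))^2) ----> exp (- (0 * norm \<zeta>)\<^sup>2 / 2) * (cmod (FT f \<zeta>))^2"
   by (intro tendsto_intros LIMSEQ_Suc lim_1_over_n) auto
  then have "(%n. ?w n \<zeta>) ----> enn ((cmod (FT f \<zeta>))^2)" by (intro tendsto_ennrealI) simp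
  then show "enn ((cmod (FT f \<zeta>))^2) = liminf (%n. ?w n \<zeta>)" by (intro lim_imp_Liminf[symmetric]) auto
 qed
 also have "... <= liminf (%n. NI \<zeta>. ?w n \<zeta>)" by (rule nn_integral_liminf) simp
 also have "... <= liminf (%n::nat. enn ((2 * pi) ^ DIM('a)) * N2 f)" by (intro Liminf_mono always_eventually allI Plancherel_gauss f) simp
 also have "... = enn ((2 * pi) ^ DIM('a)) * N2 f" by (simp add: Liminf_const)
 finally show ?thesis .
qed


section \<open>The Fourier transform on L2 and Sobolev bounds\<close>

lemma N2_dominated:
 fixes f :: "nat => 'a::euclidean_space => complex"
 assumes [measurable]: "!!n. f n \<in> BM" and g: "g \<in> L2"
  and le: "!!n x. cmod (f n x) <= cmod (g x)"
  and lim: "!!x. (%n. f n x) ----> 0"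
 shows "(%n. N2 (f n)) ----> 0"
proof -
 have [measurable]: "g \<in> BM" using g by auto
 have "(%n. NI x. enn ((cmod (f n x))^2)) ----> (NI (x::'a). 0)"
 proof (rule nn_integral_dominated_convergence[where w="%x. enn ((cmod (g x))^2)"])
  show "(NI x. enn ((cmod (g x))^2)) < \<infinity>" using g by (simp add: L2_iff N2_def)
  show "AE x in lborel. enn ((cmod (f n x))^2) <= enn ((cmod (g x))^2)" for n using le by (intro always_eventually allI ennreal_leI power_mono) auto
  have "(%n. enn ((cmod (f n x))^2)) ----> enn ((cmod 0)^2)" for x by (intro tendsto_ennrealI tendsto_intros lim)
  then show "AE x in lborel. (%n. enn ((cmod (f n x))^2)) ----> 0" by simp
 qed auto
 then show ?thesis by (simp add: N2_def)
qed

lemma two_times_ennreal: "0 <= x ==> 2 * enn x = enn (2 * x)" by (subst ennreal_mult) auto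

lemma N2_tendsto_imp_Cauchy:
 assumes [measurable]: "!!n. F n \<in> BM" "g \<in> BM"
  and lim: "(%n. N2 (%x. F n x - g x)) ----> 0" and "\<epsilon> > 0"
 shows "\<exists>N. \<forall>m\<ge>N. \<forall>n\<ge>N. N2 (%x. F m x - F n x) <= enn \<epsilon>"
proof -
 have "eventually (%n. N2 (%x. F n x - g x) < enn (\<epsilon> / 4)) sequentially" using lim by (rule order_tendstoD) (use \<open>\<epsilon> > 0\<close> in simp)
 then obtain N where N: "!!n. n >= N ==> N2 (%x. F n x - g x) <= enn (\<epsilon> / 4)" by (auto simp: eventually_sequentially intro: less_imp_le)
 have "N2 (%x. F m x - F n x) <= enn \<epsilon>" if "m >= N" "n >= N" for m n
 proof -
  have "N2 (%x. F m x - F n x) <= 2 * N2 (%x. F m x - g x) + 2 * N2 (%x. g x - F n x)" by (rule N2_triangle) auto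
  also have "... <= 2 * enn (\<epsilon> / 4) + 2 * enn (\<epsilon> / 4)" using N[OF that(1)] N[OF that(2)] by (intro add_mono mult_left_mono) (auto simp: N2_diff_commute[of g])
  also have "... = enn (2 * (\<epsilon> / 4) + 2 * (\<epsilon> / 4))" using \<open>\<epsilon> > 0\<close> by (simp add: two_times_ennreal ennreal_plus[symmetric] del: ennreal_plus)
  finally show ?thesis by simp
 qed
 then show ?thesis by blast
qed

lemma tendsto_0_sandwich_ennreal:
 fixes f g :: "nat => ennreal"
 assumes "!!n. f n <= g n" and "g ----> 0"
 shows "f ----> 0" by (rule tendsto_sandwich[OF _ _ tendsto_const assms(2)]) (use assms(1) in auto)

lemma ennreal_tendsto_0_cmult:
 fixes f :: "nat => ennreal"
 assumes "f ----> 0" and "c < \<infinity>"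
 shows "(%n. c * f n) ----> 0" using ennreal_tendsto_cmult[of c f 0 sequentially] assms by simp

lemma N2_tendsto_unique:
 assumes [measurable]: "!!n. F n \<in> BM" "g \<in> BM" "h \<in> BM"
  and "(%n. N2 (%x. F n x - g x)) ----> 0" "(%n. N2 (%x. F n x - h x)) ----> 0"
 shows "AE x in lborel. g x = h x"
proof -
 have "(%n. 2 * N2 (%x. F n x - g x) + 2 * N2 (%x. F n x - h x)) ----> 0 + 0" by (intro tendsto_add ennreal_tendsto_0_cmult assms) auto
 moreover have "N2 (%x. g x - h x) <= 2 * N2 (%x. F n x - g x) + 2 * N2 (%x. F n x - h x)" for n using N2_triangle[of g "F n" h] by (simp add: N2_diff_commute[of g])
 ultimately have "(%n::nat. N2 (%x. g x - h x)) ----> 0" by (intro tendsto_0_sandwich_ennreal[of "%n. N2 (%x. g x - h x)"]) auto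
 then have "N2 (%x. g x - h x) = 0" by (simp add: LIMSEQ_const_iff)
 then show ?thesis by (subst (asm) N2_0_AE) auto
qed

text \<open>The L2 limit chosen by \<open>L2_lim\<close> is a genuine limit as soon as the sequence is Cauchy.\<close>

lemma L2_lim_works:
 assumes F: "!!n. F n \<in> L2"
  and Cauchy: "!!\<epsilon>::real. \<epsilon> > 0 ==> \<exists>N. \<forall>m\<ge>N. \<forall>n\<ge>N. N2 (%x. F m x - F n x) <= enn \<epsilon>"
 shows "L2_lim F \<in> L2" "(%n. N2 (%x. F n x - L2_lim F x)) ----> 0"
proof -
 obtain g where g: "g \<in> L2" "(%n. N2 (%x. F n x - g x)) ----> 0" using L2_complete[OF F Cauchy] by blast
 have iff: "(%n. L2_norm (%x. F n x - h x)) ----> 0 \<longleftrightarrow> (%n. N2 (%x. F n x - h x)) ----> 0" if "h \<in> L2" for h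
 proof -
  have eq: "N2 (%x. F n x - h x) = enn ((L2_norm (%x. F n x - h x))^2)" for n by (rule N2_L2_norm[OF L2_diff[OF F that]])
  have "(%n. enn ((L2_norm (%x. F n x - h x))^2)) ----> enn 0 \<longleftrightarrow> (%n. (L2_norm (%x. F n x - h x))^2) ----> 0" by (rule tendsto_ennreal_iff) auto
  also have "... \<longleftrightarrow> (%n. L2_norm (%x. F n x - h x)) ----> 0"
  proof
   assume "(%n. (L2_norm (%x. F n x - h x))^2) ----> 0"
   from tendsto_real_sqrt[OF this] show "(%n. L2_norm (%x. F n x - h x)) ----> 0" by simp
  next
   assume "(%n. L2_norm (%x. F n x - h x)) ----> 0"
   from tendsto_power[OF this, of 2] show "(%n. (L2_norm (%x. F n x - h x))^2) ----> 0" by simp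
  qed
  finally show ?thesis by (simp add: eq)
 qed
 have "\<exists>g. g \<in> L2 \<and> (\<forall>n. F n \<in> L2) \<and> (%n. L2_norm (%x. F n x - g x)) ----> 0" using g F iff by blast
 from someI_ex[OF this]
 have *: "L2_lim F \<in> L2 \<and> (\<forall>n. F n \<in> L2) \<and> (%n. L2_norm (%x. F n x - L2_lim F x)) ----> 0" unfolding L2_lim_def .
 then show "L2_lim F \<in> L2" "(%n. N2 (%x. F n x - L2_lim F x)) ----> 0" using iff by auto
qed

text \<open>The truncations that occur in \<open>fourier\<close> and \<open>wigner\<close>.\<close>

definition ball_cut :: "nat => ('a::euclidean_space => complex) => 'a => complex" where
 "ball_cut n f x = indicator (cball 0 (real n)) x *\<^sub>R f x"

lemma ball_cut_measurable [measurable]: "f \<in> BM ==> ball_cut n f \<in> BM" unfolding ball_cut_def by (intro borel_measurable_scaleR borel_measurable_indicator) auto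

lemma ball_cut_L2: "f \<in> L2 ==> ball_cut n f \<in> L2" by (rule L2_bound[where B=1]) (auto simp: ball_cut_def indicator_def)

lemma indicator_cball_L2: "(%x. cor (indicator (cball (0::'a::euclidean_space) r) x)) \<in> L2"
proof -
 have "N2 (%x::'a. cor (indicator (cball 0 r) x)) = (NI (x::'a). indicator (cball 0 r) x)" unfolding N2_def by (intro nn_integral_cong) (auto simp: indicator_def)
 also have "... < \<infinity>" using emeasure_bounded_finite[of "cball (0::'a) r"] by simp
 finally have fin: "N2 (%x::'a. cor (indicator (cball 0 r) x)) < \<infinity>" .
 have "(%x::'a. cor (indicator (cball 0 r) x)) \<in> BM" by (rule measurable_compose[OF borel_measurable_indicator[of "cball (0::'a) r" borel]]) auto
 with fin show ?thesis by (simp add: L2_iff)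
qed

lemma L2_compact_support_integrable:
 assumes "f \<in> L2" and "!!x. r < norm x ==> f x = 0"
 shows "L1 f"
proof -
 have "L1 (%x. cor (indicator (cball 0 r) x) * f x)" by (rule L2_mult_integrable[OF indicator_cball_L2 assms(1)])
 moreover have "cor (indicator (cball 0 r) x) * f x = f x" for x using assms(2)[of x] by (cases "norm x <= r") (auto simp: indicator_def)
 ultimately show ?thesis by simp
qed

lemma ball_cut_integrable: "f \<in> L2 ==> L1 (ball_cut n f)" by (rule L2_compact_support_integrable[where r="real n", OF ball_cut_L2]) (auto simp: ball_cut_def)

lemma ball_cut_tendsto:
 assumes "f \<in> L2"
 shows "(%n. N2 (%x. ball_cut n f x - f x)) ----> 0"
proof (rule N2_dominated[OF _ assms])
 show "(%x. ball_cut n f x - f x) \<in> BM" for n using assms by measurable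
 show "cmod (ball_cut n f x - f x) <= cmod (f x)" for n x by (auto simp: ball_cut_def indicator_def)
 fix x :: 'a
 have "eventually (%n. ball_cut n f x - f x = 0) sequentially" using eventually_ge_at_top[of "nat \<lceil>norm x\<rceil>"]
 proof eventually_elim
  case (elim n)
  then have "norm x <= real n" by linarith
  then show ?case by (simp add: ball_cut_def)
 qed
 then show "(%n. ball_cut n f x - f x) ----> 0" by (simp add: tendsto_eventually)
qed

definition fourier_const :: "'a::euclidean_space itself => real" where
 "fourier_const _ = (2 * pi) powr (- (real DIM('a) / 2))"

lemma fourier_const_sq: "(fourier_const TYPE('a::euclidean_space))^2 * (2 * pi) ^ DIM('a) = 1"
proof -
 have "(fourier_const TYPE('a))^2 = (2 * pi) powr (- real DIM('a))" by (simp add: fourier_const_def power2_eq_square powr_add[symmetric])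
 also have "... = 1 / (2 * pi) ^ DIM('a)" by (simp add: powr_minus powr_realpow divide_inverse)
 finally show ?thesis by simp
qed

lemma N2_FT_normalised:
 fixes f :: "'a::euclidean_space => complex"
 assumes "L1 f"
 shows "N2 (%\<zeta>. cor (fourier_const TYPE('a)) * FT f \<zeta>) <= N2 f"
proof -
 have [measurable]: "f \<in> BM" using assms by (auto dest: borel_measurable_integrable)
 have "N2 (%\<zeta>. cor (fourier_const TYPE('a)) * FT f \<zeta>)
   = enn ((fourier_const TYPE('a))^2) * N2 (FT f)" by (subst N2_cmult) auto
 also have "... <= enn ((fourier_const TYPE('a))^2) * (enn ((2 * pi) ^ DIM('a)) * N2 f)" by (intro mult_left_mono Plancherel_inequality assms) auto
 also have "... = N2 f" by (simp only: mult.assoc[symmetric] ennreal_mult'[symmetric] zero_le_power2 fourier_const_sq ennreal_1 mult_1_left)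
 finally show ?thesis .
qed

lemma FT_L2: "f \<in> L2 ==> L1 f ==> FT f \<in> L2" using Plancherel_inequality[of f] by (auto simp: L2_iff ennreal_mult_less_top intro: le_less_trans)

text \<open>\<open>ball_cut n U\<close> is Cauchy in L2, and by the Plancherel inequality so are the transforms in the definition of \<open>fourier\<close>.\<close>

lemma fourier_L2:
 fixes U :: "'a::euclidean_space => complex"
 assumes U: "U \<in> L2"
 shows "fourier U \<in> L2"
  and "!!G. (!!n. G n \<in> L2) ==> (!!n. L1 (G n)) ==> (%n. N2 (%x. G n x - U x)) ----> 0 ==>
   (%n. N2 (%\<zeta>. cor (fourier_const TYPE('a)) * FT (G n) \<zeta> - fourier U \<zeta>)) ----> 0"
proof -
 define F where "F G n \<zeta> = cor (fourier_const TYPE('a)) * FT (G n) \<zeta>" for G :: "nat => 'a => complex" and n \<zeta>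
 have F_L2: "F G n \<in> L2" if "G n \<in> L2" "L1 (G n)" for G n unfolding F_def by (intro L2_cmult FT_L2 that)
 have diff: "N2 (%\<zeta>. F G m \<zeta> - F H n \<zeta>) <= N2 (%x. G m x - H n x)"
  if "L1 (G m)" "L1 (H n)" for G H m n
 proof -
  have "(%\<zeta>. F G m \<zeta> - F H n \<zeta>) = (%\<zeta>. cor (fourier_const TYPE('a)) * FT (%x. G m x - H n x) \<zeta>)" by (simp add: F_def FT_diff that algebra_simps)
  then show ?thesis using that by (simp add: N2_FT_normalised)
 qed
 let ?C = "%n. ball_cut n U"
 have C: "?C n \<in> L2" "L1 (?C n)" for n using U by (auto intro: ball_cut_L2 ball_cut_integrable)
 have [measurable]: "U \<in> BM" using U by auto
 have fourier_eq: "fourier U = L2_lim (F ?C)" unfolding fourier_def F_def FT_def fourier_const_def set_lebesgue_integral_def ball_cut_def by (simp add: scaleR_conv_of_real mult.left_commute)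
 have "\<exists>N. \<forall>m\<ge>N. \<forall>n\<ge>N. N2 (%x. F ?C m x - F ?C n x) <= enn \<epsilon>" if eps: "\<epsilon> > 0" for \<epsilon>
 proof -
  obtain N where N: "!!m n. m >= N ==> n >= N ==> N2 (%x. ?C m x - ?C n x) <= enn \<epsilon>" using N2_tendsto_imp_Cauchy[of ?C U, OF _ _ ball_cut_tendsto[OF U] eps] by auto
  have "N2 (%x. F ?C m x - F ?C n x) <= enn \<epsilon>" if "m >= N" "n >= N" for m n by (rule order_trans[OF diff[where G = ?C and H = ?C, OF C(2) C(2)] N[OF that]])
  then show ?thesis by blast
 qed
 from L2_lim_works[of "F ?C", OF F_L2 this] C
 have lim: "fourier U \<in> L2" "(%n. N2 (%\<zeta>. F ?C n \<zeta> - fourier U \<zeta>)) ----> 0" by (auto simp: fourier_eq)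
 show "fourier U \<in> L2" by fact
 have [measurable]: "fourier U \<in> BM" using lim by auto
 fix G :: "nat => 'a => complex"
 assume G: "!!n. G n \<in> L2" "!!n. L1 (G n)" "(%n. N2 (%x. G n x - U x)) ----> 0"
 have [measurable]: "G n \<in> BM" "F G n \<in> BM" "F ?C n \<in> BM" for n using G(1) F_L2 C G(2) by auto
 have bd: "N2 (%\<zeta>. F G n \<zeta> - fourier U \<zeta>)
   <= 2 * (2 * N2 (%x. G n x - U x) + 2 * N2 (%x. ?C n x - U x)) + 2 * N2 (%\<zeta>. F ?C n \<zeta> - fourier U \<zeta>)" for n
 proof -
  have 1: "N2 (%\<zeta>. F G n \<zeta> - fourier U \<zeta>) <= 2 * N2 (%\<zeta>. F G n \<zeta> - F ?C n \<zeta>) + 2 * N2 (%\<zeta>. F ?C n \<zeta> - fourier U \<zeta>)" by (rule N2_triangle) auto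
  have 2: "N2 (%\<zeta>. F G n \<zeta> - F ?C n \<zeta>) <= N2 (%x. G n x - ?C n x)" by (rule diff) (use G C in auto)
  have 3: "N2 (%x. G n x - ?C n x) <= 2 * N2 (%x. G n x - U x) + 2 * N2 (%x. ?C n x - U x)" using N2_triangle[of "G n" U "?C n"] by (simp add: N2_diff_commute[of U])
  show ?thesis by (rule order_trans[OF 1 add_right_mono[OF mult_left_mono[OF order_trans[OF 2 3]]]]) simp
 qed
 have lm: "(%n. 2 * (2 * N2 (%x. G n x - U x) + 2 * N2 (%x. ?C n x - U x)) + 2 * N2 (%\<zeta>. F ?C n \<zeta> - fourier U \<zeta>)) ----> 2 * (0 + 0) + 0"
  by (intro tendsto_add ennreal_tendsto_0_cmult ennreal_tendsto_cmult G(3) lim(2) ball_cut_tendsto U) auto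
 show "(%n. N2 (%\<zeta>. cor (fourier_const TYPE('a)) * FT (G n) \<zeta> - fourier U \<zeta>)) ----> 0" unfolding F_def[symmetric] by (rule tendsto_0_sandwich_ennreal[OF bd]) (use lm in simp)
qed

text \<open>
 A weighted bound on the transforms of an approximating sequence passes to the limit by Fatou's
 lemma; remainders may be dropped if they vanish in \<^emph>\<open>some\<close> weighted space, since only
 convergence almost everywhere along a subsequence is used.
\<close>

lemma Sobolev_closure:
 fixes U :: "'a::euclidean_space => complex"
 assumes U: "U \<in> L2"
  and G: "!!n. G n \<in> L2" "!!n. L1 (G n)" "(%n. N2 (%x. G n x - U x)) ----> 0"
  and A [measurable]: "!!n. A n \<in> BM"
  and E [measurable]: "!!n. E n \<in> BM"
  and \<omega> [measurable]: "\<omega> \<in> BM" and \<omega>_pos: "!!\<zeta>. 0 < \<omega> \<zeta>"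
  and FT: "!!n \<zeta>. FT (G n) \<zeta> = A n \<zeta> + E n \<zeta>"
  and A_bound: "!!n. (NI \<zeta>. enn ((1 + (norm \<zeta>)^2) powr s * (cmod (A n \<zeta>))^2)) <= enn B"
  and E_lim: "(%n. NI \<zeta>. enn (\<omega> \<zeta> * (cmod (E n \<zeta>))^2)) ----> 0"
  and "B >= 0"
 shows "U \<in> Hs s" and "Hs_norm s U <= sqrt B"
proof -
 define c where "c = fourier_const TYPE('a)"
 have [measurable]: "U \<in> BM" "fourier U \<in> BM" "G n \<in> BM" for n using U fourier_L2(1)[OF U] G(1) by auto
 have c: "0 < c" "c^2 <= 1"
 proof -
  show "0 < c" by (simp add: c_def fourier_const_def)
  have "1 <= (2 * pi) ^ DIM('a)" using pi_ge_two by (intro one_le_power) linarith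
  then have "c^2 * 1 <= c^2 * (2 * pi) ^ DIM('a)" by (intro mult_left_mono) auto
  then show "c^2 <= 1" by (simp only: c_def fourier_const_sq mult_1_right)
 qed
 define f where "f n \<zeta> = enn ((cmod (cor c * FT (G n) \<zeta> - fourier U \<zeta>))^2) + enn (\<omega> \<zeta> * (cmod (E n \<zeta>))^2)" for n \<zeta>
 have [measurable]: "f n \<in> BM" for n unfolding f_def by measurable
 have "(%n. N2 (%\<zeta>. cor c * FT (G n) \<zeta> - fourier U \<zeta>) + (NI \<zeta>. enn (\<omega> \<zeta> * (cmod (E n \<zeta>))^2))) ----> 0 + 0"
  unfolding c_def by (intro tendsto_add fourier_L2(2)[OF U G] E_lim)
 moreover have "(NI \<zeta>. f n \<zeta>) = N2 (%\<zeta>. cor c * FT (G n) \<zeta> - fourier U \<zeta>) + (NI \<zeta>. enn (\<omega> \<zeta> * (cmod (E n \<zeta>))^2))" for n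
  unfolding f_def N2_def by (rule nn_integral_add) auto
 ultimately have "(%n. NI \<zeta>. f n \<zeta>) ----> 0" by simp
 then obtain r :: "nat => nat" where r: "strict_mono r" "AE \<zeta> in lborel. (%n. f (r n) \<zeta>) ----> 0" by (rule nn_integral_tendsto_0_subseq_AE[rotated]) auto
 have sq0: "(%n. z n) ----> 0" if "(%n. enn (a * (cmod (z n))^2)) ----> 0" "a > 0" for z :: "nat => complex" and a
 proof -
  have "(%n. enn (a * (cmod (z n))^2)) ----> enn 0" using that by simp
  then have "(%n. a * (cmod (z n))^2) ----> 0" by (subst (asm) tendsto_ennreal_iff) (use that in auto)
  from tendsto_real_sqrt[OF tendsto_mult_left[OF this, of "1 / a"]]
  have "(%n. cmod (z n)) ----> 0" using that(2) by simp
  then show ?thesis by (rule tendsto_norm_zero_cancel)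
 qed
 have conv: "AE \<zeta> in lborel. (%n. cor c * A (r n) \<zeta>) ----> fourier U \<zeta>" using r(2)
 proof eventually_elim
  case (elim \<zeta>)
  have "(%n. enn (1 * (cmod (cor c * FT (G (r n)) \<zeta> - fourier U \<zeta>))^2)) ----> 0" by (rule tendsto_0_sandwich_ennreal[OF _ elim]) (simp add: f_def)
  then have 1: "(%n. cor c * FT (G (r n)) \<zeta> - fourier U \<zeta>) ----> 0" by (rule sq0) simp
  have "(%n. enn (\<omega> \<zeta> * (cmod (E (r n) \<zeta>))^2)) ----> 0" by (rule tendsto_0_sandwich_ennreal[OF _ elim]) (simp add: f_def)
  then have 2: "(%n. E (r n) \<zeta>) ----> 0" by (rule sq0) (rule \<omega>_pos)
  have "(%n. (cor c * FT (G (r n)) \<zeta> - fourier U \<zeta>) - cor c * E (r n) \<zeta> + fourier U \<zeta>) ----> 0 - cor c * 0 + fourier U \<zeta>" by (intro tendsto_intros 1 2)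
  then show ?case by (simp add: FT algebra_simps)
 qed
 let ?w = "%\<zeta>::'a. (1 + (norm \<zeta>)^2) powr s"
 have "(NI \<zeta>. enn (?w \<zeta> * (cmod (fourier U \<zeta>))^2)) = (NI \<zeta>. liminf (%n. enn (?w \<zeta> * (cmod (cor c * A (r n) \<zeta>))^2)))"
 proof (rule nn_integral_cong_AE, use conv in eventually_elim)
  case (elim \<zeta>)
  then have "(%n. enn (?w \<zeta> * (cmod (cor c * A (r n) \<zeta>))^2)) ----> enn (?w \<zeta> * (cmod (fourier U \<zeta>))^2)" by (intro tendsto_ennrealI tendsto_intros)
  then show ?case by (intro lim_imp_Liminf[symmetric]) auto
 qed
 also have "... <= liminf (%n. NI \<zeta>. enn (?w \<zeta> * (cmod (cor c * A (r n) \<zeta>))^2))" by (rule nn_integral_liminf) simp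
 also have "... <= liminf (%n::nat. enn B)"
 proof (intro Liminf_mono always_eventually allI)
  fix n
  have "(NI \<zeta>. enn (?w \<zeta> * (cmod (cor c * A (r n) \<zeta>))^2))
    <= (NI \<zeta>. enn (?w \<zeta> * (cmod (A (r n) \<zeta>))^2))"
  proof (intro nn_integral_mono ennreal_leI mult_left_mono)
   fix \<zeta>
   have "c^2 * (cmod (A (r n) \<zeta>))^2 <= 1 * (cmod (A (r n) \<zeta>))^2" by (rule mult_right_mono) (use c in auto)
   then show "(cmod (cor c * A (r n) \<zeta>))^2 <= (cmod (A (r n) \<zeta>))^2" by (simp add: norm_mult power_mult_distrib)
  qed auto
  also have "... <= enn B" by (rule A_bound)
  finally show "(NI \<zeta>. enn (?w \<zeta> * (cmod (cor c * A (r n) \<zeta>))^2)) <= enn B" .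
 qed
 finally have fin: "(NI \<zeta>. enn (?w \<zeta> * (cmod (fourier U \<zeta>))^2)) <= enn B" by (simp add: Liminf_const)
 then have int: "L1 (%\<zeta>. ?w \<zeta> * (cmod (fourier U \<zeta>))^2)" by (intro integrableI_nonneg) (auto intro: le_less_trans)
 then show "U \<in> Hs s" using U by (simp add: Hs_def)
 have "(LI \<zeta>. ?w \<zeta> * (cmod (fourier U \<zeta>))^2) <= B" using fin \<open>B >= 0\<close> by (subst (asm) nn_integral_eq_integral[OF int]) auto
 then show "Hs_norm s U <= sqrt B" by (simp add: Hs_norm_def)
qed


section \<open>Orthonormal systems\<close>

lemma L2_inner_integrable: "f \<in> L2 ==> g \<in> L2 ==> L1 (%x. cnj (f x) * g x)" by (rule L2_mult_integrable[OF L2_cnj])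

lemma L2_inner_self: "f \<in> L2 ==> L2_inner f f = cor ((L2_norm f)^2)"
proof -
 assume "f \<in> L2"
 have "L2_inner f f = (LI x. cor ((cmod (f x))^2))" unfolding L2_inner_def complex_norm_square by (simp add: mult.commute)
 also have "... = cor (LI x. (cmod (f x))^2)" by (rule integral_complex_of_real)
 finally show ?thesis by (simp add: L2_norm_def)
qed

lemma L2_inner_commute: "L2_inner g f = cnj (L2_inner f g)"
proof -
 have "cnj (L2_inner f g) = (LI x. cnj (cnj (f x) * g x))" unfolding L2_inner_def by (rule Bochner_Integration.integral_cnj[symmetric])
 then show ?thesis by (simp add: L2_inner_def mult.commute)
qed

lemma L2_inner_diff_right: "f \<in> L2 ==> g \<in> L2 ==> h \<in> L2 ==> L2_inner f (%x. g x - h x) = L2_inner f g - L2_inner f h"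
 unfolding L2_inner_def by (simp add: right_diff_distrib L2_inner_integrable)

lemma L2_inner_diff_left: "f \<in> L2 ==> g \<in> L2 ==> h \<in> L2 ==> L2_inner (%x. g x - h x) f = L2_inner g f - L2_inner h f" unfolding L2_inner_def by (simp add: left_diff_distrib L2_inner_integrable)

lemma L2_inner_cmult_right: "L2_inner f (%x. c * g x) = c * L2_inner f g" unfolding L2_inner_def by (simp add: mult.left_commute)

lemma L2_inner_cmult_left: "L2_inner (%x. c * f x) g = cnj c * L2_inner f g" unfolding L2_inner_def by (simp add: mult.assoc)

lemma L2_inner_cong_AE:
 assumes "AE x in lborel. g x = h x" "g \<in> BM" "h \<in> BM" "f \<in> BM"
 shows "L2_inner f g = L2_inner f h"
proof -
 have [measurable]: "(%x. cnj (f x)) \<in> BM" by (rule measurable_compose[OF assms(4)]) (auto intro: borel_measurable_continuous_onI continuous_intros)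
 note [measurable] = assms(2-4)
 show ?thesis unfolding L2_inner_def by (rule integral_cong_AE) (use assms(1) in auto)
qed

lemma L2_inner_sum_right:
 assumes "finite I" "f \<in> L2" "!!i. i \<in> I ==> g i \<in> L2"
 shows "L2_inner f (%x. \<Sum>i\<in>I. c i * g i x) = (\<Sum>i\<in>I. c i * L2_inner f (g i))"
proof -
 have "L2_inner f (%x. \<Sum>i\<in>I. c i * g i x) = (LI x. (\<Sum>i\<in>I. c i * (cnj (f x) * g i x)))" unfolding L2_inner_def by (simp add: sum_distrib_left mult.left_commute)
 also have "... = (\<Sum>i\<in>I. LI x. c i * (cnj (f x) * g i x))" using assms by (intro Bochner_Integration.integral_sum integrable_mult_right L2_inner_integrable) auto
 finally show ?thesis by (simp add: L2_inner_def)
qed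

text \<open>Pairing with a fixed L2 function is continuous in L2.\<close>

lemma L2_pairing_tendsto:
 assumes "f \<in> L2" "!!n. F n \<in> L2" "g \<in> L2" and lim: "(%n. N2 (%x. F n x - g x)) ----> 0"
 shows "(%n. LI x. F n x * f x) ----> (LI x. g x * f x)"
proof -
 have "enn ((cmod ((LI x. F n x * f x) - (LI x. g x * f x)))^2) <= N2 f * N2 (%x. F n x - g x)" for n
 proof -
  have "(LI x. F n x * f x) - (LI x. g x * f x) = (LI x. f x * (F n x - g x))" using assms by (subst Bochner_Integration.integral_diff[symmetric])
    (auto intro!: L2_mult_integrable simp: algebra_simps)
  then show ?thesis using Cauchy_Schwarz_L2[of f "%x. F n x - g x"] assms(1-3) by auto
 qed
 moreover have "(%n. N2 f * N2 (%x. F n x - g x)) ----> 0" by (rule ennreal_tendsto_0_cmult[OF lim]) (rule L2_N2_finite[OF assms(1)])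
 ultimately have "(%n. enn ((cmod ((LI x. F n x * f x) - (LI x. g x * f x)))^2)) ----> 0" by (rule tendsto_0_sandwich_ennreal)
 then have "(%n. enn ((cmod ((LI x. F n x * f x) - (LI x. g x * f x)))^2)) ----> enn 0" by simp
 then have "(%n. (cmod ((LI x. F n x * f x) - (LI x. g x * f x)))^2) ----> 0" by (subst (asm) tendsto_ennreal_iff) auto
 from tendsto_real_sqrt[OF this]
 have "(%n. cmod ((LI x. F n x * f x) - (LI x. g x * f x))) ----> 0" by simp
 then show ?thesis by (simp add: tendsto_norm_zero_iff LIM_zero_iff)
qed

definition orthonormal :: "(nat => 'a::euclidean_space => complex) => bool" where
 "orthonormal e \<longleftrightarrow> (\<forall>n. e n \<in> L2) \<and> (\<forall>j k. L2_inner (e j) (e k) = (if j = k then 1 else 0))"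

lemma orthonormal_basis_orthonormal: "orthonormal_basis e ==> orthonormal e" by (simp add: orthonormal_basis_def orthonormal_def)

lemma orthonormal_norm_sum:
 assumes "orthonormal e" "finite I"
 shows "(L2_norm (%x. \<Sum>i\<in>I. c i * e i x))^2 = (\<Sum>i\<in>I. (cmod (c i))^2)"
proof -
 have e: "e n \<in> L2" "L2_inner (e j) (e k) = (if j = k then 1 else 0)" for n j k using assms(1) by (auto simp: orthonormal_def)
 let ?S = "%x. \<Sum>i\<in>I. c i * e i x"
 have S: "?S \<in> L2" using assms(2) e by (intro L2_sum L2_cmult) auto
 have inner: "L2_inner ?S (e i) = cnj (c i)" if "i \<in> I" for i
 proof -
  have "L2_inner (e i) ?S = (\<Sum>j\<in>I. c j * (if i = j then 1 else 0))" using assms(2) e by (subst L2_inner_sum_right) auto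
  also have "... = c i" using that assms(2) by (simp add: if_distrib cong: if_cong)
  finally show ?thesis by (subst L2_inner_commute) simp
 qed
 have "cor ((L2_norm ?S)^2) = (\<Sum>i\<in>I. c i * L2_inner ?S (e i))" using assms(2) e S by (subst L2_inner_self[symmetric], simp, subst L2_inner_sum_right) auto
 also have "... = (\<Sum>i\<in>I. cor ((cmod (c i))^2))" unfolding complex_norm_square by (intro sum.cong refl) (simp add: inner)
 also have "... = cor (\<Sum>i\<in>I. (cmod (c i))^2)" by simp
 finally show ?thesis by (simp only: of_real_eq_iff)
qed

lemma orthonormal_pythagoras:
 assumes "orthonormal e" "finite I" "f \<in> L2"
 shows "(L2_norm (%x. f x - (\<Sum>i\<in>I. L2_inner (e i) f * e i x)))^2
    = (L2_norm f)^2 - (\<Sum>i\<in>I. (cmod (L2_inner (e i) f))^2)"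
proof -
 have e: "e n \<in> L2" for n using assms(1) by (auto simp: orthonormal_def)
 let ?S = "%x. \<Sum>i\<in>I. L2_inner (e i) f * e i x"
 have S: "?S \<in> L2" using assms(2) e by (intro L2_sum L2_cmult) auto
 have SS: "L2_inner ?S ?S = cor (\<Sum>i\<in>I. (cmod (L2_inner (e i) f))^2)" by (subst L2_inner_self[OF S]) (simp only: orthonormal_norm_sum[OF assms(1,2)])
 have fS: "L2_inner f ?S = cor (\<Sum>i\<in>I. (cmod (L2_inner (e i) f))^2)"
 proof -
  have "L2_inner f ?S = (\<Sum>i\<in>I. L2_inner (e i) f * L2_inner f (e i))" using assms e by (subst L2_inner_sum_right) auto
  also have "... = (\<Sum>i\<in>I. cor ((cmod (L2_inner (e i) f))^2))" unfolding complex_norm_square by (subst L2_inner_commute[of _ f]) simp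
  finally show ?thesis by simp
 qed
 have Sf: "L2_inner ?S f = cor (\<Sum>i\<in>I. (cmod (L2_inner (e i) f))^2)" by (subst L2_inner_commute) (simp only: fS complex_cnj_complex_of_real)
 have "cor ((L2_norm (%x. f x - ?S x))^2) = L2_inner (%x. f x - ?S x) (%x. f x - ?S x)" by (rule L2_inner_self[OF L2_diff[OF assms(3) S], symmetric])
 also have "... = (L2_inner f f - L2_inner ?S f) - (L2_inner f ?S - L2_inner ?S ?S)" using assms(3) S L2_diff[OF assms(3) S] by (simp add: L2_inner_diff_right L2_inner_diff_left)
 also have "... = cor ((L2_norm f)^2 - (\<Sum>i\<in>I. (cmod (L2_inner (e i) f))^2))" by (simp only: SS fS Sf L2_inner_self[OF assms(3)] of_real_diff)  simp
 finally show ?thesis by (simp only: of_real_eq_iff)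
qed

text \<open>The part of \<open>f\<close> orthogonal to finitely many members has nonnegative norm.\<close>

lemma Bessel:
 assumes "orthonormal e" "finite I" "f \<in> L2"
 shows "(\<Sum>i\<in>I. (cmod (L2_inner (e i) f))^2) <= (L2_norm f)^2" using orthonormal_pythagoras[OF assms] zero_le_power2[of "L2_norm (%x. f x - (\<Sum>i\<in>I. L2_inner (e i) f * e i x))"] by linarith

lemma summable_of_bounded:
 fixes f :: "nat => real"
 assumes "!!n. 0 <= f n" "!!N. (\<Sum>n<N. f n) <= M"
 shows "summable f" "suminf f <= M"
proof -
 show "summable f" by (rule bounded_imp_summable[of f M])
   (use assms(1) assms(2)[of "Suc _"] in \<open>auto simp: lessThan_Suc_atMost\<close>)
 then show "suminf f <= M" by (rule suminf_le_const) (rule assms(2))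
qed

lemma orthonormal_series:
 assumes "orthonormal e" and M: "!!N. (\<Sum>n<N. (cmod (c n))^2) <= M"
 shows "\<exists>k\<in>L2. (%N. N2 (%x. (\<Sum>n<N. c n * e n x) - k x)) ----> 0"
proof (rule L2_complete)
 have e: "e n \<in> L2" for n using assms(1) by (auto simp: orthonormal_def)
 show S: "(%x. \<Sum>n<N. c n * e n x) \<in> L2" for N using e by (intro L2_sum L2_cmult) auto
 fix \<epsilon> :: real assume "\<epsilon> > 0"
 have "summable (%n. (cmod (c n))^2)" by (rule summable_of_bounded(1)[OF _ M]) simp
 then obtain N where N: "!!m n. m >= N ==> norm (\<Sum>k\<in>{m..<n}. (cmod (c k))^2) < \<epsilon>" using \<open>\<epsilon> > 0\<close> unfolding summable_Cauchy by blast
 have *: "N2 (%x. (\<Sum>k<n. c k * e k x) - (\<Sum>k<m. c k * e k x)) <= enn \<epsilon>" if "N <= m" "m <= n" for m n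
 proof -
  have "(\<Sum>k<n. c k * e k x) - (\<Sum>k<m. c k * e k x) = (\<Sum>k\<in>{m..<n}. c k * e k x)" for x using sum_diff_nat_ivl[of 0 m n "%k. c k * e k x"] that by (simp add: atLeast0LessThan)
  then have "N2 (%x. (\<Sum>k<n. c k * e k x) - (\<Sum>k<m. c k * e k x)) = N2 (%x. \<Sum>k\<in>{m..<n}. c k * e k x)" by simp
  also have "... = enn (\<Sum>k\<in>{m..<n}. (cmod (c k))^2)" using e by (subst N2_L2_norm) (auto intro!: L2_sum L2_cmult simp: orthonormal_norm_sum[OF assms(1)])
  also have "... <= enn \<epsilon>" using N[OF that(1), of n] by (intro ennreal_leI) auto
  finally show ?thesis .
 qed
 have "N2 (%x. (\<Sum>k<m. c k * e k x) - (\<Sum>k<n. c k * e k x)) <= enn \<epsilon>" if "m >= N" "n >= N" for m n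
 proof (cases "n <= m")
  case True then show ?thesis using *[of n m] that by simp
 next
  case False then show ?thesis using *[of m n] that by (subst N2_diff_commute) simp
 qed
 then show "\<exists>N. \<forall>m\<ge>N. \<forall>n\<ge>N. N2 (%x. (\<Sum>k<m. c k * e k x) - (\<Sum>k<n. c k * e k x)) <= enn \<epsilon>" by blast
qed

lemma basis_eqI:
 assumes "orthonormal_basis e" "f \<in> L2" "g \<in> L2" "!!n. L2_inner (e n) f = L2_inner (e n) g"
 shows "AE x in lborel. f x = g x"
proof -
 have "L2_inner (e n) (%x. f x - g x) = 0" for n using assms by (subst L2_inner_diff_right) (auto simp: orthonormal_basis_def)
 then have "AE x in lborel. f x - g x = 0" using assms(1) L2_diff[OF assms(2,3)] by (auto simp: orthonormal_basis_def)
 then show ?thesis by simp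
qed

text \<open>The Fourier series converges in L2 by Bessel, and its limit has the same coefficients as \<open>f\<close>.\<close>

lemma basis_expansion:
 assumes e: "orthonormal_basis e" and f: "f \<in> L2"
 shows "(%N. N2 (%x. (\<Sum>n<N. L2_inner (e n) f * e n x) - f x)) ----> 0"
  and "(%n. (cmod (L2_inner (e n) f))^2) sums (L2_norm f)\<^sup>2"
proof -
 note on = orthonormal_basis_orthonormal[OF e]
 have eL: "e n \<in> L2" for n using on by (auto simp: orthonormal_def)
 let ?S = "%N x. \<Sum>n<N. L2_inner (e n) f * e n x"
 have S: "?S N \<in> L2" for N using eL by (intro L2_sum L2_cmult) auto
 have "(\<Sum>n<N. (cmod (L2_inner (e n) f))^2) <= (L2_norm f)^2" for N by (rule Bessel[OF on _ f]) simp
 from orthonormal_series[OF on this]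
 obtain k where k: "k \<in> L2" "(%N. N2 (%x. ?S N x - k x)) ----> 0" by blast
 have "AE x in lborel. k x = f x"
 proof (rule basis_eqI[OF e k(1) f])
  fix i
  have "(%N. LI x. ?S N x * cnj (e i x)) ----> (LI x. k x * cnj (e i x))" by (rule L2_pairing_tendsto[OF L2_cnj[OF eL] S k])
  moreover have "(LI x. ?S N x * cnj (e i x)) = (\<Sum>n<N. L2_inner (e n) f * L2_inner (e i) (e n))" for N using L2_inner_sum_right[of "{..<N}" "e i" e "%n. L2_inner (e n) f"] eL
   by (simp add: L2_inner_def mult.commute)
  ultimately have "(%N. \<Sum>n<N. L2_inner (e n) f * L2_inner (e i) (e n)) ----> L2_inner (e i) k" by (simp add: L2_inner_def mult.commute)
  moreover have "eventually (%N. (\<Sum>n<N. L2_inner (e n) f * L2_inner (e i) (e n)) = L2_inner (e i) f) sequentially" using eventually_gt_at_top[of i]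
  proof eventually_elim
   case (elim N)
   have "(\<Sum>n<N. L2_inner (e n) f * L2_inner (e i) (e n)) = (\<Sum>n<N. L2_inner (e n) f * (if i = n then 1 else 0))" using on by (simp add: orthonormal_def)
   also have "... = L2_inner (e i) f" using elim by (simp add: if_distrib cong: if_cong)
   finally show ?case .
  qed
  then have "(%N. \<Sum>n<N. L2_inner (e n) f * L2_inner (e i) (e n)) ----> L2_inner (e i) f" by (rule tendsto_eventually)
  ultimately show "L2_inner (e i) k = L2_inner (e i) f" by (rule LIMSEQ_unique)
 qed
 then have eq: "N2 (%x. ?S N x - k x) = N2 (%x. ?S N x - f x)" for N by (intro N2_cong_AE) (auto elim: eventually_mono)
 show lim: "(%N. N2 (%x. ?S N x - f x)) ----> 0" using k(2) unfolding eq .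
 have "N2 (%x. ?S N x - f x) = enn ((L2_norm f)^2 - (\<Sum>n<N. (cmod (L2_inner (e n) f))^2))" for N by (subst N2_diff_commute, subst N2_L2_norm[OF L2_diff[OF f S]])
    (simp only: orthonormal_pythagoras[OF on finite_lessThan f])
 with lim have "(%N. enn ((L2_norm f)^2 - (\<Sum>n<N. (cmod (L2_inner (e n) f))^2))) ----> enn 0" by simp
 then have "(%N. (L2_norm f)^2 - (\<Sum>n<N. (cmod (L2_inner (e n) f))^2)) ----> 0" by (subst (asm) tendsto_ennreal_iff) (auto simp: Bessel[OF on _ f])
 from tendsto_diff[OF tendsto_const[of "(L2_norm f)^2"] this]
 show "(%n. (cmod (L2_inner (e n) f))^2) sums (L2_norm f)\<^sup>2" by (simp add: sums_def)
qed


section \<open>Density operators are Hilbert-Schmidt operators\<close>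

text \<open>
 For \<open>B \<ge> 0\<close> with \<open>B \<le> K\<close>, the form of \<open>B\<close> is nonnegative at \<open>f - B f / K\<close>.
\<close>

lemma nonneg_op_norm_le_form:
 assumes B: "bounded_op B" "nonneg_op B" and K: "K > 0" "!!f. f \<in> L2 ==> L2_norm (B f) <= K * L2_norm f" and f: "f \<in> L2"
 shows "(L2_norm (B f))^2 <= K * Re (L2_inner f (B f))"
proof -
 have BL: "B g \<in> L2" if "g \<in> L2" for g using B(1) that by (auto simp: bounded_op_def)
 have herm: "L2_inner g (B h) = L2_inner (B g) h" if "g \<in> L2" "h \<in> L2" for g h using B(2) that by (auto simp: nonneg_op_def hermitian_op_def)
 define s where "s = cor (1 / K)"
 define g where "g = B f"
 have g: "g \<in> L2" "B g \<in> L2" "B f \<in> L2" using BL f by (auto simp: g_def)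
 define u where "u x = f x - s * g x" for x
 have u: "u \<in> L2" unfolding u_def by (intro L2_diff L2_cmult f g)
 have lin: "AE x in lborel. B u x = g x - s * B g x"
 proof -
  have "AE x in lborel. B (%y. 1 * f y + (- s) * g y) x = 1 * B f x + (- s) * B g x" using B(1) f g(1) unfolding bounded_op_def by blast
  then show ?thesis by (simp add: u_def[abs_def] g_def)
 qed
 have "L2_inner u (B u) = L2_inner u (%x. g x - s * B g x)" using BL[OF u] u g by (intro L2_inner_cong_AE lin) auto
 also have "... = L2_inner u g - s * L2_inner u (B g)" using u g by (simp add: L2_inner_diff_right L2_cmult L2_inner_cmult_right)
 also have "L2_inner u g = L2_inner f g - cnj s * L2_inner g g" unfolding u_def using f g by (simp add: L2_inner_diff_left L2_cmult L2_inner_cmult_left)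
 also have "L2_inner u (B g) = L2_inner f (B g) - cnj s * L2_inner g (B g)" unfolding u_def using f g by (simp add: L2_inner_diff_left L2_cmult L2_inner_cmult_left)
 also have "L2_inner f (B g) = L2_inner g g" using herm[OF f g(1)] by (simp add: g_def)
 finally have eq: "L2_inner u (B u) = L2_inner f g - cnj s * L2_inner g g - s * (L2_inner g g - cnj s * L2_inner g (B g))" .
 have pos: "0 <= Re (L2_inner u (B u))" using B(2) u by (auto simp: nonneg_op_def)
 define P where "P = (L2_norm g)^2"
 define Q where "Q = Re (L2_inner g (B g))"
 have "0 <= Re (L2_inner f g) - P / K - (P / K - Q / K^2)" using pos K(1) unfolding eq s_def P_def Q_def by (simp add: L2_inner_self[OF g(1)] power2_eq_square field_simps)
 moreover have "Q <= K * P"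
 proof -
  have "Q <= cmod (L2_inner g (B g))" unfolding Q_def by (rule complex_Re_le_cmod)
  also have "... <= L2_norm g * L2_norm (B g)" by (rule Cauchy_Schwarz_L2_inner[OF g(1,2)])
  also have "... <= L2_norm g * (K * L2_norm g)" by (intro mult_left_mono K(2) g) auto
  finally show ?thesis by (simp add: P_def power2_eq_square mult.left_commute)
 qed
 then have "Q / K^2 <= P / K" using K(1) by (simp add: field_simps power2_eq_square)
 ultimately have "P / K <= Re (L2_inner f g)" by linarith
 then show ?thesis using K(1) by (simp add: P_def g_def field_simps)
qed

text \<open>Basis independence of \<open>\<Sum> |B e\<^sub>j|\<^sup>2\<close>, via the double sum of \<open>|\<langle>e'\<^sub>n, B e\<^sub>j\<rangle>|\<^sup>2\<close>.\<close>

lemma density_operator_Hilbert_Schmidt: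
 assumes R: "density_operator R" and e: "orthonormal_basis e"
 shows "summable (%n. (L2_norm (R (e n)))^2)"
proof -
 obtain B e' where B: "is_modulus R B" "orthonormal_basis e'" "summable (%n. Re (L2_inner (e' n) (B (e' n))))" using R unfolding density_operator_def trace_class_def by blast
 have B': "bounded_op B" "nonneg_op B" using B(1) by (auto simp: is_modulus_def)
 have RL: "R f \<in> L2" if "f \<in> L2" for f using R that by (auto simp: density_operator_def trace_class_def bounded_op_def)
 have BL: "B f \<in> L2" if "f \<in> L2" for f using B' that by (auto simp: bounded_op_def)
 have eL: "e n \<in> L2" "e' n \<in> L2" for n using e B(2) by (auto simp: orthonormal_basis_def)
 have norm_eq: "(L2_norm (R f))^2 = (L2_norm (B f))^2" if "f \<in> L2" for f
 proof -
  have "L2_inner (B f) (B f) = L2_inner (R f) (R f)" using B(1) that by (auto simp: is_modulus_def)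
  then show ?thesis using that by (simp only: L2_inner_self RL BL of_real_eq_iff)
 qed
 obtain K0 where K0: "!!f. f \<in> L2 ==> L2_norm (B f) <= K0 * L2_norm f" using B'(1) unfolding bounded_op_def by blast
 define K where "K = \<bar>K0\<bar> + 1"
 have K: "K > 0" "L2_norm (B f) <= K * L2_norm f" if "f \<in> L2" for f
 proof -
  have "K0 * L2_norm f <= K * L2_norm f" unfolding K_def by (intro mult_right_mono) auto
  then show "L2_norm (B f) <= K * L2_norm f" using K0[OF that] by linarith
 qed (simp add: K_def)
 have K_pos: "K > 0" by (simp add: K_def)
 have sum': "summable (%n. (L2_norm (B (e' n)))^2)"
 proof (rule summable_comparison_test)
  show "\<exists>N. \<forall>n\<ge>N. norm ((L2_norm (B (e' n)))^2) <= K * Re (L2_inner (e' n) (B (e' n)))" using nonneg_op_norm_le_form[OF B' K_pos K(2) eL(2)] by simp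
  show "summable (%n. K * Re (L2_inner (e' n) (B (e' n))))" by (intro summable_mult B(3))
 qed
 have "(\<Sum>j<N. (L2_norm (B (e j)))^2) <= (\<Sum>n. (L2_norm (B (e' n)))^2)" for N
 proof -
  have sums: "(%n. \<Sum>j<N. (cmod (L2_inner (e' n) (B (e j))))^2) sums (\<Sum>j<N. (L2_norm (B (e j)))^2)" by (intro sums_sum basis_expansion(2) B(2) BL eL)
  have "(\<Sum>j<N. (cmod (L2_inner (e' n) (B (e j))))^2) <= (L2_norm (B (e' n)))^2" for n
  proof -
   have "L2_inner (e' n) (B (e j)) = cnj (L2_inner (e j) (B (e' n)))" for j
   proof -
    have "L2_inner (e' n) (B (e j)) = L2_inner (B (e' n)) (e j)" using B'(2) eL by (auto simp: nonneg_op_def hermitian_op_def)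
    then show ?thesis by (simp add: L2_inner_commute[of "B (e' n)"])
   qed
   then show ?thesis using Bessel[OF orthonormal_basis_orthonormal[OF e], of "{..<N}" "B (e' n)"] BL eL by simp
  qed
  then have "(\<Sum>n. \<Sum>j<N. (cmod (L2_inner (e' n) (B (e j))))^2) <= (\<Sum>n. (L2_norm (B (e' n)))^2)" by (intro suminf_le sums_summable[OF sums] sum')
  then show ?thesis using sums_unique[OF sums] by simp
 qed
 then have "summable (%j. (L2_norm (B (e j)))^2)" by (intro summable_of_bounded(1)) auto
 then show ?thesis using norm_eq eL by simp
qed

definition some_basis :: "nat => 'a::euclidean_space => complex" where
 "some_basis = (SOME e. orthonormal_basis e)"

lemma density_operator_some_basis:
 assumes "density_operator (R :: 'a::euclidean_space L2_op)"
 shows "orthonormal_basis (some_basis :: nat => 'a => complex)" using assms unfolding density_operator_def trace_class_def some_basis_def by (metis someI_ex)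

text \<open>As \<open>R\<close> is hermitian, the diagonal entries of \<open>R\<^sup>2\<close> are the squared norms of the \<open>R e\<^sub>n\<close>.\<close>

lemma op_trace_square:
 assumes R: "density_operator (R :: 'a::euclidean_space L2_op)" and M: "Re (op_trace (R \<circ> R)) <= M"
 shows "(\<Sum>j<N. (L2_norm (R (some_basis j)))^2) <= M"
proof -
 note e = density_operator_some_basis[OF R]
 have eL: "some_basis n \<in> (L2 :: ('a => complex) set)" for n using e by (auto simp: orthonormal_basis_def)
 have RL: "R f \<in> L2" if "f \<in> L2" for f using R that by (auto simp: density_operator_def trace_class_def bounded_op_def)
 have "L2_inner (some_basis n) (R (R (some_basis n))) = cor ((L2_norm (R (some_basis n)))^2)" for n
 proof -
  have "L2_inner (some_basis n) (R (R (some_basis n))) = L2_inner (R (some_basis n)) (R (some_basis n))" using R RL eL by (auto simp: density_operator_def nonneg_op_def hermitian_op_def)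
  then show ?thesis by (simp add: L2_inner_self RL eL)
 qed
 then have "op_trace (R \<circ> R) = (\<Sum>n. cor ((L2_norm (R (some_basis n)))^2))" unfolding op_trace_def some_basis_def[symmetric] by simp
 also have "... = cor (\<Sum>n. (L2_norm (R (some_basis n)))^2)" by (rule suminf_of_real[symmetric]) (rule density_operator_Hilbert_Schmidt[OF R e])
 finally have "(\<Sum>n. (L2_norm (R (some_basis n)))^2) <= M" using M by simp
 moreover have "(\<Sum>j<N. (L2_norm (R (some_basis j)))^2) <= (\<Sum>n. (L2_norm (R (some_basis n)))^2)" by (rule sum_le_suminf[OF density_operator_Hilbert_Schmidt[OF R e]]) auto
 ultimately show ?thesis by linarith
qed


section \<open>Integral kernels\<close>

lemma integral_tensor:
 fixes f :: "'a::euclidean_space => complex" and g :: "'b::euclidean_space => complex"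
 assumes "L1 f" "L1 g"
 shows "(LI z. f (fst z) * g (snd z)) = (LI x. f x) * (LI y. g y)" using integral_prod_fst[OF integrable_tensor[OF assms]] by simp

lemma N2_tensor:
 fixes f :: "'a::euclidean_space => complex" and g :: "'b::euclidean_space => complex"
 assumes [measurable]: "f \<in> BM" "g \<in> BM"
 shows "N2 (%z. f (fst z) * g (snd z)) = N2 f * N2 g" unfolding N2_def by (subst nn_integral_tensor[symmetric]) (auto simp: norm_mult power_mult_distrib ennreal_mult)

lemma tensor_L2:
 fixes f :: "'a::euclidean_space => complex" and g :: "'b::euclidean_space => complex"
 assumes "f \<in> L2" "g \<in> L2"
 shows "(%z. f (fst z) * g (snd z)) \<in> L2"
proof -
 have [measurable]: "f \<in> BM" "g \<in> BM" using assms by auto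
 show ?thesis using assms by (auto simp: L2_iff N2_tensor ennreal_mult_less_top)
qed

definition tens :: "(nat => 'a::euclidean_space => complex) => nat => 'a \<times> 'a => complex" where
 "tens e n z = e (fst (prod_decode n)) (fst z) * cnj (e (snd (prod_decode n)) (snd z))"

definition matrix_coeff :: "(nat => 'a::euclidean_space => complex) => 'a L2_op => nat => complex" where
 "matrix_coeff e R n = L2_inner (e (fst (prod_decode n))) (R (e (snd (prod_decode n))))"

lemma tens_pairing:
 assumes "orthonormal e" "f \<in> L2" "g \<in> L2"
 shows "(LI z. tens e n z * (cnj (f (fst z)) * g (snd z)))
    = L2_inner f (e (fst (prod_decode n))) * L2_inner (e (snd (prod_decode n))) g"
proof -
 have e: "e n \<in> L2" for n using assms(1) by (auto simp: orthonormal_def)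
 let ?i = "fst (prod_decode n)" and ?j = "snd (prod_decode n)"
 have "(LI z. tens e n z * (cnj (f (fst z)) * g (snd z)))
   = (LI z. (cnj (f (fst z)) * e ?i (fst z)) * (cnj (e ?j (snd z)) * g (snd z)))" by (intro Bochner_Integration.integral_cong) (auto simp: tens_def)
 also have "... = L2_inner f (e ?i) * L2_inner (e ?j) g" unfolding L2_inner_def using assms e by (intro integral_tensor L2_inner_integrable) auto
 finally show ?thesis .
qed

lemma tens_L2: "orthonormal e ==> tens e n \<in> L2" unfolding tens_def[abs_def] by (intro tensor_L2 L2_cnj) (auto simp: orthonormal_def)

lemma tens_orthonormal:
 assumes e: "orthonormal e"
 shows "orthonormal (tens e)" unfolding orthonormal_def
proof (intro conjI allI)
 show "tens e n \<in> L2" for n by (rule tens_L2[OF e])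
 have eL: "e n \<in> L2" "L2_inner (e j) (e k) = (if j = k then 1 else 0)" for n j k using e by (auto simp: orthonormal_def)
 fix m n
 have "L2_inner (tens e m) (tens e n)
   = (LI z. tens e n z * (cnj (e (fst (prod_decode m)) (fst z)) * e (snd (prod_decode m)) (snd z)))" unfolding L2_inner_def by (intro Bochner_Integration.integral_cong) (auto simp: tens_def)
 also have "... = L2_inner (e (fst (prod_decode m))) (e (fst (prod_decode n))) * L2_inner (e (snd (prod_decode n))) (e (snd (prod_decode m)))" by (rule tens_pairing[OF e eL(1) eL(1)])
 also have "... = (if m = n then 1 else 0)"
 proof (cases "m = n")
  case False
  then have "prod_decode m ~= prod_decode n" by (metis prod_decode_inverse)
  then show ?thesis using False by (auto simp: eL(2) prod_eq_iff)
 qed (simp add: eL(2))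
 finally show "L2_inner (tens e m) (tens e n) = (if m = n then 1 else 0)" .
qed

lemma matrix_coeff_bound:
 assumes e: "orthonormal e" and RL: "!!f. f \<in> L2 ==> R f \<in> L2" and M: "!!N. (\<Sum>j<N. (L2_norm (R (e j)))^2) <= M"
 shows "(\<Sum>n<N. (cmod (matrix_coeff e R n))^2) <= M"
proof -
 define K where "K = Suc (Max ((%n. max (fst (prod_decode n)) (snd (prod_decode n))) ` {..N}))"
 have le: "fst (prod_decode n) < K" "snd (prod_decode n) < K" if "n < N" for n
 proof -
  have "max (fst (prod_decode n)) (snd (prod_decode n)) < K" unfolding K_def using that by (intro le_imp_less_Suc Max_ge) auto
  then show "fst (prod_decode n) < K" "snd (prod_decode n) < K" by auto
 qed
 have eL: "e n \<in> L2" for n using e by (auto simp: orthonormal_def)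
 let ?g = "%(i, j). (cmod (L2_inner (e i) (R (e j))))^2"
 have "(\<Sum>n<N. (cmod (matrix_coeff e R n))^2) = sum ?g (prod_decode ` {..<N})" by (subst sum.reindex) (auto simp: matrix_coeff_def inj_on_def split_beta intro: inj_onD[OF inj_prod_decode])
 also have "... <= sum ?g ({..<K} \<times> {..<K})"
 proof (rule sum_mono2)
  show "prod_decode ` {..<N} \<subseteq> {..<K} \<times> {..<K}" using le by (intro image_subsetI) (auto simp: mem_Times_iff)
 qed auto
 also have "... = (\<Sum>i<K. \<Sum>j<K. (cmod (L2_inner (e i) (R (e j))))^2)" by (simp add: sum.cartesian_product)
 also have "... = (\<Sum>j<K. \<Sum>i<K. (cmod (L2_inner (e i) (R (e j))))^2)" by (rule sum.swap)
 also have "... <= (\<Sum>j<K. (L2_norm (R (e j)))^2)" by (intro sum_mono Bessel e RL eL) auto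
 also have "... <= M" by (rule M)
 finally show ?thesis .
qed

lemma kernel_operator_L2:
 fixes k :: "'a::euclidean_space \<times> 'a => complex"
 assumes "k \<in> L2" "f \<in> L2"
 shows "(%x. LI y. k (x, y) * f y) \<in> L2"
proof -
 have [measurable]: "k \<in> BM" "f \<in> BM" using assms by auto
 have "N2 (%x. LI y. k (x, y) * f y) <= (NI x. N2 (%y. k (x, y)) * N2 f)" unfolding N2_def[of "%x. LI y. k (x, y) * f y"] by (intro nn_integral_mono Cauchy_Schwarz_L2) auto
 also have "... = N2 k * N2 f" unfolding N2_def by (subst nn_integral_multc) (auto simp: nn_integral_prod_fst)
 also have "... < \<infinity>" using assms by (auto simp: L2_iff ennreal_mult_less_top)
 finally show ?thesis by (auto simp: L2_iff)
qed

text \<open>Testing against the countably many basis functions determines almost every section of the kernel.\<close>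

lemma kernel_unique:
 fixes k k' :: "'a::euclidean_space \<times> 'a => complex"
 assumes e: "orthonormal_basis (e :: nat => 'a => complex)" and k: "k \<in> L2" "k' \<in> L2"
  and eq: "!!f. f \<in> L2 ==> AE x in lborel. (LI y. k (x, y) * f y) = (LI y. k' (x, y) * f y)"
 shows "AE z in lborel. k z = k' z"
proof -
 have [measurable]: "k \<in> BM" "k' \<in> BM" using k by auto
 have sec: "AE x in lborel. (%y. k (x, y)) \<in> L2" if "k \<in> L2" for k :: "'a \<times> 'a => complex"
 proof -
  have [measurable]: "k \<in> BM" using that by auto
  have "(NI x. N2 (%y. k (x, y))) = N2 k" unfolding N2_def by (rule nn_integral_prod_fst[symmetric]) auto
  also have "... < \<infinity>" using that by (rule L2_N2_finite)
  finally have "AE x in lborel. N2 (%y. k (x, y)) ~= \<infinity>" unfolding N2_def by (intro nn_integral_PInf_AE) auto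
  then show ?thesis by eventually_elim (auto simp: L2_iff less_top)
 qed
 have eL: "e n \<in> L2" for n using e by (auto simp: orthonormal_basis_def)
 have "AE x in lborel. \<forall>n. (LI y. k (x, y) * cnj (e n y)) = (LI y. k' (x, y) * cnj (e n y))" unfolding AE_all_countable by (intro allI eq L2_cnj eL)
 with sec[OF k(1)] sec[OF k(2)] have "AE x in lborel. N2 (%y. k (x, y) - k' (x, y)) = 0"
 proof eventually_elim
  case (elim x)
  have "AE y in lborel. k (x, y) = k' (x, y)" using elim by (intro basis_eqI[OF e]) (auto simp: L2_inner_def mult.commute)
  then have "AE y in lborel. k (x, y) - k' (x, y) = 0" by (auto elim: eventually_mono)
  then show ?case by (subst N2_0_AE) auto
 qed
 then have "(NI x. N2 (%y. k (x, y) - k' (x, y))) = (NI (x::'a). 0)" by (intro nn_integral_cong_AE) auto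
 moreover have "(NI x. N2 (%y. k (x, y) - k' (x, y))) = N2 (%z. k z - k' z)" unfolding N2_def by (rule nn_integral_prod_fst[symmetric, of "%z. enn ((cmod (k z - k' z))^2)"]) auto
 ultimately have "N2 (%z. k z - k' z) = 0" by simp
 then show ?thesis by (subst (asm) N2_0_AE) auto
qed

text \<open>The matrix coefficients are square summable, so the tensor series converges in L2, and its sum acts as the operator.\<close>

theorem integral_kernel_expansion:
 fixes R :: "'a::euclidean_space L2_op"
 assumes R: "density_operator R" and M: "Re (op_trace (R \<circ> R)) <= M"
 shows "integral_kernel R \<in> L2"
  and "(%N. N2 (%z. (\<Sum>n<N. matrix_coeff some_basis R n * tens some_basis n z) - integral_kernel R z)) ----> 0"
  and "N2 (integral_kernel R) <= enn (2 * M)"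
  and "!!N. (\<Sum>n<N. (cmod (matrix_coeff some_basis R n))^2) <= M"
proof -
 let ?e = "some_basis :: nat => 'a => complex"
 note e = density_operator_some_basis[OF R]
 note on = orthonormal_basis_orthonormal[OF e]
 have eL: "?e n \<in> L2" for n using on by (auto simp: orthonormal_def)
 have RL: "R f \<in> L2" if "f \<in> L2" for f using R that by (auto simp: density_operator_def trace_class_def bounded_op_def)
 have herm: "L2_inner f (R g) = L2_inner (R f) g" if "f \<in> L2" "g \<in> L2" for f g using R that by (auto simp: density_operator_def nonneg_op_def hermitian_op_def)
 show cb: "(\<Sum>n<N. (cmod (matrix_coeff ?e R n))^2) <= M" for N by (rule matrix_coeff_bound[OF on RL op_trace_square[OF R M]])
 let ?S = "%N z. \<Sum>n<N. matrix_coeff ?e R n * tens ?e n z"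
 have S: "?S N \<in> L2" for N by (intro L2_sum L2_cmult tens_L2 on) auto
 obtain k where k: "k \<in> L2" "(%N. N2 (%z. ?S N z - k z)) ----> 0" using orthonormal_series[OF tens_orthonormal[OF on] cb] by blast
 have [measurable]: "k \<in> BM" using k by auto
 have pair_basis: "(LI z. k z * (cnj (?e i (fst z)) * ?e l (snd z))) = L2_inner (?e i) (R (?e l))" for i l
 proof -
  have "(%N. LI z. ?S N z * (cnj (?e i (fst z)) * ?e l (snd z))) ----> (LI z. k z * (cnj (?e i (fst z)) * ?e l (snd z)))" by (rule L2_pairing_tendsto[OF _ S k]) (intro tensor_L2 L2_cnj eL)
  moreover have "eventually (%N. (LI z. ?S N z * (cnj (?e i (fst z)) * ?e l (snd z))) = L2_inner (?e i) (R (?e l))) sequentially" using eventually_gt_at_top[of "prod_encode (i, l)"]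
  proof eventually_elim
   case (elim N)
   have "(LI z. ?S N z * (cnj (?e i (fst z)) * ?e l (snd z)))
     = (LI z. (\<Sum>n<N. matrix_coeff ?e R n * (tens ?e n z * (cnj (?e i (fst z)) * ?e l (snd z)))))" by (simp add: sum_distrib_right mult.assoc)
   also have "... = (\<Sum>n<N. LI z. matrix_coeff ?e R n * (tens ?e n z * (cnj (?e i (fst z)) * ?e l (snd z))))"
    by (intro Bochner_Integration.integral_sum integrable_mult_right L2_mult_integrable tens_L2 tensor_L2 L2_cnj eL on)
   also have "... = (\<Sum>n<N. matrix_coeff ?e R n * (L2_inner (?e i) (?e (fst (prod_decode n))) * L2_inner (?e (snd (prod_decode n))) (?e l)))" by (simp add: tens_pairing[OF on eL eL])
   also have "... = (\<Sum>n<N. if prod_encode (i, l) = n then matrix_coeff ?e R n else 0)"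
   proof (intro sum.cong refl)
    fix n
    have "prod_encode (i, l) = n \<longleftrightarrow> i = fst (prod_decode n) \<and> l = snd (prod_decode n)" by (metis fst_conv prod.collapse prod_decode_inverse prod_encode_inverse snd_conv)
    then show "matrix_coeff ?e R n * (L2_inner (?e i) (?e (fst (prod_decode n))) * L2_inner (?e (snd (prod_decode n))) (?e l))
      = (if prod_encode (i, l) = n then matrix_coeff ?e R n else 0)" using on by (auto simp: orthonormal_def)
   qed
   also have "... = matrix_coeff ?e R (prod_encode (i, l))" using elim by simp
   finally show ?case by (simp add: matrix_coeff_def)
  qed
  then have "(%N. LI z. ?S N z * (cnj (?e i (fst z)) * ?e l (snd z))) ----> L2_inner (?e i) (R (?e l))" by (rule tendsto_eventually)
  ultimately show ?thesis by (rule LIMSEQ_unique)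
 qed
 have rep: "AE x in lborel. R f x = (LI y. k (x, y) * f y)" if f: "f \<in> L2" for f
 proof (rule basis_eqI[OF e RL[OF f] kernel_operator_L2[OF k(1) f]])
  fix i
  have [measurable]: "f \<in> BM" "?e i \<in> BM" using f eL by auto
  have int: "L1 (%z. k z * (cnj (?e i (fst z)) * f (snd z)))" by (intro L2_mult_integrable k tensor_L2 L2_cnj eL f)
  have 1: "L2_inner (?e i) (%x. LI y. k (x, y) * f y) = (LI z. k z * (cnj (?e i (fst z)) * f (snd z)))"
  proof -
   have "(LI z. k z * (cnj (?e i (fst z)) * f (snd z))) = (LI x. LI y. k (x, y) * (cnj (?e i x) * f y))" using integral_prod_fst[OF int] by simp
   also have "... = (LI x. LI y. cnj (?e i x) * (k (x, y) * f y))" by (simp add: mult.left_commute)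
   finally show ?thesis by (simp add: L2_inner_def)
  qed
  let ?P = "%N x. \<Sum>l<N. L2_inner (?e l) f * ?e l x"
  have P: "?P N \<in> L2" for N by (intro L2_sum L2_cmult eL) auto
  note exp = basis_expansion(1)[OF e f]
  have "(%N. LI z. (cnj (?e i (fst z)) * ?P N (snd z)) * k z) ----> (LI z. (cnj (?e i (fst z)) * f (snd z)) * k z)"
  proof (rule L2_pairing_tendsto[OF k(1)])
   show "(%z. cnj (?e i (fst z)) * ?P N (snd z)) \<in> L2" for N by (intro tensor_L2 L2_cnj eL P)
   show "(%z. cnj (?e i (fst z)) * f (snd z)) \<in> L2" by (intro tensor_L2 L2_cnj eL f)
   have "N2 (%z. cnj (?e i (fst z)) * ?P N (snd z) - cnj (?e i (fst z)) * f (snd z))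
     = N2 (%x. cnj (?e i x)) * N2 (%x. ?P N x - f x)" for N unfolding right_diff_distrib[symmetric] using L2_measurable[OF L2_cnj[OF eL[of i]]] L2_measurable[OF L2_diff[OF P f]] by (rule N2_tensor)
   moreover have "(%N. N2 (%x. cnj (?e i x)) * N2 (%x. ?P N x - f x)) ----> 0" by (rule ennreal_tendsto_0_cmult[OF exp L2_N2_finite[OF L2_cnj[OF eL]]])
   ultimately show "(%N. N2 (%z. cnj (?e i (fst z)) * ?P N (snd z) - cnj (?e i (fst z)) * f (snd z))) ----> 0" by simp
  qed
  moreover have "(LI z. (cnj (?e i (fst z)) * ?P N (snd z)) * k z) = (LI x. ?P N x * cnj (R (?e i) x))" for N
  proof -
   have "(LI z. (cnj (?e i (fst z)) * ?P N (snd z)) * k z)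
     = (LI z. (\<Sum>l<N. L2_inner (?e l) f * (k z * (cnj (?e i (fst z)) * ?e l (snd z)))))" by (intro Bochner_Integration.integral_cong refl) (simp add: sum_distrib_left sum_distrib_right mult_ac)
   also have "... = (\<Sum>l<N. LI z. L2_inner (?e l) f * (k z * (cnj (?e i (fst z)) * ?e l (snd z))))"
    by (intro Bochner_Integration.integral_sum integrable_mult_right L2_mult_integrable k tensor_L2 L2_cnj eL)
   also have "... = (\<Sum>l<N. L2_inner (?e l) f * L2_inner (R (?e i)) (?e l))" by (simp add: pair_basis herm[OF eL eL])
   also have "... = L2_inner (R (?e i)) (?P N)" by (rule L2_inner_sum_right[symmetric]) (auto intro: RL eL)
   finally show ?thesis by (simp add: L2_inner_def mult.commute)
  qed
  moreover have "(%N. LI x. ?P N x * cnj (R (?e i) x)) ----> (LI x. f x * cnj (R (?e i) x))" by (rule L2_pairing_tendsto[OF L2_cnj[OF RL[OF eL]] P f exp])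
  ultimately have "(LI z. (cnj (?e i (fst z)) * f (snd z)) * k z) = (LI x. f x * cnj (R (?e i) x))" using LIMSEQ_unique by auto
  then have "L2_inner (R (?e i)) f = (LI z. k z * (cnj (?e i (fst z)) * f (snd z)))" by (simp add: L2_inner_def mult.commute)
  with 1 show "L2_inner (?e i) (R f) = L2_inner (?e i) (%x. LI y. k (x, y) * f y)" by (simp add: herm[OF eL f])
 qed
 have ik: "integral_kernel R \<in> L2 \<and> (\<forall>f\<in>L2. AE X in lborel. R f X = (LI Y. integral_kernel R (X, Y) * f Y))" unfolding integral_kernel_def by (rule someI[of _ k]) (use k rep in blast)
 show "integral_kernel R \<in> L2" using ik by blast
 have "AE z in lborel. k z = integral_kernel R z"
 proof (rule kernel_unique[OF e k(1)])
  show "integral_kernel R \<in> L2" using ik by blast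
  fix f :: "'a => complex" assume f: "f \<in> L2"
  have "AE x in lborel. R f x = (LI y. integral_kernel R (x, y) * f y)" using ik f by blast
  with rep[OF f] show "AE x in lborel. (LI y. k (x, y) * f y) = (LI y. integral_kernel R (x, y) * f y)" by eventually_elim simp
 qed
 then have "N2 (%z. ?S N z - k z) = N2 (%z. ?S N z - integral_kernel R z)" for N by (intro N2_cong_AE) (auto elim: eventually_mono)
 then show lim: "(%N. N2 (%z. ?S N z - integral_kernel R z)) ----> 0" using k(2) by simp
 have "N2 (integral_kernel R) <= 2 * N2 (%z. ?S N z - integral_kernel R z) + enn (2 * M)" for N
 proof -
  have M0: "0 <= M" using cb[of 0] by simp
  have "N2 (integral_kernel R) = N2 (%z. (integral_kernel R z - ?S N z) + ?S N z)" by simp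
  also have "... <= 2 * N2 (%z. integral_kernel R z - ?S N z) + 2 * N2 (?S N)" by (rule N2_add) (use S ik in auto)
  also have "N2 (?S N) = enn (\<Sum>n<N. (cmod (matrix_coeff ?e R n))^2)" by (subst N2_L2_norm[OF S]) (simp only: orthonormal_norm_sum[OF tens_orthonormal[OF on] finite_lessThan])
  also have "2 * N2 (%z. integral_kernel R z - ?S N z) + 2 * enn (\<Sum>n<N. (cmod (matrix_coeff ?e R n))^2)
    <= 2 * N2 (%z. integral_kernel R z - ?S N z) + 2 * enn M" by (intro add_left_mono mult_left_mono ennreal_leI cb) auto
  finally show ?thesis using M0 by (simp add: N2_diff_commute[of "integral_kernel R"] two_times_ennreal)
 qed
 moreover have "(%N. 2 * N2 (%z. ?S N z - integral_kernel R z) + enn (2 * M)) ----> 0 + enn (2 * M)" by (intro tendsto_add ennreal_tendsto_0_cmult lim tendsto_const) auto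
 ultimately show "N2 (integral_kernel R) <= enn (2 * M)" by (intro LIMSEQ_le_const[of _ "enn (2 * M)"]) auto
qed


section \<open>Joint measurability in time and space\<close>

text \<open>
 The coefficients of a weakly continuous family are continuous in time, so the expansion in the
 tensor basis converges in L2 of time and space, and this limit is jointly measurable.
\<close>

context
 fixes R :: "real => 'a::euclidean_space L2_op" and T M :: real
 assumes T: "T > 0"
  and density: "!!t. t \<in> {-T..T} ==> density_operator (R t)"
  and wot: "wot_continuous_on {-T..T} R"
  and trace: "!!t. t \<in> {-T..T} ==> Re (op_trace (R t \<circ> R t)) <= M"
begin

lemma family_basis: "orthonormal_basis (some_basis :: nat => 'a => complex)" using density_operator_some_basis[OF density[of 0]] T by simp

lemma family_matrix_coeff_continuous: "continuous_on {-T..T} (%t. matrix_coeff some_basis (R t) n)" using wot family_basis unfolding wot_continuous_on_def matrix_coeff_def orthonormal_basis_def by blast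

lemma family_trace_bound_nonneg: "0 <= M" using integral_kernel_expansion(4)[OF density[of 0] trace[of 0], of 0] T by simp

lemma family_pairing_continuous:
 assumes \<Phi>: "\<Phi> \<in> L2"
 shows "continuous_on {-T..T} (%t. LI z. integral_kernel (R t) z * \<Phi> z)"
proof -
 let ?e = "some_basis :: nat => 'a => complex"
 note on = orthonormal_basis_orthonormal[OF family_basis]
 define \<phi> where "\<phi> n = (LI z. tens ?e n z * \<Phi> z)" for n
 define m where "m N t = (\<Sum>n<N. matrix_coeff ?e (R t) n * \<phi> n)" for N t
 define l where "l t = (LI z. integral_kernel (R t) z * \<Phi> z)" for t
 have \<phi>_sum: "(\<Sum>n<N. (cmod (\<phi> n))^2) <= (L2_norm (%z. cnj (\<Phi> z)))^2" for N
 proof -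
  have "cmod (\<phi> n) = cmod (L2_inner (tens ?e n) (%z. cnj (\<Phi> z)))" for n
  proof -
   have "L2_inner (%z. cnj (\<Phi> z)) (tens ?e n) = \<phi> n" unfolding \<phi>_def L2_inner_def by (simp add: mult.commute)
   then show ?thesis by (subst L2_inner_commute) simp
  qed
  then show ?thesis using Bessel[OF tens_orthonormal[OF on] finite_lessThan L2_cnj[OF \<Phi>]] by simp
 qed
 then have sm: "summable (%n. (cmod (\<phi> n))^2)" by (intro summable_of_bounded(1)) auto
 have S: "(%z. \<Sum>n<N. matrix_coeff ?e (R t) n * tens ?e n z) \<in> L2" for N t by (intro L2_sum L2_cmult tens_L2 on) auto
 have m_lim: "(%N. m N t) ----> l t" if t: "t \<in> {-T..T}" for t
 proof -
  have "(LI z. (\<Sum>n<N. matrix_coeff ?e (R t) n * tens ?e n z) * \<Phi> z) = m N t" for N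
  proof -
   have "(LI z. (\<Sum>n<N. matrix_coeff ?e (R t) n * tens ?e n z) * \<Phi> z)
     = (LI z. (\<Sum>n<N. matrix_coeff ?e (R t) n * (tens ?e n z * \<Phi> z)))" by (simp add: sum_distrib_right mult.assoc)
   also have "... = (\<Sum>n<N. LI z. matrix_coeff ?e (R t) n * (tens ?e n z * \<Phi> z))" by (intro Bochner_Integration.integral_sum integrable_mult_right L2_mult_integrable tens_L2 on \<Phi>)
   finally show ?thesis by (simp add: m_def \<phi>_def)
  qed
  then show ?thesis using L2_pairing_tendsto[OF \<Phi> S integral_kernel_expansion(1,2)[OF density[OF t] trace[OF t]]] by (simp add: l_def)
 qed
 have unif: "uniform_limit {-T..T} m l sequentially"
 proof (rule uniform_limitI)
  fix \<epsilon> :: real assume "\<epsilon> > 0"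
  define \<delta> where "\<delta> = (\<epsilon> / 2)^2 / (M + 1)"
  have "\<delta> > 0" using \<open>\<epsilon> > 0\<close> family_trace_bound_nonneg by (simp add: \<delta>_def)
  then obtain N where N: "!!m n. m >= N ==> norm (\<Sum>k\<in>{m..<n}. (cmod (\<phi> k))^2) < \<delta>" using sm unfolding summable_Cauchy by blast
  have "dist (m n t) (l t) < \<epsilon>" if n: "n >= N" and t: "t \<in> {-T..T}" for n t
  proof -
   have bd: "cmod (m n t - m j t) <= \<epsilon> / 2" if "j >= n" for j
   proof -
    have "m j t - m n t = (\<Sum>k\<in>{n..<j}. matrix_coeff ?e (R t) k * \<phi> k)"
     unfolding m_def using sum_diff_nat_ivl[of 0 n j "%k. matrix_coeff ?e (R t) k * \<phi> k"] that by (simp add: atLeast0LessThan)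
    then have "cmod (m n t - m j t) <= (\<Sum>k\<in>{n..<j}. cmod (matrix_coeff ?e (R t) k) * cmod (\<phi> k))" by (subst norm_minus_commute) (auto simp: norm_mult intro!: order_trans[OF norm_sum])
    then have "(cmod (m n t - m j t))^2 <= (\<Sum>k\<in>{n..<j}. cmod (matrix_coeff ?e (R t) k) * cmod (\<phi> k))^2" by (intro power_mono) auto
    also have "... <= (\<Sum>k\<in>{n..<j}. (cmod (matrix_coeff ?e (R t) k))^2) * (\<Sum>k\<in>{n..<j}. (cmod (\<phi> k))^2)" by (rule Cauchy_Schwarz_ineq_sum)
    also have "... <= M * \<delta>"
    proof (rule mult_mono)
     have "(\<Sum>k\<in>{n..<j}. (cmod (matrix_coeff ?e (R t) k))^2) <= (\<Sum>k<j. (cmod (matrix_coeff ?e (R t) k))^2)" by (intro sum_mono2) auto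
     also have "... <= M" by (rule integral_kernel_expansion(4)[OF density[OF t] trace[OF t]])
     finally show "(\<Sum>k\<in>{n..<j}. (cmod (matrix_coeff ?e (R t) k))^2) <= M" .
     show "(\<Sum>k\<in>{n..<j}. (cmod (\<phi> k))^2) <= \<delta>" using N[OF n, of j] by simp
    qed (auto intro: sum_nonneg family_trace_bound_nonneg)
    also have "... <= (\<epsilon> / 2)^2"
    proof -
     have "(M + 1) * \<delta> = (\<epsilon> / 2)^2" using family_trace_bound_nonneg by (simp add: \<delta>_def)
     then show ?thesis using \<open>\<delta> > 0\<close> by (simp add: algebra_simps)
    qed
    finally show ?thesis by (rule power2_le_imp_le) (use \<open>\<epsilon> > 0\<close> in simp)
   qed
   have "(%j. cmod (m n t - m j t)) ----> cmod (m n t - l t)" by (intro tendsto_intros m_lim t)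
   then have "cmod (m n t - l t) <= \<epsilon> / 2" by (rule LIMSEQ_le_const2) (use bd in blast)
   then show ?thesis using \<open>\<epsilon> > 0\<close> by (simp add: dist_norm)
  qed
  then show "\<forall>\<^sub>F n in sequentially. \<forall>t\<in>{-T..T}. dist (m n t) (l t) < \<epsilon>" unfolding eventually_sequentially by blast
 qed
 have "continuous_on {-T..T} (m N)" for N unfolding m_def[abs_def] by (intro continuous_intros family_matrix_coeff_continuous)
 then show ?thesis using uniform_limit_theorem[OF _ unif] unfolding l_def[abs_def] by simp
qed

lemma joint_kernel:
 obtains k :: "real \<times> ('a \<times> 'a) => complex"
 where "k \<in> L2" "!!t z. t \<notin> {-T..T} ==> k (t, z) = 0"
  "AE t in lborel. t \<in> {-T..T} --> (AE z in lborel. k (t, z) = integral_kernel (R t) z)"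
proof -
 let ?e = "some_basis :: nat => 'a => complex"
 note on = orthonormal_basis_orthonormal[OF family_basis]
 define c where "c n t = indicator {-T..T} t *\<^sub>R matrix_coeff ?e (R t) n" for n t
 have [measurable]: "c n \<in> BM" for n unfolding c_def by (intro borel_measurable_continuous_on_indicator family_matrix_coeff_continuous) auto
 have [measurable]: "tens ?e n \<in> BM" for n using tens_L2[OF on] by auto
 have c_sum: "(\<Sum>n<N. (cmod (c n t))^2) <= M * indicator {-T..T} t" for N t using integral_kernel_expansion(4)[OF density[of t] trace[of t], of N] by (auto simp: c_def indicator_def)
 have Nc: "(\<Sum>n<N. N2 (c n)) <= enn (M * (2 * T))" for N
 proof -
  have "(\<Sum>n<N. N2 (c n)) = (NI t. (\<Sum>n<N. enn ((cmod (c n t))^2)))" unfolding N2_def by (rule nn_integral_sum[symmetric]) auto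
  also have "... <= (NI t. enn M * indicator {-T..T} t)"
  proof (rule nn_integral_mono)
   fix t
   have "(\<Sum>n<N. enn ((cmod (c n t))^2)) = enn (\<Sum>n<N. (cmod (c n t))^2)" by (rule sum_ennreal) auto
   also have "... <= enn (M * indicator {-T..T} t)" by (intro ennreal_leI c_sum)
   finally show "(\<Sum>n<N. enn ((cmod (c n t))^2)) <= enn M * indicator {-T..T} t" by (auto simp: indicator_def split: if_splits)
  qed
  also have "... = enn (M * (2 * T))" using T family_trace_bound_nonneg by (simp add: nn_integral_cmult_indicator ennreal_mult)
  finally show ?thesis .
 qed
 have cL: "c n \<in> L2" for n
 proof -
  have "N2 (c n) <= (\<Sum>i<Suc n. N2 (c i))" by (rule member_le_sum) auto
  also have "... <= enn (M * (2 * T))" by (rule Nc)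
  also have "... < \<infinity>" by simp
  finally show ?thesis by (simp add: L2_iff)
 qed
 define F where "F N z = (\<Sum>n<N. c n (fst z) * tens ?e n (snd z))" for N z
 have F: "F N \<in> L2" for N unfolding F_def by (intro L2_sum tensor_L2 cL tens_L2 on) auto
 have N2_block: "N2 (%z. \<Sum>n\<in>I. c n (fst z) * tens ?e n (snd z)) = enn (\<Sum>n\<in>I. (L2_norm (c n))^2)" if "finite I" for I
 proof -
  have "N2 (%z. \<Sum>n\<in>I. c n (fst z) * tens ?e n (snd z)) = (NI t. N2 (%z. \<Sum>n\<in>I. c n t * tens ?e n z))" unfolding N2_def using that by (subst nn_integral_prod_fst) auto
  also have "... = (NI t. (\<Sum>n\<in>I. enn ((cmod (c n t))^2)))"
  proof (rule nn_integral_cong)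
   fix t
   have "(%z. \<Sum>n\<in>I. c n t * tens ?e n z) \<in> L2" using that by (intro L2_sum L2_cmult tens_L2 on)
   from N2_L2_norm[OF this] show "N2 (%z. \<Sum>n\<in>I. c n t * tens ?e n z) = (\<Sum>n\<in>I. enn ((cmod (c n t))^2))" by (simp add: orthonormal_norm_sum[OF tens_orthonormal[OF on] that] sum_ennreal)
  qed
  also have "... = (\<Sum>n\<in>I. N2 (c n))" unfolding N2_def by (rule nn_integral_sum) auto
  also have "... = enn (\<Sum>n\<in>I. (L2_norm (c n))^2)" by (simp add: N2_L2_norm cL sum_ennreal)
  finally show ?thesis .
 qed
 have bound: "(\<Sum>n<N. (L2_norm (c n))^2) <= M * (2 * T)" for N
 proof -
  have "enn (\<Sum>n<N. (L2_norm (c n))^2) <= enn (M * (2 * T))" using Nc[of N] by (simp add: N2_L2_norm cL sum_ennreal)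
  then show ?thesis using T family_trace_bound_nonneg by (simp add: ennreal_le_iff)
 qed
 have "\<exists>g\<in>L2. (%N. N2 (%z. F N z - g z)) ----> 0"
 proof (rule L2_complete[OF F])
  fix \<epsilon> :: real assume "\<epsilon> > 0"
  have "summable (%n. (L2_norm (c n))^2)" by (rule summable_of_bounded(1)[OF _ bound]) simp
  then obtain N where N: "!!m n. m >= N ==> norm (\<Sum>k\<in>{m..<n}. (L2_norm (c k))^2) < \<epsilon>" using \<open>\<epsilon> > 0\<close> unfolding summable_Cauchy by blast
  have *: "N2 (%z. F n z - F m z) <= enn \<epsilon>" if "N <= m" "m <= n" for m n
  proof -
   have "F n z - F m z = (\<Sum>k\<in>{m..<n}. c k (fst z) * tens ?e k (snd z))" for z
    unfolding F_def using sum_diff_nat_ivl[of 0 m n "%k. c k (fst z) * tens ?e k (snd z)"] that by (simp add: atLeast0LessThan)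
   then have "N2 (%z. F n z - F m z) = enn (\<Sum>k\<in>{m..<n}. (L2_norm (c k))^2)" by (simp only: N2_block[OF finite_atLeastLessThan])
   also have "... <= enn \<epsilon>" using N[OF that(1), of n] by (intro ennreal_leI) auto
   finally show ?thesis .
  qed
  have "N2 (%z. F m z - F n z) <= enn \<epsilon>" if "m >= N" "n >= N" for m n
  proof (cases "n <= m")
   case True then show ?thesis using *[of n m] that by simp
  next
   case False then show ?thesis using *[of m n] that by (subst N2_diff_commute) simp
  qed
  then show "\<exists>N. \<forall>m\<ge>N. \<forall>n\<ge>N. N2 (%z. F m z - F n z) <= enn \<epsilon>" by blast
 qed
 then obtain g where g: "g \<in> L2" "(%N. N2 (%z. F N z - g z)) ----> 0" by blast
 have [measurable]: "F N \<in> BM" "g \<in> BM" for N using F g by auto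
 have "N2 (%z. F N z - g z) = (NI t. N2 (%z. F N (t, z) - g (t, z)))" for N unfolding N2_def by (rule nn_integral_prod_fst) auto
 then have "(%N. NI t. N2 (%z. F N (t, z) - g (t, z))) ----> 0" using g(2) by simp
 then obtain r where r: "strict_mono (r :: nat => nat)" "AE t in lborel. (%n. N2 (%z. F (r n) (t, z) - g (t, z))) ----> 0" by (rule nn_integral_tendsto_0_subseq_AE[rotated]) (auto simp: N2_def)
 have ae: "AE t in lborel. t \<in> {-T..T} --> (AE z in lborel. g (t, z) = integral_kernel (R t) z)" using r(2)
 proof (eventually_elim, intro impI)
  case (elim t)
  assume t: "t \<in> {-T..T}"
  have F_t: "F N (t, z) = (\<Sum>n<N. matrix_coeff ?e (R t) n * tens ?e n z)" for N z using t by (simp add: F_def c_def)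
  note exp = integral_kernel_expansion(1,2)[OF density[OF t] trace[OF t]]
  have lim: "(%n. N2 (%z. F (r n) (t, z) - integral_kernel (R t) z)) ----> 0" using LIMSEQ_subseq_LIMSEQ[OF exp(2) r(1)] by (simp add: F_t o_def)
  show "AE z in lborel. g (t, z) = integral_kernel (R t) z" by (rule N2_tendsto_unique[OF _ _ _ elim lim]) (use exp(1) in auto)
 qed
 define k where "k p = indicator {-T..T} (fst p) *\<^sub>R g p" for p
 have [measurable]: "k \<in> BM"
 proof -
  have [measurable]: "(%t. indicator {-T..T} t :: real) \<in> BM" by (rule borel_measurable_indicator) auto
  show ?thesis unfolding k_def by measurable
 qed
 show ?thesis
 proof (rule that[of k])
  show "k \<in> L2" by (rule L2_bound[OF g(1), where B=1]) (auto simp: k_def indicator_def)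
  show "k (t, z) = 0" if "t \<notin> {-T..T}" for t z using that by (simp add: k_def)
  show "AE t in lborel. t \<in> {-T..T} --> (AE z in lborel. k (t, z) = integral_kernel (R t) z)" using ae by eventually_elim (auto simp: k_def)
 qed
qed

end


section \<open>Smooth cutoffs\<close>

text \<open>A function of one real variable together with all its derivatives.\<close>

definition smooth_chain :: "(nat => real => real) => bool" where
 "smooth_chain \<beta> \<longleftrightarrow> (\<forall>j s. (\<beta> j has_real_derivative \<beta> (Suc j) s) (at s))"

lemma smooth_chain_Suc: "smooth_chain \<beta> ==> smooth_chain (%j. \<beta> (Suc j))" by (simp add: smooth_chain_def)

lemma smooth_chain_deriv: "smooth_chain \<beta> ==> (\<beta> j has_real_derivative \<beta> (Suc j) s) (at s)" by (simp add: smooth_chain_def)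

lemma smooth_chain_continuous: "smooth_chain \<beta> ==> continuous_on A (\<beta> j)" by (meson DERIV_isCont continuous_at_imp_continuous_on smooth_chain_deriv)

text \<open>The functions \<open>p (1 / x) exp (- 1 / x)\<close> with \<open>p\<close> a polynomial are closed under differentiation.\<close>

definition flat :: "real poly => real => real" where
 "flat p x = (if x > 0 then poly p (1 / x) * exp (- (1 / x)) else 0)"

definition flat_deriv :: "real poly => real poly" where
 "flat_deriv p = [:0, 0, 1:] * (p - pderiv p)"

lemma poly_exp_tendsto_0: "((%u. poly p u * exp (- u)) \<longlongrightarrow> (0::real)) at_top"
proof (induction p)
 case (pCons a p)
 have mono: "((%u::real. u ^ n * exp (- u)) \<longlongrightarrow> 0) at_top" for n using tendsto_power_div_exp_0[of n] by (simp add: exp_minus divide_inverse)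
 have "((%u. \<Sum>i\<le>degree (pCons a p). poly.coeff (pCons a p) i * (u ^ i * exp (- u))) \<longlongrightarrow> (\<Sum>i\<le>degree (pCons a p). poly.coeff (pCons a p) i * 0)) at_top"
  by (intro tendsto_intros mono)
 then show ?case by (simp add: poly_altdef sum_distrib_right mult.assoc del: poly_pCons)
qed simp

lemma flat_has_derivative: "(flat p has_real_derivative flat (flat_deriv p) x) (at x)"
proof -
 consider "x > 0" | "x < 0" | "x = 0" by linarith
 then show ?thesis
 proof cases
  case 1
  have "((%x. poly p (1 / x) * exp (- (1 / x))) has_real_derivative
    (poly (pderiv p) (1 / x) * (- 1 / x^2)) * exp (- (1 / x)) + exp (- (1 / x)) * (1 / x^2) * poly p (1 / x)) (at x)"
   using 1 by (auto intro!: derivative_eq_intros DERIV_chain2[OF poly_DERIV] simp: power2_eq_square)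
  then have "((%x. poly p (1 / x) * exp (- (1 / x))) has_real_derivative flat (flat_deriv p) x) (at x)" using 1 by (simp add: flat_def flat_deriv_def power2_eq_square field_simps)
  then show ?thesis by (rule has_field_derivative_transform_within_open[where S = "{0<..}"]) (use 1 in \<open>auto simp: flat_def\<close>)
 next
  case 2
  have "((%x. 0) has_real_derivative flat (flat_deriv p) x) (at x)" using 2 by (simp add: flat_def)
  then show ?thesis by (rule has_field_derivative_transform_within_open[where S = "{..<0}"]) (use 2 in \<open>auto simp: flat_def\<close>)
 next
  case 3
  have "((%h. flat p h / h) \<longlongrightarrow> 0) (at 0)" unfolding filterlim_at_split
  proof
   have "((%h::real. 0) \<longlongrightarrow> 0) (at_left 0)" by simp
   then show "((%h. flat p h / h) \<longlongrightarrow> 0) (at_left 0)" by (rule Lim_transform_eventually) (auto simp: flat_def eventually_at_filter)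
   have "((%h. poly (pCons 0 p) (inverse h) * exp (- inverse h)) \<longlongrightarrow> 0) (at_right (0::real))" by (rule filterlim_compose[OF poly_exp_tendsto_0 filterlim_inverse_at_top_right])
   then show "((%h. flat p h / h) \<longlongrightarrow> 0) (at_right 0)" by (rule Lim_transform_eventually) (auto simp: flat_def eventually_at_filter divide_inverse)
  qed
  then show ?thesis using 3 by (simp add: DERIV_def flat_def)
 qed
qed

definition cutoff :: "nat => real => real" where
 "cutoff j s = exp 1 * ((- 1) ^ j * flat ((flat_deriv ^^ j) 1) (1 - s))"

lemma flat_chain: "smooth_chain (%j s. flat ((flat_deriv ^^ j) 1) (a + s))" unfolding smooth_chain_def by (auto intro!: DERIV_chain2[OF flat_has_derivative, THEN DERIV_cong] derivative_eq_intros)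

lemma flat_chain_reflected: "smooth_chain (%j s. (- 1) ^ j * flat ((flat_deriv ^^ j) 1) (a - s))" unfolding smooth_chain_def by (auto intro!: derivative_eq_intros DERIV_chain2[OF flat_has_derivative])

lemma cutoff_chain: "smooth_chain cutoff" unfolding smooth_chain_def cutoff_def by (auto intro!: derivative_eq_intros DERIV_chain2[OF flat_has_derivative])

lemma cutoff_eq_0: "s >= 1 ==> cutoff j s = 0" by (simp add: cutoff_def flat_def)

lemma cutoff_at_0: "cutoff 0 0 = 1" by (simp add: cutoff_def flat_def exp_add[symmetric])

lemma cutoff_continuous [continuous_intros]: "continuous_on A f ==> continuous_on A (%x. cutoff j (f x))" using continuous_on_compose2[OF smooth_chain_continuous[OF cutoff_chain, of UNIV]] by auto

lemma cutoff_0_bounds: "s >= 0 ==> 0 <= cutoff 0 s \<and> cutoff 0 s <= 1" by (auto simp: cutoff_def flat_def exp_add[symmetric] field_simps)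

lemma cutoff_bounded: "\<exists>B\<ge>0. \<forall>s\<ge>0. \<bar>cutoff j s\<bar> <= B"
proof -
 have "bounded (cutoff j ` {0..1})" by (intro compact_imp_bounded compact_continuous_image smooth_chain_continuous cutoff_chain) auto
 then obtain B where "\<forall>s\<in>{0..1}. \<bar>cutoff j s\<bar> <= B" by (auto simp: bounded_iff)
 then have B: "!!s. 0 <= s ==> s <= 1 ==> \<bar>cutoff j s\<bar> <= B" by auto
 have "B >= 0" using B[of 0] by (simp add: order_trans[OF abs_ge_zero])
 moreover have "\<bar>cutoff j s\<bar> <= B" if "s >= 0" for s using B[of s] that cutoff_eq_0[of s j] \<open>B >= 0\<close> by (cases "s <= 1") auto
 ultimately show ?thesis by blast
qed


section \<open>A class of smooth functions\<close>

text \<open>It is closed under differentiation, so its members are smooth by coinduction.\<close>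

inductive_set elementary :: "('b::euclidean_space => complex) set" where
 const: "(%x. c) \<in> elementary"
| lin: "bounded_linear l ==> (%x. cor (l x)) \<in> elementary"
| wave: "(%x. cis (- (\<zeta> \<cdot> x))) \<in> elementary"
| chain_lin: "smooth_chain \<beta> ==> bounded_linear l ==> (%x. cor (\<beta> 0 (l x))) \<in> elementary"
| chain_quad: "smooth_chain \<beta> ==> bounded_linear (L :: 'b => 'b) ==> (%x. cor (\<beta> 0 (c * (L x \<cdot> L x)))) \<in> elementary"
| add: "f \<in> elementary ==> g \<in> elementary ==> (%x. f x + g x) \<in> elementary"
| mult: "f \<in> elementary ==> g \<in> elementary ==> (%x. f x * g x) \<in> elementary"

lemma has_derivative_of_real_complex:
 "(f has_derivative f') F ==> ((%x. cor (f x)) has_derivative (%x. cor (f' x))) F" by (rule bounded_linear.has_derivative[OF bounded_linear_of_real])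

lemma elementary_has_derivative:
 assumes "f \<in> elementary"
 shows "\<exists>D. (\<forall>x. (f has_derivative D x) (at x)) \<and> (\<forall>b. (%x. D x b) \<in> elementary)" using assms
proof induction
 case (const c)
 show ?case by (intro exI[of _ "%x b. 0"]) (auto intro: elementary.const)
next
 case (lin l)
 show ?case by (intro exI[of _ "%x b. cor (l b)"])
    (auto intro: elementary.const has_derivative_of_real_complex bounded_linear_imp_has_derivative lin)
next
 case (wave \<zeta>)
 have "((%x. cis (- (\<zeta> \<cdot> x))) has_derivative (%b. - \<i> * cor (\<zeta> \<cdot> b) * cis (- (\<zeta> \<cdot> x)))) (at x)" for x
 proof -
  have 1: "((%x. - \<i> * cor (\<zeta> \<cdot> x)) has_derivative (%b. - \<i> * cor (\<zeta> \<cdot> b))) (at x)"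
   by (intro has_derivative_mult_right has_derivative_of_real_complex has_derivative_inner_right has_derivative_ident)
  show ?thesis using has_derivative_compose[OF 1, of exp "(*) (exp (- \<i> * cor (\<zeta> \<cdot> x)))"] DERIV_exp[of "- \<i> * cor (\<zeta> \<cdot> x)"]
   by (simp add: has_field_derivative_def cis_conv_exp mult_ac)
 qed
 moreover have "(%x. - \<i> * cor (\<zeta> \<cdot> b) * cis (- (\<zeta> \<cdot> x))) \<in> elementary" for b by (intro elementary.mult elementary.const elementary.wave)
 ultimately show ?case by (intro exI[of _ "%x b. - \<i> * cor (\<zeta> \<cdot> b) * cis (- (\<zeta> \<cdot> x))"]) auto
next
 case (chain_lin \<beta> l)
 have "((%x. \<beta> 0 (l x)) has_derivative (%b. \<beta> 1 (l x) * l b)) (at x)" for x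
  using has_derivative_compose[OF bounded_linear_imp_has_derivative[OF chain_lin(2)], of "\<beta> 0" "(*) (\<beta> 1 (l x))" x UNIV]
   smooth_chain_deriv[OF chain_lin(1), of 0 "l x"] by (simp add: has_field_derivative_def)
 moreover have "(%x. cor (\<beta> 1 (l x) * l b)) \<in> elementary" for b using elementary.mult[OF elementary.chain_lin[OF smooth_chain_Suc[OF chain_lin(1)] chain_lin(2)] elementary.const[of "cor (l b)"]]
  by simp
 ultimately show ?case by (intro exI[of _ "%x b. cor (\<beta> 1 (l x) * l b)"] conjI allI has_derivative_of_real_complex) blast+
next
 case (chain_quad \<beta> L c)
 have 1: "((%x. c * (L x \<cdot> L x)) has_derivative (%b. c * (2 * (L x \<cdot> L b)))) (at x)" for x using bounded_linear_imp_has_derivative[OF chain_quad(2), of "at x"]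
  by (auto intro!: derivative_eq_intros simp: inner_commute)
 have "((%x. \<beta> 0 (c * (L x \<cdot> L x))) has_derivative (%b. \<beta> 1 (c * (L x \<cdot> L x)) * (c * (2 * (L x \<cdot> L b))))) (at x)" for x
  using has_derivative_compose[OF 1, of "\<beta> 0" "(*) (\<beta> 1 (c * (L x \<cdot> L x)))" x]
   smooth_chain_deriv[OF chain_quad(1), of 0 "c * (L x \<cdot> L x)"] by (simp add: has_field_derivative_def)
 moreover have "(%x. cor (\<beta> 1 (c * (L x \<cdot> L x)) * (c * (2 * (L x \<cdot> L b))))) \<in> elementary" for b
 proof -
  have "bounded_linear (%x. c * (2 * (L x \<cdot> L b)))" by (intro bounded_linear_const_mult bounded_linear_inner_left_comp[OF chain_quad(2)] )
  from elementary.mult[OF elementary.chain_quad[OF smooth_chain_Suc[OF chain_quad(1)] chain_quad(2)] elementary.lin[OF this]]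
  show ?thesis by simp
 qed
 ultimately show ?case by (intro exI[of _ "%x b. cor (\<beta> 1 (c * (L x \<cdot> L x)) * (c * (2 * (L x \<cdot> L b))))"]
     conjI allI has_derivative_of_real_complex) blast+
next
 case (add f g)
 then obtain D E where D: "!!x. (f has_derivative D x) (at x)" "!!b. (%x. D x b) \<in> elementary"
  and E: "!!x. (g has_derivative E x) (at x)" "!!b. (%x. E x b) \<in> elementary" by blast
 show ?case by (intro exI[of _ "%x b. D x b + E x b"]) (auto intro: has_derivative_add D E elementary.add)
next
 case (mult f g)
 then obtain D E where D: "!!x. (f has_derivative D x) (at x)" "!!b. (%x. D x b) \<in> elementary"
  and E: "!!x. (g has_derivative E x) (at x)" "!!b. (%x. E x b) \<in> elementary" by blast
 show ?case by (intro exI[of _ "%x b. f x * E x b + D x b * g x"])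
    (auto intro!: has_derivative_mult D E elementary.add elementary.mult mult.hyps)
qed

lemma elementary_frechet_derivative:
 assumes "f \<in> elementary"
 shows "f differentiable (at x)" "(%x. frechet_derivative f (at x) b) \<in> elementary"
proof -
 obtain D where D: "!!x. (f has_derivative D x) (at x)" "!!b. (%x. D x b) \<in> elementary" using elementary_has_derivative[OF assms] by blast
 show "f differentiable (at x)" using D(1) by (auto simp: differentiable_def)
 have "frechet_derivative f (at x) = D x" for x using frechet_derivative_at[OF D(1)] by simp
 then show "(%x. frechet_derivative f (at x) b) \<in> elementary" using D(2) by simp
qed

lemma elementary_pderivs: "f \<in> elementary ==> pderivs vs f \<in> elementary" by (induction vs) (auto intro: elementary_frechet_derivative)

lemma elementary_smooth: "f \<in> elementary ==> smooth f" unfolding smooth_def differentiable_on_def by (auto intro!: differentiable_at_withinI elementary_frechet_derivative(1) elementary_pderivs)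

text \<open>Directional derivatives are computed along lines.\<close>

lemma pderivs_line:
 assumes "f \<in> elementary" and "((%s. f (x + s *\<^sub>R v)) has_vector_derivative d) (at 0)"
 shows "pderivs [v] f x = d"
proof -
 obtain D where D: "!!x. (f has_derivative D x) (at x)" using elementary_has_derivative[OF assms(1)] by blast
 have "((%s. x + s *\<^sub>R v) has_derivative (%s. s *\<^sub>R v)) (at (0::real))" by (auto intro!: derivative_eq_intros)
 from has_derivative_compose[OF this, of f "D x"] D
 have "((%s. f (x + s *\<^sub>R v)) has_derivative (%s. D x (s *\<^sub>R v))) (at 0)" by simp
 moreover have "D x (s *\<^sub>R v) = s *\<^sub>R D x v" for s using has_derivative_bounded_linear[OF D] by (simp add: linear_cmul bounded_linear.linear)
 ultimately have "((%s. f (x + s *\<^sub>R v)) has_vector_derivative D x v) (at 0)" by (simp add: has_vector_derivative_def)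
 then have "D x v = d" using assms(2) vector_derivative_unique_at by blast
 then show ?thesis using frechet_derivative_at[OF D, of x] by simp
qed


lemma elementary_polynomial:
 fixes p :: "real => real"
 assumes "real_polynomial_function p"
 shows "(%x :: real \<times> 'c::euclidean_space. cor (p (fst x))) \<in> elementary" using assms
proof induction
 case (linear f)
 then have "bounded_linear (%x :: real \<times> 'c. f (fst x))" using bounded_linear_compose[OF linear bounded_linear_fst] by simp
 then show ?case by (rule elementary.lin)
next
 case (add f g)
 then show ?case using elementary.add by fastforce
next
 case (mult f g)
 then show ?case using elementary.mult by fastforce
qed (rule elementary.const)


section \<open>The du Bois-Reymond lemma\<close>

text \<open>By Weierstrass \<open>g\<close> is a uniform limit of polynomials, so it is orthogonal to itself.\<close>

lemma polynomial_orthogonal_zero: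
 fixes g :: "real => real"
 assumes g: "continuous_on {a..b} g" and "a < b"
  and orth: "!!q. real_polynomial_function q ==> integral {a..b} (%t. g t * q t) = 0"
  and t: "t \<in> {a..b}"
 shows "g t = 0"
proof -
 obtain K where "\<forall>t\<in>{a..b}. \<bar>g t\<bar> <= K" using compact_imp_bounded[OF compact_continuous_image[OF g compact_Icc]] by (auto simp: bounded_iff)
 then have K: "!!t. t \<in> {a..b} ==> \<bar>g t\<bar> <= K" by blast
 have K0: "0 <= K" using K[OF t] by linarith
 have "integral {a..b} (%t. g t * g t) <= 0"
 proof (rule field_le_epsilon)
  fix e :: real assume "e > 0"
  define d where "d = e / ((K + 1) * (b - a))"
  have d: "d > 0" using \<open>e > 0\<close> K0 \<open>a < b\<close> by (simp add: d_def)
  obtain q where q: "real_polynomial_function q" "!!t. t \<in> {a..b} ==> \<bar>g t - q t\<bar> < d" using Stone_Weierstrass_real_polynomial_function[OF compact_Icc g d] by blast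
  have qc: "continuous_on {a..b} q" by (rule continuous_on_polymonial_function) (use q(1) in \<open>simp add: real_polynomial_function_eq\<close>)
  have "integral {a..b} (%t. g t * g t) = integral {a..b} (%t. g t * g t) - integral {a..b} (%t. g t * q t)" using orth[OF q(1)] by simp
  also have "... = integral {a..b} (%t. g t * (g t - q t))" by (subst Henstock_Kurzweil_Integration.integral_diff[symmetric])
     (auto intro!: integrable_continuous_real continuous_intros g qc simp: algebra_simps)
  also have "... <= norm (integral {a..b} (%t. g t * (g t - q t)))" by simp
  also have "... <= (K * d) * (b - a)"
  proof (rule integral_bound)
   show "continuous_on {a..b} (%t. g t * (g t - q t))" by (intro continuous_intros g qc)
   show "norm (g t * (g t - q t)) <= K * d" if "t \<in> {a..b}" for t using K[OF that] q(2)[OF that] K0 by (simp add: abs_mult mult_mono less_imp_le)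
  qed (use \<open>a < b\<close> in auto)
  also have "... <= (K + 1) * d * (b - a)" using d \<open>a < b\<close> by (intro mult_right_mono) auto
  also have "... = e"
  proof -
   define X where "X = (K + 1) * (b - a)"
   have "X ~= 0" "d = e / X" using K0 \<open>a < b\<close> by (auto simp: X_def d_def)
   then have "d * X = e" by simp
   then have "d * ((K + 1) * (b - a)) = e" by (simp only: X_def)
   then show ?thesis by (simp add: mult_ac)
  qed
  finally show "integral {a..b} (%t. g t * g t) <= 0 + e" by simp
 qed
 moreover have "0 <= integral {a..b} (%t. g t * g t)" by (intro Henstock_Kurzweil_Integration.integral_nonneg integrable_continuous_real continuous_intros g) auto
 ultimately have "integral {a..b} (%t. g t * g t) = 0" by simp
 moreover have "integral {a..b} (%t. g t * g t) = 0 \<longleftrightarrow> (\<forall>t\<in>{a..b}. g t * g t = 0)"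
  by (rule integral_eq_0_iff) (use \<open>a < b\<close> in \<open>auto intro: continuous_on_mult g\<close>)
 ultimately have "g t * g t = 0" using t by blast
 then show ?thesis by simp
qed

lemma polynomial_antiderivative:
 fixes q :: "real => real"
 assumes "real_polynomial_function q"
 obtains p where "real_polynomial_function p" "!!t. (p has_real_derivative q t) (at t)"
proof -
 obtain a n where q: "q = (%x. \<Sum>i\<le>n. a i * x ^ i)" using assms unfolding real_polynomial_function_iff_sum by blast
 define p where "p x = (\<Sum>i\<le>n. (a i / real (Suc i)) * x ^ Suc i)" for x
 have "p = (%x. \<Sum>i\<le>Suc n. (if i = 0 then 0 else a (i - 1) / real i) * x ^ i)" unfolding p_def by (rule ext, subst sum.atMost_Suc_shift) simp
 then have "real_polynomial_function p" unfolding real_polynomial_function_iff_sum by (intro exI[of _ "%i. if i = 0 then 0 else a (i - 1) / real i"] exI[of _ "Suc n"])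
 moreover have "(p has_real_derivative q t) (at t)" for t
 proof -
  have "((%x. (a i / real (Suc i)) * x ^ Suc i) has_real_derivative a i * t ^ i) (at t)" for i using DERIV_cmult[OF DERIV_pow[of "Suc i" t UNIV], of "a i / real (Suc i)"] by simp
  then show ?thesis unfolding p_def[abs_def] q by (intro DERIV_sum)
 qed
 ultimately show ?thesis using that by blast
qed

text \<open>
 If \<open>m' = S\<close> holds weakly against \<open>B p\<close> with one bump \<open>B\<close> and all polynomials \<open>p\<close>, then
 \<open>B m\<close> minus the antiderivative of \<open>B' m + B S\<close> is orthogonal to all polynomials and vanishes.
\<close>

lemma du_Bois_Reymond:
 fixes m S :: "real => complex" and B B' :: "real => real"
 assumes ab: "a < b" and m: "continuous_on {a..b} m" and S: "continuous_on {a..b} S"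
  and B: "!!t. (B has_real_derivative B' t) (at t)" and B': "continuous_on UNIV B'"
  and weak: "!!p p'. real_polynomial_function p ==> (!!t. (p has_real_derivative p' t) (at t)) ==>
    integral {a..b} (%t. cor (B' t * p t + B t * p' t) * m t)
   = - integral {a..b} (%t. cor (B t * p t) * S t)"
  and t0: "t0 \<in> {a<..<b}" "B t0 > 0"
 shows "(m has_vector_derivative S t0) (at t0)"
proof -
 have Bc: "continuous_on A B" for A by (meson B DERIV_isCont continuous_at_imp_continuous_on)
 have B'c: "continuous_on A B'" for A using B' continuous_on_subset by blast
 define w where "w t = cor (B' t) * m t + cor (B t) * S t" for t
 have w: "continuous_on {a..b} w" unfolding w_def by (intro continuous_intros m S Bc B'c)
 define W where "W t = integral {a..t} w" for t
 have W': "(W has_vector_derivative w t) (at t within {a..b})" if "t \<in> {a..b}" for t unfolding W_def by (rule integral_has_vector_derivative[OF w that])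
 have W: "continuous_on {a..b} W" using W' by (meson has_vector_derivative_continuous continuous_on_eq_continuous_within)
 define G where "G t = cor (B t) * m t - W t" for t
 have G: "continuous_on {a..b} G" unfolding G_def by (intro continuous_intros m W Bc)
 have poly_cont: "continuous_on A p" if "real_polynomial_function p" for p :: "real => real" and A
  by (rule continuous_on_polymonial_function) (use that in \<open>simp add: real_polynomial_function_eq\<close>)
 have parts: "integral {a..b} (%t. cor (p' t) * (cor (B t) * m t)) + integral {a..b} (%t. cor (p t) * w t) = 0"
  if p: "real_polynomial_function p" "real_polynomial_function p'" "!!t. (p has_real_derivative p' t) (at t)" for p p'
 proof -
  have "integral {a..b} (%t. cor (p' t) * (cor (B t) * m t)) + integral {a..b} (%t. cor (p t) * w t)
    = integral {a..b} (%t. cor (B' t * p t + B t * p' t) * m t) + integral {a..b} (%t. cor (B t * p t) * S t)" by (subst (1 2) Henstock_Kurzweil_Integration.integral_add[symmetric])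
     (auto intro!: integrable_continuous_real continuous_intros m S w Bc B'c poly_cont p(1,2)
      Henstock_Kurzweil_Integration.integral_cong simp: w_def algebra_simps)
  then show ?thesis using weak[OF p(1,3)] by simp
 qed
 have W_a: "W a = 0" by (simp add: W_def)
 have W_b: "W b = 0" using parts[of "%t. 1" "%t. 0"] by (simp add: real_polynomial_function.intros(2) W_def)
 have orth: "integral {a..b} (%t. cor (q t) * G t) = 0" if q: "real_polynomial_function q" for q
 proof -
  obtain p where p: "real_polynomial_function p" "!!t. (p has_real_derivative q t) (at t)" using polynomial_antiderivative[OF q] by blast
  have "((%t. cor (p t) * w t + cor (q t) * W t) has_integral (cor (p b) * W b - cor (p a) * W a)) {a..b}"
  proof (rule fundamental_theorem_of_calculus)
   fix t assume "t \<in> {a..b}"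
   have "((%t. cor (p t)) has_vector_derivative cor (q t)) (at t within {a..b})"
    using p(2)[of t] by (intro has_vector_derivative_of_real) (simp add: has_real_derivative_iff_has_vector_derivative has_vector_derivative_at_within)
   from has_vector_derivative_mult[OF this W'[OF \<open>t \<in> {a..b}\<close>]]
   show "((%t. cor (p t) * W t) has_vector_derivative cor (p t) * w t + cor (q t) * W t) (at t within {a..b})" .
  qed (use ab in auto)
  then have "integral {a..b} (%t. cor (p t) * w t + cor (q t) * W t) = 0" by (simp add: W_a W_b integral_unique)
  then have "integral {a..b} (%t. cor (p t) * w t) + integral {a..b} (%t. cor (q t) * W t) = 0" by (subst (asm) Henstock_Kurzweil_Integration.integral_add)
     (auto intro!: integrable_continuous_real continuous_intros w W poly_cont p q)
  moreover have "integral {a..b} (%t. cor (q t) * G t)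
    = integral {a..b} (%t. cor (q t) * (cor (B t) * m t)) - integral {a..b} (%t. cor (q t) * W t)" unfolding G_def by (subst Henstock_Kurzweil_Integration.integral_diff[symmetric])
     (auto intro!: integrable_continuous_real continuous_intros m W Bc poly_cont p q simp: algebra_simps)
  ultimately show ?thesis using parts[OF p(1) q p(2)] by (simp add: add_eq_0_iff)
 qed
 have G0: "G t = 0" if t: "t \<in> {a..b}" for t
 proof -
  have int: "(%t. cor (q t) * G t) integrable_on {a..b}" if "real_polynomial_function q" for q by (intro integrable_continuous_real continuous_intros G poly_cont that)
  have "Re (G t) = 0"
  proof (rule polynomial_orthogonal_zero[OF _ ab _ t])
   show "continuous_on {a..b} (%t. Re (G t))" by (intro continuous_intros G)
   fix q :: "real => real" assume q: "real_polynomial_function q"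
   have "integral {a..b} (%t. Re (cor (q t) * G t)) = Re (integral {a..b} (%t. cor (q t) * G t))" using integral_linear[OF int[OF q] bounded_linear_Re] by (simp add: o_def)
   then show "integral {a..b} (%t. Re (G t) * q t) = 0" using orth[OF q] by (simp add: mult.commute)
  qed
  moreover have "Im (G t) = 0"
  proof (rule polynomial_orthogonal_zero[OF _ ab _ t])
   show "continuous_on {a..b} (%t. Im (G t))" by (intro continuous_intros G)
   fix q :: "real => real" assume q: "real_polynomial_function q"
   have "integral {a..b} (%t. Im (cor (q t) * G t)) = Im (integral {a..b} (%t. cor (q t) * G t))" using integral_linear[OF int[OF q] bounded_linear_Im] by (simp add: o_def)
   then show "integral {a..b} (%t. Im (G t) * q t) = 0" using orth[OF q] by (simp add: mult.commute)
  qed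
  ultimately show ?thesis by (simp add: complex_eq_iff)
 qed
 have open_pos: "open ({a<..<b} \<inter> {t. 0 < B t})" by (intro open_Int open_greaterThanLessThan open_Collect_less Bc continuous_on_const)
 have W'0: "(W has_vector_derivative w t0) (at t0)" using W'[of t0] t0(1) at_within_Icc_at[of a t0 b] by simp
 have inv: "((%t. inverse (B t)) has_real_derivative - (B' t0 / (B t0)^2)) (at t0)"
  by (rule DERIV_cong[OF DERIV_inverse_fun[OF B]]) (use t0(2) in \<open>simp_all add: power2_eq_square divide_inverse\<close>)
 have W_eq: "W t = cor (B t) * m t" if "t \<in> {a..b}" for t using G0[OF that] by (simp add: G_def)
 have "inverse (B t0) *\<^sub>R w t0 + (- (B' t0 / (B t0)^2)) *\<^sub>R W t0 = S t0"
 proof -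
  have ne: "cor (B t0) ~= 0" using t0(2) by simp
  have "W t0 = cor (B t0) * m t0" using W_eq t0(1) by simp
  then have "inverse (B t0) *\<^sub>R w t0 + (- (B' t0 / (B t0)^2)) *\<^sub>R W t0
    = inverse (cor (B t0)) * (cor (B' t0) * m t0 + cor (B t0) * S t0)
     - cor (B' t0) / (cor (B t0))^2 * (cor (B t0) * m t0)" by (simp add: w_def scaleR_conv_of_real)
  also have "... = S t0" using ne by (simp add: field_simps power2_eq_square)
  finally show ?thesis .
 qed
 with has_vector_derivative_scaleR[OF inv W'0]
 have "((%t. inverse (B t) *\<^sub>R W t) has_vector_derivative S t0) (at t0)" by simp
 then show ?thesis
 proof (rule has_vector_derivative_transform_within_open[OF _ open_pos])
  show "t0 \<in> {a<..<b} \<inter> {t. 0 < B t}" using t0 by simp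
  fix t assume t: "t \<in> {a<..<b} \<inter> {t. 0 < B t}"
  then have "W t = cor (B t) * m t" by (intro W_eq) auto
  then show "inverse (B t) *\<^sub>R W t = m t" using t by (simp add: scaleR_conv_of_real)
 qed
qed

lemma set_integral_open_interval:
 fixes f :: "real => complex"
 assumes "continuous_on {a..b} f"
 shows "(LINT t:{a<..<b}|lborel. f t) = integral {a..b} f"
proof -
 have si: "set_integrable lborel {a..b} f" by (rule borel_integrable_atLeastAtMost'[OF assms])
 then have meas: "(%t. indicator {a..b} t *\<^sub>R f t) \<in> BM" by (auto simp: set_integrable_def dest: borel_measurable_integrable)
 have eq: "(%t. indicator {a<..<b} t *\<^sub>R f t) = (%t. indicator {a<..<b} t *\<^sub>R (indicator {a..b} t *\<^sub>R f t))" by (auto simp: indicator_def)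
 have meas': "(%t. indicator {a<..<b} t *\<^sub>R f t) \<in> BM" by (subst eq, rule borel_measurable_scaleR[OF borel_measurable_indicator meas]) simp
 have "(LINT t:{a<..<b}|lborel. f t) = (LINT t:{a..b}|lborel. f t)" unfolding set_lebesgue_integral_def
 proof (rule integral_cong_AE)
  show "AE t in lborel. indicator {a<..<b} t *\<^sub>R f t = indicator {a..b} t *\<^sub>R f t" using AE_lborel_singleton[of a] AE_lborel_singleton[of b] by eventually_elim (auto simp: indicator_def)
 qed (use meas meas' in simp_all)
 also have "... = integral {a..b} f" by (rule set_borel_integral_eq_integral(2)[OF si])
 finally show ?thesis .
qed


section \<open>The von Neumann equation tested against truncated plane waves\<close>

definition plane :: "real => 'b::euclidean_space => 'b => complex" where
 "plane c \<zeta> z = cis (- (\<zeta> \<cdot> z)) * cor (cutoff 0 (c * (z \<cdot> z)))"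

definition plane_deriv :: "real => 'b::euclidean_space => 'b => 'b => complex" where
 "plane_deriv c \<zeta> w z = cis (- (\<zeta> \<cdot> z)) *
   (- \<i> * cor (\<zeta> \<cdot> w) * cor (cutoff 0 (c * (z \<cdot> z)))
   + cor (2 * c * (z \<cdot> w)) * cor (cutoff 1 (c * (z \<cdot> z))))"

definition plane_deriv2 :: "real => 'b::euclidean_space => 'b => 'b => complex" where
 "plane_deriv2 c \<zeta> w z = cis (- (\<zeta> \<cdot> z)) *
   (- cor ((\<zeta> \<cdot> w)^2) * cor (cutoff 0 (c * (z \<cdot> z)))
   - \<i> * cor (4 * c * ((\<zeta> \<cdot> w) * (z \<cdot> w))) * cor (cutoff 1 (c * (z \<cdot> z)))
   + cor (2 * c * (w \<cdot> w)) * cor (cutoff 1 (c * (z \<cdot> z)))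
   + cor (4 * c^2 * (z \<cdot> w)^2) * cor (cutoff 2 (c * (z \<cdot> z))))"

lemma wave_line: "((%s. cis (- (\<zeta> \<cdot> (z + s *\<^sub>R w)))) has_vector_derivative - \<i> * cor (\<zeta> \<cdot> w) * cis (- (\<zeta> \<cdot> z))) (at 0)"
proof -
 have "((%s. - \<i> * cor (\<zeta> \<cdot> (z + s *\<^sub>R w))) has_vector_derivative - \<i> * cor (\<zeta> \<cdot> w)) (at 0)" by (intro has_vector_derivative_mult_right has_vector_derivative_of_real)
    (auto intro!: derivative_eq_intros simp: inner_add_right)
 from field_vector_diff_chain_at[OF this, of exp] DERIV_exp
 show ?thesis by (simp add: o_def cis_conv_exp)
qed

lemma cutoff_line: "((%s. cor (cutoff j (c * ((z + s *\<^sub>R w) \<cdot> (z + s *\<^sub>R w))))) has_vector_derivative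
  cor (cutoff (Suc j) (c * (z \<cdot> z)) * (2 * c * (z \<cdot> w)))) (at 0)"
proof -
 have 1: "((%s. c * ((z + s *\<^sub>R w) \<cdot> (z + s *\<^sub>R w))) has_real_derivative 2 * c * (z \<cdot> w)) (at 0)"
  by (auto intro!: derivative_eq_intros simp: inner_add_left inner_add_right inner_commute)
 have "((%s. cutoff j (c * ((z + s *\<^sub>R w) \<cdot> (z + s *\<^sub>R w)))) has_real_derivative cutoff (Suc j) (c * (z \<cdot> z)) * (2 * c * (z \<cdot> w))) (at 0)"
  using DERIV_chain2[OF _ 1, of "cutoff j"] smooth_chain_deriv[OF cutoff_chain, of j "c * (z \<cdot> z)"] by simp
 then show ?thesis by (intro has_vector_derivative_of_real) (simp add: has_real_derivative_iff_has_vector_derivative)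
qed

lemma plane_line: "((%s. plane c \<zeta> (z + s *\<^sub>R w)) has_vector_derivative plane_deriv c \<zeta> w z) (at 0)" using has_vector_derivative_mult[OF wave_line[of \<zeta> z w] cutoff_line[of 0 c z w]]
 by (simp add: plane_def plane_deriv_def algebra_simps)

lemma plane_deriv_line: "((%s. plane_deriv c \<zeta> w (z + s *\<^sub>R w)) has_vector_derivative plane_deriv2 c \<zeta> w z) (at 0)"
proof -
 have "((%s. cor (2 * c * ((z + s *\<^sub>R w) \<cdot> w))) has_vector_derivative cor (2 * c * (w \<cdot> w))) (at 0)"
  by (intro has_vector_derivative_of_real) (auto intro!: derivative_eq_intros simp: inner_add_left)
 from has_vector_derivative_mult[OF wave_line[of \<zeta> z w] has_vector_derivative_add[OF
   has_vector_derivative_mult_right[OF cutoff_line[of 0 c z w], of "- \<i> * cor (\<zeta> \<cdot> w)"]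
   has_vector_derivative_mult[OF this cutoff_line[of 1 c z w]]]]
 show ?thesis by (simp add: plane_deriv_def plane_deriv2_def algebra_simps power2_eq_square numeral_2_eq_2)
qed

definition tested_hamiltonian ::
 "real => real => ('a::euclidean_space => real) => real => 'a \<times> 'a => 'a \<times> 'a => complex" where
 "tested_hamiltonian h m V c \<zeta> z = cis (- (\<zeta> \<cdot> z)) *
   (cor (h^2 / (2 * m) * ((norm (fst \<zeta>))^2 - (norm (snd \<zeta>))^2) + (V (fst z) - V (snd z))) * cor (cutoff 0 (c * (z \<cdot> z)))
   + cor (h^2 / (2 * m)) *
     (\<i> * cor (4 * c * (fst \<zeta> \<cdot> fst z - snd \<zeta> \<cdot> snd z)) * cor (cutoff 1 (c * (z \<cdot> z)))
     - cor (4 * c^2 * ((norm (fst z))^2 - (norm (snd z))^2)) * cor (cutoff 2 (c * (z \<cdot> z)))))"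

lemma sum_quadratic_form:
 fixes a x :: "'a::euclidean_space"
 shows "(\<Sum>b\<in>Basis. e * (- cor ((a \<cdot> b)^2) * p - \<i> * cor (4 * c * ((a \<cdot> b) * (x \<cdot> b))) * q
      + cor (2 * c) * q + cor (4 * c^2 * (x \<cdot> b)^2) * r))
    = e * (- cor ((norm a)^2) * p - \<i> * cor (4 * c * (a \<cdot> x)) * q
      + cor (2 * c * real DIM('a)) * q + cor (4 * c^2 * (norm x)^2) * r)"
proof -
 have sq: "(\<Sum>b\<in>Basis. cor ((y \<cdot> b)^2)) = cor ((norm y)^2)" for y :: 'a
 proof -
  have "(norm y)^2 = (\<Sum>b\<in>Basis. (y \<cdot> b) * (y \<cdot> b))" using euclidean_inner[of y y] by (simp only: power2_norm_eq_inner)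
  also have "... = (\<Sum>b\<in>Basis. (y \<cdot> b)^2)" by (simp add: power2_eq_square)
  finally show ?thesis by (simp only: of_real_sum)
 qed
 have ax: "(\<Sum>b\<in>Basis. cor ((a \<cdot> b) * (x \<cdot> b))) = cor (a \<cdot> x)" by (simp only: of_real_sum[symmetric] euclidean_inner[of a x])
 have "(\<Sum>b\<in>Basis. e * (- cor ((a \<cdot> b)^2) * p - \<i> * cor (4 * c * ((a \<cdot> b) * (x \<cdot> b))) * q
      + cor (2 * c) * q + cor (4 * c^2 * (x \<cdot> b)^2) * r))
   = (\<Sum>b\<in>Basis. (- e * p) * cor ((a \<cdot> b)^2) + (- e * \<i> * cor (4 * c) * q) * cor ((a \<cdot> b) * (x \<cdot> b))
      + e * cor (2 * c) * q + (e * cor (4 * c^2) * r) * cor ((x \<cdot> b)^2))" by (intro sum.cong refl) (simp add: algebra_simps)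
 also have "... = (- e * p) * cor ((norm a)^2) + (- e * \<i> * cor (4 * c) * q) * cor (a \<cdot> x)
      + e * cor (2 * c) * (of_nat DIM('a) * q) + (e * cor (4 * c^2) * r) * cor ((norm x)^2)" by (simp only: sum.distrib sum_distrib_left[symmetric] sq ax sum_constant)
 also have "... = e * (- cor ((norm a)^2) * p - \<i> * cor (4 * c * (a \<cdot> x)) * q
      + cor (2 * c * real DIM('a)) * q + cor (4 * c^2 * (norm x)^2) * r)" by (simp add: algebra_simps)
 finally show ?thesis .
qed

lemma sum_plane_deriv2_fst:
 fixes \<zeta> z :: "'a::euclidean_space \<times> 'a"
 shows "(\<Sum>b\<in>Basis. plane_deriv2 c \<zeta> (b, 0) z) = cis (- (\<zeta> \<cdot> z)) *
   (- cor ((norm (fst \<zeta>))^2) * cor (cutoff 0 (c * (z \<cdot> z)))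
   - \<i> * cor (4 * c * (fst \<zeta> \<cdot> fst z)) * cor (cutoff 1 (c * (z \<cdot> z)))
   + cor (2 * c * real DIM('a)) * cor (cutoff 1 (c * (z \<cdot> z)))
   + cor (4 * c^2 * (norm (fst z))^2) * cor (cutoff 2 (c * (z \<cdot> z))))" unfolding plane_deriv2_def sum_quadratic_form[symmetric] by (intro sum.cong refl) (simp add: inner_prod_def)

lemma sum_plane_deriv2_snd:
 fixes \<zeta> z :: "'a::euclidean_space \<times> 'a"
 shows "(\<Sum>b\<in>Basis. plane_deriv2 c \<zeta> (0, b) z) = cis (- (\<zeta> \<cdot> z)) *
   (- cor ((norm (snd \<zeta>))^2) * cor (cutoff 0 (c * (z \<cdot> z)))
   - \<i> * cor (4 * c * (snd \<zeta> \<cdot> snd z)) * cor (cutoff 1 (c * (z \<cdot> z)))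
   + cor (2 * c * real DIM('a)) * cor (cutoff 1 (c * (z \<cdot> z)))
   + cor (4 * c^2 * (norm (snd z))^2) * cor (cutoff 2 (c * (z \<cdot> z))))" unfolding plane_deriv2_def sum_quadratic_form[symmetric] by (intro sum.cong refl) (simp add: inner_prod_def)

lemma tested_hamiltonian_eq:
 "- cor (h^2 / (2 * m)) * ((\<Sum>b\<in>Basis. plane_deriv2 c \<zeta> (b, 0) z) - (\<Sum>b\<in>Basis. plane_deriv2 c \<zeta> (0, b) z))
   + cor (V (fst z) - V (snd z)) * plane c \<zeta> z = tested_hamiltonian h m V c \<zeta> z" unfolding sum_plane_deriv2_fst sum_plane_deriv2_snd tested_hamiltonian_def plane_def
 by (simp add: algebra_simps)

lemma L2_continuous_compact_support:
 assumes f: "continuous_on UNIV f" and z: "!!z. r < norm z ==> f z = 0"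
 shows "f \<in> L2"
proof -
 have "bounded (f ` cball 0 r)" by (intro compact_imp_bounded compact_continuous_image continuous_on_subset[OF f]) auto
 then obtain B where B: "\<forall>z\<in>cball 0 r. cmod (f z) <= B" by (auto simp: bounded_iff)
 show ?thesis
 proof (rule L2_bound[OF indicator_cball_L2[of r], where B=B])
  show "f \<in> BM" using f by (rule borel_measurable_continuous_onI)
  fix x show "cmod (f x) <= B * cmod (cor (indicator (cball 0 r) x))" using B z[of x] by (cases "norm x <= r") (auto simp: indicator_def)
 qed
qed

lemma cutoff_radius: "c > 0 ==> 1 / sqrt c < norm z ==> cutoff j (c * (z \<cdot> z)) = 0"
proof (rule cutoff_eq_0)
 assume "c > 0" "1 / sqrt c < norm z"
 then have "(1 / sqrt c)^2 <= (norm z)^2" by (intro power_mono) auto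
 then show "1 <= c * (z \<cdot> z)" using \<open>c > 0\<close> by (simp add: power_divide power2_norm_eq_inner field_simps)
qed

lemma plane_continuous: "continuous_on UNIV (plane c \<zeta>)" unfolding plane_def[abs_def] cis_conv_exp by (intro continuous_intros)

lemma plane_L2:
 assumes "c > 0"
 shows "plane c \<zeta> \<in> L2"
proof (rule L2_continuous_compact_support[OF plane_continuous, where r = "1 / sqrt c"])
 fix z :: 'a assume "1 / sqrt c < norm z"
 then show "plane c \<zeta> z = 0" using cutoff_radius[OF assms, of z 0] by (simp add: plane_def)
qed

lemma tested_hamiltonian_continuous:
 assumes "continuous_on UNIV V"
 shows "continuous_on UNIV (tested_hamiltonian h m V c \<zeta>)" unfolding tested_hamiltonian_def[abs_def] cis_conv_exp by (intro continuous_intros continuous_on_compose2[OF assms]) auto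

lemma tested_hamiltonian_L2:
 assumes "continuous_on UNIV V" "c > 0"
 shows "tested_hamiltonian h m V c \<zeta> \<in> L2"
proof (rule L2_continuous_compact_support[OF tested_hamiltonian_continuous[OF assms(1)], where r = "1 / sqrt c"])
 fix z :: "'a \<times> 'a" assume z: "1 / sqrt c < norm z"
 note cutoff_radius[OF assms(2) z]
 then show "tested_hamiltonian h m V c \<zeta> z = 0" unfolding tested_hamiltonian_def by simp
qed

text \<open>Test functions are products \<open>\<theta>(t) plane(z)\<close>.\<close>

lemma weak_equation_product:
 fixes R :: "real => 'a::euclidean_space L2_op"
 assumes weak: "weak_von_neumann_solution h m V T R" and c: "c > 0"
  and \<theta>: "(%x :: real \<times> ('a \<times> 'a). cor (\<theta> (fst x))) \<in> elementary"
  and \<theta>': "!!t. (\<theta> has_real_derivative \<theta>' t) (at t)"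
  and supp: "!!t. \<bar>t\<bar> > T' ==> \<theta> t = 0" and "T' < T"
 shows "(LINT t:{-T<..<T}|lborel. cor (\<theta>' t) * (- \<i> * cor h * (LI z. integral_kernel (R t) z * plane c \<zeta> z)))
    = (LINT t:{-T<..<T}|lborel. cor (\<theta> t) * (LI z. integral_kernel (R t) z * tested_hamiltonian h m V c \<zeta> z))"
proof -
 define \<phi> :: "real \<times> ('a \<times> 'a) => complex" where "\<phi> x = cor (\<theta> (fst x)) * plane c \<zeta> (snd x)" for x
 have plane_elem: "(%x :: real \<times> ('a \<times> 'a). plane c \<zeta> (snd x)) \<in> elementary"
 proof -
  have "bounded_linear (%x :: real \<times> ('a \<times> 'a). (0 :: real, snd x))" by (intro bounded_linear_Pair bounded_linear_zero bounded_linear_snd)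
  from elementary.mult[OF elementary.wave[of "(0, \<zeta>)"] elementary.chain_quad[OF cutoff_chain this, of c]]
  show ?thesis by (simp add: plane_def inner_prod_def)
 qed
 have \<phi>: "\<phi> \<in> elementary" unfolding \<phi>_def by (rule elementary.mult[OF \<theta> plane_elem])
 have "\<phi> \<in> test_functions ({-T<..<T} \<times> UNIV)" unfolding test_functions_def
 proof (intro CollectI conjI exI[of _ "{-T'..T'} \<times> cball 0 (1 / sqrt c)"])
  show "smooth \<phi>" by (rule elementary_smooth[OF \<phi>])
  show "compact ({-T'..T'} \<times> cball (0::'a\<times>'a) (1 / sqrt c))" by (intro compact_Times) auto
  show "{-T'..T'} \<times> cball (0::'a\<times>'a) (1 / sqrt c) \<subseteq> {-T<..<T} \<times> UNIV" using \<open>T' < T\<close> by auto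
  show "\<forall>x. x \<notin> {-T'..T'} \<times> cball 0 (1 / sqrt c) --> \<phi> x = 0"
  proof (intro allI impI)
   fix x :: "real \<times> ('a \<times> 'a)" assume x: "x \<notin> {-T'..T'} \<times> cball 0 (1 / sqrt c)"
   show "\<phi> x = 0"
   proof (cases "\<bar>fst x\<bar> > T'")
    case False
    then have "1 / sqrt c < norm (snd x)" using x by (cases x) (auto simp: not_le)
    then show ?thesis using cutoff_radius[OF c, of "snd x" 0] by (simp add: \<phi>_def plane_def)
   qed (simp add: \<phi>_def supp)
  qed
 qed
 note eq = weak[unfolded weak_von_neumann_solution_def, rule_format, OF this]
 have d0: "pderivs [(1, 0)] \<phi> (t, z) = cor (\<theta>' t) * plane c \<zeta> z" for t z
 proof (rule pderivs_line[OF \<phi>])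
  have "((%s. \<theta> (t + s)) has_real_derivative \<theta>' t) (at 0)"
  proof -
   have "((%s. t + s) has_real_derivative 1) (at 0)" by (auto intro!: derivative_eq_intros)
   from DERIV_chain2[OF _ this, of \<theta> "\<theta>' t"] \<theta>'[of t] show ?thesis by simp
  qed
  then have "((%s. cor (\<theta> (t + s))) has_vector_derivative cor (\<theta>' t)) (at 0)" by (intro has_vector_derivative_of_real) (simp add: has_real_derivative_iff_has_vector_derivative)
  from has_vector_derivative_mult_left[OF this]
  show "((%s. \<phi> ((t, z) + s *\<^sub>R (1, 0))) has_vector_derivative cor (\<theta>' t) * plane c \<zeta> z) (at 0)" by (simp add: \<phi>_def)
 qed
 have d1: "pderivs [(0, w)] \<phi> = (%x. cor (\<theta> (fst x)) * plane_deriv c \<zeta> w (snd x))" for w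
 proof (rule ext, rule pderivs_line[OF \<phi>])
  fix x :: "real \<times> ('a \<times> 'a)"
  show "((%s. \<phi> (x + s *\<^sub>R (0, w))) has_vector_derivative cor (\<theta> (fst x)) * plane_deriv c \<zeta> w (snd x)) (at 0)"
   unfolding \<phi>_def using has_vector_derivative_mult_right[OF plane_line] by simp
 qed
 have d2: "pderivs [(0, w), (0, w)] \<phi> (t, z) = cor (\<theta> t) * plane_deriv2 c \<zeta> w z" for w t z
 proof -
  have "pderivs [(0, w), (0, w)] \<phi> (t, z) = pderivs [(0, w)] (pderivs [(0, w)] \<phi>) (t, z)" by simp
  also have "... = cor (\<theta> t) * plane_deriv2 c \<zeta> w z"
  proof (rule pderivs_line[OF elementary_pderivs[OF \<phi>]])
   show "((%s. pderivs [(0, w)] \<phi> ((t, z) + s *\<^sub>R (0, w))) has_vector_derivative cor (\<theta> t) * plane_deriv2 c \<zeta> w z) (at 0)"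
    unfolding d1 using has_vector_derivative_mult_right[OF plane_deriv_line] by simp
  qed
  finally show ?thesis .
 qed
 have rhs: "- cor (h^2 / (2 * m)) * ((\<Sum>b\<in>Basis. pderivs [(0, b, 0), (0, b, 0)] \<phi> (t, z)) - (\<Sum>b\<in>Basis. pderivs [(0, 0, b), (0, 0, b)] \<phi> (t, z)))
    + cor (V (fst z) - V (snd z)) * \<phi> (t, z) = cor (\<theta> t) * tested_hamiltonian h m V c \<zeta> z" for t z unfolding tested_hamiltonian_eq[symmetric] d2 \<phi>_def
  by (simp add: sum_distrib_left[symmetric] algebra_simps)
 have l: "(LI z. integral_kernel (R t) z * (- \<i> * cor h * (cor (\<theta>' t) * plane c \<zeta> z)))
   = cor (\<theta>' t) * (- \<i> * cor h * (LI z. integral_kernel (R t) z * plane c \<zeta> z))" for t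
  by (subst mult.assoc[symmetric], subst (2) mult.commute) (simp add: mult_ac flip: integral_mult_right_zero)
 have r: "(LI z. integral_kernel (R t) z * (cor (\<theta> t) * tested_hamiltonian h m V c \<zeta> z))
   = cor (\<theta> t) * (LI z. integral_kernel (R t) z * tested_hamiltonian h m V c \<zeta> z)" for t by (simp add: mult.left_commute)
 show ?thesis using eq unfolding d0 rhs l r .
qed

text \<open>The weak equation in time is a distributional derivative with continuous right-hand side, hence a classical one by \<open>du_Bois_Reymond\<close>.\<close>

theorem von_Neumann_tested:
 fixes R :: "real => 'a::euclidean_space L2_op"
 assumes T: "T > 0"
  and density: "!!t. t \<in> {-T..T} ==> density_operator (R t)"
  and wot: "wot_continuous_on {-T..T} R"
  and trace: "!!t. t \<in> {-T..T} ==> Re (op_trace (R t \<circ> R t)) <= M"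
  and weak: "weak_von_neumann_solution h m V T R" and h: "h > 0" and V: "continuous_on UNIV V" and c: "c > 0"
  and t0: "t0 \<in> {-T<..<T}"
 shows "((%t. LI z. integral_kernel (R t) z * plane c \<zeta> z) has_vector_derivative
   - (\<i> / cor h) * (LI z. integral_kernel (R t0) z * tested_hamiltonian h m V c \<zeta> z)) (at t0)"
proof -
 have cont: "continuous_on {-T..T} (%t. LI z. integral_kernel (R t) z * \<Phi> z)" if "\<Phi> \<in> L2" for \<Phi> by (rule family_pairing_continuous[OF T _ wot _ that]) (fact density trace)+
 define \<mu> where "\<mu> t = (LI z. integral_kernel (R t) z * plane c \<zeta> z)" for t
 define S where "S t = (LI z. integral_kernel (R t) z * tested_hamiltonian h m V c \<zeta> z)" for t
 have \<mu>c: "continuous_on {-T..T} \<mu>" unfolding \<mu>_def by (rule cont[OF plane_L2[OF c]])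
 have Sc: "continuous_on {-T..T} S" unfolding S_def by (rule cont[OF tested_hamiltonian_L2[OF V c]])
 define T' where "T' = (\<bar>t0\<bar> + T) / 2"
 have T': "\<bar>t0\<bar> < T'" "T' < T" using t0 by (auto simp: T'_def abs_if)
 define F where "F j s = flat ((flat_deriv ^^ j) 1) (T' + s)" for j s
 define G where "G j s = (- 1) ^ j * flat ((flat_deriv ^^ j) 1) (T' - s)" for j s
 have FG: "smooth_chain F" "smooth_chain G" unfolding F_def[abs_def] G_def[abs_def] by (rule flat_chain, rule flat_chain_reflected)
 define B where "B t = F 0 t * G 0 t" for t
 define B' where "B' t = F 0 t * G 1 t + F 1 t * G 0 t" for t
 have B: "(B has_real_derivative B' t) (at t)" for t using DERIV_mult[OF smooth_chain_deriv[OF FG(1), of 0 t] smooth_chain_deriv[OF FG(2), of 0 t]] by (simp add: B_def[abs_def] B'_def algebra_simps)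
 have B'c: "continuous_on UNIV B'" unfolding B'_def[abs_def] by (intro continuous_intros smooth_chain_continuous FG)
 have B_supp: "B t = 0" if "\<bar>t\<bar> > T'" for t using that by (auto simp: B_def F_def G_def flat_def abs_if split: if_splits)
 have B_pos: "B t0 > 0" using T' by (auto simp: B_def F_def G_def flat_def abs_if split: if_splits)
 have "(\<mu> has_vector_derivative - (\<i> / cor h) * S t0) (at t0)"
 proof (rule du_Bois_Reymond[OF _ \<mu>c _ B B'c _ t0 B_pos])
  show "- T < T" using T by simp
  show "continuous_on {-T..T} (%t. - (\<i> / cor h) * S t)" by (intro continuous_intros Sc)
  fix p p' assume p: "real_polynomial_function p" "!!t. (p has_real_derivative p' t) (at t)"
  have pc: "continuous_on A p" for A by (rule continuous_on_polymonial_function) (use p(1) in \<open>simp add: real_polynomial_function_eq\<close>)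
  have p'c: "continuous_on A p'" for A
  proof -
   obtain q where q: "polynomial_function q" "!!x. (p has_vector_derivative q x) (at x)" using has_vector_derivative_polynomial_function[of p] p(1) by (auto simp: real_polynomial_function_eq)
   have "p' = q" by (intro ext DERIV_unique[OF p(2)]) (use q(2) in \<open>simp add: has_real_derivative_iff_has_vector_derivative\<close>)
   then show ?thesis using continuous_on_polymonial_function[OF q(1)] by simp
  qed
  have Bc: "continuous_on A B" for A by (meson B DERIV_isCont continuous_at_imp_continuous_on)
  have B'cA: "continuous_on A B'" for A using B'c continuous_on_subset by blast
  have elem: "(%x :: real \<times> ('a \<times> 'a). cor (B (fst x) * p (fst x))) \<in> elementary" using elementary.mult[OF elementary.mult[OF elementary.chain_lin[OF FG(1) bounded_linear_fst]
     elementary.chain_lin[OF FG(2) bounded_linear_fst]] elementary_polynomial[OF p(1)]] by (simp add: B_def)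
  have der: "((%t. B t * p t) has_real_derivative B' t * p t + B t * p' t) (at t)" for t using DERIV_mult[OF B p(2)] by (simp add: algebra_simps)
  from weak_equation_product[OF weak c elem der, of T' \<zeta>] T' B_supp
  have "(LINT t:{-T<..<T}|lborel. cor (B' t * p t + B t * p' t) * (- \<i> * cor h * \<mu> t))
    = (LINT t:{-T<..<T}|lborel. cor (B t * p t) * S t)" by (simp add: \<mu>_def S_def)
  then have "integral {-T..T} (%t. cor (B' t * p t + B t * p' t) * (- \<i> * cor h * \<mu> t))
    = integral {-T..T} (%t. cor (B t * p t) * S t)" by (subst (asm) (1 2) set_integral_open_interval) (auto intro!: continuous_intros \<mu>c Sc pc p'c Bc B'cA)
  moreover have "integral {-T..T} (%t. cor (B' t * p t + B t * p' t) * (- \<i> * cor h * \<mu> t))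
    = - \<i> * cor h * integral {-T..T} (%t. cor (B' t * p t + B t * p' t) * \<mu> t)" by (subst integral_mult_right[symmetric]) (simp add: mult_ac)
  moreover have "integral {-T..T} (%t. cor (B t * p t) * (- (\<i> / cor h) * S t))
    = - (\<i> / cor h) * integral {-T..T} (%t. cor (B t * p t) * S t)" by (subst integral_mult_right[symmetric]) (simp add: mult_ac)
  ultimately show "integral {-T..T} (%t. cor (B' t * p t + B t * p' t) * \<mu> t)
    = - integral {-T..T} (%t. cor (B t * p t) * (- (\<i> / cor h) * S t))" using h by (simp add: field_simps)
 qed
 then show ?thesis unfolding \<mu>_def S_def .
qed


section \<open>Wigner coordinates\<close>

definition wcoord :: "real => 'a::euclidean_space \<times> 'a => 'a \<times> 'a" where
 "wcoord h p = (fst p + (h / 2) *\<^sub>R snd p, fst p - (h / 2) *\<^sub>R snd p)"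

lemma wcoord_continuous [continuous_intros]: "continuous_on A f ==> continuous_on A (%x. wcoord h (f x))" unfolding wcoord_def by (intro continuous_intros)

lemma wcoord_measurable [measurable]: "wcoord h \<in> borel \<rightarrow>\<^sub>M borel" by (intro borel_measurable_continuous_onI continuous_intros)

text \<open>Substitute \<open>X = Y + h y\<close> for fixed \<open>Y\<close>, then \<open>Y = x - h y / 2\<close> for fixed \<open>y\<close>.\<close>

lemma nn_integral_wcoord:
 fixes f :: "'a::euclidean_space \<times> 'a => ennreal"
 assumes [measurable]: "f \<in> BM" and "h > 0"
 shows "(NI z. f z) = enn (h ^ DIM('a)) * (NI p. f (wcoord h p))"
proof -
 have "(NI z. f z) = (NI Y. NI X. f (X, Y))" by (rule nn_integral_prod_snd) simp
 also have "... = (NI Y. enn (h ^ DIM('a)) * (NI y. f (Y + h *\<^sub>R y, Y)))" using assms(2) by (intro nn_integral_cong, subst nn_integral_affine[where c=h]) auto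
 also have "... = enn (h ^ DIM('a)) * (NI Y. NI y. f (Y + h *\<^sub>R y, Y))" by (rule nn_integral_cmult) measurable
 also have "(NI Y. NI y. f (Y + h *\<^sub>R y, Y)) = (\<integral>\<^sup>+p. f (fst p + h *\<^sub>R snd p, fst p) \<partial>(lborel :: ('a\<times>'a) measure))" by (subst nn_integral_prod_fst) auto
 also have "... = (NI y. NI Y. f (Y + h *\<^sub>R y, Y))" by (subst nn_integral_prod_snd) auto
 also have "... = (NI y. NI x. f (wcoord h (x, y)))"
 proof (rule nn_integral_cong)
  fix y :: 'a
  have "(NI Y. f (Y + h *\<^sub>R y, Y)) = (NI x. f ((- (h / 2)) *\<^sub>R y + x + h *\<^sub>R y, (- (h / 2)) *\<^sub>R y + x))" by (rule nn_integral_shift[symmetric]) measurable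
  also have "... = (NI x. f (wcoord h (x, y)))"
  proof (intro nn_integral_cong arg_cong[of _ _ f])
   fix x
   have "h *\<^sub>R y = (h / 2) *\<^sub>R y + (h / 2) *\<^sub>R y" by (simp add: scaleR_add_left[symmetric])
   then show "((- (h / 2)) *\<^sub>R y + x + h *\<^sub>R y, (- (h / 2)) *\<^sub>R y + x) = wcoord h (x, y)" by (simp add: wcoord_def)
  qed
  finally show "(NI Y. f (Y + h *\<^sub>R y, Y)) = (NI x. f (wcoord h (x, y)))" .
 qed
 also have "... = (NI p. f (wcoord h p))" by (subst nn_integral_prod_snd) auto
 finally show ?thesis .
qed

lemma lborel_wcoord:
 assumes "h > 0"
 shows "(lborel :: ('a::euclidean_space \<times> 'a) measure) = density (distr lborel borel (wcoord h)) (%_. enn (h ^ DIM('a)))"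
proof (rule measure_eqI)
 fix A :: "('a \<times> 'a) set" assume "A \<in> sets lborel"
 then have [measurable]: "A \<in> sets borel" by simp
 have "emeasure lborel A = (NI z. indicator A z)" by simp
 also have "... = enn (h ^ DIM('a)) * (NI p. indicator A (wcoord h p))" by (rule nn_integral_wcoord) (use assms in auto)
 also have "(NI p. indicator A (wcoord h p)) = (\<integral>\<^sup>+z. indicator A z \<partial>distr lborel borel (wcoord h))" by (rule nn_integral_distr[symmetric]) auto
 also have "enn (h ^ DIM('a)) * (\<integral>\<^sup>+z. indicator A z \<partial>distr lborel borel (wcoord h)) = emeasure (density (distr lborel borel (wcoord h)) (%_. enn (h ^ DIM('a)))) A"
  by (simp add: emeasure_density nn_integral_cmult)
 finally show "emeasure lborel A = emeasure (density (distr lborel borel (wcoord h)) (%_. enn (h ^ DIM('a)))) A" .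
qed simp

lemma integral_wcoord:
 fixes f :: "'a::euclidean_space \<times> 'a => complex"
 assumes [measurable]: "f \<in> BM" and h: "h > 0"
 shows "(LI z. f z) = cor (h ^ DIM('a)) * (LI p. f (wcoord h p))"
proof -
 have "(LI z. f z) = (\<integral>z. (h ^ DIM('a)) *\<^sub>R f z \<partial>distr lborel borel (wcoord h))" by (subst lborel_wcoord[OF h]) (rule integral_density, use h in auto)
 also have "... = (LI p. (h ^ DIM('a)) *\<^sub>R f (wcoord h p))" by (rule integral_distr) auto
 finally show ?thesis by (simp add: scaleR_conv_of_real)
qed

lemma N2_wcoord:
 fixes f :: "'a::euclidean_space \<times> 'a => complex"
 assumes [measurable]: "f \<in> BM" and h: "h > 0"
 shows "N2 f = enn (h ^ DIM('a)) * N2 (%p. f (wcoord h p))" unfolding N2_def by (rule nn_integral_wcoord[OF _ h]) simp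

lemma L2_wcoord:
 fixes f :: "'a::euclidean_space \<times> 'a => complex"
 assumes f: "f \<in> L2" and h: "h > 0"
 shows "(%p. f (wcoord h p)) \<in> L2"
proof -
 have [measurable]: "f \<in> BM" using f by auto
 have "enn (h ^ DIM('a)) * N2 (%p. f (wcoord h p)) < \<infinity>" using N2_wcoord[of f h] L2_N2_finite[OF f] h by simp
 then have "N2 (%p. f (wcoord h p)) < \<infinity>" using h by (auto simp: ennreal_mult_less_top)
 then show ?thesis by (simp add: L2_iff)
qed

lemma AE_wcoord:
 fixes f g :: "'a::euclidean_space \<times> 'a => complex"
 assumes [measurable]: "f \<in> BM" "g \<in> BM" and h: "h > 0"
  and "AE z in lborel. f z = g z"
 shows "AE p in lborel. f (wcoord h p) = g (wcoord h p)"
proof -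
 have "AE z in lborel. f z - g z = 0" using assms(4) by (auto elim: eventually_mono)
 then have "N2 (%z. f z - g z) = 0" by (subst N2_0_AE) auto
 then have "N2 (%p. f (wcoord h p) - g (wcoord h p)) = 0" using N2_wcoord[of "%z. f z - g z" h] h by auto
 then show ?thesis by (subst (asm) N2_0_AE) auto
qed


section \<open>Velocity averages of the Wigner transform\<close>

lemma L2_section_AE:
 fixes k :: "'a::euclidean_space \<times> 'b::euclidean_space => complex"
 assumes "k \<in> L2"
 shows "AE x in lborel. (%y. k (x, y)) \<in> L2"
proof -
 have [measurable]: "k \<in> BM" using assms by auto
 have "(NI x. N2 (%y. k (x, y))) = N2 k" unfolding N2_def by (rule nn_integral_prod_fst[symmetric]) auto
 also have "... < \<infinity>" using assms by (rule L2_N2_finite)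
 finally have "AE x in lborel. N2 (%y. k (x, y)) ~= \<infinity>" unfolding N2_def by (intro nn_integral_PInf_AE) auto
 then show ?thesis by eventually_elim (auto simp: L2_iff less_top)
qed

lemma N2_section_pairing:
 fixes k :: "'a::euclidean_space \<times> 'b::euclidean_space => complex"
 assumes [measurable]: "k \<in> BM" "f \<in> BM"
 shows "N2 (%x. LI y. k (x, y) * f y) <= N2 k * N2 f"
proof -
 have "N2 (%x. LI y. k (x, y) * f y) <= (NI x. N2 (%y. k (x, y)) * N2 f)" unfolding N2_def[of "%x. LI y. k (x, y) * f y"] by (intro nn_integral_mono Cauchy_Schwarz_L2) auto
 also have "... = N2 k * N2 f" unfolding N2_def by (subst nn_integral_multc) (auto simp: nn_integral_prod_fst)
 finally show ?thesis .
qed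

lemma section_pairing_L2:
 fixes k :: "'a::euclidean_space \<times> 'b::euclidean_space => complex"
 assumes "k \<in> L2" "f \<in> L2"
 shows "(%x. LI y. k (x, y) * f y) \<in> L2"
proof -
 have [measurable]: "k \<in> BM" "f \<in> BM" using assms by auto
 have "N2 (%x. LI y. k (x, y) * f y) <= N2 k * N2 f" by (rule N2_section_pairing) auto
 also have "... < \<infinity>" using assms by (auto simp: L2_iff ennreal_mult_less_top)
 finally show ?thesis by (auto simp: L2_iff)
qed

lemma section_pairing_tendsto:
 fixes k :: "'a::euclidean_space \<times> 'b::euclidean_space => complex"
 assumes k: "k \<in> L2" and K: "!!n. K n \<in> L2" and f: "f \<in> L2"
  and lim: "(%n. N2 (%z. K n z - k z)) ----> 0"
 shows "(%n. N2 (%x. (LI y. K n (x, y) * f y) - (LI y. k (x, y) * f y))) ----> 0"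
proof (rule tendsto_0_sandwich_ennreal)
 have [measurable]: "k \<in> BM" "K n \<in> BM" "f \<in> BM" for n using k K f by auto
 show "(%n. N2 f * N2 (%z. K n z - k z)) ----> 0" by (rule ennreal_tendsto_0_cmult[OF lim L2_N2_finite[OF f]])
 fix n
 have "N2 (%x. (LI y. K n (x, y) * f y) - (LI y. k (x, y) * f y))
   = N2 (%x. LI y. (K n (x, y) - k (x, y)) * f y)"
 proof (rule N2_cong_AE)
  show "AE x in lborel. (LI y. K n (x, y) * f y) - (LI y. k (x, y) * f y) = (LI y. (K n (x, y) - k (x, y)) * f y)" using L2_section_AE[OF k] L2_section_AE[OF K[of n]]
  proof eventually_elim
   case (elim x)
   then show ?case using L2_mult_integrable[OF elim(2) f] L2_mult_integrable[OF elim(1) f] by (simp add: left_diff_distrib)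
  qed
 qed
 also have "... <= N2 (%z. K n z - k z) * N2 f" by (rule N2_section_pairing[of "%z. K n z - k z"]) auto
 finally show "N2 (%x. (LI y. K n (x, y) * f y) - (LI y. k (x, y) * f y)) <= N2 f * N2 (%z. K n z - k z)" by (simp add: mult.commute)
qed

lemma FT_multiplication:
 fixes f g :: "'a::euclidean_space => complex"
 assumes "L1 f" "L1 g"
 shows "(LI v. FT f v * g v) = (LI y. f y * FT g y)"
proof -
 have [measurable]: "f \<in> BM" "g \<in> BM" using assms by (auto dest: borel_measurable_integrable)
 define H :: "'a \<times> 'a => complex" where "H p = cis (- (fst p \<cdot> snd p)) * (g (fst p) * f (snd p))" for p
 have H: "L1 H" by (rule Bochner_Integration.integrable_bound[OF integrable_tensor[OF assms(2,1)]]) (auto simp: H_def[abs_def] norm_mult)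
 have "(LI v. FT f v * g v) = (LI v. LI y. H (v, y))" by (simp add: FT_def H_def mult_ac flip: integral_mult_right_zero)
 also have "... = (LI y. LI v. H (v, y))" by (rule integral_prod_swap[OF H])
 also have "... = (LI y. f y * FT g y)" by (simp add: FT_def H_def mult_ac inner_commute flip: integral_mult_right_zero)
 finally show ?thesis .
qed

text \<open>Fubini moves the Fourier transform from the truncated kernel to \<open>\<psi>\<close>, and the truncation is removed in L2.\<close>

theorem rho_eq:
 fixes R :: "'a::euclidean_space L2_op"
 assumes R: "integral_kernel R \<in> L2" and h: "h > 0" and \<psi>: "\<psi> \<in> L2" "L1 \<psi>"
 shows "AE x in lborel. rho \<psi> h R x
   = (LI y. integral_kernel R (wcoord h (x, y)) * FT \<psi> y) / cor ((2 * pi) ^ DIM('a))"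
proof -
 define q where "q p = integral_kernel R (wcoord h p)" for p
 have q: "q \<in> L2" unfolding q_def by (rule L2_wcoord[OF R h])
 define c :: complex where "c = 1 / cor ((2 * pi) ^ DIM('a))"
 define qn :: "nat => 'a \<times> 'a => complex" where "qn n p = indicator (cball 0 (real n)) (snd p) *\<^sub>R q p" for n p
 have [measurable]: "q \<in> BM" "\<psi> \<in> BM" using q \<psi> by auto
 have [measurable]: "qn n \<in> BM" for n
 proof -
  have [measurable]: "(%y::'a. indicator (cball 0 (real n)) y :: real) \<in> BM" by (rule borel_measurable_indicator) simp
  show ?thesis unfolding qn_def by measurable
 qed
 have qn: "qn n \<in> L2" for n by (rule L2_bound[OF q, where B=1]) (auto simp: qn_def indicator_def)
 have qn_lim: "(%n. N2 (%p. qn n p - q p)) ----> 0"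
 proof (rule N2_dominated[OF _ q])
  show "cmod (qn n p - q p) <= cmod (q p)" for n p by (auto simp: qn_def indicator_def)
  fix p :: "'a \<times> 'a"
  have "eventually (%n. qn n p - q p = 0) sequentially" using eventually_ge_at_top[of "nat \<lceil>norm (snd p)\<rceil>"]
  proof eventually_elim
   case (elim n)
   then have "norm (snd p) <= real n" by linarith
   then show ?case by (simp add: qn_def)
  qed
  then show "(%n. qn n p - q p) ----> 0" by (simp add: tendsto_eventually)
 qed auto
 define F :: "nat => 'a \<times> 'a => complex" where "F n p = c * FT (%y. qn n (fst p, y)) (snd p)" for n p
 have [measurable]: "F n \<in> BM" for n unfolding F_def FT_def by measurable
 have wig: "wigner h R = L2_lim F" unfolding wigner_def F_def FT_def c_def qn_def q_def wcoord_def set_lebesgue_integral_def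
  by (rule arg_cong[where f = L2_lim], intro ext) (simp add: case_prod_beta scaleR_conv_of_real mult.left_commute)
 have sect: "AE x in lborel. (%y. qn n (x, y)) \<in> L2 \<and> L1 (%y. qn n (x, y))" for n using L2_section_AE[OF qn[of n]]
 proof eventually_elim
  case (elim x)
  then show ?case using L2_compact_support_integrable[OF elim, of "real n"] by (auto simp: qn_def)
 qed
 have c_sq: "enn ((cmod c)^2) * enn ((2 * pi) ^ DIM('a)) <= 1"
 proof -
  define P where "P = (2 * pi) ^ DIM('a)"
  have P: "1 <= P" unfolding P_def using pi_ge_two by (intro one_le_power) linarith
  have "cmod c = 1 / P" by (simp add: c_def P_def norm_divide norm_power norm_mult power_mult_distrib)
  then have "(cmod c)^2 * P = 1 / P" using P by (simp add: power2_eq_square)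
  then have "(cmod c)^2 * P <= 1" using P by simp
  then have "(cmod c)^2 * (2 * pi) ^ DIM('a) <= 1" by (simp only: P_def)
  then show ?thesis by (simp add: ennreal_mult[symmetric] ennreal_le_1)
 qed
 have F_bound: "N2 (%p. F n p - F m p) <= N2 (%p. qn n p - qn m p)" for n m
 proof -
  have "N2 (%p. F n p - F m p) = (NI x. N2 (%v. F n (x, v) - F m (x, v)))" unfolding N2_def by (rule nn_integral_prod_fst) auto
  also have "... <= (NI x. N2 (%y. qn n (x, y) - qn m (x, y)))"
  proof (rule nn_integral_mono_AE, use sect[of n] sect[of m] in eventually_elim)
   case (elim x)
   have i: "L1 (%y. qn n (x, y) - qn m (x, y))" using elim by simp
   have "(%v. F n (x, v) - F m (x, v)) = (%v. c * FT (%y. qn n (x, y) - qn m (x, y)) v)" using elim by (simp add: F_def FT_diff right_diff_distrib)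
   then have "N2 (%v. F n (x, v) - F m (x, v)) = enn ((cmod c)^2) * N2 (FT (%y. qn n (x, y) - qn m (x, y)))" by (simp add: N2_cmult)
   also have "... <= enn ((cmod c)^2) * (enn ((2 * pi) ^ DIM('a)) * N2 (%y. qn n (x, y) - qn m (x, y)))" by (intro mult_left_mono Plancherel_inequality i) simp
   also have "... <= 1 * N2 (%y. qn n (x, y) - qn m (x, y))" unfolding mult.assoc[symmetric] by (rule mult_right_mono[OF c_sq]) simp
   finally show ?case by simp
  qed
  also have "... = N2 (%p. qn n p - qn m p)" unfolding N2_def by (rule nn_integral_prod_fst[symmetric, of "%p. enn ((cmod (qn n p - qn m p))^2)"]) auto
  finally show ?thesis .
 qed
 have F_L2: "F n \<in> L2" for n
 proof -
  have "N2 (F n) = (NI x. N2 (%v. F n (x, v)))" unfolding N2_def by (rule nn_integral_prod_fst) auto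
  also have "... <= (NI x. N2 (%y. qn n (x, y)))"
  proof (rule nn_integral_mono_AE, use sect[of n] in eventually_elim)
   case (elim x)
   have "N2 (%v. F n (x, v)) = enn ((cmod c)^2) * N2 (FT (%y. qn n (x, y)))" by (simp add: F_def N2_cmult)
   also have "... <= enn ((cmod c)^2) * (enn ((2 * pi) ^ DIM('a)) * N2 (%y. qn n (x, y)))" by (intro mult_left_mono Plancherel_inequality) (use elim in auto)
   also have "... <= 1 * N2 (%y. qn n (x, y))" unfolding mult.assoc[symmetric] by (rule mult_right_mono[OF c_sq]) simp
   finally show ?case by simp
  qed
  also have "... = N2 (qn n)" unfolding N2_def by (rule nn_integral_prod_fst[symmetric, of "%p. enn ((cmod (qn n p))^2)"]) auto
  also have "... < \<infinity>" by (rule L2_N2_finite[OF qn])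
  finally show ?thesis by (simp add: L2_iff)
 qed
 have F_Cauchy: "\<exists>N. \<forall>m\<ge>N. \<forall>n\<ge>N. N2 (%p. F m p - F n p) <= enn \<epsilon>" if eps: "\<epsilon> > 0" for \<epsilon>
 proof -
  obtain N where N: "!!m n. m >= N ==> n >= N ==> N2 (%p. qn m p - qn n p) <= enn \<epsilon>" using N2_tendsto_imp_Cauchy[of qn q, OF _ _ qn_lim eps] by auto
  have "N2 (%p. F m p - F n p) <= enn \<epsilon>" if "m >= N" "n >= N" for m n by (rule order_trans[OF F_bound N[OF that]])
  then show ?thesis by blast
 qed
 note W = L2_lim_works[OF F_L2 F_Cauchy, folded wig]
 have FT\<psi>: "FT \<psi> \<in> L2" by (rule FT_L2[OF \<psi>])
 note lim1 = section_pairing_tendsto[OF W(1) F_L2 \<psi>(1) W(2)]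
 note lim2 = section_pairing_tendsto[OF L2_cmult[OF q, of c] L2_cmult[OF qn, of c] FT\<psi>]
 have "(%n. N2 (%p. c * qn n p - c * q p)) ----> 0"
 proof -
  have "N2 (%p. c * qn n p - c * q p) = enn ((cmod c)^2) * N2 (%p. qn n p - q p)" for n unfolding right_diff_distrib[symmetric] by (rule N2_cmult) auto
  then show ?thesis using ennreal_tendsto_0_cmult[OF qn_lim, of "enn ((cmod c)^2)"] by simp
 qed
 note lim2 = lim2[OF this]
 have eq: "AE x in lborel. (LI v. F n (x, v) * \<psi> v) = (LI y. c * qn n (x, y) * FT \<psi> y)" for n using sect[of n]
 proof eventually_elim
  case (elim x)
  have "(LI v. F n (x, v) * \<psi> v) = c * (LI v. FT (%y. qn n (x, y)) v * \<psi> v)" by (simp add: F_def mult.assoc)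
  also have "... = c * (LI y. qn n (x, y) * FT \<psi> y)" using elim by (subst FT_multiplication) (auto intro: \<psi>)
  finally show ?case by (simp add: mult.assoc)
 qed
 have [measurable]: "wigner h R \<in> BM" using W(1) by auto
 have [measurable]: "FT \<psi> \<in> BM" by measurable
 have "(%n. N2 (%x. (LI v. F n (x, v) * \<psi> v) - (LI y. c * q (x, y) * FT \<psi> y))) ----> 0"
 proof -
  have "N2 (%x. (LI v. F n (x, v) * \<psi> v) - (LI y. c * q (x, y) * FT \<psi> y))
    = N2 (%x. (LI y. c * qn n (x, y) * FT \<psi> y) - (LI y. c * q (x, y) * FT \<psi> y))" for n by (rule N2_cong_AE) (use eq[of n] in \<open>auto elim: eventually_mono\<close>)
  then show ?thesis using lim2 by simp
 qed
 with lim1 have "AE x in lborel. (LI v. wigner h R (x, v) * \<psi> v) = (LI y. c * q (x, y) * FT \<psi> y)" by (intro N2_tendsto_unique[of "%n x. LI v. F n (x, v) * \<psi> v"]) auto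
 then show ?thesis by eventually_elim (simp add: rho_def q_def c_def mult.assoc)
qed


section \<open>Resolvent integrals\<close>

text \<open>An even integrable profile that dominates all one-dimensional integrands below.\<close>

definition profile :: "real => real" where
 "profile u = 1 / ((1 + \<bar>u\<bar>) * sqrt (1 + \<bar>u\<bar>))"

lemma profile_measurable [measurable]: "profile \<in> BM" unfolding profile_def by measurable

lemma profile_nonneg: "0 <= profile u" by (simp add: profile_def)

lemma nn_integral_profile: "(NI u. enn (profile u)) <= enn 4"
proof -
 define f where "f u = 1 / ((1 + u) * sqrt (1 + u))" for u :: real
 have half: "(NI u. enn (f u) * indicator {0..} u) = enn 2"
 proof -
  have "(NI u. enn (f u) * indicator {0..} u) = enn (0 - (- 2 / sqrt (1 + 0)))"
  proof (rule nn_integral_FTC_atLeast)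
   show "f \<in> BM" unfolding f_def by measurable
   show "((%u. - 2 / sqrt (1 + u)) has_real_derivative f u) (at u)" if "0 <= u" for u using that by (auto intro!: derivative_eq_intros simp: f_def field_simps)
   show "((%u. - 2 / sqrt (1 + u)) \<longlongrightarrow> (0::real)) at_top"
   proof (rule tendsto_divide_0[OF tendsto_const])
    have "filterlim (%u::real. 1 + u) at_top at_top" by (rule filterlim_tendsto_add_at_top[OF tendsto_const filterlim_ident])
    then have "filterlim (%u::real. sqrt (1 + u)) at_top at_top" by (rule filterlim_compose[OF sqrt_at_top])
    then show "filterlim (%u::real. sqrt (1 + u)) at_infinity at_top" by (rule filterlim_at_top_imp_at_infinity)
   qed
  qed (simp add: f_def)
  then show ?thesis by simp
 qed
 have "(NI u. enn (profile u)) <= (NI u. enn (profile u) * indicator {0..} u + enn (profile u) * indicator {..0} u)" by (intro nn_integral_mono) (auto simp: indicator_def)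
 also have "... = (NI u. enn (profile u) * indicator {0..} u) + (NI u. enn (profile u) * indicator {..0} u)" by (rule nn_integral_add) auto
 also have "(NI u. enn (profile u) * indicator {..0} u) = (NI u. enn (profile u) * indicator {0..} u)"
  by (subst nn_integral_real_affine[where c="-1" and t=0]) (auto intro!: nn_integral_cong simp: profile_def indicator_def)
 also have "(NI u. enn (profile u) * indicator {0..} u) = enn 2" unfolding half[symmetric] by (intro nn_integral_cong) (auto simp: profile_def f_def indicator_def)
 also have "enn 2 + enn 2 = enn 4" by (simp flip: ennreal_plus)
 finally show ?thesis .
qed

lemma inverse_square_le_profile: "1 / (1 + u^2) <= 2 * profile u"
proof -
 define a where "a = \<bar>u\<bar>"
 have a: "a >= 0" "u^2 = a^2" by (auto simp: a_def)
 have "sqrt (1 + a) <= 1 + a" using a by (intro real_le_lsqrt) (auto simp: power2_eq_square algebra_simps)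
 then have "(1 + a) * sqrt (1 + a) <= (1 + a) * (1 + a)" using a by (intro mult_left_mono) auto
 also have "... <= 2 * (1 + a^2)" using zero_le_power2[of "a - 1"] by (simp add: power2_eq_square algebra_simps)
 finally have "(1 + a) * sqrt (1 + a) <= 2 * (1 + a^2)" .
 moreover have "0 < (1 + a) * sqrt (1 + a)" using a by simp
 ultimately have "1 / (1 + a^2) <= 2 / ((1 + a) * sqrt (1 + a))" by (simp add: divide_simps add_pos_nonneg)
 then show ?thesis by (simp add: profile_def a(2) a_def[symmetric])
qed

lemma nn_integral_resolvent:
 assumes "\<alpha> > 0"
 shows "(NI p. enn (1 / (\<alpha>^2 + p^2))) <= enn (8 / \<alpha>)"
proof -
 have "(NI p. enn (1 / (\<alpha>^2 + p^2))) = enn \<alpha> * (NI u. enn (1 / (\<alpha>^2 + (\<alpha> * u)^2)))" using assms by (subst nn_integral_real_affine[where c=\<alpha> and t=0]) auto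
 also have "... = (NI u. enn \<alpha> * enn (1 / (\<alpha>^2 + (\<alpha> * u)^2)))" by (rule nn_integral_cmult[symmetric]) measurable
 also have "... <= (NI u. enn (2 / \<alpha>) * enn (profile u))"
 proof (rule nn_integral_mono)
  fix u
  have "\<alpha> * (1 / (\<alpha>^2 + (\<alpha> * u)^2)) = 1 / \<alpha> * (1 / (1 + u^2))"
  proof -
   have "\<alpha>^2 + (\<alpha> * u)^2 = \<alpha> * (\<alpha> * (1 + u^2))" by (simp add: power2_eq_square algebra_simps)
   then show ?thesis using assms by simp
  qed
  also have "... <= 1 / \<alpha> * (2 * profile u)" using assms by (intro mult_left_mono inverse_square_le_profile) auto
  finally have "\<alpha> * (1 / (\<alpha>^2 + (\<alpha> * u)^2)) <= 2 / \<alpha> * profile u" by simp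
  then have "enn (\<alpha> * (1 / (\<alpha>^2 + (\<alpha> * u)^2))) <= enn (2 / \<alpha> * profile u)" by (rule ennreal_leI)
  then show "enn \<alpha> * enn (1 / (\<alpha>^2 + (\<alpha> * u)^2)) <= enn (2 / \<alpha>) * enn (profile u)" using assms by (simp add: ennreal_mult[symmetric] profile_nonneg)
 qed
 also have "... = enn (2 / \<alpha>) * (NI u. enn (profile u))" by (rule nn_integral_cmult) measurable
 also have "... <= enn (2 / \<alpha>) * enn 4" by (intro mult_left_mono nn_integral_profile) simp
 also have "... = enn (2 / \<alpha> * 4)" by (rule ennreal_mult[symmetric]) (use assms in auto)
 finally show ?thesis by simp
qed

definition decay :: "nat => 'a::euclidean_space => real" where
 "decay N v = 1 / (1 + norm v) ^ N"

lemma decay_measurable [measurable]: "decay N \<in> BM" unfolding decay_def by measurable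

lemma decay_pos: "0 < decay N v" by (simp add: decay_def add_pos_nonneg)

lemma decay_nonneg: "0 <= decay N v" by (simp add: decay_def)

lemma decay_antimono: "M <= N ==> decay N v <= decay M v" unfolding decay_def by (intro divide_left_mono power_increasing mult_pos_pos zero_less_power) (auto simp: add_pos_nonneg)

lemma decay_Suc: "(1 + norm v) * decay (Suc N) v = decay N v"
proof -
 have "1 + norm v ~= 0" using norm_ge_zero[of v] by linarith
 then show ?thesis by (simp add: decay_def)
qed

lemma decay_shift:
 fixes u v :: "'a::euclidean_space"
 assumes "norm u <= 1"
 shows "decay N v <= 2 ^ N * decay N (v + u)"
proof -
 have "1 + norm (v + u) <= 2 * (1 + norm v)" 
 proof -
  have "norm (v + u) <= norm v + 1" by (rule order_trans[OF norm_triangle_ineq add_left_mono[OF assms]])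
  moreover have "norm v >= 0" by (rule norm_ge_zero)
  moreover have "1 + r <= 2 * (1 + s)" if "r <= s + 1" "s >= 0" for r s :: real using that by auto
  ultimately show ?thesis by blast
 qed
 then have "(1 + norm (v + u)) ^ N <= (2 * (1 + norm v)) ^ N" by (intro power_mono) auto
 then have "(1 + norm (v + u)) ^ N <= 2 ^ N * (1 + norm v) ^ N" by (simp only: power_mult_distrib)
 moreover have "0 < (1 + norm (v + u)) ^ N" "0 < (1 + norm v) ^ N" by (auto intro!: zero_less_power add_pos_nonneg)
 ultimately show ?thesis by (simp add: decay_def field_simps)
qed

lemma nn_integral_decay:
 assumes "N >= 2 * DIM('a::euclidean_space)"
 shows "(NI (v::'a). enn (decay N v)) <= enn (4 ^ DIM('a))"
proof -
 have "(NI (v::'a). enn (decay N v)) <= (NI (v::'a). (\<Prod>b\<in>Basis. enn (profile (v \<cdot> b))))"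
 proof (rule nn_integral_mono)
  fix v :: 'a
  have "(\<Prod>b\<in>(Basis::'a set). (1 + \<bar>v \<cdot> b\<bar>) * sqrt (1 + \<bar>v \<cdot> b\<bar>)) <= (\<Prod>b\<in>(Basis::'a set). (1 + norm v)^2)"
  proof (rule prod_mono, intro conjI)
   fix b :: 'a assume "b \<in> Basis"
   have 1: "1 + \<bar>v \<cdot> b\<bar> <= 1 + norm v" using Basis_le_norm[OF \<open>b \<in> Basis\<close>] by simp
   have "sqrt (1 + \<bar>v \<cdot> b\<bar>) <= 1 + \<bar>v \<cdot> b\<bar>" by (intro real_le_lsqrt) (auto simp: power2_eq_square algebra_simps)
   with 1 have "sqrt (1 + \<bar>v \<cdot> b\<bar>) <= 1 + norm v" by linarith
   with 1 show "(1 + \<bar>v \<cdot> b\<bar>) * sqrt (1 + \<bar>v \<cdot> b\<bar>) <= (1 + norm v)^2" unfolding power2_eq_square by (intro mult_mono) auto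
  qed auto
  also have "... = (1 + norm v) ^ (2 * DIM('a))" by (simp add: power_mult)
  also have "... <= (1 + norm v) ^ N" using assms by (intro power_increasing) auto
  finally have le: "(\<Prod>b\<in>(Basis::'a set). (1 + \<bar>v \<cdot> b\<bar>) * sqrt (1 + \<bar>v \<cdot> b\<bar>)) <= (1 + norm v) ^ N" .
  have pos: "0 < (\<Prod>b\<in>(Basis::'a set). (1 + \<bar>v \<cdot> b\<bar>) * sqrt (1 + \<bar>v \<cdot> b\<bar>))" by (intro prod_pos) (auto intro!: mult_pos_pos add_pos_nonneg)
  have "decay N v <= 1 / (\<Prod>b\<in>(Basis::'a set). (1 + \<bar>v \<cdot> b\<bar>) * sqrt (1 + \<bar>v \<cdot> b\<bar>))"
   unfolding decay_def using le pos by (intro divide_left_mono) (auto intro!: mult_pos_pos zero_less_power add_pos_nonneg)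
  also have "... = (\<Prod>b\<in>Basis. profile (v \<cdot> b))" by (simp add: profile_def prod_dividef)
  finally have "enn (decay N v) <= enn (\<Prod>b\<in>Basis. profile (v \<cdot> b))" by (rule ennreal_leI)
  then show "enn (decay N v) <= (\<Prod>b\<in>Basis. enn (profile (v \<cdot> b)))" by (simp add: prod_ennreal profile_nonneg)
 qed
 also have "... = (\<Prod>b\<in>(Basis::'a set). NI x. enn (profile x))" by (rule nn_integral_lborel_prod) auto
 also have "... <= (\<Prod>b\<in>(Basis::'a set). enn 4)" unfolding prod_constant by (intro power_mono nn_integral_profile) simp
 also have "... = enn (4 ^ DIM('a))" by (simp add: ennreal_power[symmetric])
 finally show ?thesis .
qed

definition resolvent_weight :: "nat => real => real => real => 'a::euclidean_space => ennreal" where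
 "resolvent_weight N m \<alpha> \<tau> k = (NI v. enn (decay N v / (\<alpha>^2 + (\<tau> + (k \<cdot> v) / m)^2)))"

lemma resolvent_weight_trivial:
 assumes "\<alpha> > 0" "N >= 2 * DIM('a::euclidean_space)"
 shows "resolvent_weight N m \<alpha> \<tau> (k::'a) <= enn (4 ^ DIM('a) / \<alpha>^2)"
proof -
 have "resolvent_weight N m \<alpha> \<tau> k <= (NI (v::'a). enn (1 / \<alpha>^2) * enn (decay N v))" unfolding resolvent_weight_def
 proof (rule nn_integral_mono)
  fix v :: 'a
  have "decay N v / (\<alpha>^2 + (\<tau> + (k \<cdot> v) / m)^2) <= decay N v / \<alpha>^2" using assms(1) decay_nonneg by (intro divide_left_mono mult_pos_pos add_pos_nonneg) auto
  then show "enn (decay N v / (\<alpha>^2 + (\<tau> + (k \<cdot> v) / m)^2)) <= enn (1 / \<alpha>^2) * enn (decay N v)" by (simp add: ennreal_mult[symmetric] decay_nonneg ennreal_leI)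
 qed
 also have "... = enn (1 / \<alpha>^2) * (NI (v::'a). enn (decay N v))" by (rule nn_integral_cmult) measurable
 also have "... <= enn (1 / \<alpha>^2) * enn (4 ^ DIM('a))" by (intro mult_left_mono nn_integral_decay assms) simp
 finally show ?thesis by (simp add: ennreal_mult[symmetric])
qed

text \<open>
 Averaging over the translations \<open>v \<mapsto> v + s k / |k|\<close> with \<open>0 \<le> s \<le> 1\<close> hardly changes the weight, but
 sweeps \<open>\<tau> + k \<cdot> v / m\<close> over an interval of length \<open>|k| / m\<close>; this is where averaging in velocity gains.
\<close>

lemma resolvent_weight_gain:
 assumes "\<alpha> > 0" "m > 0" "N >= 2 * DIM('a::euclidean_space)" "k ~= 0"
 shows "resolvent_weight N m \<alpha> \<tau> (k::'a) <= enn (2 ^ N * 4 ^ DIM('a) * (8 * m / (\<alpha> * norm k)))"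
proof -
 define P where "P p = 1 / (\<alpha>^2 + p^2)" for p :: real
 have P0: "P p >= 0" for p by (simp add: P_def)
 have [measurable]: "P \<in> BM" unfolding P_def by measurable
 define u where "u = k /\<^sub>R norm k"
 have u: "norm u = 1" "k \<cdot> u = norm k" using assms(4) by (auto simp: u_def power2_norm_eq_inner[symmetric] power2_eq_square)
 have "resolvent_weight N m \<alpha> \<tau> k = (NI (s::real). indicator {0..1} s * (NI v. enn (decay N v * P (\<tau> + (k \<cdot> v) / m))))"
  by (subst nn_integral_multc) (auto simp: resolvent_weight_def P_def)
 also have "... <= (NI (s::real). indicator {0..1} s * (NI v. enn (2 ^ N * decay N v * P (\<tau> + (k \<cdot> v) / m - s * norm k / m))))"
 proof (rule nn_integral_mono)
  fix s :: real
  show "indicator {0..1} s * (NI v. enn (decay N v * P (\<tau> + (k \<cdot> v) / m)))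
    <= indicator {0..1} s * (NI v. enn (2 ^ N * decay N v * P (\<tau> + (k \<cdot> v) / m - s * norm k / m)))"
  proof (cases "s \<in> {0..1}")
   case True
   define g where "g v = enn (2 ^ N * decay N v * P (\<tau> + (k \<cdot> v) / m - s * norm k / m))" for v
   have [measurable]: "g \<in> BM" unfolding g_def by measurable
   have "(NI v. enn (decay N v * P (\<tau> + (k \<cdot> v) / m))) <= (NI v. g (s *\<^sub>R u + v))"
   proof (rule nn_integral_mono)
    fix v :: 'a
    have 1: "decay N v <= 2 ^ N * decay N (s *\<^sub>R u + v)" using decay_shift[of "s *\<^sub>R u" N v] True u by (simp add: add.commute)
    have 2: "\<tau> + (k \<cdot> (s *\<^sub>R u + v)) / m - s * norm k / m = \<tau> + (k \<cdot> v) / m" by (simp add: inner_add_right u add_divide_distrib)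
    have "decay N v * P (\<tau> + (k \<cdot> v) / m) <= 2 ^ N * decay N (s *\<^sub>R u + v) * P (\<tau> + (k \<cdot> v) / m)" by (rule mult_right_mono[OF 1 P0])
    then show "enn (decay N v * P (\<tau> + (k \<cdot> v) / m)) <= g (s *\<^sub>R u + v)" unfolding g_def 2 by (rule ennreal_leI)
   qed
   also have "... = (NI v. g v)" by (rule nn_integral_shift) measurable
   finally show ?thesis using True by (simp add: g_def)
  qed simp
 qed
 also have "... = (NI (s::real). NI v. indicator {0..1} s * enn (2 ^ N * decay N v * P (\<tau> + (k \<cdot> v) / m - s * norm k / m)))" by (intro nn_integral_cong nn_integral_cmult[symmetric]) measurable
 also have "... <= (NI (s::real). NI v. enn (2 ^ N * decay N v) * enn (P (\<tau> + (k \<cdot> v) / m - s * norm k / m)))"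
  by (intro nn_integral_mono) (auto simp: indicator_def ennreal_mult[symmetric] decay_nonneg P0)
 also have "... = (\<integral>\<^sup>+p. enn (2 ^ N * decay N (snd p)) * enn (P (\<tau> + (k \<cdot> snd p) / m - fst p * norm k / m)) \<partial>(lborel :: (real \<times> 'a) measure))"
  by (subst nn_integral_prod_fst) auto
 also have "... = (NI v. NI (s::real). enn (2 ^ N * decay N v) * enn (P (\<tau> + (k \<cdot> v) / m - s * norm k / m)))" by (subst nn_integral_prod_snd) auto
 also have "... = (NI v. enn (2 ^ N * decay N v) * (NI (s::real). enn (P (\<tau> + (k \<cdot> v) / m - s * norm k / m))))" by (intro nn_integral_cong nn_integral_cmult) measurable
 also have "... <= (NI (v::'a). enn (2 ^ N * decay N v) * enn (8 * m / (\<alpha> * norm k)))"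
 proof (intro nn_integral_mono mult_left_mono)
  fix v :: 'a
  have "enn (norm k / m) * (NI (s::real). enn (P (\<tau> + (k \<cdot> v) / m - s * norm k / m))) = (NI p. enn (P p))"
   using assms by (subst nn_integral_real_affine[where c="- (norm k / m)" and t="\<tau> + (k \<cdot> v) / m" and f="%p. enn (P p)"])
    (auto simp: mult.commute)
  also have "... <= enn (8 / \<alpha>)" unfolding P_def by (rule nn_integral_resolvent[OF assms(1)])
  finally have le: "enn (norm k / m) * (NI (s::real). enn (P (\<tau> + (k \<cdot> v) / m - s * norm k / m))) <= enn (8 / \<alpha>)" .
  have "(NI (s::real). enn (P (\<tau> + (k \<cdot> v) / m - s * norm k / m)))
    = enn (m / norm k) * (enn (norm k / m) * (NI (s::real). enn (P (\<tau> + (k \<cdot> v) / m - s * norm k / m))))" unfolding mult.assoc[symmetric] using assms by (simp add: ennreal_mult[symmetric])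
  also have "... <= enn (m / norm k) * enn (8 / \<alpha>)" by (rule mult_left_mono[OF le]) simp
  also have "... = enn (8 * m / (\<alpha> * norm k))" using assms by (simp add: ennreal_mult[symmetric] mult.commute)
  finally show "(NI (s::real). enn (P (\<tau> + (k \<cdot> v) / m - s * norm k / m))) <= enn (8 * m / (\<alpha> * norm k))" .
 qed simp
 also have "... = (NI (v::'a). enn (2 ^ N) * enn (decay N v)) * enn (8 * m / (\<alpha> * norm k))" by (subst nn_integral_multc) (auto simp: ennreal_mult decay_nonneg)
 also have "... = enn (2 ^ N) * (NI (v::'a). enn (decay N v)) * enn (8 * m / (\<alpha> * norm k))" by (subst nn_integral_cmult) auto
 also have "... <= enn (2 ^ N) * enn (4 ^ DIM('a)) * enn (8 * m / (\<alpha> * norm k))" by (intro mult_right_mono mult_left_mono nn_integral_decay assms) auto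
 also have "... = enn (2 ^ N * 4 ^ DIM('a) * (8 * m / (\<alpha> * norm k)))" using assms by (simp add: ennreal_mult[symmetric])
 finally show ?thesis .
qed


text \<open>For large \<open>\<tau>\<close>, compare \<open>\<tau>\<^sup>2\<close> with \<open>p\<^sup>2 + (k \<cdot> v / m)\<^sup>2\<close> and pay with two powers of decay.\<close>

lemma resolvent_weight_time:
 assumes "\<alpha> > 0" "m > 0" "N >= 2 * DIM('a::euclidean_space)"
 shows "enn (\<alpha>^2 + \<tau>^2) * resolvent_weight (N + 2) m \<alpha> \<tau> (k::'a)
    <= enn (2 * 4 ^ DIM('a)) + enn (2 * (norm k / m)^2) * resolvent_weight N m \<alpha> \<tau> k"
proof -
 have "enn (\<alpha>^2 + \<tau>^2) * resolvent_weight (N + 2) m \<alpha> \<tau> k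
   = (NI (v::'a). enn (\<alpha>^2 + \<tau>^2) * enn (decay (N + 2) v / (\<alpha>^2 + (\<tau> + (k \<cdot> v) / m)^2)))" unfolding resolvent_weight_def by (rule nn_integral_cmult[symmetric]) measurable
 also have "... <= (NI (v::'a). 2 * enn (decay N v) + enn (2 * (norm k / m)^2) * enn (decay N v / (\<alpha>^2 + (\<tau> + (k \<cdot> v) / m)^2)))"
 proof (rule nn_integral_mono)
  fix v :: 'a
  define \<kappa> where "\<kappa> = (k \<cdot> v) / m"
  define D where "D = \<alpha>^2 + (\<tau> + \<kappa>)^2"
  have D: "D > 0" using assms(1) by (simp add: D_def add_pos_nonneg)
  have "\<bar>\<kappa>\<bar> <= norm k / m * norm v" using Cauchy_Schwarz_ineq2[of k v] assms(2) by (simp add: \<kappa>_def abs_divide divide_right_mono)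
  also have "... <= norm k / m * (1 + norm v)" using assms(2) by (intro mult_left_mono) auto
  finally have "\<bar>\<kappa>\<bar>^2 <= (norm k / m * (1 + norm v))^2" by (intro power_mono) auto
  then have \<kappa>: "\<kappa>^2 <= (norm k / m)^2 * (1 + norm v)^2" by (simp only: power2_abs power_mult_distrib)
  have "\<tau>^2 <= 2 * (\<tau> + \<kappa>)^2 + 2 * \<kappa>^2" using zero_le_power2[of "\<tau> + 2 * \<kappa>"] by (simp add: power2_eq_square algebra_simps)
  then have "\<alpha>^2 + \<tau>^2 <= 2 * D + 2 * \<kappa>^2" by (simp add: D_def add_increasing)
  also have "... <= 2 * D + 2 * ((norm k / m)^2 * (1 + norm v)^2)" using \<kappa> by simp
  finally have "(\<alpha>^2 + \<tau>^2) * (decay (N + 2) v / D) <= (2 * D + 2 * ((norm k / m)^2 * (1 + norm v)^2)) * (decay (N + 2) v / D)" using D by (intro mult_right_mono) (auto simp: decay_nonneg)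
  also have "... = 2 * decay (N + 2) v + 2 * (norm k / m)^2 * ((1 + norm v)^2 * decay (N + 2) v / D)" using D by (simp add: field_simps)
  also have "(1 + norm v)^2 * decay (N + 2) v = decay N v" using decay_Suc[of v N] decay_Suc[of v "Suc N"] by (simp add: power2_eq_square mult.assoc)
  also have "2 * decay (N + 2) v + 2 * (norm k / m)^2 * (decay N v / D) <= 2 * decay N v + 2 * (norm k / m)^2 * (decay N v / D)" by (intro add_right_mono mult_left_mono decay_antimono) auto
  finally have "enn ((\<alpha>^2 + \<tau>^2) * (decay (N + 2) v / D)) <= enn (2 * decay N v + 2 * (norm k / m)^2 * (decay N v / D))" by (rule ennreal_leI)
  also have "... = 2 * enn (decay N v) + enn (2 * (norm k / m)^2) * enn (decay N v / D)" using D by (subst ennreal_plus) (auto simp: decay_nonneg two_times_ennreal ennreal_mult[symmetric])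
  finally show "enn (\<alpha>^2 + \<tau>^2) * enn (decay (N + 2) v / (\<alpha>^2 + (\<tau> + (k \<cdot> v) / m)^2))
    <= 2 * enn (decay N v) + enn (2 * (norm k / m)^2) * enn (decay N v / (\<alpha>^2 + (\<tau> + (k \<cdot> v) / m)^2))"
   using D by (simp add: D_def \<kappa>_def ennreal_mult[symmetric] decay_nonneg del: ennreal_plus)
 qed
 also have "... = 2 * (NI (v::'a). enn (decay N v)) + enn (2 * (norm k / m)^2) * resolvent_weight N m \<alpha> \<tau> k"
  unfolding resolvent_weight_def by (subst nn_integral_add) (auto simp: nn_integral_cmult)
 also have "... <= 2 * enn (4 ^ DIM('a)) + enn (2 * (norm k / m)^2) * resolvent_weight N m \<alpha> \<tau> k" by (intro add_right_mono mult_left_mono nn_integral_decay assms) auto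
 finally show ?thesis by (simp add: two_times_ennreal)
qed

lemma resolvent_weight_antimono: "M <= N ==> resolvent_weight N m \<alpha> \<tau> k <= resolvent_weight M m \<alpha> \<tau> k"
 unfolding resolvent_weight_def by (intro nn_integral_mono ennreal_leI divide_right_mono decay_antimono) auto

text \<open>The three bounds are the trivial one, the gain from averaging along \<open>k\<close>, and the decay in \<open>\<tau>\<close> away from the resonant frequencies; the common value \<open>i\<close> makes the weight a real number.\<close>

lemma resolvent_weight_bounds:
 assumes m: "m > 0" and N: "N >= 2 * DIM('a::euclidean_space) + 2"
 obtains C where "C > 0"
  "!!\<alpha> \<tau> (k::'a). \<alpha> > 0 ==> \<exists>i\<ge>0. resolvent_weight N m \<alpha> \<tau> k = enn i \<and>
    i <= C / \<alpha>^2 \<and> norm k * i <= C / \<alpha> \<and> (\<alpha>^2 + \<tau>^2) * i <= C * (1 + norm k / \<alpha>)"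
proof -
 define a where "a = (4::real) ^ DIM('a)"
 define g where "g = 2 ^ N * a * (8 * m)"
 define C where "C = 2 * a + g + 2 * g / m^2"
 have a: "a > 0" by (simp add: a_def)
 have g: "g > 0" using m a by (simp add: g_def)
 have "2 * g / m^2 > 0" using g m by simp
 then have C: "C > 0" "a <= C" "g <= C" "2 * a <= C" "2 * g / m^2 <= C" using a g unfolding C_def by linarith+
 show ?thesis
 proof (rule that[OF C(1)])
  fix \<alpha> \<tau> :: real and k :: 'a assume \<alpha>: "\<alpha> > 0"
  have triv: "resolvent_weight (N - 2) m \<alpha> \<tau> k <= enn (a / \<alpha>^2)" unfolding a_def using N by (intro resolvent_weight_trivial \<alpha>) auto
  have N2: "resolvent_weight N m \<alpha> \<tau> k <= resolvent_weight (N - 2) m \<alpha> \<tau> k" by (rule resolvent_weight_antimono) simp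
  obtain i where i: "i >= 0" "resolvent_weight N m \<alpha> \<tau> k = enn i" using order_trans[OF N2 triv] by (cases "resolvent_weight N m \<alpha> \<tau> k") (auto simp: top_unique)
  obtain j where j: "j >= 0" "resolvent_weight (N - 2) m \<alpha> \<tau> k = enn j" using triv by (cases "resolvent_weight (N - 2) m \<alpha> \<tau> k") (auto simp: top_unique)
  have ij: "i <= j" using N2 i j by (simp add: ennreal_le_iff)
  have j1: "j <= a / \<alpha>^2" using triv j a \<alpha> by (simp add: ennreal_le_iff)
  have j2: "norm k * j <= g / \<alpha>"
  proof (cases "k = 0")
   case True then show ?thesis using g \<alpha> by simp
  next
   case False
   have "enn j <= enn (2 ^ (N - 2) * 4 ^ DIM('a) * (8 * m / (\<alpha> * norm k)))" unfolding j(2)[symmetric] using N by (intro resolvent_weight_gain \<alpha> m False) auto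
   then have "j <= 2 ^ (N - 2) * 4 ^ DIM('a) * (8 * m / (\<alpha> * norm k))" using \<alpha> m False by (subst (asm) ennreal_le_iff) auto
   also have "... <= 2 ^ N * 4 ^ DIM('a) * (8 * m / (\<alpha> * norm k))" using \<alpha> m False by (intro mult_right_mono power_increasing) auto
   also have "... = g / \<alpha> / norm k" by (simp add: g_def a_def)
   finally show ?thesis by (subst (asm) pos_le_divide_eq) (use False in \<open>auto simp: mult.commute\<close>)
  qed
  have "enn (\<alpha>^2 + \<tau>^2) * enn i <= enn (2 * a) + enn (2 * (norm k / m)^2) * enn j"
  proof -
   have N': "N - 2 + 2 = N" "2 * DIM('a) <= N - 2" using N by auto
   show ?thesis using resolvent_weight_time[OF \<alpha> m N'(2), of \<tau> k] unfolding N'(1) i(2) j(2) a_def[symmetric] .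
  qed
  then have "enn ((\<alpha>^2 + \<tau>^2) * i) <= enn (2 * a + 2 * (norm k / m)^2 * j)" using i(1) j(1) a by (simp add: ennreal_mult[symmetric] ennreal_plus[symmetric] del: ennreal_plus)
  then have "(\<alpha>^2 + \<tau>^2) * i <= 2 * a + 2 * (norm k / m)^2 * j" using i(1) j(1) a by (subst (asm) ennreal_le_iff) auto
  also have "2 * (norm k / m)^2 * j = (2 * norm k / m^2) * (norm k * j)" by (simp add: power2_eq_square)
  also have "... <= (2 * norm k / m^2) * (g / \<alpha>)" by (intro mult_left_mono j2) auto
  also have "2 * a + (2 * norm k / m^2) * (g / \<alpha>) = 2 * a + (2 * g / m^2) * (norm k / \<alpha>)" by simp
  also have "... <= C + C * (norm k / \<alpha>)" using C \<alpha> by (intro add_mono mult_right_mono) auto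
  finally have 3: "(\<alpha>^2 + \<tau>^2) * i <= C * (1 + norm k / \<alpha>)" by (simp add: distrib_left)
  have 1: "i <= C / \<alpha>^2" using ij j1 divide_right_mono[OF C(2), of "\<alpha>^2"] by simp
  have "norm k * i <= norm k * j" using ij by (intro mult_left_mono) auto
  then have 2: "norm k * i <= C / \<alpha>" using j2 divide_right_mono[OF C(3), of \<alpha>] \<alpha> by simp
  show "\<exists>i\<ge>0. resolvent_weight N m \<alpha> \<tau> k = enn i \<and> i <= C / \<alpha>^2 \<and> norm k * i <= C / \<alpha> \<and> (\<alpha>^2 + \<tau>^2) * i <= C * (1 + norm k / \<alpha>)"
   using i 1 2 3 by blast
 qed
qed


text \<open>With \<open>\<alpha> = 1 / h\<close>: half a derivative of the velocity average costs \<open>h powr (- 1/2)\<close>.\<close>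

lemma half_derivative_arith:
 fixes i C \<alpha> \<tau> k :: real
 assumes i: "i >= 0" "i <= C / \<alpha>^2" "k * i <= C / \<alpha>" "(\<alpha>^2 + \<tau>^2) * i <= C * (1 + k / \<alpha>)"
  and "\<alpha> >= 1" "k >= 0" "C > 0"
 shows "(1 + \<bar>\<tau>\<bar> + k) * (\<alpha>^2 * i) <= 4 * C * \<alpha>"
proof -
 have \<alpha>: "\<alpha> > 0" using assms by simp
 have "\<alpha>^2 * i <= C" using i(2) \<alpha> by (simp add: field_simps)
 also have "C <= C * \<alpha>" using \<open>\<alpha> >= 1\<close> \<open>C > 0\<close> by simp
 finally have 1: "\<alpha>^2 * i <= C * \<alpha>" .
 have "\<alpha>^2 * (k * i) <= \<alpha>^2 * (C / \<alpha>)" by (intro mult_left_mono i(3)) auto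
 moreover have "\<alpha>^2 * (C / \<alpha>) = C * \<alpha>" using \<alpha> by (simp add: power2_eq_square)
 moreover have "\<alpha>^2 * (k * i) = k * (\<alpha>^2 * i)" by (rule mult.left_commute)
 ultimately have 2: "k * (\<alpha>^2 * i) <= C * \<alpha>" by (simp only:)
 have C\<alpha>: "0 <= C * \<alpha>" using \<alpha> \<open>C > 0\<close> by simp
 have 3: "\<bar>\<tau>\<bar> * (\<alpha>^2 * i) <= 2 * C * \<alpha>"
 proof (cases "\<bar>\<tau>\<bar> <= k")
  case True
  then have "\<bar>\<tau>\<bar> * (\<alpha>^2 * i) <= k * (\<alpha>^2 * i)" using i(1) by (intro mult_right_mono) auto
  then show ?thesis using 2 C\<alpha> by linarith
 next
  case False
  define D where "D = \<alpha>^2 + \<tau>^2"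
  have D: "D > 0" using \<alpha> by (simp add: D_def add_pos_nonneg)
  have "2 * (\<bar>\<tau>\<bar> * \<alpha>) <= D" using zero_le_power2[of "\<bar>\<tau>\<bar> - \<alpha>"] by (simp add: D_def power2_eq_square algebra_simps)
  moreover have "0 <= \<bar>\<tau>\<bar> * \<alpha>" using \<alpha> by simp
  ultimately have t: "\<bar>\<tau>\<bar> * \<alpha> <= D" by linarith
  have "D * (\<bar>\<tau>\<bar> * (\<alpha>^2 * i)) = \<bar>\<tau>\<bar> * \<alpha>^2 * (D * i)" by simp
  also have "... <= \<bar>\<tau>\<bar> * \<alpha>^2 * (C * (1 + k / \<alpha>))" using i(4) by (intro mult_left_mono) (auto simp: D_def)
  also have "... <= \<bar>\<tau>\<bar> * \<alpha>^2 * (C * (1 + \<bar>\<tau>\<bar> / \<alpha>))" using False \<alpha> \<open>C > 0\<close> by (intro mult_left_mono add_left_mono divide_right_mono) auto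
  also have "... = C * \<alpha> * (\<bar>\<tau>\<bar> * \<alpha> + \<tau>^2)" using \<alpha> by (simp add: power2_eq_square field_simps)
  also have "... <= C * \<alpha> * (D + D)" using t \<alpha> \<open>C > 0\<close> by (intro mult_left_mono add_mono) (auto simp: D_def)
  finally have "D * (\<bar>\<tau>\<bar> * (\<alpha>^2 * i)) <= D * (2 * C * \<alpha>)" by (simp add: algebra_simps)
  then show ?thesis using D by simp
 qed
 show ?thesis using 1 2 3 by (simp add: algebra_simps)
qed

text \<open>With \<open>\<alpha>\<^sup>2 = max 1 |k|\<close>: a quarter of a derivative, uniformly.\<close>

lemma quarter_derivative_arith:
 fixes i C \<alpha> \<tau> k :: real
 assumes i: "i >= 0" "i <= C / \<alpha>^2" "k * i <= C / \<alpha>" "(\<alpha>^2 + \<tau>^2) * i <= C * (1 + k / \<alpha>)"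
  and \<alpha>: "\<alpha> = sqrt (max 1 k)" and "k >= 0" "C > 0"
 shows "sqrt (1 + \<bar>\<tau>\<bar> + k) * (\<alpha>^2 * i) <= 4 * C"
proof -
 have \<alpha>1: "\<alpha> >= 1" and \<alpha>2: "\<alpha>^2 = max 1 k" using \<alpha> by (auto simp: max_def)
 have 1: "\<alpha>^2 * i <= C" using i(2) \<alpha>1 by (simp add: field_simps)
 have 2: "\<alpha> * (\<alpha>^2 * i) <= C"
 proof (cases "k <= 1")
  case True
  then have "\<alpha> = 1" using \<alpha> by (simp add: max_def)
  then show ?thesis using 1 by simp
 next
  case False
  then have "\<alpha>^2 = k" using \<alpha>2 by simp
  then show ?thesis using i(3) \<alpha>1 by (simp add: field_simps)
 qed
 have k\<alpha>: "sqrt k <= \<alpha>" unfolding \<alpha> by (rule real_sqrt_le_mono) simp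
 have 3: "sqrt \<bar>\<tau>\<bar> * (\<alpha>^2 * i) <= 2 * C"
 proof (cases "\<bar>\<tau>\<bar> <= \<alpha>^2")
  case True
  then have "sqrt \<bar>\<tau>\<bar> <= \<alpha>" using \<alpha>1 by (intro real_le_lsqrt) auto
  then have "sqrt \<bar>\<tau>\<bar> * (\<alpha>^2 * i) <= \<alpha> * (\<alpha>^2 * i)" using i(1) by (intro mult_right_mono) auto
  then show ?thesis using 2 \<open>C > 0\<close> by linarith
 next
  case False
  define r where "r = sqrt \<bar>\<tau>\<bar>"
  have r2: "r^2 = \<bar>\<tau>\<bar>" by (simp add: r_def)
  have r\<alpha>: "\<alpha> <= r" unfolding r_def using False \<alpha>1 by (intro real_le_rsqrt) auto
  have "k / \<alpha> <= \<alpha>" using \<alpha>1 \<alpha>2 by (simp add: field_simps power2_eq_square[symmetric])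
  then have "C * (1 + k / \<alpha>) <= C * (2 * r)" using \<alpha>1 r\<alpha> \<open>C > 0\<close> by (intro mult_left_mono) auto
  with i(4) have "(\<alpha>^2 + \<tau>^2) * i <= 2 * C * r" by simp
  moreover have "\<tau>^2 * i <= (\<alpha>^2 + \<tau>^2) * i" using i(1) by (intro mult_right_mono) auto
  moreover have "\<tau>^2 = r^2 * r^2" unfolding r2 by (simp add: power2_eq_square)
  moreover have "r^2 * r^2 * i = r * (r * r^2 * i)" by (simp add: power2_eq_square)
  ultimately have "r * (r * r^2 * i) <= 2 * C * r" by (metis order_trans)
  then have "r * (r * r^2 * i) <= r * (2 * C)" by (simp only: mult_ac)
  then have 4: "r * r^2 * i <= 2 * C" using r\<alpha> \<alpha>1 by (subst (asm) mult_le_cancel_left_pos) auto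
  have "r * (\<alpha>^2 * i) <= r * (r^2 * i)" using r\<alpha> \<alpha>1 i(1) by (intro mult_left_mono mult_right_mono power_mono) auto
  then show ?thesis using 4 by (simp add: r_def mult.assoc)
 qed
 have "sqrt (1 + \<bar>\<tau>\<bar> + k) <= sqrt (1 + \<bar>\<tau>\<bar>) + sqrt k" using \<open>k >= 0\<close> by (intro sqrt_add_le_add_sqrt) auto
 also have "sqrt (1 + \<bar>\<tau>\<bar>) <= sqrt 1 + sqrt \<bar>\<tau>\<bar>" by (intro sqrt_add_le_add_sqrt) auto
 finally have "sqrt (1 + \<bar>\<tau>\<bar> + k) <= 1 + sqrt \<bar>\<tau>\<bar> + \<alpha>" using k\<alpha> by simp
 then have "sqrt (1 + \<bar>\<tau>\<bar> + k) * (\<alpha>^2 * i) <= (1 + sqrt \<bar>\<tau>\<bar> + \<alpha>) * (\<alpha>^2 * i)" using i(1) by (intro mult_right_mono) auto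
 also have "... <= 4 * C" using 1 2 3 by (simp add: distrib_right)
 finally show ?thesis .
qed

text \<open>The quarter derivative tolerates a jump in time: the weight is integrable against the resolvent.\<close>

lemma resolvent_weight_boundary:
 assumes m: "m > 0" and N: "N >= 2 * DIM('a::euclidean_space) + 1"
 obtains C where "C > 0"
  "!!k::'a. (NI \<tau>. enn (sqrt (1 + \<bar>\<tau>\<bar> + norm k)) * resolvent_weight N m (sqrt (max 1 (norm k))) \<tau> k) <= enn C"
proof -
 define K where "K = 1 + 1 / m"
 have K: "K > 0" using m by (simp add: K_def add_pos_pos)
 define C where "C = (8 + 8 * K) * 4 ^ DIM('a)"
 have C: "C > 0" using K by (simp add: C_def)
 show ?thesis
 proof (rule that[OF C])
  fix k :: 'a
  define \<alpha> where "\<alpha> = sqrt (max 1 (norm k))"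
  have \<alpha>: "\<alpha> >= 1" "norm k <= \<alpha>^2" by (auto simp: \<alpha>_def max_def)
  define w where "w \<tau> = sqrt (1 + \<bar>\<tau>\<bar> + norm k)" for \<tau>
  have [measurable]: "w \<in> BM" unfolding w_def by measurable
  have w0: "w \<tau> >= 0" for \<tau> by (simp add: w_def)
  have "(NI \<tau>. enn (w \<tau>) * resolvent_weight N m \<alpha> \<tau> k)
    = (NI \<tau>. NI (v::'a). enn (w \<tau>) * enn (decay N v / (\<alpha>^2 + (\<tau> + (k \<cdot> v) / m)^2)))"
   unfolding resolvent_weight_def by (intro nn_integral_cong nn_integral_cmult[symmetric]) measurable
  also have "... = (\<integral>\<^sup>+p. enn (w (fst p)) * enn (decay N (snd p) / (\<alpha>^2 + (fst p + (k \<cdot> snd p) / m)^2)) \<partial>(lborel :: (real \<times> 'a) measure))"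
   by (subst nn_integral_prod_fst) auto
  also have "... = (NI (v::'a). NI \<tau>. enn (w \<tau>) * enn (decay N v / (\<alpha>^2 + (\<tau> + (k \<cdot> v) / m)^2)))" by (subst nn_integral_prod_snd) auto
  also have "... <= (NI (v::'a). enn (8 + 8 * K) * enn (decay (N - 1) v))"
  proof (rule nn_integral_mono)
   fix v :: 'a
   define \<kappa> where "\<kappa> = (k \<cdot> v) / m"
   define g where "g p = enn (2 * decay N v) * enn (profile p) + enn (\<alpha> * (K * (1 + norm v)) * decay N v) * enn (1 / (\<alpha>^2 + p^2))" for p
   have [measurable]: "g \<in> BM" unfolding g_def by measurable
   have "(NI \<tau>. enn (w \<tau>) * enn (decay N v / (\<alpha>^2 + (\<tau> + (k \<cdot> v) / m)^2))) <= (NI \<tau>. g (\<kappa> + \<tau>))"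
   proof (rule nn_integral_mono)
    fix \<tau>
    define p where "p = \<kappa> + \<tau>"
    have D: "\<alpha>^2 + p^2 > 0" using \<alpha> by (intro add_pos_nonneg) auto
    have "\<bar>\<kappa>\<bar> <= norm k / m * norm v" using Cauchy_Schwarz_ineq2[of k v] m by (simp add: \<kappa>_def abs_divide divide_right_mono)
    then have "norm k + \<bar>\<kappa>\<bar> <= norm k * (1 + norm v / m)" using m by (simp add: algebra_simps)
    also have "... <= norm k * (K * (1 + norm v))" using m by (intro mult_left_mono) (auto simp: K_def field_simps)
    also have "... <= \<alpha>^2 * (K * (1 + norm v))^2"
    proof (rule mult_mono[OF \<alpha>(2)])
     have "1 <= K * (1 + norm v)" using m by (simp add: K_def field_simps add_nonneg_nonneg)
     then show "K * (1 + norm v) <= (K * (1 + norm v))^2" by (rule self_le_power) simp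
    qed (use K in auto)
    finally have "norm k + \<bar>\<kappa>\<bar> <= (\<alpha> * (K * (1 + norm v)))^2" by (simp only: power_mult_distrib)
    moreover have "\<bar>\<tau>\<bar> <= \<bar>p\<bar> + \<bar>\<kappa>\<bar>" by (simp add: p_def)
    ultimately have "1 + \<bar>\<tau>\<bar> + norm k <= (1 + \<bar>p\<bar>) + (\<alpha> * (K * (1 + norm v)))^2" by linarith
    then have "w \<tau> <= sqrt ((1 + \<bar>p\<bar>) + (\<alpha> * (K * (1 + norm v)))^2)" unfolding w_def by (rule real_sqrt_le_mono)
    also have "... <= sqrt (1 + \<bar>p\<bar>) + sqrt ((\<alpha> * (K * (1 + norm v)))^2)" by (intro sqrt_add_le_add_sqrt) auto
    also have "sqrt ((\<alpha> * (K * (1 + norm v)))^2) = \<alpha> * (K * (1 + norm v))" using \<alpha> K by simp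
    finally have w: "w \<tau> <= sqrt (1 + \<bar>p\<bar>) + \<alpha> * (K * (1 + norm v))" .
    have prof: "sqrt (1 + \<bar>p\<bar>) / (\<alpha>^2 + p^2) <= 2 * profile p"
    proof -
     have "(1 + \<bar>p\<bar>) * (1 + \<bar>p\<bar>) <= 2 * (1 + p^2)" using zero_le_power2[of "\<bar>p\<bar> - 1"] by (simp add: power2_eq_square algebra_simps)
     also have "... <= 2 * (\<alpha>^2 + p^2)" using \<alpha>(1) by simp
     finally have "(1 + \<bar>p\<bar>) * (1 + \<bar>p\<bar>) <= 2 * (\<alpha>^2 + p^2)" .
     then have "sqrt (1 + \<bar>p\<bar>) * ((1 + \<bar>p\<bar>) * sqrt (1 + \<bar>p\<bar>)) <= 2 * (\<alpha>^2 + p^2)" by (simp add: mult.left_commute)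
     then have "sqrt (1 + \<bar>p\<bar>) <= 2 * (\<alpha>^2 + p^2) / ((1 + \<bar>p\<bar>) * sqrt (1 + \<bar>p\<bar>))" by (subst pos_le_divide_eq) auto
     then show ?thesis using D by (subst pos_divide_le_eq) (auto simp: profile_def mult_ac)
    qed
    have "w \<tau> * (decay N v / (\<alpha>^2 + p^2)) <= (sqrt (1 + \<bar>p\<bar>) + \<alpha> * (K * (1 + norm v))) * (decay N v / (\<alpha>^2 + p^2))"
     using D by (intro mult_right_mono w) (auto simp: decay_nonneg)
    also have "... = decay N v * (sqrt (1 + \<bar>p\<bar>) / (\<alpha>^2 + p^2)) + \<alpha> * (K * (1 + norm v)) * decay N v * (1 / (\<alpha>^2 + p^2))" by (subst distrib_right) (simp add: mult_ac)
    also have "... <= decay N v * (2 * profile p) + \<alpha> * (K * (1 + norm v)) * decay N v * (1 / (\<alpha>^2 + p^2))" by (intro add_right_mono mult_left_mono prof decay_nonneg)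
    finally have "enn (w \<tau> * (decay N v / (\<alpha>^2 + p^2))) <= enn (2 * decay N v * profile p + \<alpha> * (K * (1 + norm v)) * decay N v * (1 / (\<alpha>^2 + p^2)))"
     by (intro ennreal_leI) (simp add: mult_ac)
    also have "... = enn (2 * decay N v * profile p) + enn (\<alpha> * (K * (1 + norm v)) * decay N v * (1 / (\<alpha>^2 + p^2)))"
     using \<alpha> K D by (intro ennreal_plus mult_nonneg_nonneg) (auto simp: decay_nonneg profile_nonneg)
    also have "... = g p" unfolding g_def using \<alpha> K D by (intro arg_cong2[of _ _ _ _ "(+)"] ennreal_mult mult_nonneg_nonneg) (auto simp: decay_nonneg profile_nonneg)
    finally show "enn (w \<tau>) * enn (decay N v / (\<alpha>^2 + (\<tau> + (k \<cdot> v) / m)^2)) <= g (\<kappa> + \<tau>)"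
     using D by (simp add: p_def[symmetric] ennreal_mult[symmetric] w0 decay_nonneg add.commute[of \<tau>] \<kappa>_def[symmetric])
   qed
   also have "... = (NI p. g p)" by (rule nn_integral_shift) measurable
   also have "... = enn (2 * decay N v) * (NI p. enn (profile p)) + enn (\<alpha> * (K * (1 + norm v)) * decay N v) * (NI p. enn (1 / (\<alpha>^2 + p^2)))"
    unfolding g_def by (subst nn_integral_add) (auto simp: nn_integral_cmult)
   also have "... <= enn (2 * decay N v) * enn 4 + enn (\<alpha> * (K * (1 + norm v)) * decay N v) * enn (8 / \<alpha>)"
    using \<alpha> by (intro add_mono mult_left_mono nn_integral_profile nn_integral_resolvent) auto
   also have "... = enn (2 * decay N v * 4) + enn (\<alpha> * (K * (1 + norm v)) * decay N v * (8 / \<alpha>))"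
    using \<alpha> K by (intro arg_cong2[of _ _ _ _ "(+)"] ennreal_mult[symmetric] mult_nonneg_nonneg) (auto simp: decay_nonneg)
   also have "... = enn (2 * decay N v * 4 + \<alpha> * (K * (1 + norm v)) * decay N v * (8 / \<alpha>))" using \<alpha> K by (intro ennreal_plus[symmetric] mult_nonneg_nonneg) (auto simp: decay_nonneg)
   also have "... <= enn ((8 + 8 * K) * decay (N - 1) v)"
   proof (rule ennreal_leI)
    have "(1 + norm v) * decay N v = decay (N - 1) v" using decay_Suc[of v "N - 1"] N by simp
    then have "\<alpha> * (K * (1 + norm v)) * decay N v * (8 / \<alpha>) = 8 * K * decay (N - 1) v" using \<alpha> by (simp add: mult_ac)
    moreover have "decay N v <= decay (N - 1) v" by (rule decay_antimono) simp
    ultimately show "2 * decay N v * 4 + \<alpha> * (K * (1 + norm v)) * decay N v * (8 / \<alpha>) <= (8 + 8 * K) * decay (N - 1) v" by (simp add: distrib_right)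
   qed
   also have "... = enn (8 + 8 * K) * enn (decay (N - 1) v)" using K by (simp add: ennreal_mult decay_nonneg)
   finally show "(NI \<tau>. enn (w \<tau>) * enn (decay N v / (\<alpha>^2 + (\<tau> + (k \<cdot> v) / m)^2))) <= enn (8 + 8 * K) * enn (decay (N - 1) v)" .
  qed
  also have "... = enn (8 + 8 * K) * (NI (v::'a). enn (decay (N - 1) v))" by (rule nn_integral_cmult) measurable
  also have "... <= enn (8 + 8 * K) * enn (4 ^ DIM('a))" using N by (intro mult_left_mono nn_integral_decay) auto
  also have "... = enn C" using K by (simp add: C_def ennreal_mult)
  finally show "(NI \<tau>. enn (sqrt (1 + \<bar>\<tau>\<bar> + norm k)) * resolvent_weight N m (sqrt (max 1 (norm k))) \<tau> k) <= enn C" unfolding w_def \<alpha>_def .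
 qed
qed


section \<open>Averages of Fourier transforms in the velocity variable\<close>

text \<open>Cauchy-Schwarz in \<open>v\<close> at each frequency, and Plancherel in all variables.\<close>

lemma avg_bound:
 fixes G :: "real \<times> ('a::euclidean_space \<times> 'a) => complex" and M :: "real \<times> 'a => 'a => complex"
 assumes G: "L1 G" and M: "!!q. M q \<in> BM"
  and S: "!!q. enn (\<omega> q) * N2 (M q) <= enn S" and \<omega>: "!!q. \<omega> q >= 0"
 shows "(NI q. enn (\<omega> q * (cmod (LI v. M q v * FT G (fst q, (snd q, v))))^2))
   <= enn (S * (2 * pi) ^ (1 + 2 * DIM('a))) * N2 G"
proof -
 have [measurable]: "G \<in> BM" using G by (auto dest: borel_measurable_integrable)
 have [measurable]: "M q \<in> BM" for q by (rule M)
 have "(NI q. enn (\<omega> q * (cmod (LI v. M q v * FT G (fst q, (snd q, v))))^2))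
   <= (NI q. enn S * N2 (%v. FT G (fst q, (snd q, v))))"
 proof (rule nn_integral_mono)
  fix q :: "real \<times> 'a"
  have "enn (\<omega> q * (cmod (LI v. M q v * FT G (fst q, (snd q, v))))^2)
    = enn (\<omega> q) * enn ((cmod (LI v. M q v * FT G (fst q, (snd q, v))))^2)" using \<omega> by (simp add: ennreal_mult)
  also have "... <= enn (\<omega> q) * (N2 (M q) * N2 (%v. FT G (fst q, (snd q, v))))" by (intro mult_left_mono Cauchy_Schwarz_L2) auto
  also have "... <= enn S * N2 (%v. FT G (fst q, (snd q, v)))" unfolding mult.assoc[symmetric] by (rule mult_right_mono[OF S]) simp
  finally show "enn (\<omega> q * (cmod (LI v. M q v * FT G (fst q, (snd q, v))))^2)
    <= enn S * N2 (%v. FT G (fst q, (snd q, v)))" .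
 qed
 also have "... = enn S * (NI q. N2 (%v. FT G (fst q, (snd q, v))))" unfolding N2_def by (rule nn_integral_cmult) measurable
 also have "(NI q. N2 (%v. FT G (fst q, (snd q, v)))) = (NI \<tau>. NI k. N2 (%v. FT G (\<tau>, (k, v))))" unfolding N2_def by (subst nn_integral_prod_fst) auto
 also have "... = N2 (FT G)" unfolding N2_def by (subst nn_integral_prod_fst, measurable, subst nn_integral_prod_fst, auto)
 also have "enn S * N2 (FT G) <= enn S * (enn ((2 * pi) ^ DIM(real \<times> ('a \<times> 'a))) * N2 G)" by (intro mult_left_mono Plancherel_inequality G) simp
 also have "... = enn (S * (2 * pi) ^ (1 + 2 * DIM('a))) * N2 G"
 proof -
  have "DIM(real \<times> ('a \<times> 'a)) = 1 + 2 * DIM('a)" by simp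
  then show ?thesis unfolding mult.assoc[symmetric] by (simp only: ennreal_mult''[symmetric] zero_le_power pi_ge_zero mult_nonneg_nonneg zero_le_numeral)
 qed
 finally show ?thesis .
qed

text \<open>A source concentrated at one time has no decay in \<open>\<tau>\<close>; that integral falls on the multiplier instead.\<close>

lemma avg_boundary_bound:
 fixes G :: "'a::euclidean_space \<times> 'a => complex" and M :: "real \<times> 'a => 'a => complex"
 assumes G: "L1 G" and M [measurable]: "(%p. M (fst p) (snd p)) \<in> BM"
  and [measurable]: "\<omega> \<in> BM"
  and S: "!!k. (NI \<tau>. enn (\<omega> (\<tau>, k)) * N2 (M (\<tau>, k))) <= enn S" and \<omega>: "!!q. \<omega> q >= 0"
 shows "(NI q. enn (\<omega> q * (cmod (LI v. M q v * FT G (snd q, v)))^2))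
   <= enn (S * (2 * pi) ^ (2 * DIM('a))) * N2 G"
proof -
 have [measurable]: "G \<in> BM" using G by (auto dest: borel_measurable_integrable)
 have Mq: "(%x. M (f x) (g x)) \<in> borel_measurable L" if [measurable]: "f \<in> borel_measurable L" "g \<in> borel_measurable L"
  for f :: "'z => real \<times> 'a" and g :: "'z => 'a" and L :: "'z measure"
 proof -
  have "(%x. (f x, g x)) \<in> borel_measurable L" by (rule measurable_Pair[OF that, unfolded borel_prod])
  from measurable_compose[OF this M] show ?thesis by simp
 qed
 have [measurable]: "M q \<in> BM" for q using Mq[of "%_. q" borel "%v. v"] by simp
 have [measurable]: "(%q. N2 (M q)) \<in> BM"
 proof -
  have "(%p. M (fst p) (snd p)) \<in> borel_measurable (borel \<Otimes>\<^sub>M borel)" by (rule Mq) measurable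
  then have [measurable]: "(%p. M (fst p) (snd p)) \<in> borel_measurable (borel \<Otimes>\<^sub>M lborel)" by (simp cong: measurable_cong_sets)
  have "(%q. NI v. (%p. enn ((cmod (M (fst p) (snd p)))^2)) (q, v)) \<in> BM" by (rule lborel.borel_measurable_nn_integral_fst) measurable
  then show ?thesis by (simp add: N2_def)
 qed
 have "(NI q. enn (\<omega> q * (cmod (LI v. M q v * FT G (snd q, v)))^2))
   <= (NI q. (enn (\<omega> q) * N2 (M q)) * N2 (%v. FT G (snd q, v)))"
 proof (rule nn_integral_mono)
  fix q :: "real \<times> 'a"
  have "enn (\<omega> q * (cmod (LI v. M q v * FT G (snd q, v)))^2)
    = enn (\<omega> q) * enn ((cmod (LI v. M q v * FT G (snd q, v)))^2)" using \<omega> by (simp add: ennreal_mult)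
  also have "... <= enn (\<omega> q) * (N2 (M q) * N2 (%v. FT G (snd q, v)))" by (intro mult_left_mono Cauchy_Schwarz_L2) auto
  finally show "enn (\<omega> q * (cmod (LI v. M q v * FT G (snd q, v)))^2)
    <= (enn (\<omega> q) * N2 (M q)) * N2 (%v. FT G (snd q, v))" by (simp add: mult.assoc)
 qed
 also have "... = (NI k. NI \<tau>. (enn (\<omega> (\<tau>, k)) * N2 (M (\<tau>, k))) * N2 (%v. FT G (k, v)))"
 proof -
  have [measurable]: "(%q :: real \<times> 'a. N2 (%v. FT G (snd q, v))) \<in> BM" unfolding N2_def by measurable
  show ?thesis by (subst nn_integral_prod_snd) auto
 qed
 also have "... = (NI k. (NI \<tau>. enn (\<omega> (\<tau>, k)) * N2 (M (\<tau>, k))) * N2 (%v. FT G (k, v)))" by (intro nn_integral_cong nn_integral_multc) measurable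
 also have "... <= (NI k. enn S * N2 (%v. FT G (k, v)))" by (intro nn_integral_mono mult_right_mono S) simp
 also have "... = enn S * N2 (FT G)" unfolding N2_def by (subst nn_integral_cmult, measurable, subst nn_integral_prod_fst, auto)
 also have "... <= enn S * (enn ((2 * pi) ^ DIM('a \<times> 'a)) * N2 G)" by (intro mult_left_mono Plancherel_inequality G) simp
 also have "... = enn (S * (2 * pi) ^ (2 * DIM('a))) * N2 G"
 proof -
  have "DIM('a \<times> 'a) = 2 * DIM('a)" by simp
  then show ?thesis unfolding mult.assoc[symmetric] by (simp only: ennreal_mult''[symmetric] zero_le_power pi_ge_zero mult_nonneg_nonneg zero_le_numeral)
 qed
 finally show ?thesis .
qed

text \<open>Integrating in \<open>v\<close> first turns the multiplier into its Fourier transform at \<open>y\<close>.\<close>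

lemma avg_hat:
 fixes G :: "real \<times> ('a::euclidean_space \<times> 'a) => complex"
 assumes G: "L1 G" and M: "L1 M"
 shows "(LI v. M v * FT G (\<tau>, (k, v)))
    = (LI z. cis (- (\<tau> * fst z + k \<cdot> fst (snd z))) * (G z * FT M (snd (snd z))))"
proof -
 have [measurable]: "G \<in> BM" "M \<in> BM" using assms by (auto dest: borel_measurable_integrable)
 define H :: "'a \<times> (real \<times> ('a \<times> 'a)) => complex"
  where "H p = cis (- (\<tau> * fst (snd p) + (k \<cdot> fst (snd (snd p)) + fst p \<cdot> snd (snd (snd p))))) * (M (fst p) * G (snd p))" for p
 have H: "L1 H" by (rule Bochner_Integration.integrable_bound[OF integrable_tensor[OF M G]]) (auto simp: H_def[abs_def] norm_mult)
 have "(LI v. M v * FT G (\<tau>, (k, v))) = (LI v. LI z. H (v, z))" by (simp add: FT_def H_def inner_prod_def mult_ac flip: integral_mult_right_zero)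
 also have "... = (LI z. LI v. H (v, z))" by (rule integral_prod_swap[OF H])
 also have "... = (LI z. cis (- (\<tau> * fst z + k \<cdot> fst (snd z))) * (G z * FT M (snd (snd z))))"
 proof (intro Bochner_Integration.integral_cong refl)
  fix z :: "real \<times> ('a \<times> 'a)"
  have c: "cis (- (\<tau> * fst z + (k \<cdot> fst (snd z) + v \<cdot> snd (snd z)))) = cis (- (\<tau> * fst z + k \<cdot> fst (snd z))) * cis (- (snd (snd z) \<cdot> v))" for v
   by (simp add: cis_mult inner_commute algebra_simps)
  have "(LI v. H (v, z)) = (LI v. (cis (- (\<tau> * fst z + k \<cdot> fst (snd z))) * G z) * (cis (- (snd (snd z) \<cdot> v)) * M v))" by (simp only: H_def fst_conv snd_conv c mult_ac)
  also have "... = (cis (- (\<tau> * fst z + k \<cdot> fst (snd z))) * G z) * FT M (snd (snd z))" unfolding FT_def by (rule integral_mult_right_zero)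
  finally show "(LI v. H (v, z)) = cis (- (\<tau> * fst z + k \<cdot> fst (snd z))) * (G z * FT M (snd (snd z)))" by (simp add: mult.assoc)
 qed
 finally show ?thesis .
qed

text \<open>A directional derivative integrates to zero: compare \<open>F\<close> with its translate and use Fubini.\<close>

lemma integral_directional_derivative:
 fixes F F' :: "'a::euclidean_space => complex"
 assumes F: "L1 F" and F': "L1 F'" and cont: "continuous_on UNIV F'"
  and der: "!!v. ((%s. F (v + s *\<^sub>R b)) has_vector_derivative F' v) (at 0)"
 shows "(LI v. F' v) = 0"
proof -
 have [measurable]: "F \<in> BM" "F' \<in> BM" using F F' by (auto dest: borel_measurable_integrable)
 have der': "((%s. F (v + s *\<^sub>R b)) has_vector_derivative F' (v + r *\<^sub>R b)) (at r)" for v r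
 proof -
  have "((%s. s - r) has_vector_derivative 1) (at r)" by (auto intro!: derivative_eq_intros)
  from vector_diff_chain_at[OF this, of "%s. F ((v + r *\<^sub>R b) + s *\<^sub>R b)" "F' (v + r *\<^sub>R b)"] der[of "v + r *\<^sub>R b"]
  have "((%s. F ((v + r *\<^sub>R b) + (s - r) *\<^sub>R b)) has_vector_derivative F' (v + r *\<^sub>R b)) (at r)" by (simp add: o_def)
  moreover have "(v + r *\<^sub>R b) + (s - r) *\<^sub>R b = v + s *\<^sub>R b" for s by (simp add: algebra_simps)
  ultimately show ?thesis by simp
 qed
 have cont_line: "continuous_on {0..1} (%r. F' (v + r *\<^sub>R b))" for v by (intro continuous_on_compose2[OF cont] continuous_intros) auto
 define H :: "'a \<times> real => complex" where "H p = indicator {0..1} (snd p) *\<^sub>R F' (fst p + snd p *\<^sub>R b)" for p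
 have [measurable]: "(%r::real. indicator {0..1} r :: real) \<in> BM" by (rule borel_measurable_indicator) auto
 have Hm: "H \<in> BM" unfolding H_def by measurable
 have H: "L1 H" unfolding integrable_iff_bounded
 proof
  have "(NI p. enn (norm (H p))) = (NI r. NI v. enn (norm (H (v, r))))" using Hm by (subst nn_integral_prod_snd) auto
  also have "... <= (\<integral>\<^sup>+r. (NI v. enn (cmod (F' v))) * indicator {0..1} r \<partial>(lborel :: real measure))"
  proof (rule nn_integral_mono)
   fix r :: real
   have "(NI v. enn (cmod (F' (v + r *\<^sub>R b)))) = (NI v. enn (cmod (F' v)))" using nn_integral_shift[of "%v. enn (cmod (F' v))" "r *\<^sub>R b"] by (simp add: add.commute)
   then show "(NI v. enn (norm (H (v, r)))) <= (NI v. enn (cmod (F' v))) * indicator {0..1} r" by (auto simp: H_def indicator_def)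
  qed
  also have "... = (NI v. enn (cmod (F' v)))" by (subst nn_integral_cmult_indicator) auto
  also have "... < \<infinity>" using F' by (simp add: integrable_iff_bounded)
  finally show "(NI p. enn (norm (H p))) < \<infinity>" .
 qed (use Hm in simp)
 have inner: "(LI r. H (v, r)) = F (b + v) - F v" for v
 proof -
  have "(LI r. H (v, r)) = (LINT r:{0..1}|lborel. F' (v + r *\<^sub>R b))" by (simp add: H_def set_lebesgue_integral_def)
  also have "... = integral {0..1} (%r. F' (v + r *\<^sub>R b))" by (rule set_borel_integral_eq_integral(2)[OF borel_integrable_atLeastAtMost'[OF cont_line]])
  also have "((%r. F' (v + r *\<^sub>R b)) has_integral (F (v + 1 *\<^sub>R b) - F (v + 0 *\<^sub>R b))) {0..1}" by (rule fundamental_theorem_of_calculus) (auto intro: has_vector_derivative_at_within der')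
  then have "integral {0..1} (%r. F' (v + r *\<^sub>R b)) = F (v + 1 *\<^sub>R b) - F (v + 0 *\<^sub>R b)" by (rule integral_unique)
  finally show ?thesis by (simp add: add.commute)
 qed
 have shF: "L1 (%v. F (b + v))" using F nn_integral_shift[of "%v. enn (cmod (F v))" b] by (simp add: integrable_iff_bounded)
 have "(LI v. LI r. H (v, r)) = 0" unfolding inner using F shF integral_shift[of F b] by simp
 then have "(LI r. LI v. H (v, r)) = 0" using integral_prod_swap[OF H] by simp
 moreover have "(LI v. H (v, r)) = indicator {0..1} r *\<^sub>R (LI v. F' v)" for r :: real using integral_shift[of F' "r *\<^sub>R b"] by (simp add: H_def add.commute)
 ultimately show ?thesis by simp
qed

lemma FT_derivative:
 fixes M M' :: "'a::euclidean_space => complex"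
 assumes M: "L1 M" "continuous_on UNIV M" and M': "L1 M'" "continuous_on UNIV M'"
  and der: "!!v. ((%s. M (v + s *\<^sub>R b)) has_vector_derivative M' v) (at 0)"
 shows "FT M' y = \<i> * cor (y \<cdot> b) * FT M y"
proof -
 define e where "e v = cis (- (y \<cdot> v))" for v
 have ec: "continuous_on UNIV e" unfolding e_def cis_conv_exp by (intro continuous_intros)
 have i: "L1 (%v. e v * M v)" "L1 (%v. e v * M' v)" unfolding e_def by (auto intro: FT_integrable M M')
 have "(LI v. e v * M' v + (- \<i> * cor (y \<cdot> b)) * (e v * M v)) = 0"
 proof (rule integral_directional_derivative[where F = "%v. e v * M v" and b = b])
  fix v
  have "((%s. e (v + s *\<^sub>R b) * M (v + s *\<^sub>R b)) has_vector_derivative e v * M' v + (- \<i> * cor (y \<cdot> b) * e v) * M v) (at 0)"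
   using has_vector_derivative_mult[OF wave_line[of y v b] der[of v]] by (simp add: e_def)
  then show "((%s. e (v + s *\<^sub>R b) * M (v + s *\<^sub>R b)) has_vector_derivative e v * M' v + (- \<i> * cor (y \<cdot> b)) * (e v * M v)) (at 0)" by (simp add: mult.assoc)
 qed (use i in \<open>auto intro!: continuous_intros ec M M'\<close>)
 then have "FT M' y - \<i> * cor (y \<cdot> b) * FT M y = 0" using i unfolding FT_def e_def by simp
 then show ?thesis by simp
qed


section \<open>The resolvent multiplier\<close>

text \<open>The symbol \<open>\<tau> + k \<cdot> v / m\<close> of free transport, moved off the real axis by \<open>a\<close>; the sign \<open>\<sigma>\<close> is the direction in which time runs.\<close>

definition symb :: "real => real => real => real => 'a::euclidean_space => 'a => complex" where
 "symb m a \<sigma> \<tau> k v = cor a + \<i> * cor (\<sigma> * (\<tau> + (k \<cdot> v) / m))"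

definition rmult :: "('a::euclidean_space => complex) => real => real => real => real => 'a => 'a => complex" where
 "rmult \<psi> m a \<sigma> \<tau> k v = \<psi> v / symb m a \<sigma> \<tau> k v"

definition rmult_deriv :: "('a::euclidean_space => complex) => ('a => complex) => 'a => real => real => real => real => 'a => 'a => complex" where
 "rmult_deriv \<psi> \<psi>' b m a \<sigma> \<tau> k v = \<psi>' v / symb m a \<sigma> \<tau> k v - \<psi> v * (\<i> * cor (\<sigma> * (k \<cdot> b) / m)) / (symb m a \<sigma> \<tau> k v)^2"

lemma symb_norm: "\<sigma>^2 = 1 ==> (cmod (symb m a \<sigma> \<tau> k v))^2 = a^2 + (\<tau> + (k \<cdot> v) / m)^2" by (simp add: symb_def cmod_power2 power_mult_distrib)

lemma symb_nonzero: "a > 0 ==> symb m a \<sigma> \<tau> k v ~= 0" by (simp add: symb_def complex_eq_iff)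

lemma symb_norm_ge: "a > 0 ==> a <= cmod (symb m a \<sigma> \<tau> k v)" using abs_Re_le_cmod[of "symb m a \<sigma> \<tau> k v"] by (simp add: symb_def)

lemma symb_continuous: "continuous_on UNIV (symb m a \<sigma> \<tau> k)" unfolding symb_def[abs_def] divide_inverse
 by (intro continuous_on_add continuous_on_mult continuous_on_of_real continuous_on_const continuous_on_inner continuous_on_id)

lemma rmult_bound: "a > 0 ==> cmod (rmult \<psi> m a \<sigma> \<tau> k v) <= 1 / a * cmod (\<psi> v)"
 using frac_le[OF norm_ge_zero[of "\<psi> v"] order_refl _ symb_norm_ge[of a m \<sigma> \<tau> k v]] by (simp add: rmult_def norm_divide)

lemma N2_rmult:
 fixes \<psi> :: "'a::euclidean_space => complex"
 assumes \<sigma>: "\<sigma>^2 = 1" and \<psi>: "!!v. (cmod (\<psi> v))^2 <= B * decay N v" and B: "B >= 0"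
 shows "N2 (rmult \<psi> m a \<sigma> \<tau> k) <= enn B * resolvent_weight N m a \<tau> k"
proof -
 have "N2 (rmult \<psi> m a \<sigma> \<tau> k) <= (NI (v::'a). enn B * enn (decay N v / (a^2 + (\<tau> + (k \<cdot> v) / m)^2)))" unfolding N2_def
 proof (rule nn_integral_mono)
  fix v :: 'a
  have "(cmod (rmult \<psi> m a \<sigma> \<tau> k v))^2 = (cmod (\<psi> v))^2 / (a^2 + (\<tau> + (k \<cdot> v) / m)^2)" by (simp add: rmult_def norm_divide power_divide symb_norm[OF \<sigma>])
  also have "... <= B * decay N v / (a^2 + (\<tau> + (k \<cdot> v) / m)^2)" by (intro divide_right_mono \<psi>) auto
  finally have "enn ((cmod (rmult \<psi> m a \<sigma> \<tau> k v))^2) <= enn (B * (decay N v / (a^2 + (\<tau> + (k \<cdot> v) / m)^2)))" by (intro ennreal_leI) simp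
  then show "enn ((cmod (rmult \<psi> m a \<sigma> \<tau> k v))^2) <= enn B * enn (decay N v / (a^2 + (\<tau> + (k \<cdot> v) / m)^2))" by (simp only: ennreal_mult'[OF B])
 qed
 also have "... = enn B * resolvent_weight N m a \<tau> k" unfolding resolvent_weight_def by (rule nn_integral_cmult) measurable
 finally show ?thesis .
qed

text \<open>The derivative of the symbol is \<open>k \<cdot> b / m\<close>, and one more factor \<open>1 / symb\<close> is at most \<open>1 / a\<close>.\<close>

lemma N2_rmult_deriv:
 fixes \<psi> \<psi>' :: "'a::euclidean_space => complex"
 assumes \<sigma>: "\<sigma>^2 = 1" and a: "a > 0" and m: "m > 0" and b: "norm b = 1"
  and \<psi>: "!!v. (cmod (\<psi> v))^2 <= B * decay N v" and \<psi>': "!!v. (cmod (\<psi>' v))^2 <= B * decay N v" and B: "B >= 0"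
 shows "N2 (rmult_deriv \<psi> \<psi>' b m a \<sigma> \<tau> k) <= enn (2 * B * (1 + (norm k / (m * a))^2)) * resolvent_weight N m a \<tau> k"
proof -
 have "N2 (rmult_deriv \<psi> \<psi>' b m a \<sigma> \<tau> k) <= (NI (v::'a). enn (2 * B * (1 + (norm k / (m * a))^2)) * enn (decay N v / (a^2 + (\<tau> + (k \<cdot> v) / m)^2)))" unfolding N2_def
 proof (rule nn_integral_mono)
  fix v :: 'a
  let ?s = "symb m a \<sigma> \<tau> k v"
  define D where "D = a^2 + (\<tau> + (k \<cdot> v) / m)^2"
  have D: "D >= a^2" "D > 0" "(cmod ?s)^2 = D" using a by (auto simp: D_def symb_norm[OF \<sigma>] add_pos_nonneg)
  have 1: "(cmod (\<psi>' v / ?s))^2 <= B * decay N v / D" using divide_right_mono[OF \<psi>'[of v], of D] D by (simp add: norm_divide power_divide)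
  have kb: "\<bar>\<sigma> * (k \<cdot> b) / m\<bar> <= norm k / m"
  proof -
   have "\<sigma> = 1 \<or> \<sigma> = -1" using \<sigma> power2_eq_1_iff by blast
   then have "\<bar>\<sigma>\<bar> = 1" by auto
   then show ?thesis using Cauchy_Schwarz_ineq2[of k b] b m by (simp add: abs_mult divide_right_mono)
  qed
  have "(cmod (\<psi> v * (\<i> * cor (\<sigma> * (k \<cdot> b) / m)) / ?s^2))^2 = (cmod (\<psi> v))^2 * \<bar>\<sigma> * (k \<cdot> b) / m\<bar>^2 / (D * D)"
  proof -
   have n: "cmod (?s^2) = D" using D(3) by (simp add: norm_power)
   have "cmod (\<psi> v * (\<i> * cor (\<sigma> * (k \<cdot> b) / m)) / ?s^2) = cmod (\<psi> v) * \<bar>\<sigma> * (k \<cdot> b) / m\<bar> / D"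
    unfolding norm_divide n norm_mult norm_of_real norm_ii by simp
   then show ?thesis by (simp only: power_divide power_mult_distrib power2_eq_square[of D])
  qed
  also have "... <= (B * decay N v) * (norm k / m)^2 / (a^2 * D)" using D a by (intro frac_le mult_mono power_mono kb \<psi> mult_nonneg_nonneg mult_pos_pos) (auto simp: B decay_nonneg)
  also have "... = (norm k / (m * a))^2 * (B * decay N v / D)" by (simp add: power_divide power_mult_distrib mult_ac)
  finally have 2: "(cmod (\<psi> v * (\<i> * cor (\<sigma> * (k \<cdot> b) / m)) / ?s^2))^2 <= (norm k / (m * a))^2 * (B * decay N v / D)" .
  have "(cmod (rmult_deriv \<psi> \<psi>' b m a \<sigma> \<tau> k v))^2 <= 2 * (cmod (\<psi>' v / ?s))^2 + 2 * (cmod (\<psi> v * (\<i> * cor (\<sigma> * (k \<cdot> b) / m)) / ?s^2))^2"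
   using cmod_add_sq[of "\<psi>' v / ?s" "- (\<psi> v * (\<i> * cor (\<sigma> * (k \<cdot> b) / m)) / ?s^2)"] by (simp add: rmult_deriv_def)
  also have "... <= 2 * (B * decay N v / D) + 2 * ((norm k / (m * a))^2 * (B * decay N v / D))" by (intro add_mono mult_left_mono 1 2) auto
  also have "... = 2 * B * (1 + (norm k / (m * a))^2) * (decay N v / D)" by (simp add: algebra_simps)
  finally have "enn ((cmod (rmult_deriv \<psi> \<psi>' b m a \<sigma> \<tau> k v))^2) <= enn (2 * B * (1 + (norm k / (m * a))^2) * (decay N v / D))" by (rule ennreal_leI)
  then show "enn ((cmod (rmult_deriv \<psi> \<psi>' b m a \<sigma> \<tau> k v))^2) <= enn (2 * B * (1 + (norm k / (m * a))^2)) * enn (decay N v / (a^2 + (\<tau> + (k \<cdot> v) / m)^2))"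
   using B D by (simp add: D_def[symmetric] ennreal_mult[symmetric] decay_nonneg add_nonneg_nonneg del: ennreal_plus)
 qed
 also have "... = enn (2 * B * (1 + (norm k / (m * a))^2)) * resolvent_weight N m a \<tau> k" unfolding resolvent_weight_def by (rule nn_integral_cmult) measurable
 finally show ?thesis .
qed

lemma rmult_line:
 assumes \<psi>: "((%s. \<psi> (v + s *\<^sub>R b)) has_vector_derivative \<psi>' v) (at 0)" and a: "a > 0" and m: "m > 0"
 shows "((%s. rmult \<psi> m a \<sigma> \<tau> k (v + s *\<^sub>R b)) has_vector_derivative rmult_deriv \<psi> \<psi>' b m a \<sigma> \<tau> k v) (at 0)"
proof -
 let ?s = "symb m a \<sigma> \<tau> k v"
 have s1: "((%s. symb m a \<sigma> \<tau> k (v + s *\<^sub>R b)) has_vector_derivative \<i> * cor (\<sigma> * (k \<cdot> b) / m)) (at 0)"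
 proof -
  have "((%s. \<sigma> * (\<tau> + (k \<cdot> (v + s *\<^sub>R b)) / m)) has_real_derivative \<sigma> * (k \<cdot> b) / m) (at 0)" using m by (auto intro!: derivative_eq_intros simp: inner_add_right)
  then have "((%s. cor (\<sigma> * (\<tau> + (k \<cdot> (v + s *\<^sub>R b)) / m))) has_vector_derivative cor (\<sigma> * (k \<cdot> b) / m)) (at 0)"
   by (intro has_vector_derivative_of_real) (simp add: has_real_derivative_iff_has_vector_derivative)
  from has_vector_derivative_add[OF has_vector_derivative_const has_vector_derivative_mult_right[OF this, of \<i>], of "cor a"]
  show ?thesis by (simp add: symb_def)
 qed
 have "(inverse has_field_derivative - (inverse ?s * inverse ?s)) (at (symb m a \<sigma> \<tau> k (v + 0 *\<^sub>R b)))"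
  using DERIV_inverse[OF symb_nonzero[OF a], of m \<sigma> \<tau> k v] by (simp add: power2_eq_square)
 from field_vector_diff_chain_at[OF s1 this]
 have "((%s. inverse (symb m a \<sigma> \<tau> k (v + s *\<^sub>R b))) has_vector_derivative (\<i> * cor (\<sigma> * (k \<cdot> b) / m)) * - (inverse ?s * inverse ?s)) (at 0)" by (simp only: o_def)
 from has_vector_derivative_mult[OF \<psi> this]
 show ?thesis by (simp add: rmult_def rmult_deriv_def divide_inverse power2_eq_square algebra_simps)
qed

lemma rmult_continuous: "a > 0 ==> continuous_on UNIV \<psi> ==> continuous_on UNIV (rmult \<psi> m a \<sigma> \<tau> k)"
 unfolding rmult_def[abs_def] by (intro continuous_intros symb_continuous) (auto simp: symb_nonzero)

lemma rmult_deriv_continuous: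
 "a > 0 ==> continuous_on UNIV \<psi> ==> continuous_on UNIV \<psi>' ==> continuous_on UNIV (rmult_deriv \<psi> \<psi>' b m a \<sigma> \<tau> k)"
 unfolding rmult_deriv_def[abs_def] by (intro continuous_intros symb_continuous) (auto simp: symb_nonzero)

lemma rmult_integrable:
 assumes "a > 0" "L1 \<psi>" "continuous_on UNIV \<psi>"
 shows "L1 (rmult \<psi> m a \<sigma> \<tau> k)"
proof (rule Bochner_Integration.integrable_bound[of _ "%v. cor (1 / a) * \<psi> v"])
 show "rmult \<psi> m a \<sigma> \<tau> k \<in> borel_measurable lborel" using borel_measurable_continuous_onI[OF rmult_continuous[OF assms(1,3)]] by simp
 show "AE v in lborel. norm (rmult \<psi> m a \<sigma> \<tau> k v) <= norm (cor (1 / a) * \<psi> v)"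
  by (rule AE_I2) (use rmult_bound[OF assms(1)] assms(1) in \<open>simp add: norm_mult norm_divide\<close>)
qed (use assms in auto)

lemma rmult_deriv_integrable:
 assumes a: "a > 0" and "L1 \<psi>" "continuous_on UNIV \<psi>" "L1 \<psi>'" "continuous_on UNIV \<psi>'"
 shows "L1 (rmult_deriv \<psi> \<psi>' b m a \<sigma> \<tau> k)"
proof -
 have "rmult_deriv \<psi> \<psi>' b m a \<sigma> \<tau> k = (%v. rmult \<psi>' m a \<sigma> \<tau> k v
   - (\<i> * cor (\<sigma> * (k \<cdot> b) / m)) * rmult (rmult \<psi> m a \<sigma> \<tau> k) m a \<sigma> \<tau> k v)" by (simp add: fun_eq_iff rmult_deriv_def rmult_def power2_eq_square)
 moreover have "L1 (%v. rmult \<psi>' m a \<sigma> \<tau> k v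
   - (\<i> * cor (\<sigma> * (k \<cdot> b) / m)) * rmult (rmult \<psi> m a \<sigma> \<tau> k) m a \<sigma> \<tau> k v)"
  by (intro Bochner_Integration.integrable_diff integrable_mult_right rmult_integrable rmult_continuous assms)
 ultimately show ?thesis by simp
qed


section \<open>The truncated transport equation in Fourier variables\<close>

text \<open>The spatial profiles that may multiply a kernel: the product is then integrable and square integrable.\<close>

definition admissible :: "('b::euclidean_space => complex) => bool" where
 "admissible W \<longleftrightarrow> W \<in> BM \<and> (\<exists>B. \<forall>p. cmod (W p) <= B) \<and> (\<exists>r. \<forall>p. r < norm p --> W p = 0)"

lemma admissible_measurable: "admissible W ==> W \<in> BM" by (simp add: admissible_def)

lemma admissible_bounded: "admissible W ==> (!!B. (!!p. cmod (W p) <= B) ==> thesis) ==> thesis" by (auto simp: admissible_def)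

lemma admissible_L2:
 assumes "admissible W"
 shows "W \<in> L2"
proof -
 obtain B r where W: "W \<in> BM" "!!p. cmod (W p) <= B" "!!p. r < norm p ==> W p = 0" using assms by (auto simp: admissible_def)
 show ?thesis
 proof (rule L2_bound[OF indicator_cball_L2[of r] W(1)])
  show "cmod (W p) <= B * cmod (cor (indicator (cball 0 r) p))" for p using W(2)[of p] W(3)[of p] by (cases "norm p <= r") auto
 qed
qed

lemma admissible_continuous:
 assumes W: "continuous_on UNIV W" and r: "!!p. r < norm p ==> W p = 0"
 shows "admissible W"
proof -
 have "bounded (W ` cball 0 r)" by (intro compact_imp_bounded compact_continuous_image continuous_on_subset[OF W]) auto
 then obtain B where B: "\<forall>p\<in>cball 0 r. cmod (W p) <= B" by (auto simp: bounded_iff)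
 have "cmod (W p) <= max 0 B" for p using B r[of p] by (cases "norm p <= r") (auto simp: le_max_iff_disj)
 then show ?thesis using r borel_measurable_continuous_onI[OF W] unfolding admissible_def by blast
qed

lemma wcoord_inner:
 fixes p :: "'a::euclidean_space \<times> 'a"
 shows "wcoord h p \<cdot> wcoord h p = 2 * (fst p \<cdot> fst p) + h^2 / 2 * (snd p \<cdot> snd p)"
 by (simp add: wcoord_def inner_prod_def inner_add_left inner_add_right inner_diff_left inner_diff_right power2_eq_square inner_commute)

lemma wcoord_norm_ge:
 fixes p :: "'a::euclidean_space \<times> 'a"
 shows "min 2 (h^2 / 2) * (norm p)^2 <= wcoord h p \<cdot> wcoord h p"
proof -
 have "min 2 (h^2 / 2) * (fst p \<cdot> fst p) <= 2 * (fst p \<cdot> fst p)" by (intro mult_right_mono) auto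
 moreover have "min 2 (h^2 / 2) * (snd p \<cdot> snd p) <= h^2 / 2 * (snd p \<cdot> snd p)" by (intro mult_right_mono) auto
 moreover have "(norm p)^2 = fst p \<cdot> fst p + snd p \<cdot> snd p" by (simp add: power2_norm_eq_inner inner_prod_def)
 ultimately show ?thesis by (simp only: wcoord_inner distrib_left add_mono)
qed

definition wcut :: "real => real => nat => 'a::euclidean_space \<times> 'a => complex" where
 "wcut h c j p = cor (cutoff j (c * (wcoord h p \<cdot> wcoord h p)))"

lemma wcut_zero:
 assumes "c > 0" "h > 0" "1 / sqrt (c * min 2 (h^2 / 2)) < norm p"
 shows "wcut h c j p = 0"
proof -
 define a where "a = c * min 2 (h^2 / 2)"
 have a: "a > 0" using assms by (simp add: a_def)
 have "(1 / sqrt a)^2 <= (norm p)^2" using assms(3) a by (intro power_mono) (auto simp: a_def)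
 then have "1 <= a * (norm p)^2" using a by (simp add: power_divide field_simps)
 also have "... <= c * (wcoord h p \<cdot> wcoord h p)" using mult_left_mono[OF wcoord_norm_ge[of h p], of c] assms(1) by (simp add: a_def mult.assoc)
 finally show ?thesis by (simp add: wcut_def cutoff_eq_0)
qed

lemma wcut_continuous: "continuous_on UNIV (wcut h c j)" unfolding wcut_def[abs_def] by (intro continuous_intros)

lemma admissible_wcut:
 assumes "c > 0" "h > 0" "continuous_on UNIV A"
 shows "admissible (%p. A p * wcut h c j p)"
proof (rule admissible_continuous)
 show "continuous_on UNIV (%p. A p * wcut h c j p)" by (intro continuous_intros assms(3) wcut_continuous)
 show "A p * wcut h c j p = 0" if "1 / sqrt (c * min 2 (h^2 / 2)) < norm p" for p using wcut_zero[OF assms(1,2) that] by simp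
qed

definition wpot :: "real => ('a::euclidean_space => real) => 'a \<times> 'a => real" where
 "wpot h V p = V (fst (wcoord h p)) - V (snd (wcoord h p))"

lemma wpot_continuous:
 assumes "continuous_on UNIV V"
 shows "continuous_on UNIV (wpot h V)" unfolding wpot_def[abs_def] by (intro continuous_intros continuous_on_compose2[OF assms]) auto

text \<open>The dual coordinates: a plane wave with frequency \<open>\<kappa>\<close> in \<open>(x, y)\<close>, written in \<open>(X, Y)\<close>.\<close>

definition freq :: "real => 'a::euclidean_space \<times> 'a => 'a \<times> 'a" where
 "freq h \<kappa> = ((1 / 2) *\<^sub>R fst \<kappa> + (1 / h) *\<^sub>R snd \<kappa>, (1 / 2) *\<^sub>R fst \<kappa> - (1 / h) *\<^sub>R snd \<kappa>)"

lemma freq_wcoord: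
 assumes "h > 0"
 shows "freq h \<kappa> \<cdot> wcoord h p = \<kappa> \<cdot> p"
  and "(norm (fst (freq h \<kappa>)))^2 - (norm (snd (freq h \<kappa>)))^2 = 2 * (fst \<kappa> \<cdot> snd \<kappa>) / h"
  and "fst (freq h \<kappa>) \<cdot> fst (wcoord h p) - snd (freq h \<kappa>) \<cdot> snd (wcoord h p) = (h / 2) * (fst \<kappa> \<cdot> snd p) + (2 / h) * (snd \<kappa> \<cdot> fst p)"
  and "(norm (fst (wcoord h p)))^2 - (norm (snd (wcoord h p)))^2 = 2 * h * (fst p \<cdot> snd p)" using assms
 by (auto simp: freq_def wcoord_def inner_prod_def power2_norm_eq_inner inner_add_left inner_add_right
   inner_diff_left inner_diff_right inner_commute[of "snd \<kappa>" "fst \<kappa>"] inner_commute[of "snd p" "fst p"] field_simps)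

text \<open>The remainder produced by the cutoff; it carries at least one factor \<open>c\<close>.\<close>

definition rem_k :: "real => real => real => 'a::euclidean_space => 'a \<times> 'a => complex" where
 "rem_k h m c b p = \<i> * cor (h^2 / (2 * m) * (4 * c) * (h / 2) * (snd p \<cdot> b)) * wcut h c 1 p"

definition rem_xi :: "real => real => real => 'a::euclidean_space => 'a \<times> 'a => complex" where
 "rem_xi h m c b p = \<i> * cor (h^2 / (2 * m) * (4 * c) * (2 / h) * (fst p \<cdot> b)) * wcut h c 1 p"

definition rem_0 :: "real => real => real => 'a::euclidean_space \<times> 'a => complex" where
 "rem_0 h m c p = - cor (h^2 / (2 * m) * (4 * c^2) * (2 * h * (fst p \<cdot> snd p))) * wcut h c 2 p"

lemma plane_freq: "h > 0 ==> plane c (freq h \<kappa>) (wcoord h p) = cis (- (\<kappa> \<cdot> p)) * wcut h c 0 p" by (simp add: plane_def freq_wcoord wcut_def)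

text \<open>The difference of the two Laplacians becomes the product \<open>fst \<kappa> \<cdot> snd \<kappa>\<close>, the symbol of free transport.\<close>

lemma tested_freq:
 assumes h: "h > 0"
 shows "tested_hamiltonian h m V c (freq h \<kappa>) (wcoord h p) = cis (- (\<kappa> \<cdot> p)) *
   (cor (h * (fst \<kappa> \<cdot> snd \<kappa>) / m) * wcut h c 0 p + cor (wpot h V p) * wcut h c 0 p
   + (\<Sum>b\<in>Basis. cor (fst \<kappa> \<cdot> b) * rem_k h m c b p) + (\<Sum>b\<in>Basis. cor (snd \<kappa> \<cdot> b) * rem_xi h m c b p)
   + rem_0 h m c p)"
proof -
 have 1: "(\<Sum>b\<in>Basis. cor (fst \<kappa> \<cdot> b) * rem_k h m c b p) = \<i> * cor (h^2 / (2 * m) * (4 * c) * (h / 2) * (fst \<kappa> \<cdot> snd p)) * wcut h c 1 p"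
 proof -
  have "(\<Sum>b\<in>Basis. cor (fst \<kappa> \<cdot> b) * rem_k h m c b p)
    = (\<Sum>b\<in>Basis. cor ((fst \<kappa> \<cdot> b) * (snd p \<cdot> b)) * (\<i> * cor (h^2 / (2 * m) * (4 * c) * (h / 2)) * wcut h c 1 p))" by (intro sum.cong refl) (simp add: rem_k_def mult_ac)
  also have "... = cor (\<Sum>b\<in>Basis. (fst \<kappa> \<cdot> b) * (snd p \<cdot> b)) * (\<i> * cor (h^2 / (2 * m) * (4 * c) * (h / 2)) * wcut h c 1 p)"
   by (simp only: sum_distrib_right[symmetric] of_real_sum)
  finally show ?thesis unfolding euclidean_inner[symmetric] by (simp add: mult_ac)
 qed
 have 2: "(\<Sum>b\<in>Basis. cor (snd \<kappa> \<cdot> b) * rem_xi h m c b p) = \<i> * cor (h^2 / (2 * m) * (4 * c) * (2 / h) * (snd \<kappa> \<cdot> fst p)) * wcut h c 1 p"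
 proof -
  have "(\<Sum>b\<in>Basis. cor (snd \<kappa> \<cdot> b) * rem_xi h m c b p)
    = (\<Sum>b\<in>Basis. cor ((snd \<kappa> \<cdot> b) * (fst p \<cdot> b)) * (\<i> * cor (h^2 / (2 * m) * (4 * c) * (2 / h)) * wcut h c 1 p))" by (intro sum.cong refl) (simp add: rem_xi_def mult_ac)
  also have "... = cor (\<Sum>b\<in>Basis. (snd \<kappa> \<cdot> b) * (fst p \<cdot> b)) * (\<i> * cor (h^2 / (2 * m) * (4 * c) * (2 / h)) * wcut h c 1 p)"
   by (simp only: sum_distrib_right[symmetric] of_real_sum)
  finally show ?thesis unfolding euclidean_inner[symmetric] by (simp add: mult_ac)
 qed
 have 3: "h^2 / (2 * m) * (2 * (fst \<kappa> \<cdot> snd \<kappa>) / h) = h * (fst \<kappa> \<cdot> snd \<kappa>) / m" using h by (simp add: power2_eq_square)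
 show ?thesis unfolding tested_hamiltonian_def freq_wcoord[OF h] 1 2 3 rem_0_def wcut_def wpot_def by (simp add: algebra_simps)
qed

definition src :: "real => (real \<times> ('a::euclidean_space \<times> 'a) => complex) => (real => real) => ('a \<times> 'a => complex) => real \<times> ('a \<times> 'a) => complex" where
 "src h k \<theta> W z = cor (\<theta> (fst z)) * (k (fst z, wcoord h (snd z)) * W (snd z))"

text \<open>
 A representative \<open>k\<close> of the kernels, jointly measurable in time and space.
\<close>

locale kernel_family =
 fixes R :: "real => 'a::euclidean_space L2_op" and T M h m :: real and V :: "'a => real"
  and k :: "real \<times> ('a \<times> 'a) => complex"
 assumes T: "T > 0" and h: "h > 0" and m: "m > 0"
  and density: "!!t. t \<in> {-T..T} ==> density_operator (R t)"
  and wot: "wot_continuous_on {-T..T} R"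
  and trace: "!!t. t \<in> {-T..T} ==> Re (op_trace (R t \<circ> R t)) <= M"
  and weak: "weak_von_neumann_solution h m V T R" and V: "continuous_on UNIV V"
  and k: "k \<in> L2" and k_zero: "!!t z. t \<notin> {-T..T} ==> k (t, z) = 0"
  and k_AE: "AE t in lborel. t \<in> {-T..T} --> (AE z in lborel. k (t, z) = integral_kernel (R t) z)"
begin

lemma k_measurable [measurable]: "k \<in> BM" using k by auto

lemma kernel_L2: "t \<in> {-T..T} ==> integral_kernel (R t) \<in> L2" by (rule integral_kernel_expansion(1)[OF density trace])

lemma kernel_N2: "t \<in> {-T..T} ==> N2 (integral_kernel (R t)) <= enn (2 * M)" by (rule integral_kernel_expansion(3)[OF density trace])

lemma M_nonneg: "0 <= M" using integral_kernel_expansion(4)[OF density[of 0] trace[of 0], of 0] T by simp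

lemma wk_measurable [measurable]: "(%z. k (fst z, wcoord h (snd z))) \<in> BM" by measurable

lemma wk_N2: "N2 (%z. k (fst z, wcoord h (snd z))) <= enn (4 * T * M / h ^ DIM('a))"
proof -
 have k1: "N2 (%z. k (t, z)) = enn (h ^ DIM('a)) * N2 (%p. k (t, wcoord h p))" for t by (rule N2_wcoord[OF _ h]) measurable
 have "enn (h ^ DIM('a)) * N2 (%z. k (fst z, wcoord h (snd z))) = (NI t. enn (h ^ DIM('a)) * N2 (%p. k (t, wcoord h p)))"
  unfolding N2_def by (subst nn_integral_prod_fst, measurable, subst nn_integral_cmult, auto)
 also have "... = (NI t. N2 (%z. k (t, z)))" unfolding k1 ..
 also have "... <= (NI t. enn (2 * M) * indicator {-T..T} t)"
 proof (rule nn_integral_mono_AE, use k_AE in eventually_elim)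
  case (elim t)
  show ?case
  proof (cases "t \<in> {-T..T}")
   case True
   then have "N2 (%z. k (t, z)) = N2 (integral_kernel (R t))" using elim by (intro N2_cong_AE) auto
   then show ?thesis using kernel_N2[OF True] True by simp
  next
   case False
   then show ?thesis by (simp add: k_zero[OF False] N2_def)
  qed
 qed
 also have "... = enn (4 * T * M)" using T M_nonneg by (simp add: nn_integral_cmult_indicator ennreal_mult[symmetric] mult_ac)
 finally have le: "enn (h ^ DIM('a)) * N2 (%z. k (fst z, wcoord h (snd z))) <= enn (4 * T * M)" .
 have "N2 (%z. k (fst z, wcoord h (snd z))) = enn (1 / h ^ DIM('a)) * (enn (h ^ DIM('a)) * N2 (%z. k (fst z, wcoord h (snd z))))"
  unfolding mult.assoc[symmetric] using h by (simp add: ennreal_mult[symmetric])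
 also have "... <= enn (1 / h ^ DIM('a)) * enn (4 * T * M)" by (rule mult_left_mono[OF le]) simp
 also have "... = enn (4 * T * M / h ^ DIM('a))" using T M_nonneg h by (simp add: ennreal_mult[symmetric])
 finally show ?thesis .
qed

lemma wk_L2: "(%z. k (fst z, wcoord h (snd z))) \<in> L2" using wk_N2 by (auto simp: L2_iff intro: le_less_trans)

lemma wkernel_N2:
 assumes t: "t \<in> {-T..T}"
 shows "N2 (%p. integral_kernel (R t) (wcoord h p)) <= enn (2 * M / h ^ DIM('a))"
proof -
 have [measurable]: "integral_kernel (R t) \<in> BM" using kernel_L2[OF t] by auto
 have "N2 (%p. integral_kernel (R t) (wcoord h p))
   = enn (1 / h ^ DIM('a)) * (enn (h ^ DIM('a)) * N2 (%p. integral_kernel (R t) (wcoord h p)))" unfolding mult.assoc[symmetric] using h by (simp add: ennreal_mult[symmetric])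
 also have "... = enn (1 / h ^ DIM('a)) * N2 (integral_kernel (R t))" by (subst N2_wcoord[OF _ h, of "integral_kernel (R t)"]) auto
 also have "... <= enn (1 / h ^ DIM('a)) * enn (2 * M)" by (rule mult_left_mono[OF kernel_N2[OF t]]) simp
 also have "... = enn (2 * M / h ^ DIM('a))" using M_nonneg h by (simp add: ennreal_mult[symmetric])
 finally show ?thesis .
qed

lemma wkernel_L2: "t \<in> {-T..T} ==> (%p. integral_kernel (R t) (wcoord h p)) \<in> L2" by (rule L2_wcoord[OF kernel_L2 h])

lemma src_measurable:
 assumes [measurable]: "\<theta> \<in> BM" "W \<in> BM"
 shows "src h k \<theta> W \<in> BM" unfolding src_def[abs_def] by measurable

lemma src_bound:
 assumes \<theta>: "!!t. t \<in> {-T..T} ==> \<bar>\<theta> t\<bar> <= A" and W: "!!p. cmod (W p) <= B" and "A >= 0"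
 shows "cmod (src h k \<theta> W z) <= (A * B) * cmod (k (fst z, wcoord h (snd z)))"
proof (cases "fst z \<in> {-T..T}")
 case True
 have "\<bar>\<theta> (fst z)\<bar> * (cmod (k (fst z, wcoord h (snd z))) * cmod (W (snd z))) <= A * (cmod (k (fst z, wcoord h (snd z))) * B)"
  using \<theta>[OF True] W[of "snd z"] assms(3) by (intro mult_mono) auto
 then show ?thesis by (simp add: src_def norm_mult mult_ac)
qed (simp add: src_def k_zero)

lemma src_N2:
 assumes \<theta>: "!!t. t \<in> {-T..T} ==> \<bar>\<theta> t\<bar> <= A" and W: "!!p. cmod (W p) <= B" and "A >= 0"
 shows "N2 (src h k \<theta> W) <= enn ((A * B)^2 * (4 * T * M / h ^ DIM('a)))"
proof -
 have "N2 (src h k \<theta> W) <= enn ((A * B)^2) * N2 (%z. k (fst z, wcoord h (snd z)))" by (rule N2_bound[OF wk_measurable src_bound[OF assms]])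
 also have "... <= enn ((A * B)^2) * enn (4 * T * M / h ^ DIM('a))" by (rule mult_left_mono[OF wk_N2]) simp
 also have "... = enn ((A * B)^2 * (4 * T * M / h ^ DIM('a)))" by (rule ennreal_mult'[symmetric]) simp
 finally show ?thesis .
qed

lemma src_L2:
 assumes \<theta>: "continuous_on UNIV \<theta>" and W: "admissible W"
 shows "src h k \<theta> W \<in> L2"
proof -
 have "bounded (\<theta> ` {-T..T})" by (intro compact_imp_bounded compact_continuous_image continuous_on_subset[OF \<theta>]) auto
 then obtain A where A: "\<forall>t\<in>{-T..T}. \<bar>\<theta> t\<bar> <= A" by (auto simp: bounded_iff)
 obtain B where B: "!!p. cmod (W p) <= B" using admissible_bounded[OF W] by blast
 have "A >= 0" using A[rule_format, of 0] T by auto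
 show ?thesis by (rule L2_bound[OF wk_L2 src_measurable src_bound[OF _ B \<open>A >= 0\<close>]])
    (use A \<theta> admissible_measurable[OF W] borel_measurable_continuous_onI in auto)
qed

lemma src_integrable:
 assumes \<theta>: "continuous_on UNIV \<theta>" and W: "admissible W"
 shows "L1 (src h k \<theta> W)"
proof -
 obtain r where r: "!!p. r < norm p ==> W p = 0" using W by (auto simp: admissible_def)
 show ?thesis
 proof (rule L2_compact_support_integrable[OF src_L2[OF assms], where r = "T + max 0 r"])
  fix z :: "real \<times> ('a \<times> 'a)" assume z: "T + max 0 r < norm z"
  have "norm z <= \<bar>fst z\<bar> + norm (snd z)" using norm_Pair_le[of "fst z" "snd z"] by simp
  with z have "\<bar>fst z\<bar> > T \<or> norm (snd z) > r" by linarith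
  then show "src h k \<theta> W z = 0"
  proof
   assume "\<bar>fst z\<bar> > T"
   then have "fst z \<notin> {-T..T}" by auto
   then show ?thesis by (simp add: src_def k_zero)
  qed (simp add: src_def r)
 qed
qed

lemma FT_src:
 assumes \<theta>: "continuous_on UNIV \<theta>" and W: "admissible W"
 shows "L1 (%t. cis (- (\<tau> * t)) * (cor (\<theta> t) * FT (%p. k (t, wcoord h p) * W p) \<kappa>))"
  and "FT (src h k \<theta> W) (\<tau>, \<kappa>) = (LI t. cis (- (\<tau> * t)) * (cor (\<theta> t) * FT (%p. k (t, wcoord h p) * W p) \<kappa>))"
proof -
 note int = FT_integrable[OF src_integrable[OF assms], of "(\<tau>, \<kappa>)"]
 have eq: "(LI p. cis (- ((\<tau>, \<kappa>) \<cdot> (t, p))) * src h k \<theta> W (t, p))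
   = cis (- (\<tau> * t)) * (cor (\<theta> t) * FT (%p. k (t, wcoord h p) * W p) \<kappa>)" for t
 proof -
  have "cis (- ((\<tau>, \<kappa>) \<cdot> (t, p))) = cis (- (\<tau> * t)) * cis (- (\<kappa> \<cdot> p))" for p by (simp add: cis_mult)
  then have "(LI p. cis (- ((\<tau>, \<kappa>) \<cdot> (t, p))) * src h k \<theta> W (t, p))
    = (LI p. (cis (- (\<tau> * t)) * cor (\<theta> t)) * (cis (- (\<kappa> \<cdot> p)) * (k (t, wcoord h p) * W p)))" by (simp add: src_def mult_ac)
  also have "... = (cis (- (\<tau> * t)) * cor (\<theta> t)) * FT (%p. k (t, wcoord h p) * W p) \<kappa>" unfolding FT_def by (rule integral_mult_right_zero)
  finally show ?thesis by (simp add: mult.assoc)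
 qed
 show "L1 (%t. cis (- (\<tau> * t)) * (cor (\<theta> t) * FT (%p. k (t, wcoord h p) * W p) \<kappa>))" using integrable_section_integral_fst[OF int] unfolding eq .
 show "FT (src h k \<theta> W) (\<tau>, \<kappa>) = (LI t. cis (- (\<tau> * t)) * (cor (\<theta> t) * FT (%p. k (t, wcoord h p) * W p) \<kappa>))"
  unfolding FT_def[of "src h k \<theta> W"] using integral_prod_fst[OF int] unfolding eq .
qed

lemma wkernel_integrable:
 assumes "t \<in> {-T..T}" "admissible W"
 shows "L1 (%p. integral_kernel (R t) (wcoord h p) * W p)" by (rule L2_mult_integrable[OF wkernel_L2[OF assms(1)] admissible_L2[OF assms(2)]])

lemma admissible_wcuts:
 assumes c: "c > 0"
 shows "admissible (wcut h c 0)" "admissible (%p. cor (wpot h V p) * wcut h c 0 p)"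
  "admissible (rem_k h m c b)" "admissible (rem_xi h m c b)" "admissible (rem_0 h m c)"
proof -
 show "admissible (wcut h c 0)" using admissible_wcut[OF c h, of "%p. 1" 0] by simp
 show "admissible (%p. cor (wpot h V p) * wcut h c 0 p)" by (intro admissible_wcut[OF c h] continuous_intros wpot_continuous V)
 show "admissible (rem_k h m c b)" unfolding rem_k_def[abs_def] by (intro admissible_wcut[OF c h] continuous_intros)
 show "admissible (rem_xi h m c b)" unfolding rem_xi_def[abs_def] by (intro admissible_wcut[OF c h] continuous_intros)
 show "admissible (rem_0 h m c)" unfolding rem_0_def[abs_def] by (intro admissible_wcut[OF c h] continuous_intros)
qed

text \<open>Spatial Fourier coefficients of the tested equation at a fixed time.\<close>

lemma plane_pairing:
 assumes t: "t \<in> {-T..T}"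
 shows "(LI z. integral_kernel (R t) z * plane c (freq h \<kappa>) z)
    = cor (h ^ DIM('a)) * FT (%p. integral_kernel (R t) (wcoord h p) * wcut h c 0 p) \<kappa>"
proof -
 have [measurable]: "integral_kernel (R t) \<in> BM" using kernel_L2[OF t] by auto
 have [measurable]: "plane c (freq h \<kappa>) \<in> BM" by (rule borel_measurable_continuous_onI[OF plane_continuous])
 have "(LI z. integral_kernel (R t) z * plane c (freq h \<kappa>) z)
   = cor (h ^ DIM('a)) * (LI p. integral_kernel (R t) (wcoord h p) * plane c (freq h \<kappa>) (wcoord h p))" by (rule integral_wcoord[OF _ h]) measurable
 then show ?thesis by (simp add: plane_freq[OF h] FT_def mult_ac)
qed

definition rhs_coeff :: "real => 'a \<times> 'a => (('a \<times> 'a => complex) => complex) => complex" where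
 "rhs_coeff c \<kappa> L = cor (h * (fst \<kappa> \<cdot> snd \<kappa>) / m) * L (wcut h c 0)
   + L (%p. cor (wpot h V p) * wcut h c 0 p)
   + (\<Sum>b\<in>Basis. cor (fst \<kappa> \<cdot> b) * L (rem_k h m c b))
   + (\<Sum>b\<in>Basis. cor (snd \<kappa> \<cdot> b) * L (rem_xi h m c b)) + L (rem_0 h m c)"

lemma tested_pairing:
 assumes t: "t \<in> {-T..T}" and c: "c > 0"
 shows "(LI z. integral_kernel (R t) z * tested_hamiltonian h m V c (freq h \<kappa>) z)
    = cor (h ^ DIM('a)) * rhs_coeff c \<kappa> (%W. FT (%p. integral_kernel (R t) (wcoord h p) * W p) \<kappa>)"
proof -
 define K where "K p = integral_kernel (R t) (wcoord h p)" for p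
 have [measurable]: "integral_kernel (R t) \<in> BM" using kernel_L2[OF t] by auto
 have [measurable]: "tested_hamiltonian h m V c (freq h \<kappa>) \<in> BM" by (rule borel_measurable_continuous_onI[OF tested_hamiltonian_continuous[OF V]])
 have I: "L1 (%p. cis (- (\<kappa> \<cdot> p)) * (K p * W p))" if "admissible W" for W unfolding K_def by (intro FT_integrable wkernel_integrable t that)
 note adm = admissible_wcuts[OF c]
 have "(LI z. integral_kernel (R t) z * tested_hamiltonian h m V c (freq h \<kappa>) z)
   = cor (h ^ DIM('a)) * (LI p. K p * tested_hamiltonian h m V c (freq h \<kappa>) (wcoord h p))" unfolding K_def by (rule integral_wcoord[OF _ h]) measurable
 also have "(LI p. K p * tested_hamiltonian h m V c (freq h \<kappa>) (wcoord h p))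
   = (LI p. cor (h * (fst \<kappa> \<cdot> snd \<kappa>) / m) * (cis (- (\<kappa> \<cdot> p)) * (K p * wcut h c 0 p))
     + cis (- (\<kappa> \<cdot> p)) * (K p * (cor (wpot h V p) * wcut h c 0 p))
     + (\<Sum>b\<in>Basis. cor (fst \<kappa> \<cdot> b) * (cis (- (\<kappa> \<cdot> p)) * (K p * rem_k h m c b p)))
     + (\<Sum>b\<in>Basis. cor (snd \<kappa> \<cdot> b) * (cis (- (\<kappa> \<cdot> p)) * (K p * rem_xi h m c b p)))
     + cis (- (\<kappa> \<cdot> p)) * (K p * rem_0 h m c p))" by (intro Bochner_Integration.integral_cong refl)
    (simp add: tested_freq[OF h] distrib_left sum_distrib_left mult_ac)
 also have "... = rhs_coeff c \<kappa> (%W. FT (%p. K p * W p) \<kappa>)" unfolding rhs_coeff_def FT_def by (simp add: I adm Bochner_Integration.integral_sum)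
 finally show ?thesis by (simp add: K_def)
qed

text \<open>Integrate the tested equation against \<open>\<theta>\<close> and \<open>cis (- (\<tau> * t))\<close> by parts in time.\<close>

theorem source_identity:
 assumes \<theta>: "!!t. (\<theta> has_real_derivative \<theta>' t) (at t)" and \<theta>': "continuous_on UNIV \<theta>'" and c: "c > 0"
 shows "\<i> * cor \<tau> * FT (src h k \<theta> (wcut h c 0)) (\<tau>, \<kappa>)
    = FT (src h k \<theta>' (wcut h c 0)) (\<tau>, \<kappa>) - \<i> / cor h * rhs_coeff c \<kappa> (%W. FT (src h k \<theta> W) (\<tau>, \<kappa>))
     - (cis (- (\<tau> * T)) * cor (\<theta> T) * FT (%p. integral_kernel (R T) (wcoord h p) * wcut h c 0 p) \<kappa>
      - cis (\<tau> * T) * cor (\<theta> (- T)) * FT (%p. integral_kernel (R (- T)) (wcoord h p) * wcut h c 0 p) \<kappa>)"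
proof -
 have \<theta>c: "continuous_on A \<theta>" for A by (meson \<theta> DERIV_isCont continuous_at_imp_continuous_on)
 have \<theta>'c: "continuous_on A \<theta>'" for A using \<theta>' continuous_on_subset by blast
 define H where "H = cor (h ^ DIM('a))"
 have H: "H ~= 0" using h by (simp add: H_def)
 define \<mu> where "\<mu> t = (LI z. integral_kernel (R t) z * plane c (freq h \<kappa>) z)" for t
 define S where "S t = (LI z. integral_kernel (R t) z * tested_hamiltonian h m V c (freq h \<kappa>) z)" for t
 have cont: "continuous_on {-T..T} (%t. LI z. integral_kernel (R t) z * \<Phi> z)" if "\<Phi> \<in> L2" for \<Phi> by (rule family_pairing_continuous[OF T _ wot _ that]) (fact density trace)+
 have \<mu>c: "continuous_on {-T..T} \<mu>" unfolding \<mu>_def by (rule cont[OF plane_L2[OF c]])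
 have Sc: "continuous_on {-T..T} S" unfolding S_def by (rule cont[OF tested_hamiltonian_L2[OF V c]])
 have \<mu>': "(\<mu> has_vector_derivative - (\<i> / cor h) * S t) (at t)" if "t \<in> {-T<..<T}" for t unfolding \<mu>_def S_def by (rule von_Neumann_tested[OF T density wot trace weak h V c that])
 define e where "e t = cis (- (\<tau> * t))" for t
 have ec: "continuous_on A e" for A unfolding e_def cis_conv_exp by (intro continuous_intros)
 have e': "(e has_vector_derivative - \<i> * cor \<tau> * e t) (at t)" for t
 proof -
  have "((%t. - \<i> * cor (\<tau> * t)) has_vector_derivative - \<i> * cor \<tau>) (at t)" by (intro has_vector_derivative_mult_right has_vector_derivative_of_real) (auto intro!: derivative_eq_intros)
  from field_vector_diff_chain_at[OF this DERIV_exp] show ?thesis by (simp add: o_def e_def[abs_def] cis_conv_exp mult.assoc)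
 qed
 define f' where "f' t = e t * (cor (\<theta>' t) * \<mu> t) - \<i> * cor \<tau> * (e t * (cor (\<theta> t) * \<mu> t))
    - \<i> / cor h * (e t * (cor (\<theta> t) * S t))" for t
 have f'c: "continuous_on {-T..T} f'" unfolding f'_def by (intro continuous_intros ec \<theta>c \<theta>'c \<mu>c Sc) (use h in auto)
 have "(f' has_integral (e T * cor (\<theta> T) * \<mu> T - e (- T) * cor (\<theta> (- T)) * \<mu> (- T))) {-T..T}"
 proof (rule fundamental_theorem_of_calculus_interior)
  show "continuous_on {-T..T} (%t. e t * cor (\<theta> t) * \<mu> t)" by (intro continuous_intros ec \<theta>c \<mu>c)
  fix t assume t: "t \<in> {-T<..<T}"
  have "((%t. cor (\<theta> t)) has_vector_derivative cor (\<theta>' t)) (at t)" using \<theta>[of t] by (intro has_vector_derivative_of_real) (simp add: has_real_derivative_iff_has_vector_derivative)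
  from has_vector_derivative_mult[OF has_vector_derivative_mult[OF e' this] \<mu>'[OF t]]
  show "((%t. e t * cor (\<theta> t) * \<mu> t) has_vector_derivative f' t) (at t)" by (simp add: f'_def algebra_simps)
 qed (use T in auto)
 then have int: "(LINT t:{-T..T}|lborel. f' t) = e T * cor (\<theta> T) * \<mu> T - e (- T) * cor (\<theta> (- T)) * \<mu> (- T)"
  using set_borel_integral_eq_integral(2)[OF borel_integrable_atLeastAtMost'[OF f'c]] by (simp add: integral_unique)
 define g where "g W t = FT (%p. k (t, wcoord h p) * W p) \<kappa>" for W t
 have g_lin: "rhs_coeff c \<kappa> (%W. X * (Y * g W t)) = X * (Y * rhs_coeff c \<kappa> (%W. g W t))" for X Y t unfolding rhs_coeff_def by (simp add: sum_distrib_left algebra_simps)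
 have adm: "admissible (wcut h c 0)" "admissible (%p. cor (wpot h V p) * wcut h c 0 p)"
  "admissible (rem_k h m c b)" "admissible (rem_xi h m c b)" "admissible (rem_0 h m c)" for b using admissible_wcuts[OF c] by auto
 note I = FT_src(1)[of _ _ \<tau> \<kappa>, folded g_def e_def]
 note F = FT_src(2)[of _ _ \<tau> \<kappa>, folded g_def e_def]
 have AE_eq: "AE t in lborel. indicator {-T..T} t *\<^sub>R f' t = H * (e t * (cor (\<theta>' t) * g (wcut h c 0) t))
   - H * (\<i> * cor \<tau>) * (e t * (cor (\<theta> t) * g (wcut h c 0) t))
   - H * (\<i> / cor h) * rhs_coeff c \<kappa> (%W. e t * (cor (\<theta> t) * g W t))" using k_AE
 proof eventually_elim
  case (elim t)
  show ?case
  proof (cases "t \<in> {-T..T}")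
   case True
   have [measurable]: "integral_kernel (R t) \<in> BM" using kernel_L2[OF True] by auto
   have "AE p in lborel. k (t, wcoord h p) = integral_kernel (R t) (wcoord h p)" by (rule AE_wcoord[OF _ _ h]) (use elim True in auto)
   then have gk: "g W t = FT (%p. integral_kernel (R t) (wcoord h p) * W p) \<kappa>" if "admissible W" for W unfolding g_def FT_def using admissible_measurable[OF that]
    by (intro integral_cong_AE) (auto elim: eventually_mono)
   have "rhs_coeff c \<kappa> (%W. FT (%p. integral_kernel (R t) (wcoord h p) * W p) \<kappa>) = rhs_coeff c \<kappa> (%W. g W t)" unfolding rhs_coeff_def by (simp only: gk adm)
   then have "S t = H * rhs_coeff c \<kappa> (%W. g W t)" "\<mu> t = H * g (wcut h c 0) t"
    using tested_pairing[OF True c, of \<kappa>] plane_pairing[OF True, of c \<kappa>] by (simp_all add: S_def \<mu>_def H_def gk adm)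
   then show ?thesis using True unfolding f'_def g_lin by (simp add: mult_ac)
  next
   case False
   then have "g W t = 0" for W by (simp add: g_def FT_def k_zero)
   then show ?thesis using False by (simp add: rhs_coeff_def)
  qed
 qed
 have rhs_int: "L1 (%t. rhs_coeff c \<kappa> (%W. e t * (cor (\<theta> t) * g W t)))"
  unfolding rhs_coeff_def by (intro Bochner_Integration.integrable_add Bochner_Integration.integrable_sum integrable_mult_right I \<theta>c adm)
 have rhs_FT: "(LI t. rhs_coeff c \<kappa> (%W. e t * (cor (\<theta> t) * g W t))) = rhs_coeff c \<kappa> (%W. FT (src h k \<theta> W) (\<tau>, \<kappa>))"
  unfolding rhs_coeff_def by (simp add: I F \<theta>c adm Bochner_Integration.integral_sum)
 have "(LINT t:{-T..T}|lborel. f' t) = (LI t. H * (e t * (cor (\<theta>' t) * g (wcut h c 0) t))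
   - H * (\<i> * cor \<tau>) * (e t * (cor (\<theta> t) * g (wcut h c 0) t))
   - H * (\<i> / cor h) * rhs_coeff c \<kappa> (%W. e t * (cor (\<theta> t) * g W t)))" unfolding set_lebesgue_integral_def
 proof (rule integral_cong_AE[OF _ _ AE_eq])
  show "(%t. indicator {-T..T} t *\<^sub>R f' t) \<in> borel_measurable lborel" using borel_measurable_continuous_on_indicator[OF _ f'c] by simp
  have "L1 (%t. H * (e t * (cor (\<theta>' t) * g (wcut h c 0) t))
   - H * (\<i> * cor \<tau>) * (e t * (cor (\<theta> t) * g (wcut h c 0) t))
   - H * (\<i> / cor h) * rhs_coeff c \<kappa> (%W. e t * (cor (\<theta> t) * g W t)))" by (intro Bochner_Integration.integrable_diff integrable_mult_right I rhs_int \<theta>c \<theta>'c adm)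
  then show "(%t. H * (e t * (cor (\<theta>' t) * g (wcut h c 0) t))
   - H * (\<i> * cor \<tau>) * (e t * (cor (\<theta> t) * g (wcut h c 0) t))
   - H * (\<i> / cor h) * rhs_coeff c \<kappa> (%W. e t * (cor (\<theta> t) * g W t))) \<in> borel_measurable lborel" by (rule borel_measurable_integrable)
 qed
 also have "... = H * FT (src h k \<theta>' (wcut h c 0)) (\<tau>, \<kappa>) - H * (\<i> * cor \<tau>) * FT (src h k \<theta> (wcut h c 0)) (\<tau>, \<kappa>)
   - H * (\<i> / cor h) * rhs_coeff c \<kappa> (%W. FT (src h k \<theta> W) (\<tau>, \<kappa>))"
 proof -
  note J = I[OF \<theta>'c adm(1)] I[OF \<theta>c adm(1)] rhs_int
  show ?thesis by (subst Bochner_Integration.integral_diff, intro Bochner_Integration.integrable_diff integrable_mult_right J, intro integrable_mult_right J,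
     subst Bochner_Integration.integral_diff, (intro integrable_mult_right J)+)
     (simp only: integral_mult_right_zero rhs_FT F[OF \<theta>'c adm(1)] F[OF \<theta>c adm(1)])
 qed
 finally have "H * (FT (src h k \<theta>' (wcut h c 0)) (\<tau>, \<kappa>) - \<i> * cor \<tau> * FT (src h k \<theta> (wcut h c 0)) (\<tau>, \<kappa>)
   - \<i> / cor h * rhs_coeff c \<kappa> (%W. FT (src h k \<theta> W) (\<tau>, \<kappa>)))
   = e T * cor (\<theta> T) * \<mu> T - e (- T) * cor (\<theta> (- T)) * \<mu> (- T)" unfolding int by (simp add: algebra_simps)
 also have "... = H * (e T * cor (\<theta> T) * FT (%p. integral_kernel (R T) (wcoord h p) * wcut h c 0 p) \<kappa>
   - e (- T) * cor (\<theta> (- T)) * FT (%p. integral_kernel (R (- T)) (wcoord h p) * wcut h c 0 p) \<kappa>)"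
  using plane_pairing[of T c \<kappa>] plane_pairing[of "- T" c \<kappa>] T by (simp add: \<mu>_def H_def algebra_simps)
 finally have "FT (src h k \<theta>' (wcut h c 0)) (\<tau>, \<kappa>) - \<i> * cor \<tau> * FT (src h k \<theta> (wcut h c 0)) (\<tau>, \<kappa>)
   - \<i> / cor h * rhs_coeff c \<kappa> (%W. FT (src h k \<theta> W) (\<tau>, \<kappa>))
   = e T * cor (\<theta> T) * FT (%p. integral_kernel (R T) (wcoord h p) * wcut h c 0 p) \<kappa>
   - e (- T) * cor (\<theta> (- T)) * FT (%p. integral_kernel (R (- T)) (wcoord h p) * wcut h c 0 p) \<kappa>" using H by simp
 then show ?thesis by (simp add: e_def algebra_simps)
qed

end


section \<open>Weighted bounds and limits of regular functions\<close>

definition wbound :: "('b::euclidean_space => real) => real => ('b => complex) => bool" where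
 "wbound w X f \<longleftrightarrow> f \<in> BM \<and> 0 <= X \<and> (NI q. enn (w q * (cmod (f q))^2)) <= enn X"

lemma wbound_measurable: "wbound w X f ==> f \<in> BM" by (simp add: wbound_def)

lemma wbound_cmult:
 assumes "wbound w X f" and [measurable]: "w \<in> BM"
 shows "wbound w ((cmod c)^2 * X) (%q. c * f q)"
proof -
 have [measurable]: "f \<in> BM" and X: "0 <= X"
  and le: "(NI q. enn (w q * (cmod (f q))^2)) <= enn X" using assms(1) by (auto simp: wbound_def)
 have "enn (w q * (cmod (c * f q))^2) = enn ((cmod c)^2) * enn (w q * (cmod (f q))^2)" for q by (subst ennreal_mult'[symmetric]) (auto simp: norm_mult power_mult_distrib mult_ac)
 then have "(NI q. enn (w q * (cmod (c * f q))^2)) = enn ((cmod c)^2) * (NI q. enn (w q * (cmod (f q))^2))" by (simp add: nn_integral_cmult)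
 also have "... <= enn ((cmod c)^2) * enn X" by (rule mult_left_mono[OF le]) simp
 also have "... = enn ((cmod c)^2 * X)" by (rule ennreal_mult'[symmetric]) simp
 finally show ?thesis using X by (simp add: wbound_def)
qed

lemma wbound_mult:
 assumes "wbound (%q. w q * (a q)^2) X f" and [measurable]: "a \<in> BM"
 shows "wbound w X (%q. cor (a q) * f q)" using assms by (auto simp: wbound_def norm_mult power_mult_distrib mult_ac)

lemma wbound_mono:
 assumes "wbound w X f" and "X <= Y" and "!!q. cmod (g q) <= cmod (f q)" and "!!q. 0 <= w q" and "g \<in> BM"
 shows "wbound w Y g"
proof -
 have "(NI q. enn (w q * (cmod (g q))^2)) <= (NI q. enn (w q * (cmod (f q))^2))" by (intro nn_integral_mono ennreal_leI mult_left_mono power_mono assms) auto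
 also have "... <= enn X" using assms by (simp add: wbound_def)
 also have "... <= enn Y" using assms by (intro ennreal_leI)
 finally show ?thesis using assms by (simp add: wbound_def)
qed

lemma wbound_add:
 assumes "wbound w X f" "wbound w Y g" and w: "!!q. 0 <= w q" and [measurable]: "w \<in> BM"
 shows "wbound w (2 * X + 2 * Y) (%q. f q + g q)"
proof -
 have [measurable]: "f \<in> BM" "g \<in> BM" and XY: "0 <= X" "0 <= Y"
  and le: "(NI q. enn (w q * (cmod (f q))^2)) <= enn X" "(NI q. enn (w q * (cmod (g q))^2)) <= enn Y" using assms(1,2) by (auto simp: wbound_def)
 have "(NI q. enn (w q * (cmod (f q + g q))^2))
   <= (NI q. enn 2 * enn (w q * (cmod (f q))^2) + enn 2 * enn (w q * (cmod (g q))^2))"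
 proof (rule nn_integral_mono)
  fix q
  have "w q * (cmod (f q + g q))^2 <= w q * (2 * (cmod (f q))^2 + 2 * (cmod (g q))^2)" by (intro mult_left_mono cmod_add_sq w)
  also have "... = 2 * (w q * (cmod (f q))^2) + 2 * (w q * (cmod (g q))^2)" by (simp add: algebra_simps)
  finally have "enn (w q * (cmod (f q + g q))^2) <= enn (2 * (w q * (cmod (f q))^2) + 2 * (w q * (cmod (g q))^2))" by (rule ennreal_leI)
  also have "... = enn 2 * enn (w q * (cmod (f q))^2) + enn 2 * enn (w q * (cmod (g q))^2)" using w[of q] by (simp only: ennreal_plus ennreal_mult'[of 2] mult_nonneg_nonneg zero_le_numeral zero_le_power2)
  finally show "enn (w q * (cmod (f q + g q))^2) <= enn 2 * enn (w q * (cmod (f q))^2) + enn 2 * enn (w q * (cmod (g q))^2)" .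
 qed
 also have "... = enn 2 * (NI q. enn (w q * (cmod (f q))^2)) + enn 2 * (NI q. enn (w q * (cmod (g q))^2))"
  by (subst nn_integral_add, measurable, subst nn_integral_cmult, measurable, subst nn_integral_cmult, auto)
 also have "... <= enn 2 * enn X + enn 2 * enn Y" by (intro add_mono mult_left_mono le) auto
 also have "... = enn (2 * X + 2 * Y)" using XY by (simp only: ennreal_plus ennreal_mult'[of 2] mult_nonneg_nonneg zero_le_numeral)
 finally show ?thesis using XY by (simp add: wbound_def)
qed

lemma wbound_sum:
 assumes "finite I" and f: "!!i. i \<in> I ==> wbound w X (f i)" and w: "!!q. 0 <= w q" and [measurable]: "w \<in> BM" and X: "0 <= X"
 shows "wbound w (4 ^ card I * X) (%q. \<Sum>i\<in>I. f i q)" using assms(1) f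
proof (induction I)
 case empty
 then show ?case using X by (simp add: wbound_def)
next
 case (insert i I)
 have b: "wbound w (2 * X + 2 * (4 ^ card I * X)) (%q. f i q + (\<Sum>i\<in>I. f i q))" by (intro wbound_add insert w) (use insert in auto)
 have le: "2 * X + 2 * (4 ^ card I * X) <= 4 ^ card (insert i I) * X" using insert(1,2) X mult_right_mono[of 1 "4 ^ card I" X] by (simp add: mult.commute)
 have eq: "(%q. f i q + (\<Sum>i\<in>I. f i q)) = (%q. \<Sum>i\<in>insert i I. f i q)" using insert(1,2) by simp
 show ?case using wbound_mono[OF b le order_refl w wbound_measurable[OF b]] unfolding eq .
qed

lemma N2_add_tendsto:
 assumes [measurable]: "!!n. f n \<in> BM" "!!n. g n \<in> BM" "f0 \<in> BM" "g0 \<in> BM"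
  and lim: "(%n. N2 (%q. f n q - f0 q)) ----> 0" "(%n. N2 (%q. g n q - g0 q)) ----> 0"
 shows "(%n. N2 (%q. (f n q + g n q) - (f0 q + g0 q))) ----> 0"
proof (rule tendsto_0_sandwich_ennreal)
 show "N2 (%q. (f n q + g n q) - (f0 q + g0 q)) <= 2 * N2 (%q. f n q - f0 q) + 2 * N2 (%q. g n q - g0 q)" for n using N2_add[of "%q. f n q - f0 q" "%q. g n q - g0 q"] by (simp add: algebra_simps)
 show "(%n. 2 * N2 (%q. f n q - f0 q) + 2 * N2 (%q. g n q - g0 q)) ----> 0" using tendsto_add[OF ennreal_tendsto_0_cmult[OF lim(1), of 2] ennreal_tendsto_0_cmult[OF lim(2), of 2]] by simp
qed

text \<open>
 The hypotheses under which a limit of integrable functions inherits a Sobolev bound: the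
 transforms split into a part that is bounded with weight \<open>w\<close> and a part that disappears,
 in a much weaker weighted norm, at the rate of the cutoff.
\<close>

definition regular :: "(real \<times> 'a::euclidean_space => real) => real => (real \<times> 'a => complex) => bool" where
 "regular w X U \<longleftrightarrow> U \<in> L2 \<and> (\<exists>G A E Y. (\<forall>n::nat. G n \<in> L2 \<and> L1 (G n) \<and> (\<forall>\<zeta>. FT (G n) \<zeta> = A n \<zeta> + E n \<zeta>) \<and>
   wbound w X (A n) \<and> wbound (%q. decay 2 (snd q)) (Y * (1 / real (Suc n))) (E n)) \<and> (%n. N2 (%q. G n q - U q)) ----> 0)"

lemma regularE:
 assumes "regular w X U"
 obtains G A E Y where "U \<in> L2" "!!n. G n \<in> L2" "!!n. L1 (G n)" "!!n \<zeta>. FT (G n) \<zeta> = A n \<zeta> + E n \<zeta>"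
  "!!n. wbound w X (A n)" "!!n::nat. wbound (%q. decay 2 (snd q)) (Y * (1 / real (Suc n))) (E n)" "(%n. N2 (%q. G n q - U q)) ----> 0"
proof -
 obtain G A E Y where *: "\<forall>n::nat. G n \<in> L2 \<and> L1 (G n) \<and> (\<forall>\<zeta>. FT (G n) \<zeta> = A n \<zeta> + E n \<zeta>) \<and>
   wbound w X (A n) \<and> wbound (%q. decay 2 (snd q)) (Y * (1 / real (Suc n))) (E n)" "(%n. N2 (%q. G n q - U q)) ----> 0" and U: "U \<in> L2" using assms unfolding regular_def by blast
 show ?thesis by (rule that[OF U _ _ _ _ _ *(2)]; use *(1) in blast)
qed

lemma decay_snd_measurable [measurable]: "(%q::real \<times> 'a::euclidean_space. decay N (snd q)) \<in> BM" by measurable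

lemma regular_add:
 assumes "regular w X U" "regular w Y U'" and w: "!!q. 0 <= w q" "w \<in> BM"
 shows "regular w (2 * X + 2 * Y) (%q. U q + U' q)"
proof -
 obtain G A E Z where U: "U \<in> L2" and G: "!!n. G n \<in> L2" "!!n. L1 (G n)" "!!n \<zeta>. FT (G n) \<zeta> = A n \<zeta> + E n \<zeta>"
   "!!n. wbound w X (A n)" "!!n::nat. wbound (%q. decay 2 (snd q)) (Z * (1 / real (Suc n))) (E n)" "(%n. N2 (%q. G n q - U q)) ----> 0" by (rule regularE[OF assms(1)]) blast
 obtain G' A' E' Z' where U': "U' \<in> L2" and G': "!!n. G' n \<in> L2" "!!n. L1 (G' n)" "!!n \<zeta>. FT (G' n) \<zeta> = A' n \<zeta> + E' n \<zeta>"
   "!!n. wbound w Y (A' n)" "!!n::nat. wbound (%q. decay 2 (snd q)) (Z' * (1 / real (Suc n))) (E' n)" "(%n. N2 (%q. G' n q - U' q)) ----> 0" by (rule regularE[OF assms(2)]) blast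
 have [measurable]: "G n \<in> BM" "U \<in> BM" "G' n \<in> BM" "U' \<in> BM" for n using G(1)[of n] G'(1)[of n] U U' by auto
 have lim: "(%n. N2 (%q. (G n q + G' n q) - (U q + U' q))) ----> 0" by (rule N2_add_tendsto[OF _ _ _ _ G(6) G'(6)]) measurable
 have err: "wbound (%q. decay 2 (snd q)) ((2 * Z + 2 * Z') * (1 / real (Suc n))) (%q. E n q + E' n q)" for n using wbound_add[OF G(5) G'(5)] by (simp add: decay_nonneg algebra_simps add_divide_distrib)
 show ?thesis unfolding regular_def by (intro conjI L2_add U U' exI[of _ "%n q. G n q + G' n q"] exI[of _ "%n q. A n q + A' n q"] exI[of _ "%n q. E n q + E' n q"]
    exI[of _ "2 * Z + 2 * Z'"] allI Bochner_Integration.integrable_add G G' lim err wbound_add w)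
    (simp add: FT_add G(2) G'(2) G(3) G'(3))
qed

lemma sobolev_norm_regular:
 fixes u :: "real => 'a::euclidean_space => complex"
 assumes "regular w X U" and w: "!!\<zeta>. (1 + (norm \<zeta>)^2) powr s <= w \<zeta>"
  and AE: "AE t in lborel. AE x in lborel. (t, x) \<in> \<Omega> --> U (t, x) = u t x"
 shows "sobolev_norm s \<Omega> u <= enn (sqrt X)"
proof -
 obtain G A E Y where U: "U \<in> L2" and G: "!!n. G n \<in> L2" "!!n. L1 (G n)" "!!n \<zeta>. FT (G n) \<zeta> = A n \<zeta> + E n \<zeta>"
   "!!n. wbound w X (A n)" "!!n::nat. wbound (%q. decay 2 (snd q)) (Y * (1 / real (Suc n))) (E n)" "(%n. N2 (%q. G n q - U q)) ----> 0" by (rule regularE[OF assms(1)]) blast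
 have A: "(NI \<zeta>. enn ((1 + (norm \<zeta>)^2) powr s * (cmod (A n \<zeta>))^2)) <= enn X" for n
 proof -
  have "(NI \<zeta>. enn ((1 + (norm \<zeta>)^2) powr s * (cmod (A n \<zeta>))^2)) <= (NI \<zeta>. enn (w \<zeta> * (cmod (A n \<zeta>))^2))" by (intro nn_integral_mono ennreal_leI mult_right_mono w) auto
  also have "... <= enn X" using G(4) by (simp add: wbound_def)
  finally show ?thesis .
 qed
 have E: "(%n. NI \<zeta>. enn (decay 2 (snd \<zeta>) * (cmod (E n \<zeta>))^2)) ----> 0"
 proof (rule tendsto_0_sandwich_ennreal)
  show "(NI \<zeta>. enn (decay 2 (snd \<zeta>) * (cmod (E n \<zeta>))^2)) <= enn (Y * (1 / real (Suc n)))" for n using G(5)[of n] by (simp add: wbound_def)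
  have "(%n. Y * (1 / real (Suc n))) ----> Y * 0" by (intro tendsto_mult tendsto_const LIMSEQ_inverse_real_of_nat[unfolded inverse_eq_divide])
  from tendsto_ennrealI[OF this] show "(%n. enn (Y * (1 / real (Suc n)))) ----> 0" by simp
 qed
 have X: "0 <= X" using G(4)[of 0] by (simp add: wbound_def)
 note cl = Sobolev_closure[OF U G(1,2,6) wbound_measurable[OF G(4)] wbound_measurable[OF G(5)] _ _ G(3) A E X]
 have "U \<in> Hs s" "Hs_norm s U <= sqrt X" by (rule cl; simp add: decay_pos)+
 then have "sobolev_norm s \<Omega> u <= enn (Hs_norm s U)" unfolding sobolev_norm_def using AE by (intro INF_lower) auto
 also have "... <= enn (sqrt X)" by (rule ennreal_leI) fact
 finally show ?thesis .
qed


section \<open>Velocity averages\<close>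

text \<open>Kernels live on time \<open>\<times>\<close> (\<open>x\<close>, \<open>y\<close>), averages on (time \<open>\<times>\<close> \<open>x\<close>).\<close>

lemma lborel_assoc:
 "(lborel :: ('c::euclidean_space \<times> ('a::euclidean_space \<times> 'b::euclidean_space)) measure)
   = distr lborel borel (%p. (fst (fst p), (snd (fst p), snd p)))"
proof (rule measure_eqI)
 fix S :: "('c \<times> ('a \<times> 'b)) set" assume "S \<in> sets lborel"
 then have [measurable]: "S \<in> sets borel" by simp
 have "emeasure lborel S = (NI z. indicator S z)" by simp
 also have "... = (NI t. NI x. NI y. indicator S (t, (x, y)))" by (subst nn_integral_prod_fst, measurable, subst nn_integral_prod_fst, auto)
 also have "... = (NI p. indicator S (fst (fst p), (snd (fst p), snd p)))"
 proof -
  have "(NI p. indicator S (fst (fst p), (snd (fst p), snd p))) = ((NI q. NI y. indicator S (fst q, (snd q, y))) :: ennreal)" by (subst nn_integral_prod_fst) auto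
  also have "... = (NI t. NI x. NI y. indicator S (t, (x, y)))" by (subst nn_integral_prod_fst) auto
  finally show ?thesis ..
 qed
 also have "... = (\<integral>\<^sup>+z. indicator S z \<partial>distr lborel borel (%p. (fst (fst p), (snd (fst p), snd p))))" by (rule nn_integral_distr[symmetric]) auto
 finally show "emeasure lborel S = emeasure (distr lborel borel (%p. (fst (fst p), (snd (fst p), snd p)))) S" by simp
qed simp

definition assoc :: "('c \<times> ('a \<times> 'b) => complex) => ('c \<times> 'a) \<times> 'b => complex" where
 "assoc f p = f (fst (fst p), (snd (fst p), snd p))"

lemma assoc_facts:
 fixes f :: "'c::euclidean_space \<times> ('a::euclidean_space \<times> 'b::euclidean_space) => complex"
 assumes [measurable]: "f \<in> BM"
 shows "assoc f \<in> BM" "N2 (assoc f) = N2 f"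
  "L1 f ==> L1 (assoc f)"
  "(LI p. assoc f p) = (LI z. f z)"
proof -
 show "assoc f \<in> BM" unfolding assoc_def[abs_def] by measurable
 show "N2 (assoc f) = N2 f"
 proof -
  have "N2 f = (\<integral>\<^sup>+z. enn ((cmod (f z))^2) \<partial>distr lborel borel (%p. (fst (fst p), (snd (fst p), snd p))))" by (simp only: N2_def lborel_assoc[symmetric])
  also have "... = N2 (assoc f)" unfolding N2_def assoc_def by (rule nn_integral_distr) auto
  finally show ?thesis ..
 qed
 show "L1 (assoc f)" if "L1 f" using that unfolding assoc_def[abs_def] by (subst (asm) lborel_assoc, subst (asm) integrable_distr_eq) auto
 show "(LI p. assoc f p) = (LI z. f z)"
 proof -
  have "(LI z. f z) = (\<integral>z. f z \<partial>distr lborel borel (%p. (fst (fst p), (snd (fst p), snd p))))" by (simp only: lborel_assoc[symmetric])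
  also have "... = (LI p. assoc f p)" unfolding assoc_def by (rule integral_distr) auto
  finally show ?thesis ..
 qed
qed

definition avg :: "((real \<times> 'a::euclidean_space) \<times> 'a => complex) => (real \<times> ('a \<times> 'a) => complex) => real \<times> 'a => complex" where
 "avg \<mu> G q = (LI v. \<mu> (q, v) * FT G (fst q, (snd q, v)))"

definition avg0 :: "((real \<times> 'a::euclidean_space) \<times> 'a => complex) => ('a \<times> 'a => complex) => real \<times> 'a => complex" where
 "avg0 \<mu> G q = (LI v. \<mu> (q, v) * FT G (snd q, v))"

lemma avg_measurable:
 assumes [measurable]: "\<mu> \<in> BM" "G \<in> BM"
 shows "avg \<mu> G \<in> BM" unfolding avg_def[abs_def] by measurable

lemma avg0_measurable:
 assumes [measurable]: "\<mu> \<in> BM" "G \<in> BM"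
 shows "avg0 \<mu> G \<in> BM" unfolding avg0_def[abs_def] by measurable

lemma avg_wbound:
 fixes G :: "real \<times> ('a::euclidean_space \<times> 'a) => complex"
 assumes G: "L1 G" "N2 G <= enn Y" and \<mu> [measurable]: "\<mu> \<in> BM"
  and S: "!!q. enn (w q) * N2 (%v. \<mu> (q, v)) <= enn S" and w: "!!q. w q >= 0" and "S >= 0" "Y >= 0"
 shows "wbound w (S * (2 * pi) ^ (1 + 2 * DIM('a)) * Y) (avg \<mu> G)"
proof -
 have [measurable]: "G \<in> BM" using G by (auto dest: borel_measurable_integrable)
 have "(NI q. enn (w q * (cmod (avg \<mu> G q))^2)) <= enn (S * (2 * pi) ^ (1 + 2 * DIM('a))) * N2 G" unfolding avg_def by (rule avg_bound[OF G(1) _ S w]) measurable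
 also have "... <= enn (S * (2 * pi) ^ (1 + 2 * DIM('a))) * enn Y" by (rule mult_left_mono[OF G(2)]) simp
 also have "... = enn (S * (2 * pi) ^ (1 + 2 * DIM('a)) * Y)" using assms by (simp add: ennreal_mult[symmetric])
 finally show ?thesis using assms by (auto simp: wbound_def avg_measurable)
qed

lemma avg0_wbound:
 fixes G :: "'a::euclidean_space \<times> 'a => complex"
 assumes G: "L1 G" "N2 G <= enn Y" and \<mu> [measurable]: "\<mu> \<in> BM" and [measurable]: "w \<in> BM"
  and S: "!!k. (NI \<tau>. enn (w (\<tau>, k)) * N2 (%v. \<mu> ((\<tau>, k), v))) <= enn S" and w: "!!q. w q >= 0" and "S >= 0" "Y >= 0"
 shows "wbound w (S * (2 * pi) ^ (2 * DIM('a)) * Y) (avg0 \<mu> G)"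
proof -
 have [measurable]: "G \<in> BM" using G by (auto dest: borel_measurable_integrable)
 have "(NI q. enn (w q * (cmod (avg0 \<mu> G q))^2)) <= enn (S * (2 * pi) ^ (2 * DIM('a))) * N2 G" unfolding avg0_def by (rule avg_boundary_bound[OF G(1) _ _ S w]) measurable
 also have "... <= enn (S * (2 * pi) ^ (2 * DIM('a))) * enn Y" by (rule mult_left_mono[OF G(2)]) simp
 also have "... = enn (S * (2 * pi) ^ (2 * DIM('a)) * Y)" using assms by (simp add: ennreal_mult[symmetric])
 finally show ?thesis using assms by (auto simp: wbound_def avg0_measurable)
qed

lemma avg_integrable:
 assumes G: "L1 G" and \<mu>: "L1 \<mu>" and [measurable]: "\<kappa> \<in> BM"
 shows "L1 (%v::'a::euclidean_space. \<mu> v * FT G (\<kappa> v))"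
proof (rule Bochner_Integration.integrable_bound[of _ "%v. cor (LI x. cmod (G x)) * \<mu> v"])
 have [measurable]: "G \<in> BM" "\<mu> \<in> BM" using assms by (auto dest: borel_measurable_integrable)
 show "(%v. \<mu> v * FT G (\<kappa> v)) \<in> borel_measurable lborel" by measurable
 show "AE v in lborel. norm (\<mu> v * FT G (\<kappa> v)) <= norm (cor (LI x. cmod (G x)) * \<mu> v)"
 proof (rule AE_I2)
  fix v
  have "cmod (FT G (\<kappa> v)) * cmod (\<mu> v) <= \<bar>(LI x. cmod (G x))\<bar> * cmod (\<mu> v)" using FT_bound[OF G, of "\<kappa> v"] by (intro mult_right_mono) auto
  then show "norm (\<mu> v * FT G (\<kappa> v)) <= norm (cor (LI x. cmod (G x)) * \<mu> v)" by (simp add: norm_mult mult_ac)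
 qed
qed (use \<mu> in auto)

text \<open>The physical side: pairing with \<open>FT \<psi>\<close> in the last variable.\<close>

definition vmean :: "('a::euclidean_space => complex) => (real \<times> ('a \<times> 'a) => complex) => real \<times> 'a => complex" where
 "vmean \<psi> G q = (LI y. assoc G (q, y) * FT \<psi> y)"

lemma vmean_FT:
 fixes G :: "real \<times> ('a::euclidean_space \<times> 'a) => complex"
 assumes G: "L1 G" and \<psi>: "L1 \<psi>"
 shows "L1 (vmean \<psi> G)" "FT (vmean \<psi> G) q = avg (%p. \<psi> (snd p)) G q"
proof -
 have [measurable]: "G \<in> BM" "\<psi> \<in> BM" using assms by (auto dest: borel_measurable_integrable)
 define B where "B = (LI x. cmod (\<psi> x))"
 have H: "L1 (%z. c z * (G z * FT \<psi> (snd (snd z))))" if [measurable]: "c \<in> BM" and c: "!!z. cmod (c z) = 1" for c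
 proof (rule Bochner_Integration.integrable_bound[of _ "%z. cor B * G z"])
  show "AE z in lborel. norm (c z * (G z * FT \<psi> (snd (snd z)))) <= norm (cor B * G z)"
  proof (rule AE_I2)
   fix z
   have "cmod (FT \<psi> (snd (snd z))) * cmod (G z) <= \<bar>B\<bar> * cmod (G z)" using FT_bound[OF \<psi>, of "snd (snd z)"] by (intro mult_right_mono) (auto simp: B_def)
   then show "norm (c z * (G z * FT \<psi> (snd (snd z)))) <= norm (cor B * G z)" by (simp add: norm_mult c mult_ac)
  qed
 qed (use G in \<open>auto\<close>)
 have v: "vmean \<psi> G = (%q. LI y. assoc (%z. G z * FT \<psi> (snd (snd z))) (q, y))" by (simp add: vmean_def[abs_def] assoc_def)
 show "L1 (vmean \<psi> G)" unfolding v by (rule integrable_section_integral_fst[OF assoc_facts(3)]) (use H[of "%_. 1"] in auto)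
 define c where "c z = cis (- (fst q * fst z + snd q \<cdot> fst (snd z)))" for z :: "real \<times> ('a \<times> 'a)"
 have [measurable]: "c \<in> BM" unfolding c_def[abs_def] by measurable
 have "FT (vmean \<psi> G) q = (LI r. LI y. assoc (%z. c z * (G z * FT \<psi> (snd (snd z)))) (r, y))" by (subst FT_def) (simp add: v assoc_def c_def inner_prod_def)
 also have "... = (LI p. assoc (%z. c z * (G z * FT \<psi> (snd (snd z)))) p)" by (rule integral_prod_fst[symmetric, OF assoc_facts(3)[OF _ H]]) (auto simp: c_def)
 also have "... = (LI z. c z * (G z * FT \<psi> (snd (snd z))))" by (rule assoc_facts(4)) measurable
 also have "... = avg (%p. \<psi> (snd p)) G q" unfolding avg_def c_def using avg_hat[OF G \<psi>, of "fst q" "snd q"] by simp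
 finally show "FT (vmean \<psi> G) q = avg (%p. \<psi> (snd p)) G q" .
qed

lemma vmean_L2: "G \<in> L2 ==> FT \<psi> \<in> L2 ==> vmean \<psi> G \<in> L2" unfolding vmean_def[abs_def] using assoc_facts[of G] by (intro section_pairing_L2) (auto simp: L2_iff)

lemma vmean_tendsto:
 assumes g: "g \<in> L2" and G: "!!n. G n \<in> L2" and "FT \<psi> \<in> L2" and lim: "(%n. N2 (%z. G n z - g z)) ----> 0"
 shows "(%n. N2 (%q. vmean \<psi> (G n) q - vmean \<psi> g q)) ----> 0" unfolding vmean_def
proof (rule section_pairing_tendsto)
 have [measurable]: "g \<in> BM" "G n \<in> BM" for n using g G by auto
 show "assoc g \<in> L2" "assoc (G n) \<in> L2" for n using assoc_facts(1,2)[of g] assoc_facts(1,2)[of "G n"] g G[of n] by (auto simp: L2_iff)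
 have "N2 (%p. assoc (G n) p - assoc g p) = N2 (%z. G n z - g z)" for n using assoc_facts(2)[of "%z. G n z - g z"] by (simp add: assoc_def[abs_def])
 then show "(%n. N2 (%p. assoc (G n) p - assoc g p)) ----> 0" using lim by simp
qed fact


section \<open>The averaged equation and its remainder\<close>

text \<open>Each remainder has a factor \<open>c |p|\<close> or \<open>(c |p|)\<^sup>2\<close>, and \<open>|p|\<close> is at most of order \<open>1 / sqrt c\<close> on the support of the cutoff.\<close>

lemma rem_small:
 fixes h m :: real
 assumes h: "h > 0"
 obtains K where "K >= 0"
  "!!c (b::'a::euclidean_space) p. 0 < c ==> c <= 1 ==> b \<in> Basis ==> cmod (rem_k h m c b p) <= K * sqrt c \<and> cmod (rem_xi h m c b p) <= K * sqrt c"
  "!!c (p::'a \<times> 'a). 0 < c ==> c <= 1 ==> cmod (rem_0 h m c p) <= K * sqrt c"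
proof -
 obtain B1 where B1: "B1 >= 0" "!!s. s >= 0 ==> \<bar>cutoff 1 s\<bar> <= B1" using cutoff_bounded by blast
 obtain B2 where B2: "B2 >= 0" "!!s. s >= 0 ==> \<bar>cutoff 2 s\<bar> <= B2" using cutoff_bounded by blast
 define \<rho> where "\<rho> = 1 / sqrt (min 2 (h^2 / 2))"
 have \<rho>: "\<rho> >= 0" using h by (simp add: \<rho>_def)
 \<comment> \<open>on the support of the cutoff, \<open>norm p\<close> is at most of order \<open>1 / sqrt c\<close>\<close>
 have supp: "norm p <= \<rho> / sqrt c" if "wcut h c j p ~= 0" "c > 0" for c j and p :: "'a \<times> 'a"
  using wcut_zero[OF that(2) h, of p j] that by (cases "norm p <= \<rho> / sqrt c") (auto simp: \<rho>_def real_sqrt_mult mult.commute)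
 have W: "cmod (wcut h c 1 p) <= B1" "cmod (wcut h c 2 p) <= B2" if "c > 0" for c and p :: "'a \<times> 'a"
  using B1(2)[of "c * (wcoord h p \<cdot> wcoord h p)"] B2(2)[of "c * (wcoord h p \<cdot> wcoord h p)"] that by (auto simp: wcut_def)
 define H where "H = \<bar>h^2 / (2 * m)\<bar>"
 define K1 where "K1 = H * 4 * (h / 2) * \<rho> * B1"
 define K2 where "K2 = H * 4 * (2 / h) * \<rho> * B1"
 define K3 where "K3 = H * 4 * (2 * h) * \<rho>^2 * B2"
 have K: "K1 >= 0" "K2 >= 0" "K3 >= 0" using h \<rho> B1 B2 by (auto simp: K1_def K2_def K3_def H_def)
 have sc: "c * (1 / sqrt c) = sqrt c" if "c > 0" for c :: real using that by (simp add: real_div_sqrt)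
 have lin: "H * (4 * c) * u * \<bar>v\<bar> * cmod (wcut h c 1 p) <= H * 4 * u * \<rho> * B1 * sqrt c"
  if "c > 0" "u >= 0" "\<bar>v\<bar> <= norm p" for c u v and p :: "'a \<times> 'a"
 proof (cases "wcut h c 1 p = 0")
  case False
  have "H * (4 * c) * u * \<bar>v\<bar> * cmod (wcut h c 1 p) <= H * (4 * c) * u * (\<rho> / sqrt c) * B1" using supp[OF False that(1)] that W(1)[OF that(1), of p] \<rho>
   by (intro mult_mono mult_left_mono mult_nonneg_nonneg) (auto simp: H_def)
  also have "... = H * 4 * u * \<rho> * B1 * (c * (1 / sqrt c))" by simp
  finally show ?thesis unfolding sc[OF that(1)] .
 qed (use that \<rho> B1 in \<open>simp add: H_def\<close>)
 show ?thesis
 proof (rule that[of "K1 + K2 + K3"])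
  fix c :: real and b :: 'a and p :: "'a \<times> 'a"
  assume c: "0 < c" "c <= 1" and b: "b \<in> Basis"
  have nb: "\<bar>snd p \<cdot> b\<bar> <= norm p" "\<bar>fst p \<cdot> b\<bar> <= norm p"
   using Basis_le_norm[OF b, of "snd p"] Basis_le_norm[OF b, of "fst p"] norm_fst_le[of "fst p" "snd p"] norm_snd_le[of "snd p" "fst p"] by auto
  have "cmod (rem_k h m c b p) = H * (4 * c) * (h / 2) * \<bar>snd p \<cdot> b\<bar> * cmod (wcut h c 1 p)" using c h by (simp add: rem_k_def norm_mult H_def abs_mult norm_divide norm_power)
  also have "... <= K1 * sqrt c" unfolding K1_def by (rule lin[OF c(1) _ nb(1)]) (use h in simp)
  finally have 1: "cmod (rem_k h m c b p) <= K1 * sqrt c" .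
  have "cmod (rem_xi h m c b p) = H * (4 * c) * (2 / h) * \<bar>fst p \<cdot> b\<bar> * cmod (wcut h c 1 p)" using c h by (simp only: rem_xi_def norm_mult norm_ii norm_of_real H_def abs_mult) simp
  also have "... <= K2 * sqrt c" unfolding K2_def by (rule lin[OF c(1) _ nb(2)]) (use h in simp)
  finally have 2: "cmod (rem_xi h m c b p) <= K2 * sqrt c" .
  have "K1 * sqrt c <= (K1 + K2 + K3) * sqrt c" "K2 * sqrt c <= (K1 + K2 + K3) * sqrt c" by (intro mult_right_mono; use K c in simp)+
  then show "cmod (rem_k h m c b p) <= (K1 + K2 + K3) * sqrt c \<and> cmod (rem_xi h m c b p) <= (K1 + K2 + K3) * sqrt c" using 1 2 by linarith
 next
  fix c :: real and p :: "'a \<times> 'a" assume c: "0 < c" "c <= 1"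
  have "cmod (rem_0 h m c p) <= K3 * sqrt c"
  proof (cases "wcut h c 2 p = 0")
   case False
   have "\<bar>fst p \<cdot> snd p\<bar> <= norm p * norm p" using Cauchy_Schwarz_ineq2[of "fst p" "snd p"] mult_mono[OF norm_fst_le[of "fst p" "snd p"] norm_snd_le[of "snd p" "fst p"]] by simp
   also have "... <= (\<rho> / sqrt c) * (\<rho> / sqrt c)" by (intro mult_mono supp[OF False c(1)]) (use \<rho> c in auto)
   also have "... = \<rho>^2 / c" using c by (simp add: power2_eq_square)
   finally have fs: "\<bar>fst p \<cdot> snd p\<bar> <= \<rho>^2 / c" .
   have "cmod (rem_0 h m c p) = H * (4 * c^2) * (2 * h) * \<bar>fst p \<cdot> snd p\<bar> * cmod (wcut h c 2 p)" using c h by (simp add: rem_0_def norm_mult H_def abs_mult norm_divide norm_power)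
   also have "... <= H * (4 * c^2) * (2 * h) * (\<rho>^2 / c) * B2" using W(2)[OF c(1), of p] fs h c by (intro mult_mono mult_left_mono mult_nonneg_nonneg) (auto simp: H_def)
   also have "... = K3 * c" using c by (simp add: K3_def power2_eq_square)
   also have "... <= K3 * sqrt c" using c K by (intro mult_left_mono) (auto intro: real_le_rsqrt simp: power2_eq_square mult_le_cancel_left1)
   finally show ?thesis .
  qed (use K c in \<open>simp add: rem_0_def\<close>)
  also have "... <= (K1 + K2 + K3) * sqrt c" by (intro mult_right_mono) (use K c in simp_all)
  finally show "cmod (rem_0 h m c p) <= (K1 + K2 + K3) * sqrt c" .
 qed (use K in simp)
qed

text \<open>Weights in the velocity variable: one derivative and one moment, with polynomial decay.\<close>

locale velocity_weight =
 fixes \<psi> :: "'a::euclidean_space => complex" and \<psi>' :: "'a => 'a => complex" and B :: real and N :: nat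
 assumes \<psi>: "L1 \<psi>" "continuous_on UNIV \<psi>" "!!v. (cmod (\<psi> v))^2 <= B * decay N v"
  and \<psi>': "!!b. b \<in> Basis ==> L1 (\<psi>' b)" "!!b. b \<in> Basis ==> continuous_on UNIV (\<psi>' b)"
   "!!b v. b \<in> Basis ==> (cmod (\<psi>' b v))^2 <= B * decay N v"
  and \<psi>_line: "!!b v. b \<in> Basis ==> ((%s. \<psi> (v + s *\<^sub>R b)) has_vector_derivative \<psi>' b v) (at 0)"
  and \<psi>x: "!!b. b \<in> Basis ==> L1 (%v. cor (v \<cdot> b) * \<psi> v)"
   "!!b v. b \<in> Basis ==> (cmod (cor (v \<cdot> b) * \<psi> v))^2 <= B * decay N v"
  and N: "N >= 2 * DIM('a) + 2" and B: "B >= 0"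

locale averaged_kernel = kernel_family R T M h m V k + velocity_weight \<psi> \<psi>' B N
 for R :: "real => 'a::euclidean_space L2_op" and T M h m :: real and V :: "'a => real"
  and k :: "real \<times> ('a \<times> 'a) => complex" and \<psi> :: "'a => complex" and \<psi>' :: "'a => 'a => complex" and B :: real and N :: nat
begin

lemma \<psi>_measurable [measurable]: "\<psi> \<in> BM" using \<psi>(1) by (auto dest: borel_measurable_integrable)

lemma \<psi>_L2: "\<psi> \<in> L2"
proof -
 have "N2 \<psi> <= (NI (v::'a). enn B * enn (decay N v))" unfolding N2_def using \<psi>(3) B by (intro nn_integral_mono) (auto simp: ennreal_mult'[symmetric] intro!: ennreal_leI)
 also have "... = enn B * (NI (v::'a). enn (decay N v))" by (rule nn_integral_cmult) measurable
 also have "... <= enn B * enn (4 ^ DIM('a))" by (intro mult_left_mono nn_integral_decay) (use N in auto)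
 also have "... < \<infinity>" by (simp add: ennreal_mult_less_top)
 finally show ?thesis by (simp add: L2_iff)
qed

lemma FT_\<psi>_L2: "FT \<psi> \<in> L2" by (rule FT_L2[OF \<psi>_L2 \<psi>(1)])

definition rm :: "('a => complex) => (real \<times> 'a => real) => real => (real \<times> 'a) \<times> 'a => complex" where
 "rm \<phi> a \<sigma> p = rmult \<phi> m (a (fst p)) \<sigma> (fst (fst p)) (snd (fst p)) (snd p)"

lemma rm_measurable [measurable]:
 assumes [measurable]: "\<phi> \<in> BM" "a \<in> BM"
 shows "rm \<phi> a \<sigma> \<in> BM" unfolding rm_def[abs_def] rmult_def symb_def by measurable

definition slice :: "real => real => 'a \<times> 'a => complex" where
 "slice t c p = integral_kernel (R t) (wcoord h p) * wcut h c 0 p"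

definition err :: "(real => real) => real => (real \<times> 'a => real) => real => real \<times> 'a => complex" where
 "err \<theta> c a \<sigma> q = (- \<i> * cor (\<sigma> / h)) *
   ((\<Sum>b\<in>Basis. cor (snd q \<cdot> b) * avg (rm \<psi> a \<sigma>) (src h k \<theta> (rem_k h m c b)) q)
   + (\<Sum>b\<in>Basis. avg (rm (%v. cor (v \<cdot> b) * \<psi> v) a \<sigma>) (src h k \<theta> (rem_xi h m c b)) q)
   + avg (rm \<psi> a \<sigma>) (src h k \<theta> (rem_0 h m c)) q)"

text \<open>
 Dividing the equation by its symbol, shifted by \<open>a\<close> off the characteristic set, turns the
 average into averages of the sources against the resolvent.
\<close>

lemma averaged_identity:
 assumes \<theta>: "!!t. (\<theta> has_real_derivative \<theta>' t) (at t)" and \<theta>': "continuous_on UNIV \<theta>'" and c: "c > 0"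
  and a: "a q > 0" and \<sigma>: "\<sigma>^2 = 1"
 shows "avg (%p. \<psi> (snd p)) (src h k \<theta> (wcut h c 0)) q =
   cor (a q) * avg (rm \<psi> a \<sigma>) (src h k \<theta> (wcut h c 0)) q
   + cor \<sigma> * avg (rm \<psi> a \<sigma>) (src h k \<theta>' (wcut h c 0)) q
   - \<i> * cor (\<sigma> / h) * avg (rm \<psi> a \<sigma>) (src h k \<theta> (%p. cor (wpot h V p) * wcut h c 0 p)) q
   + err \<theta> c a \<sigma> q
   - cor \<sigma> * (cis (- (fst q * T)) * cor (\<theta> T) * avg0 (rm \<psi> a \<sigma>) (slice T c) q
     - cis (fst q * T) * cor (\<theta> (- T)) * avg0 (rm \<psi> a \<sigma>) (slice (- T) c) q)"
proof -
 have \<theta>c: "continuous_on UNIV \<theta>" by (meson \<theta> DERIV_isCont continuous_at_imp_continuous_on)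
 define F where "F W v = FT (src h k \<theta> W) (fst q, (snd q, v))" for W v
 define F' where "F' v = FT (src h k \<theta>' (wcut h c 0)) (fst q, (snd q, v))" for v
 define r where "r \<phi> v = rmult \<phi> m (a q) \<sigma> (fst q) (snd q) v" for \<phi> v
 define pot where "pot p = cor (wpot h V p) * wcut h c 0 p" for p
 define e1 where "e1 = cis (- (fst q * T)) * cor (\<theta> T)"
 define e2 where "e2 = cis (fst q * T) * cor (\<theta> (- T))"
 define \<beta> where "\<beta> = - \<i> * cor (\<sigma> / h)"
 define \<psi>b where "\<psi>b b v = cor (v \<cdot> b) * \<psi> v" for b v
 note adm = admissible_wcuts[OF c]
 have r_int: "L1 (r \<psi>)" "!!b. b \<in> Basis ==> L1 (r (\<psi>b b))" unfolding r_def[abs_def] \<psi>b_def[abs_def]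
  by (rule rmult_integrable[OF a \<psi>(1,2)], rule rmult_integrable[OF a \<psi>x(1)]) (auto intro!: continuous_intros \<psi>(2))
 have I: "L1 (%v. r \<psi> v * F W v)" "b \<in> Basis ==> L1 (%v. r (\<psi>b b) v * F W v)" if "admissible W" for W b
  unfolding F_def by (intro avg_integrable src_integrable \<theta>c that r_int, measurable)+
 have I': "L1 (%v. r \<psi> v * F' v)" unfolding F'_def by (intro avg_integrable src_integrable \<theta>' adm r_int) measurable
 have I0: "L1 (%v. r \<psi> v * FT (slice t c) (snd q, v))" if "t \<in> {-T..T}" for t by (intro avg_integrable r_int) (auto simp: slice_def[abs_def] intro: wkernel_integrable that adm)
 have pointwise: "\<psi> v * F (wcut h c 0) v = cor (a q) * (r \<psi> v * F (wcut h c 0) v) + cor \<sigma> * (r \<psi> v * F' v)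
   + \<beta> * (r \<psi> v * F pot v)
   + \<beta> * ((\<Sum>b\<in>Basis. cor (snd q \<cdot> b) * (r \<psi> v * F (rem_k h m c b) v))
      + (\<Sum>b\<in>Basis. r (\<psi>b b) v * F (rem_xi h m c b) v) + r \<psi> v * F (rem_0 h m c) v)
   - cor \<sigma> * (e1 * (r \<psi> v * FT (slice T c) (snd q, v)) - e2 * (r \<psi> v * FT (slice (- T) c) (snd q, v)))" for v
 proof -
  define s where "s = symb m (a q) \<sigma> (fst q) (snd q) v"
  define Sk where "Sk = (\<Sum>b\<in>Basis. cor (snd q \<cdot> b) * F (rem_k h m c b) v)"
  define Sx where "Sx = (\<Sum>b\<in>Basis. cor (v \<cdot> b) * F (rem_xi h m c b) v)"
  define bd where "bd = e1 * FT (slice T c) (snd q, v) - e2 * FT (slice (- T) c) (snd q, v)"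
  have s0: "s ~= 0" unfolding s_def by (rule symb_nonzero[OF a])
  have r: "r \<psi> v * s = \<psi> v" using s0 by (simp add: r_def rmult_def s_def)
  have rx: "r (\<psi>b b) v = r \<psi> v * cor (v \<cdot> b)" for b by (simp add: r_def rmult_def \<psi>b_def)
  have "\<i> * cor (fst q) * F (wcut h c 0) v = F' v - \<i> / cor h *
    (cor (h * (snd q \<cdot> v) / m) * F (wcut h c 0) v + F pot v + Sk + Sx + F (rem_0 h m c) v) - bd" using source_identity[OF \<theta> \<theta>' c, of "fst q" "(snd q, v)"]
   unfolding rhs_coeff_def F_def F'_def pot_def[abs_def] Sk_def Sx_def bd_def e1_def e2_def slice_def[abs_def] by simp
  also have "... = F' v - \<i> * cor ((snd q \<cdot> v) / m) * F (wcut h c 0) v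
    - \<i> / cor h * (F pot v + Sk + Sx + F (rem_0 h m c) v) - bd" using h by (simp add: field_simps)
  finally have E: "\<i> * cor (fst q) * F (wcut h c 0) v = F' v - \<i> * cor ((snd q \<cdot> v) / m) * F (wcut h c 0) v
    - \<i> / cor h * (F pot v + Sk + Sx + F (rem_0 h m c) v) - bd" .
  have "s * F (wcut h c 0) v = cor (a q) * F (wcut h c 0) v + cor \<sigma> *
    (\<i> * cor (fst q) * F (wcut h c 0) v + \<i> * cor ((snd q \<cdot> v) / m) * F (wcut h c 0) v)" unfolding s_def symb_def by (simp add: algebra_simps)
  also have "... = cor (a q) * F (wcut h c 0) v + cor \<sigma> * (F' v
    - \<i> / cor h * (F pot v + Sk + Sx + F (rem_0 h m c) v) - bd)" unfolding E by simp
  finally have "s * F (wcut h c 0) v = cor (a q) * F (wcut h c 0) v + cor \<sigma> * (F' v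
    - \<i> / cor h * (F pot v + Sk + Sx + F (rem_0 h m c) v) - bd)" .
  then have "\<psi> v * F (wcut h c 0) v = r \<psi> v * (cor (a q) * F (wcut h c 0) v + cor \<sigma> * (F' v
    - \<i> / cor h * (F pot v + Sk + Sx + F (rem_0 h m c) v) - bd))" using r by (metis mult.assoc)
  moreover have "(\<Sum>b\<in>Basis. cor (snd q \<cdot> b) * (r \<psi> v * F (rem_k h m c b) v)) = r \<psi> v * Sk" by (simp add: Sk_def sum_distrib_left mult_ac)
  moreover have "(\<Sum>b\<in>Basis. r (\<psi>b b) v * F (rem_xi h m c b) v) = r \<psi> v * Sx" by (simp add: Sx_def rx sum_distrib_left mult_ac)
  moreover have "\<beta> = - (cor \<sigma> * (\<i> / cor h))" by (simp add: \<beta>_def)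
  ultimately show ?thesis by (simp add: bd_def algebra_simps)
 qed
 have T': "T \<in> {-T..T}" "- T \<in> {-T..T}" using T by auto
 have Ipot: "L1 (%v. r \<psi> v * F pot v)" using I(1)[OF adm(2)] by (simp only: pot_def[abs_def])
 define R1 where "R1 v = (\<Sum>b\<in>Basis. cor (snd q \<cdot> b) * (r \<psi> v * F (rem_k h m c b) v))
      + (\<Sum>b\<in>Basis. r (\<psi>b b) v * F (rem_xi h m c b) v) + r \<psi> v * F (rem_0 h m c) v" for v
 have R1i: "L1 R1" unfolding R1_def[abs_def] by (intro Bochner_Integration.integrable_add Bochner_Integration.integrable_sum integrable_mult_right I adm)
 have R1v: "\<beta> * (LI v. R1 v) = err \<theta> c a \<sigma> q" unfolding R1_def err_def avg_def rm_def \<beta>_def[symmetric]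
  by (simp add: I adm Bochner_Integration.integral_sum flip: F_def r_def \<psi>b_def)
 note J = I(1)[OF adm(1)] I' Ipot R1i I0[OF T'(1)] I0[OF T'(2)]
 have "avg (%p. \<psi> (snd p)) (src h k \<theta> (wcut h c 0)) q = (LI v. \<psi> v * F (wcut h c 0) v)" by (simp add: avg_def F_def)
 also have "... = (LI v. cor (a q) * (r \<psi> v * F (wcut h c 0) v) + cor \<sigma> * (r \<psi> v * F' v)
   + \<beta> * (r \<psi> v * F pot v) + \<beta> * R1 v
   - cor \<sigma> * (e1 * (r \<psi> v * FT (slice T c) (snd q, v)) - e2 * (r \<psi> v * FT (slice (- T) c) (snd q, v))))" unfolding pointwise R1_def ..
 also have "... = cor (a q) * (LI v. r \<psi> v * F (wcut h c 0) v) + cor \<sigma> * (LI v. r \<psi> v * F' v)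
   + \<beta> * (LI v. r \<psi> v * F pot v) + \<beta> * (LI v. R1 v)
   - cor \<sigma> * (e1 * (LI v. r \<psi> v * FT (slice T c) (snd q, v)) - e2 * (LI v. r \<psi> v * FT (slice (- T) c) (snd q, v)))" using J by (simp del: integral_mult_left integral_mult_right)
 finally show ?thesis unfolding R1v by (simp add: avg_def avg0_def rm_def F_def F'_def r_def e1_def e2_def \<beta>_def pot_def[abs_def])
qed

lemma N2_rm:
 assumes "!!v. (cmod (\<phi> v))^2 <= B * decay N v" and "\<sigma>^2 = 1"
 shows "N2 (%v. rm \<phi> a \<sigma> (q, v)) <= enn B * resolvent_weight N m (a q) (fst q) (snd q)" using N2_rmult[OF assms(2,1) B, of m "a q" "fst q" "snd q"] by (simp add: rm_def)

text \<open>The remainder of the cutoff vanishes in a norm with a polynomial weight.\<close>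

lemma err_wbound:
 assumes \<theta>: "continuous_on UNIV \<theta>" "!!t. t \<in> {-T..T} ==> \<bar>\<theta> t\<bar> <= 1"
  and a: "!!q. 1 <= a q" and [measurable]: "a \<in> BM" and \<sigma>: "\<sigma>^2 = 1"
 obtains Y where "!!n. wbound (%q. decay 2 (snd q)) (Y * (1 / real (Suc n))) (err \<theta> (1 / real (Suc n)) a \<sigma>)"
proof -
 obtain K where K: "K >= 0" "!!c (b::'a) p. 0 < c ==> c <= 1 ==> b \<in> Basis ==> cmod (rem_k h m c b p) <= K * sqrt c \<and> cmod (rem_xi h m c b p) <= K * sqrt c"
  "!!c (p::'a \<times> 'a). 0 < c ==> c <= 1 ==> cmod (rem_0 h m c p) <= K * sqrt c" using rem_small[OF h] by blast
 define D where "D = B * 4 ^ DIM('a) * (2 * pi) ^ (1 + 2 * DIM('a)) * (K^2 * (4 * T * M / h ^ DIM('a)))"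
 have D: "D >= 0" using B T M_nonneg h by (simp add: D_def)
 have term_bound: "wbound w (D * c) (avg (rm \<phi> a \<sigma>) (src h k \<theta> W))"
  if \<phi>: "!!v. (cmod (\<phi> v))^2 <= B * decay N v" and [measurable]: "\<phi> \<in> BM" and W: "admissible W" "!!p. cmod (W p) <= K * sqrt c"
   and c: "0 < c" and w: "!!q. 0 <= w q" "!!q. w q <= 1" for \<phi> W c w
 proof -
  have "N2 (src h k \<theta> W) <= enn ((1 * (K * sqrt c))^2 * (4 * T * M / h ^ DIM('a)))" by (rule src_N2[OF \<theta>(2) W(2)]) auto
  then have NW: "N2 (src h k \<theta> W) <= enn (c * (K^2 * (4 * T * M / h ^ DIM('a))))" using c by (simp add: power_mult_distrib mult_ac)
  have "wbound w (B * 4 ^ DIM('a) * (2 * pi) ^ (1 + 2 * DIM('a)) * (c * (K^2 * (4 * T * M / h ^ DIM('a))))) (avg (rm \<phi> a \<sigma>) (src h k \<theta> W))"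
  proof (rule avg_wbound[OF src_integrable[OF \<theta>(1) W(1)] NW _ _ w(1)])
   fix q
   have "resolvent_weight N m (a q) (fst q) (snd q) <= enn (4 ^ DIM('a) / (a q)^2)" by (rule resolvent_weight_trivial) (use a[of q] N in auto)
   also have "... <= enn (4 ^ DIM('a) / 1)" using a[of q] by (intro ennreal_leI divide_left_mono) (auto simp: one_le_power)
   finally have "enn B * resolvent_weight N m (a q) (fst q) (snd q) <= enn B * enn (4 ^ DIM('a))" by (intro mult_left_mono) auto
   then have "N2 (%v. rm \<phi> a \<sigma> (q, v)) <= enn B * enn (4 ^ DIM('a))" using N2_rm[of \<phi> \<sigma> a q, OF \<phi> \<sigma>] by (rule order_trans[rotated])
   then have "enn (w q) * N2 (%v. rm \<phi> a \<sigma> (q, v)) <= enn 1 * (enn B * enn (4 ^ DIM('a)))" using w by (intro mult_mono ennreal_leI) auto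
   then show "enn (w q) * N2 (%v. rm \<phi> a \<sigma> (q, v)) <= enn (B * 4 ^ DIM('a))" using B by (simp add: ennreal_mult)
  qed (use B T M_nonneg h c K in auto)
  then show ?thesis by (simp add: D_def mult_ac)
 qed
 have dec: "decay 2 v <= 1" for v :: 'a using decay_antimono[of 0 2 v] by (simp add: decay_def)
 have decx: "decay 2 v * (v \<cdot> b)^2 <= 1" if "b \<in> Basis" for v b :: 'a
 proof -
  have "(v \<cdot> b)^2 <= (1 + norm v)^2" using Basis_le_norm[OF that, of v] by (intro abs_le_square_iff[THEN iffD1]) simp
  then show ?thesis by (simp add: decay_def divide_le_eq)
 qed
 define Z where "Z = (cmod (- \<i> * cor (\<sigma> / h)))^2 * (2 * (2 * (4 ^ DIM('a) * D) + 2 * (4 ^ DIM('a) * D)) + 2 * D)"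
 have main: "wbound (%q. decay 2 (snd q)) (Z * c) (err \<theta> c a \<sigma>)" if c: "0 < c" "c <= 1" for c
 proof -
  note adm = admissible_wcuts[OF c(1)]
  have 1: "wbound (%q. decay 2 (snd q)) (D * c) (%q. cor (snd q \<cdot> b) * avg (rm \<psi> a \<sigma>) (src h k \<theta> (rem_k h m c b)) q)" if b: "b \<in> Basis" for b
   by (rule wbound_mult[OF term_bound[OF \<psi>(3) _ adm(3) _ c(1)]]) (use K(2)[OF c b] decx[OF b] in \<open>auto simp: decay_nonneg\<close>)
  have 2: "wbound (%q. decay 2 (snd q)) (D * c) (avg (rm (%v. cor (v \<cdot> b) * \<psi> v) a \<sigma>) (src h k \<theta> (rem_xi h m c b)))" if b: "b \<in> Basis" for b
   by (rule term_bound[OF \<psi>x(2)[OF b] _ adm(4) _ c(1)]) (use K(2)[OF c b] dec in \<open>auto simp: decay_nonneg\<close>)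
  have 3: "wbound (%q. decay 2 (snd q)) (D * c) (avg (rm \<psi> a \<sigma>) (src h k \<theta> (rem_0 h m c)))"
   by (rule term_bound[OF \<psi>(3) _ adm(5) K(3)[OF c] c(1)]) (use dec in \<open>auto simp: decay_nonneg\<close>)
  have "wbound (%q. decay 2 (snd q)) ((cmod (- \<i> * cor (\<sigma> / h)))^2 * (2 * (2 * (4 ^ DIM('a) * (D * c)) + 2 * (4 ^ DIM('a) * (D * c))) + 2 * (D * c))) (err \<theta> c a \<sigma>)"
   unfolding err_def[abs_def] using D c by (intro wbound_cmult wbound_add wbound_sum 1 2 3) (auto simp: decay_nonneg)
  then show ?thesis by (simp add: Z_def algebra_simps)
 qed
 show ?thesis by (rule that[of Z], rule main) simp_all
qed

lemma cutoff_tendsto: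
 fixes f :: "'b::euclidean_space => complex"
 assumes f: "f \<in> L2" and [measurable]: "g \<in> BM"
 shows "(%n. N2 (%z. f z * wcut h (1 / real (Suc n)) 0 (g z) - f z)) ----> 0"
proof (rule N2_dominated[OF _ f])
 fix n
 have [measurable]: "wcut h c 0 \<in> BM" for c by (rule borel_measurable_continuous_onI[OF wcut_continuous])
 have [measurable]: "f \<in> BM" using f by auto
 show "(%z. f z * wcut h (1 / real (Suc n)) 0 (g z) - f z) \<in> BM" by measurable
 fix z
 define s where "s = wcoord h (g z) \<cdot> wcoord h (g z)"
 have eq: "f z * wcut h c 0 (g z) - f z = cor (cutoff 0 (c * s) - 1) * f z" for c by (simp add: wcut_def s_def algebra_simps)
 have "\<bar>cutoff 0 (1 / real (Suc n) * s) - 1\<bar> <= 1" using cutoff_0_bounds[of "1 / real (Suc n) * s"] by (simp add: s_def)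
 then show "cmod (f z * wcut h (1 / real (Suc n)) 0 (g z) - f z) <= cmod (f z)" unfolding eq norm_mult norm_of_real by (intro mult_left_le_one_le) auto
 have "continuous_on UNIV (cutoff 0)" by (rule cutoff_continuous[OF continuous_on_id])
 then have "isCont (cutoff 0) 0" by (simp add: continuous_on_eq_continuous_at)
 moreover have "(%n. 1 / real (Suc n) * s) ----> 0" using tendsto_mult_left_zero[OF LIMSEQ_inverse_real_of_nat] by (simp add: inverse_eq_divide)
 ultimately have "(%n. cutoff 0 (1 / real (Suc n) * s)) ----> 1" using isCont_tendsto_compose[of 0 "cutoff 0"] by (simp add: cutoff_at_0)
 then have "(%n. cor (cutoff 0 (1 / real (Suc n) * s) - 1) * f z) ----> cor (1 - 1) * f z" by (intro tendsto_intros)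
 then show "(%n. f z * wcut h (1 / real (Suc n)) 0 (g z) - f z) ----> 0" unfolding eq by simp
qed

lemma src_cutoff_tendsto:
 assumes [measurable]: "\<theta> \<in> BM" and \<theta>: "!!t. t \<in> {-T..T} ==> \<bar>\<theta> t\<bar> <= 1"
 shows "(%z. cor (\<theta> (fst z)) * k (fst z, wcoord h (snd z))) \<in> L2"
  and "(%n. N2 (%z. src h k \<theta> (wcut h (1 / real (Suc n)) 0) z - cor (\<theta> (fst z)) * k (fst z, wcoord h (snd z)))) ----> 0"
proof -
 show L: "(%z. cor (\<theta> (fst z)) * k (fst z, wcoord h (snd z))) \<in> L2"
 proof (rule L2_bound[OF wk_L2, where B = 1])
  show "cmod (cor (\<theta> (fst z)) * k (fst z, wcoord h (snd z))) <= 1 * cmod (k (fst z, wcoord h (snd z)))" for z :: "real \<times> ('a \<times> 'a)"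
   using \<theta>[of "fst z"] by (cases "fst z \<in> {-T..T}") (auto simp: norm_mult k_zero intro: mult_left_le_one_le)
 qed measurable
 show "(%n. N2 (%z. src h k \<theta> (wcut h (1 / real (Suc n)) 0) z - cor (\<theta> (fst z)) * k (fst z, wcoord h (snd z)))) ----> 0" using cutoff_tendsto[OF L, of snd] by (simp add: src_def mult.assoc)
qed

lemma wcut_le_1: "c > 0 ==> cmod (wcut h c 0 p) <= 1" using cutoff_0_bounds[of "c * (wcoord h p \<cdot> wcoord h p)"] by (simp add: wcut_def)

lemma slice_facts:
 assumes "t \<in> {-T..T}" "c > 0" and C0: "M / h ^ DIM('a) <= C0"
 shows "L1 (slice t c)" "N2 (slice t c) <= enn (2 * C0)" "slice t c \<in> L2"
proof -
 show int: "L1 (slice t c)" unfolding slice_def[abs_def] by (rule wkernel_integrable[OF assms(1) admissible_wcuts(1)[OF assms(2)]])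
 have "N2 (slice t c) <= N2 (%p. integral_kernel (R t) (wcoord h p))" by (rule N2_mono) (simp add: slice_def norm_mult mult_left_le wcut_le_1[OF assms(2)])
 also have "... <= enn (2 * M / h ^ DIM('a))" by (rule wkernel_N2[OF assms(1)])
 also have "... <= enn (2 * C0)" using C0 by (intro ennreal_leI) simp
 finally show le: "N2 (slice t c) <= enn (2 * C0)" .
 show "slice t c \<in> L2" using int le_less_trans[OF le] by (auto simp: L2_iff dest: borel_measurable_integrable)
qed

lemma src_N2':
 assumes \<theta>: "!!t. t \<in> {-T..T} ==> \<bar>\<theta> t\<bar> <= A" and W: "!!p. cmod (W p) <= D" and "A >= 0" and C0: "M / h ^ DIM('a) <= C0"
 shows "N2 (src h k \<theta> W) <= enn ((A * D)^2 * (4 * T * C0))"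
proof -
 have "4 * T * M / h ^ DIM('a) = 4 * T * (M / h ^ DIM('a))" by simp
 also have "... <= 4 * T * C0" using C0 T by (intro mult_left_mono) auto
 finally have "(A * D)^2 * (4 * T * M / h ^ DIM('a)) <= (A * D)^2 * (4 * T * C0)" by (intro mult_left_mono) auto
 then show ?thesis using src_N2[OF assms(1,2,3)] by (meson order_trans ennreal_leI)
qed


section \<open>Lipschitz potentials\<close>

definition rmd :: "'a => (real \<times> 'a => real) => real => (real \<times> 'a) \<times> 'a => complex" where
 "rmd b a \<sigma> p = rmult_deriv \<psi> (\<psi>' b) b m (a (fst p)) \<sigma> (fst (fst p)) (snd (fst p)) (snd p)"

lemma rmd_measurable:
 assumes b: "b \<in> Basis" and [measurable]: "a \<in> BM"
 shows "rmd b a \<sigma> \<in> BM"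
proof -
 have [measurable]: "\<psi>' b \<in> BM" using \<psi>'(1)[OF b] by (auto dest: borel_measurable_integrable)
 show ?thesis unfolding rmd_def[abs_def] rmult_deriv_def symb_def by measurable
qed

text \<open>A factor \<open>y \<cdot> b\<close> in the source is a derivative of the multiplier in velocity.\<close>

lemma avg_integrate_by_parts:
 assumes b: "b \<in> Basis" and \<Gamma>: "admissible \<Gamma>" "admissible (%p. cor (snd p \<cdot> b) * \<Gamma> p)" and a: "a q > 0"
  and \<theta>: "continuous_on UNIV \<theta>"
 shows "avg (rm \<psi> a \<sigma>) (src h k \<theta> (%p. cor (snd p \<cdot> b) * \<Gamma> p)) q = - \<i> * avg (rmd b a \<sigma>) (src h k \<theta> \<Gamma>) q"
proof -
 define \<mu> where "\<mu> = rmult \<psi> m (a q) \<sigma> (fst q) (snd q)"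
 define \<mu>' where "\<mu>' = rmult_deriv \<psi> (\<psi>' b) b m (a q) \<sigma> (fst q) (snd q)"
 have \<mu>: "L1 \<mu>" "L1 \<mu>'" unfolding \<mu>_def \<mu>'_def by (intro rmult_integrable rmult_deriv_integrable a \<psi> \<psi>' b)+
 have FT: "FT \<mu>' y = \<i> * cor (y \<cdot> b) * FT \<mu> y" for y
 proof (rule FT_derivative[OF \<mu>(1) _ \<mu>(2)])
  show "continuous_on UNIV \<mu>" "continuous_on UNIV \<mu>'" unfolding \<mu>_def \<mu>'_def by (intro rmult_continuous rmult_deriv_continuous a \<psi> \<psi>' b)+
  show "((%s. \<mu> (v + s *\<^sub>R b)) has_vector_derivative \<mu>' v) (at 0)" for v
   unfolding \<mu>_def \<mu>'_def by (rule rmult_line[where \<psi> = \<psi> and \<psi>' = "\<psi>' b" and b = b and v = v, OF \<psi>_line[OF b] a m])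
 qed
 have "avg (rm \<psi> a \<sigma>) (src h k \<theta> (%p. cor (snd p \<cdot> b) * \<Gamma> p)) q
   = (LI z. cis (- (fst q * fst z + snd q \<cdot> fst (snd z))) * (src h k \<theta> (%p. cor (snd p \<cdot> b) * \<Gamma> p) z * FT \<mu> (snd (snd z))))"
  unfolding avg_def rm_def using avg_hat[OF src_integrable[OF \<theta> \<Gamma>(2)] \<mu>(1), of "fst q" "snd q"] by (simp add: \<mu>_def)
 also have "... = (LI z. - \<i> * (cis (- (fst q * fst z + snd q \<cdot> fst (snd z))) * (src h k \<theta> \<Gamma> z * FT \<mu>' (snd (snd z)))))"
  by (intro Bochner_Integration.integral_cong refl) (simp add: FT src_def mult_ac)
 also have "... = - \<i> * avg (rmd b a \<sigma>) (src h k \<theta> \<Gamma>) q"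
  unfolding avg_def rmd_def using avg_hat[OF src_integrable[OF \<theta> \<Gamma>(1)] \<mu>(2), of "fst q" "snd q"] by (simp add: \<mu>'_def)
 finally show ?thesis .
qed

text \<open>The components of \<open>(V X - V Y) / h\<close> along \<open>y\<close>, bounded by the Lipschitz constant.\<close>

definition slope :: "real => 'a => 'a \<times> 'a => complex" where
 "slope c b p = cor (wpot h V p / h * (snd p \<cdot> b) / (snd p \<cdot> snd p)) * wcut h c 0 p"

lemma wpot_lipschitz:
 assumes L: "L-lipschitz_on UNIV V"
 shows "\<bar>wpot h V p\<bar> <= L * (h * norm (snd p))"
proof -
 have "fst (wcoord h p) - snd (wcoord h p) = h *\<^sub>R snd p" by (simp add: wcoord_def scaleR_left_distrib[symmetric])
 then show ?thesis using lipschitz_onD[OF L, of "fst (wcoord h p)" "snd (wcoord h p)"] h by (simp add: wpot_def dist_norm)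
qed

lemma slope_facts:
 assumes L: "L-lipschitz_on UNIV V" and c: "c > 0" and b: "b \<in> Basis"
 shows "cmod (slope c b p) <= L" "admissible (slope c b)" "admissible (%p. cor (snd p \<cdot> b) * slope c b p)"
proof -
 have L0: "L >= 0" using L by (rule lipschitz_on_nonneg)
 have yb: "\<bar>y \<cdot> b\<bar> <= norm y" for y :: 'a by (rule Basis_le_norm[OF b])
 show le: "cmod (slope c b p) <= L" for p
 proof (cases "snd p = 0")
  case False
  have "\<bar>wpot h V p / h * (snd p \<cdot> b) / (snd p \<cdot> snd p)\<bar> = \<bar>wpot h V p\<bar> * \<bar>snd p \<cdot> b\<bar> / (h * (norm (snd p))^2)"
   using h by (simp add: abs_mult power2_norm_eq_inner)
  also have "... <= (L * (h * norm (snd p))) * norm (snd p) / (h * (norm (snd p))^2)" using wpot_lipschitz[OF L, of p] yb[of "snd p"] h by (intro divide_right_mono mult_mono) auto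
  also have "... = L" using h False by (simp add: power2_eq_square)
  finally have *: "\<bar>wpot h V p / h * (snd p \<cdot> b) / (snd p \<cdot> snd p)\<bar> <= L" .
  show ?thesis unfolding slope_def norm_mult norm_of_real using mult_mono[OF * wcut_le_1[OF c, of p]] L0 by simp
 qed (use L0 in \<open>simp add: slope_def\<close>)
 have [measurable]: "wcut h c 0 \<in> BM" "wpot h V \<in> BM" by (auto intro!: borel_measurable_continuous_onI wcut_continuous wpot_continuous V)
 have supp: "slope c b p = 0" if "1 / sqrt (c * min 2 (h^2 / 2)) < norm p" for p using wcut_zero[OF c h that] by (simp add: slope_def)
 show "admissible (slope c b)" unfolding admissible_def using le supp by (intro conjI exI[of _ L] exI[of _ "1 / sqrt (c * min 2 (h^2 / 2))"]) (auto simp: slope_def[abs_def])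
 obtain D where D: "!!p. cmod (cor (wpot h V p) * wcut h c 0 p) <= D" using admissible_bounded[OF admissible_wcuts(2)[OF c]] by blast
 have "cmod (cor (snd p \<cdot> b) * slope c b p) <= D / h" for p
 proof (cases "snd p = 0")
  case False
  have "(snd p \<cdot> b)^2 <= snd p \<cdot> snd p" using abs_le_square_iff[of "snd p \<cdot> b" "norm (snd p)"] yb[of "snd p"] by (simp add: power2_norm_eq_inner)
  then have q: "(snd p \<cdot> b)^2 / (snd p \<cdot> snd p) <= 1" using False by simp
  define s where "s = \<bar>snd p \<cdot> b\<bar>"
  have sq: "(snd p \<cdot> b)^2 = s * s" by (simp add: s_def power2_eq_square)
  have "cmod (cor (snd p \<cdot> b) * slope c b p) = s * (\<bar>wpot h V p\<bar> / h * s / (snd p \<cdot> snd p) * cmod (wcut h c 0 p))"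
   using h unfolding slope_def norm_mult norm_of_real abs_mult abs_divide s_def by simp
  also have "... = (snd p \<cdot> b)^2 / (snd p \<cdot> snd p) * (cmod (cor (wpot h V p) * wcut h c 0 p) / h)" unfolding sq by (simp add: norm_mult mult_ac)
  also have "... <= 1 * (D / h)" using q D[of p] h by (intro mult_mono divide_right_mono) auto
  finally show ?thesis by simp
 qed (use order_trans[OF norm_ge_zero D] h in \<open>simp add: slope_def\<close>)
 then show "admissible (%p. cor (snd p \<cdot> b) * slope c b p)"
  unfolding admissible_def using supp by (intro conjI exI[of _ "D / h"] exI[of _ "1 / sqrt (c * min 2 (h^2 / 2))"]) (auto simp: slope_def[abs_def])
qed

lemma slope_sum:
 assumes L: "L-lipschitz_on UNIV V"
 shows "cor (wpot h V p) * wcut h c 0 p = cor h * (\<Sum>b\<in>Basis. cor (snd p \<cdot> b) * slope c b p)"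
proof (cases "snd p = 0")
 case True
 then show ?thesis using wpot_lipschitz[OF L, of p] by (simp add: slope_def)
next
 case False
 have "(\<Sum>b\<in>Basis. cor (snd p \<cdot> b) * slope c b p)
   = (\<Sum>b\<in>Basis. cor ((snd p \<cdot> b) * (snd p \<cdot> b)) * (cor (wpot h V p / h / (snd p \<cdot> snd p)) * wcut h c 0 p))" by (intro sum.cong refl) (simp add: slope_def)
 also have "... = cor (snd p \<cdot> snd p) * (cor (wpot h V p / h / (snd p \<cdot> snd p)) * wcut h c 0 p)"
  unfolding sum_distrib_right[symmetric] of_real_sum[symmetric] euclidean_inner[of "snd p" "snd p", symmetric] ..
 finally show ?thesis using False h by simp
qed

lemma avg_potential:
 assumes L: "L-lipschitz_on UNIV V" and c: "c > 0" and a: "a q > 0" and \<theta>: "continuous_on UNIV \<theta>"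
 shows "avg (rm \<psi> a \<sigma>) (src h k \<theta> (%p. cor (wpot h V p) * wcut h c 0 p)) q
    = cor h * (\<Sum>b\<in>Basis. - \<i> * avg (rmd b a \<sigma>) (src h k \<theta> (slope c b)) q)"
proof -
 define S where "S b = src h k \<theta> (%p. cor (snd p \<cdot> b) * slope c b p)" for b
 have Si: "L1 (S b)" if "b \<in> Basis" for b unfolding S_def by (rule src_integrable[OF \<theta> slope_facts(3)[OF L c that]])
 have "src h k \<theta> (%p. cor (wpot h V p) * wcut h c 0 p) = (%z. cor h * (\<Sum>b\<in>Basis. S b z))" unfolding slope_sum[OF L] by (simp add: fun_eq_iff src_def S_def sum_distrib_left mult_ac)
 then have F: "FT (src h k \<theta> (%p. cor (wpot h V p) * wcut h c 0 p)) \<kappa> = cor h * (\<Sum>b\<in>Basis. FT (S b) \<kappa>)" for \<kappa>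
  by (simp only: FT_cmult) (simp add: FT_def sum_distrib_left Bochner_Integration.integral_sum FT_integrable Si)
 have r: "L1 (%v. rm \<psi> a \<sigma> (q, v))" using rmult_integrable[OF a \<psi>(1,2)] by (simp add: rm_def)
 have "avg (rm \<psi> a \<sigma>) (src h k \<theta> (%p. cor (wpot h V p) * wcut h c 0 p)) q
   = (LI v. cor h * (\<Sum>b\<in>Basis. rm \<psi> a \<sigma> (q, v) * FT (S b) (fst q, (snd q, v))))" by (simp only: avg_def F) (simp add: sum_distrib_left mult_ac)
 also have "... = cor h * (\<Sum>b\<in>Basis. avg (rm \<psi> a \<sigma>) (S b) q)" unfolding avg_def
  by (subst integral_mult_right_zero, subst Bochner_Integration.integral_sum) (auto intro!: avg_integrable Si r)
 also have "(\<Sum>b\<in>Basis. avg (rm \<psi> a \<sigma>) (S b) q) = (\<Sum>b\<in>Basis. - \<i> * avg (rmd b a \<sigma>) (src h k \<theta> (slope c b)) q)"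
  unfolding S_def by (intro sum.cong refl avg_integrate_by_parts slope_facts[OF L c] a \<theta>)
 finally show ?thesis .
qed

text \<open>
 With \<open>a\<^sup>2 = max 1 |k|\<close> the resolvent weight absorbs both the factor \<open>a\<close> in front of the
 kernel and the factor \<open>|k| / a\<close> that the velocity derivative costs; the jumps at the end
 points of the time interval are controlled by \<open>resolvent_weight_boundary\<close>.
\<close>

theorem regular_quarter:
 assumes L: "L-lipschitz_on UNIV V" and C0: "M / h ^ DIM('a) <= C0" and C: "C > 0" and Cb: "Cb > 0"
  and res: "!!\<alpha> \<tau> (\<kappa>::'a). \<alpha> > 0 ==> \<exists>i\<ge>0. resolvent_weight N m \<alpha> \<tau> \<kappa> = enn i \<and>
    i <= C / \<alpha>^2 \<and> norm \<kappa> * i <= C / \<alpha> \<and> (\<alpha>^2 + \<tau>^2) * i <= C * (1 + norm \<kappa> / \<alpha>)"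
  and resb: "!!\<kappa>::'a. (NI \<tau>. enn (sqrt (1 + \<bar>\<tau>\<bar> + norm \<kappa>)) * resolvent_weight N m (sqrt (max 1 (norm \<kappa>))) \<tau> \<kappa>) <= enn Cb"
 defines "P \<equiv> (2 * pi) ^ (1 + 2 * DIM('a))" and "P0 \<equiv> (2 * pi) ^ (2 * DIM('a))"
 defines "X1 \<equiv> B * (4 * C) * P * (4 * T * C0)" and "X2 \<equiv> 2 * B * (1 + 1 / m^2) * (4 * C) * P * (L^2 * (4 * T * C0))" and "X3 \<equiv> B * Cb * P0 * (2 * C0)"
 shows "regular (%q. sqrt (1 + \<bar>fst q\<bar> + norm (snd q))) (2 * X1 + 2 * (2 * (4 ^ DIM('a) * X2) + 2 * (2 * X3 + 2 * X3)))
   (vmean \<psi> (%z. k (fst z, wcoord h (snd z))))"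
proof -
 define w where "w q = sqrt (1 + \<bar>fst q\<bar> + norm (snd q))" for q :: "real \<times> 'a"
 define a where "a q = sqrt (max 1 (norm (snd q)))" for q :: "real \<times> 'a"
 define \<theta> where "\<theta> t = (1::real)" for t :: real
 have [measurable]: "w \<in> BM" "a \<in> BM" unfolding w_def[abs_def] a_def[abs_def] by measurable
 have w: "w q >= 0" for q by (simp add: w_def)
 have a1: "a q >= 1" for q by (simp add: a_def)
 have a0: "a q > 0" for q using a1[of q] by simp
 have \<theta>c: "continuous_on UNIV \<theta>" by (simp add: \<theta>_def)
 have \<theta>1: "\<bar>\<theta> t\<bar> <= 1" if "t \<in> {-T..T}" for t by (simp add: \<theta>_def)
 have C0': "C0 >= 0" using C0 M_nonneg h by (meson order_trans divide_nonneg_nonneg zero_le_power less_imp_le)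
 have weight: "enn (w q * (a q)^2) * resolvent_weight N m (a q) (fst q) (snd q) <= enn (4 * C)" for q
 proof -
  obtain i where i: "i >= 0" "resolvent_weight N m (a q) (fst q) (snd q) = enn i" "i <= C / (a q)^2" "norm (snd q) * i <= C / a q"
   "((a q)^2 + (fst q)^2) * i <= C * (1 + norm (snd q) / a q)" using res[OF a0] by metis
  have "w q * ((a q)^2 * i) <= 4 * C" unfolding w_def by (rule quarter_derivative_arith[OF i(1,3,4,5) a_def _ C]) simp
  then have "enn (w q * (a q)^2 * i) <= enn (4 * C)" by (intro ennreal_leI) (simp add: mult.assoc)
  then show ?thesis using w by (simp add: i(2) ennreal_mult'' i(1))
 qed
 have kern: "wbound w X1 (%q. cor (a q) * avg (rm \<psi> a 1) (src h k \<theta> (wcut h c 0)) q)" if c: "c > 0" for c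
 proof (rule wbound_mult)
  have N2: "N2 (src h k \<theta> (wcut h c 0)) <= enn (4 * T * C0)" using src_N2'[OF \<theta>1 wcut_le_1[OF c] _ C0] by simp
  show "wbound (%q. w q * (a q)^2) X1 (avg (rm \<psi> a 1) (src h k \<theta> (wcut h c 0)))" unfolding X1_def P_def
  proof (rule avg_wbound[OF src_integrable[OF \<theta>c admissible_wcuts(1)[OF c]] N2])
   fix q
   have "enn (w q * (a q)^2) * N2 (%v. rm \<psi> a 1 (q, v)) <= enn (w q * (a q)^2) * (enn B * resolvent_weight N m (a q) (fst q) (snd q))" by (intro mult_left_mono N2_rm \<psi>) auto
   also have "... <= enn B * enn (4 * C)" using mult_left_mono[OF weight, of "enn B" q] by (simp only: mult_ac zero_le)
   finally show "enn (w q * (a q)^2) * N2 (%v. rm \<psi> a 1 (q, v)) <= enn (B * (4 * C))" using B by (simp add: ennreal_mult')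
  qed (use w B C T C0' in auto)
 qed measurable
 have pot: "wbound w X2 (avg (rmd b a 1) (src h k \<theta> (slope c b)))" if c: "c > 0" and b: "b \<in> Basis" for c b unfolding X2_def P_def
 proof (rule avg_wbound[OF src_integrable[OF \<theta>c slope_facts(2)[OF L c b]] _ rmd_measurable[OF b]])
  show "N2 (src h k \<theta> (slope c b)) <= enn (L^2 * (4 * T * C0))" using src_N2'[OF \<theta>1 slope_facts(1)[OF L c b] _ C0] by simp
  fix q
  have sq: "1 + (norm (snd q) / (m * a q))^2 <= (1 + 1 / m^2) * (a q)^2"
  proof -
   have aa: "(a q)^2 >= 1" "norm (snd q) <= (a q)^2" by (auto simp: a_def)
   have "(norm (snd q) / (m * a q))^2 = (norm (snd q))^2 / (m^2 * (a q)^2)" by (simp add: power_divide power_mult_distrib)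
   also have "... <= ((a q)^2)^2 / (m^2 * (a q)^2)" by (intro divide_right_mono power_mono aa) auto
   also have "... = 1 / m^2 * (a q)^2" using a0[of q] by (simp add: power2_eq_square)
   finally show ?thesis using aa by (simp add: distrib_right)
  qed
  have "N2 (%v. rmd b a 1 (q, v)) <= enn (2 * B * (1 + (norm (snd q) / (m * a q))^2)) * resolvent_weight N m (a q) (fst q) (snd q)"
   using N2_rmult_deriv[of 1 "a q" m b \<psi> B N "\<psi>' b" "fst q" "snd q"] a0 m b \<psi>(3) \<psi>'(3)[OF b] B by (simp add: rmd_def)
  also have "... <= enn (2 * B * (1 + 1 / m^2) * (a q)^2) * resolvent_weight N m (a q) (fst q) (snd q)"
   using mult_left_mono[OF sq, of "2 * B"] B by (intro mult_right_mono ennreal_leI) (auto simp: mult.assoc)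
  finally have "enn (w q) * N2 (%v. rmd b a 1 (q, v)) <= enn (w q) * (enn (2 * B * (1 + 1 / m^2) * (a q)^2) * resolvent_weight N m (a q) (fst q) (snd q))" by (rule mult_left_mono) simp
  also have "... = enn (2 * B * (1 + 1 / m^2)) * (enn (w q * (a q)^2) * resolvent_weight N m (a q) (fst q) (snd q))"
   using B w[of q] by (simp only: ennreal_mult zero_le_power2 mult_nonneg_nonneg zero_le_numeral add_nonneg_nonneg zero_le_one divide_nonneg_nonneg mult_ac)
  also have "... <= enn (2 * B * (1 + 1 / m^2)) * enn (4 * C)" by (intro mult_left_mono weight) auto
  also have "... = enn (2 * B * (1 + 1 / m^2) * (4 * C))" using C by (intro ennreal_mult''[symmetric]) simp
  finally show "enn (w q) * N2 (%v. rmd b a 1 (q, v)) <= enn (2 * B * (1 + 1 / m^2) * (4 * C))" .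
 qed (use w B C T C0' in auto)
 have bdry: "wbound w X3 (avg0 (rm \<psi> a 1) (slice t c))" if t: "t \<in> {-T..T}" and c: "c > 0" for t c unfolding X3_def P0_def
 proof (rule avg0_wbound[OF slice_facts(1,2)[OF t c C0]])
  fix \<kappa> :: 'a
  have "(NI \<tau>. enn (w (\<tau>, \<kappa>)) * N2 (%v. rm \<psi> a 1 ((\<tau>, \<kappa>), v)))
    <= (NI \<tau>. enn B * (enn (sqrt (1 + \<bar>\<tau>\<bar> + norm \<kappa>)) * resolvent_weight N m (sqrt (max 1 (norm \<kappa>))) \<tau> \<kappa>))"
  proof (rule nn_integral_mono)
   fix \<tau> :: real
   have "enn (w (\<tau>, \<kappa>)) * N2 (%v. rm \<psi> a 1 ((\<tau>, \<kappa>), v)) <= enn (w (\<tau>, \<kappa>)) * (enn B * resolvent_weight N m (a (\<tau>, \<kappa>)) \<tau> \<kappa>)"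
    using N2_rm[of \<psi> 1 a "(\<tau>, \<kappa>)"] \<psi>(3) by (intro mult_left_mono) auto
   then show "enn (w (\<tau>, \<kappa>)) * N2 (%v. rm \<psi> a 1 ((\<tau>, \<kappa>), v))
     <= enn B * (enn (sqrt (1 + \<bar>\<tau>\<bar> + norm \<kappa>)) * resolvent_weight N m (sqrt (max 1 (norm \<kappa>))) \<tau> \<kappa>)" by (simp add: w_def a_def mult_ac)
  qed
  also have "... = enn B * (NI \<tau>. enn (sqrt (1 + \<bar>\<tau>\<bar> + norm \<kappa>)) * resolvent_weight N m (sqrt (max 1 (norm \<kappa>))) \<tau> \<kappa>)"
   unfolding resolvent_weight_def by (rule nn_integral_cmult) measurable
  also have "... <= enn B * enn Cb" by (intro mult_left_mono resb) auto
  finally show "(NI \<tau>. enn (w (\<tau>, \<kappa>)) * N2 (%v. rm \<psi> a 1 ((\<tau>, \<kappa>), v))) <= enn (B * Cb)" using B by (simp add: ennreal_mult')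
 qed (use w B Cb C0' in auto)
 have bdry': "wbound w X3 (%q. (- 1) * (u q * avg0 (rm \<psi> a 1) (slice t c) q))"
  if t: "t \<in> {-T..T}" and c: "c > 0" and u: "!!q. cmod (u q) = 1" and [measurable]: "u \<in> BM" for t c u
 proof (rule wbound_mono[OF bdry[OF t c] order_refl])
  have [measurable]: "avg0 (rm \<psi> a 1) (slice t c) \<in> BM" using bdry[OF t c] by (rule wbound_measurable)
  show "(%q. (- 1) * (u q * avg0 (rm \<psi> a 1) (slice t c) q)) \<in> BM" by measurable
 qed (simp_all add: norm_mult u w)
 obtain Y where Y: "!!n. wbound (%q. decay 2 (snd q)) (Y * (1 / real (Suc n))) (err \<theta> (1 / real (Suc n)) a 1)"
  by (rule err_wbound[where a = a and \<sigma> = 1, OF \<theta>c \<theta>1 a1 _ power_one]) auto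
 define c where "c n = 1 / real (Suc n)" for n
 have c: "c n > 0" for n by (simp add: c_def)
 define G where "G n = vmean \<psi> (src h k \<theta> (wcut h (c n) 0))" for n
 define A where "A n q = cor (a q) * avg (rm \<psi> a 1) (src h k \<theta> (wcut h (c n) 0)) q
   + ((\<Sum>b\<in>Basis. (- 1) * avg (rmd b a 1) (src h k \<theta> (slope (c n) b)) q)
   + ((- 1) * (cis (- (fst q * T)) * avg0 (rm \<psi> a 1) (slice T (c n)) q) + (- 1) * (- cis (fst q * T) * avg0 (rm \<psi> a 1) (slice (- T) (c n)) q)))" for n q
 have A: "wbound w (2 * X1 + 2 * (2 * (4 ^ DIM('a) * X2) + 2 * (2 * X3 + 2 * X3))) (A n)" for n
 proof -
  have X2: "X2 >= 0" using B C C0' T by (simp add: X2_def P_def)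
  have p: "wbound w X2 (%q. (- 1) * avg (rmd b a 1) (src h k \<theta> (slope (c n) b)) q)" if "b \<in> Basis" for b using wbound_cmult[OF pot[OF c that], of "-1" n] by simp
  show ?thesis unfolding A_def[abs_def] by (intro wbound_add wbound_sum kern p bdry' w X2 c) (use T in auto)
 qed
 have FT: "FT (G n) q = A n q + err \<theta> (c n) a 1 q" for n q
 proof -
  have z: "src h k (%t. 0) W = (%z. 0)" for W by (simp add: src_def fun_eq_iff)
  have "FT (G n) q = avg (%p. \<psi> (snd p)) (src h k \<theta> (wcut h (c n) 0)) q" unfolding G_def by (rule vmean_FT(2)[OF src_integrable[OF \<theta>c admissible_wcuts(1)[OF c]] \<psi>(1)])
  also have "... = A n q + err \<theta> (c n) a 1 q" using averaged_identity[of \<theta> "%t. 0" "c n" a q 1] a0[of q] c[of n] h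
   by (simp add: \<theta>_def[abs_def] z A_def avg_potential[OF L c a0] avg_def[of _ "%z. 0"] FT_def[of "%z. 0"] sum_negf sum_distrib_left mult.assoc)
  finally show ?thesis .
 qed
 have "regular w (2 * X1 + 2 * (2 * (4 ^ DIM('a) * X2) + 2 * (2 * X3 + 2 * X3))) (vmean \<psi> (%z. k (fst z, wcoord h (snd z))))" unfolding regular_def
 proof (intro conjI exI allI)
  show "vmean \<psi> (%z. k (fst z, wcoord h (snd z))) \<in> L2" by (rule vmean_L2[OF wk_L2 FT_\<psi>_L2])
  show "G n \<in> L2" "L1 (G n)" for n unfolding G_def by (rule vmean_L2[OF src_L2[OF \<theta>c admissible_wcuts(1)[OF c]] FT_\<psi>_L2],
    rule vmean_FT(1)[OF src_integrable[OF \<theta>c admissible_wcuts(1)[OF c]] \<psi>(1)])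
  show "FT (G n) q = A n q + err \<theta> (c n) a 1 q" for n q by (rule FT)
  show "wbound w (2 * X1 + 2 * (2 * (4 ^ DIM('a) * X2) + 2 * (2 * X3 + 2 * X3))) (A n)" for n by (rule A)
  show "wbound (%q. decay 2 (snd q)) (Y * (1 / real (Suc n))) (err \<theta> (c n) a 1)" for n using Y by (simp add: c_def)
  show "(%n. N2 (%q. G n q - vmean \<psi> (%z. k (fst z, wcoord h (snd z))) q)) ----> 0" unfolding G_def c_def by (rule vmean_tendsto[OF wk_L2 src_L2[OF \<theta>c admissible_wcuts(1)] FT_\<psi>_L2])
     (use src_cutoff_tendsto(2)[of \<theta>] in \<open>simp_all add: \<theta>_def[abs_def]\<close>)
 qed
 then show ?thesis by (simp only: w_def[abs_def])
qed

end


section \<open>Continuation by damped free transport\<close>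

text \<open>
 The velocity average of the solution jumps at the ends of the time interval when it is continued by
 zero, and functions with jumps are not half a derivative smooth.  Past an end point it is therefore
 continued by free transport, damped at the rate \<open>a\<close>: the transform of the continuation is exactly the
 boundary term of the averaged equation.
\<close>

lemma exponential_half_line:
 fixes z :: complex
 assumes z: "Re z > 0"
 shows "L1 (%s::real. indicator {0<..} s *\<^sub>R exp (- (z * cor s)))"
  and "(LI s. indicator {0<..} s *\<^sub>R exp (- (z * cor s))) = 1 / z"
proof -
 define a where "a = Re z"
 have a: "a > 0" using z by (simp add: a_def)
 have "(NI s. enn (exp (- (a * s))) * indicator {0..} s) = 0 - (- exp (- (a * 0)) / a)"
 proof (rule nn_integral_FTC_atLeast)
  show "((%s. - exp (- (a * s)) / a) has_real_derivative exp (- (a * s))) (at s)" for s using a by (auto intro!: derivative_eq_intros)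
  show "((%s. - exp (- (a * s)) / a) \<longlongrightarrow> 0) at_top" using a by real_asymp
 qed auto
 then have fin: "(NI s. enn (exp (- (a * s))) * indicator {0..} s) < \<infinity>" by simp
 show int: "L1 (%s::real. indicator {0<..} s *\<^sub>R exp (- (z * cor s)))"
 proof (rule integrableI_bounded)
  have "(NI s. enn (norm (indicator {0<..} s *\<^sub>R exp (- (z * cor s))))) <= (NI s. enn (exp (- (a * s))) * indicator {0..} s)" by (intro nn_integral_mono) (auto simp: indicator_def a_def)
  then show "(NI s. enn (norm (indicator {0<..} s *\<^sub>R exp (- (z * cor s))))) < \<infinity>" using fin by (rule le_less_trans)
 qed measurable
 have z0: "z ~= 0" using z by auto
 have lim: "((%s. - exp (- (z * cor s)) / z) \<longlongrightarrow> 0) at_top"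
 proof (rule tendsto_norm_zero_cancel)
  have "((%s. exp (- (a * s)) / cmod z) \<longlongrightarrow> 0) at_top" using a z0 by real_asymp
  then show "((%s. norm (- exp (- (z * cor s)) / z)) \<longlongrightarrow> 0) at_top" by (simp add: norm_divide a_def)
 qed
 have d: "((%s. - exp (- (z * cor s)) / z) has_vector_derivative exp (- (z * cor s))) (at s)" for s
 proof -
  have "((%w. - exp (- (z * w)) / z) has_field_derivative exp (- (z * cor s))) (at (cor s))" using z0 by (auto intro!: derivative_eq_intros)
  then show ?thesis by (rule has_vector_derivative_real_field)
 qed
 have "(LBINT s=ereal 0..\<infinity>. exp (- (z * cor s))) = 0 - (- exp (- (z * cor 0)) / z)"
 proof (rule interval_integral_FTC_integrable[where F = "%s. - exp (- (z * cor s)) / z"])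
  show "set_integrable lborel (einterval (ereal 0) \<infinity>) (%s. exp (- (z * cor s)))" using int by (simp add: set_integrable_def)
  have "continuous (at_right 0) (%s. - exp (- (z * cor s)) / z)" by (intro continuous_intros z0)
  then show "(((%s. - exp (- (z * cor s)) / z) \<circ> real_of_ereal) \<longlongrightarrow> - exp (- (z * cor 0)) / z) (at_right (ereal 0))" unfolding ereal_tendsto_simps by (simp add: continuous_within)
  show "(((%s. - exp (- (z * cor s)) / z) \<circ> real_of_ereal) \<longlongrightarrow> 0) (at_left \<infinity>)" unfolding ereal_tendsto_simps by (rule lim)
 qed (use d in \<open>auto intro!: continuous_intros\<close>)
 then show "(LI s. indicator {0<..} s *\<^sub>R exp (- (z * cor s))) = 1 / z" by (simp add: interval_lebesgue_integral_def set_lebesgue_integral_def)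
qed

text \<open>It is supported after \<open>T\<close> if \<open>\<sigma> = 1\<close> and before \<open>-T\<close> if \<open>\<sigma> = -1\<close>.\<close>

definition damp :: "real => real => real => real => real" where
 "damp T a \<sigma> t = indicator {0<..} (\<sigma> * t - T) * exp (- (a * (\<sigma> * t - T)))"

lemma damp_measurable [measurable]: "damp T a \<sigma> \<in> BM" unfolding damp_def[abs_def] by measurable

lemma damp_shift: "\<sigma>^2 = 1 ==> damp T a \<sigma> (\<sigma> * T + \<sigma> * s) = indicator {0<..} s * exp (- (a * s))" by (simp add: damp_def distrib_left mult.assoc[symmetric] power2_eq_square)

lemma damp_integrable:
 assumes "a > 0" "\<sigma>^2 = 1"
 shows "L1 (%t. cor (damp T a \<sigma> t))" "N2 (%t. cor (damp T a \<sigma> t)) < \<infinity>"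
proof -
 have \<sigma>: "\<sigma> ~= 0" using assms by auto
 have I: "L1 (%t. cor (damp T a \<sigma> t))" if "a > 0" for a
 proof -
  have "L1 (%s. cor (damp T a \<sigma> (\<sigma> * T + \<sigma> * s)))" unfolding damp_shift[OF assms(2)] using exponential_half_line(1)[of "cor a"] that
   by (simp add: scaleR_conv_of_real exp_of_real[symmetric])
  then show ?thesis by (subst (asm) lborel_integrable_real_affine_iff[OF \<sigma>])
 qed
 show "L1 (%t. cor (damp T a \<sigma> t))" by (rule I[OF assms(1)])
 have "(NI t. enn (cmod (cor (damp T (2 * a) \<sigma> t)))) < \<infinity>" using I[of "2 * a"] assms(1) by (simp add: integrable_iff_bounded)
 also have "(NI t. enn (cmod (cor (damp T (2 * a) \<sigma> t)))) = N2 (%t. cor (damp T a \<sigma> t))"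
  unfolding N2_def by (intro nn_integral_cong arg_cong[of _ _ ennreal]) (auto simp: damp_def indicator_def power2_eq_square exp_add[symmetric] algebra_simps)
 finally show "N2 (%t. cor (damp T a \<sigma> t)) < \<infinity>" .
qed

text \<open>The Laplace transform of the damped wave is the resolvent.\<close>

lemma damp_transform:
 assumes a: "a > 0" and \<sigma>: "\<sigma>^2 = 1"
 shows "(LI t. cis (- (\<tau> * t)) * (cor (damp T a \<sigma> t) * cis (- ((t - \<sigma> * T) / m * (k \<cdot> v)))))
    = cis (- (\<tau> * (\<sigma> * T))) / symb m a \<sigma> \<tau> k v"
proof -
 have \<sigma>0: "\<sigma> ~= 0" "\<bar>\<sigma>\<bar> = 1" using \<sigma> by (auto simp: power2_eq_1_iff)
 have "(LI t. cis (- (\<tau> * t)) * (cor (damp T a \<sigma> t) * cis (- ((t - \<sigma> * T) / m * (k \<cdot> v)))))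
   = (LI s. cis (- (\<tau> * (\<sigma> * T + \<sigma> * s))) * (cor (damp T a \<sigma> (\<sigma> * T + \<sigma> * s)) * cis (- ((\<sigma> * T + \<sigma> * s - \<sigma> * T) / m * (k \<cdot> v)))))"
  by (subst lborel_integral_real_affine[OF \<sigma>0(1), where t = "\<sigma> * T"]) (simp add: \<sigma>0)
 also have "... = (LI s. cis (- (\<tau> * (\<sigma> * T))) * (indicator {0<..} s *\<^sub>R exp (- (symb m a \<sigma> \<tau> k v * cor s))))"
 proof (intro Bochner_Integration.integral_cong refl)
  fix s
  have "cis (- (\<tau> * (\<sigma> * T + \<sigma> * s))) * (cor (exp (- (a * s))) * cis (- ((\<sigma> * T + \<sigma> * s - \<sigma> * T) / m * (k \<cdot> v))))
    = cis (- (\<tau> * (\<sigma> * T))) * exp (- (symb m a \<sigma> \<tau> k v * cor s))" by (simp add: cis_conv_exp exp_of_real[symmetric] exp_add[symmetric] symb_def algebra_simps add_divide_distrib)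
  then show "cis (- (\<tau> * (\<sigma> * T + \<sigma> * s))) * (cor (damp T a \<sigma> (\<sigma> * T + \<sigma> * s)) * cis (- ((\<sigma> * T + \<sigma> * s - \<sigma> * T) / m * (k \<cdot> v))))
    = cis (- (\<tau> * (\<sigma> * T))) * (indicator {0<..} s *\<^sub>R exp (- (symb m a \<sigma> \<tau> k v * cor s)))" unfolding damp_shift[OF \<sigma>] by (cases "s > 0") auto
 qed
 also have "... = cis (- (\<tau> * (\<sigma> * T))) * (1 / symb m a \<sigma> \<tau> k v)"
 proof -
  have "0 < Re (symb m a \<sigma> \<tau> k v)" using a by (simp add: symb_def)
  then show ?thesis by (simp only: integral_mult_right_zero exponential_half_line(2))
 qed
 finally show ?thesis by simp
qed

text \<open>The transform in the second variable alone, which turns a kernel into a phase space function.\<close>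

definition pft :: "('a::euclidean_space \<times> 'a => complex) => 'a \<times> 'a => complex" where
 "pft K p = FT (%y. K (fst p, y)) (snd p)"

lemma pft_measurable [measurable]:
 assumes [measurable]: "K \<in> BM"
 shows "pft K \<in> BM" unfolding pft_def[abs_def] FT_def by measurable

lemma N2_pft_diff:
 fixes K K' :: "'a::euclidean_space \<times> 'a => complex"
 assumes K: "L1 K" "L1 K'"
 shows "N2 (%p. pft K p - pft K' p) <= enn ((2 * pi) ^ DIM('a)) * N2 (%p. K p - K' p)"
proof -
 have [measurable]: "K \<in> BM" "K' \<in> BM" using K by (auto dest: borel_measurable_integrable)
 have "N2 (%p. pft K p - pft K' p) = (NI x. N2 (%v. pft K (x, v) - pft K' (x, v)))" unfolding N2_def by (subst nn_integral_prod_fst) auto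
 also have "... <= (NI x. enn ((2 * pi) ^ DIM('a)) * N2 (%y. K (x, y) - K' (x, y)))"
 proof (rule nn_integral_mono_AE, use AE_integrable_section_fst[OF K(1)] AE_integrable_section_fst[OF K(2)] in eventually_elim)
  case (elim x)
  have "N2 (FT (%y. K (x, y) - K' (x, y))) <= enn ((2 * pi) ^ DIM('a)) * N2 (%y. K (x, y) - K' (x, y))" by (rule Plancherel_inequality[OF Bochner_Integration.integrable_diff[OF elim]])
  moreover have "FT (%y. K (x, y) - K' (x, y)) = (%v. FT (%y. K (x, y)) v - FT (%y. K' (x, y)) v)" by (rule ext) (rule FT_diff[OF elim])
  ultimately show ?case by (simp add: pft_def)
 qed
 also have "... = enn ((2 * pi) ^ DIM('a)) * N2 (%p. K p - K' p)" using nn_integral_prod_fst[of "%p. enn ((cmod (K p - K' p))^2)"] unfolding N2_def by (subst nn_integral_cmult) auto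
 finally show ?thesis .
qed

lemma pft_L2:
 assumes "L1 K" "K \<in> L2"
 shows "pft K \<in> L2"
proof -
 have [measurable]: "K \<in> BM" using assms by auto
 have z: "pft (%p. 0) = (%p. 0)" by (simp add: pft_def[abs_def] FT_def)
 show ?thesis using N2_pft_diff[OF assms(1), of "%p. 0"] L2_N2_finite[OF assms(2)] by (auto simp: L2_iff z ennreal_mult_less_top intro: le_less_trans)
qed

definition flow :: "real => real => real => real => ('a::euclidean_space \<times> 'a => complex) => (real \<times> 'a) \<times> 'a => complex" where
 "flow T m a \<sigma> F p = cor (damp T a \<sigma> (fst (fst p))) *
   F (snd (fst p) - ((fst (fst p) - \<sigma> * T) / m) *\<^sub>R snd p, snd p)"

definition continuation :: "real => real => real => real => ('a::euclidean_space => complex) => ('a \<times> 'a => complex) => real \<times> 'a => complex" where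
 "continuation T m a \<sigma> \<psi> F q = (LI v. flow T m a \<sigma> F (q, v) * \<psi> v)"

lemma flow_measurable [measurable]:
 assumes [measurable]: "F \<in> BM"
 shows "flow T m a \<sigma> F \<in> BM" unfolding flow_def[abs_def] by measurable

text \<open>Transport preserves the measure of phase space.\<close>

lemma nn_integral_flow:
 fixes F :: "'a::euclidean_space \<times> 'a => complex" and g :: "'a => ennreal"
 assumes [measurable]: "F \<in> BM" "g \<in> BM" "f \<in> BM"
  and f: "!!u d. f (u * d) = f u * (f d :: ennreal)"
 shows "(NI p. f (flow T m a \<sigma> F p) * g (snd p))
    = (NI t. f (cor (damp T a \<sigma> t))) * (NI v. (NI x. f (F (x, v))) * g v)"
proof -
 define d where "d t = (t - \<sigma> * T) / m" for t
 have inner: "(NI x. NI v. f (flow T m a \<sigma> F ((t, x), v)) * g v)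
   = f (cor (damp T a \<sigma> t)) * (NI v. (NI x. f (F (x, v))) * g v)" for t
 proof -
  define G where "G p = f (F (fst p - d t *\<^sub>R snd p, snd p)) * g (snd p)" for p
  have [measurable]: "G \<in> BM" unfolding G_def[abs_def] by measurable
  have "(NI x. NI v. f (flow T m a \<sigma> F ((t, x), v)) * g v)
    = (NI x. NI v. f (cor (damp T a \<sigma> t)) * G (x, v))" by (simp add: flow_def f G_def d_def mult.assoc)
  also have "... = f (cor (damp T a \<sigma> t)) * (NI x. NI v. G (x, v))" by (simp add: nn_integral_cmult)
  also have "(NI x. NI v. G (x, v)) = (NI v. NI x. G (x, v))" using nn_integral_prod_fst[of G] nn_integral_prod_snd[of G] by simp
  also have "... = (NI v. (NI x. f (F (x, v))) * g v)"
  proof (intro nn_integral_cong)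
   fix v
   have "(NI x. G (x, v)) = (NI x. f (F (- (d t *\<^sub>R v) + x, v)) * g v)" by (simp add: G_def)
   also have "... = (NI x. f (F (- (d t *\<^sub>R v) + x, v))) * g v" by (rule nn_integral_multc) measurable
   also have "(NI x. f (F (- (d t *\<^sub>R v) + x, v))) = (NI x. f (F (x, v)))" by (rule nn_integral_shift) measurable
   finally show "(NI x. G (x, v)) = (NI x. f (F (x, v))) * g v" .
  qed
  finally show ?thesis .
 qed
 have "(NI p. f (flow T m a \<sigma> F p) * g (snd p)) = (NI q. NI v. f (flow T m a \<sigma> F (q, v)) * g v)" by (subst nn_integral_prod_fst) auto
 also have "... = (NI t. NI x. NI v. f (flow T m a \<sigma> F ((t, x), v)) * g v)" by (subst nn_integral_prod_fst) auto
 also have "... = (NI t. f (cor (damp T a \<sigma> t))) * (NI v. (NI x. f (F (x, v))) * g v)" unfolding inner by (rule nn_integral_multc) measurable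
 finally show ?thesis .
qed

lemma N2_flow:
 assumes [measurable]: "F \<in> BM"
 shows "N2 (flow T m a \<sigma> F) = N2 (%t. cor (damp T a \<sigma> t)) * N2 F"
 using nn_integral_flow[OF assms, of "%v. 1" "%u. enn ((cmod u)^2)" T m a \<sigma>] nn_integral_prod_snd[of "%p. enn ((cmod (F p))^2)"] by (simp add: N2_def norm_mult power_mult_distrib ennreal_mult)

lemma flow_pft_integrable:
 fixes K :: "'a::euclidean_space \<times> 'a => complex"
 assumes K: "L1 K" and \<psi>: "L1 \<psi>" and a: "a > 0" and \<sigma>: "\<sigma>^2 = 1"
 shows "L1 (%p. flow T m a \<sigma> (pft K) p * \<psi> (snd p))"
proof (rule integrableI_bounded)
 have [measurable]: "K \<in> BM" "\<psi> \<in> BM" using assms by (auto dest: borel_measurable_integrable)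
 show "(%p. flow T m a \<sigma> (pft K) p * \<psi> (snd p)) \<in> borel_measurable lborel" by measurable
 have b: "(NI x. enn (cmod (pft K (x, v)))) <= (NI p. enn (cmod (K p)))" for v
 proof -
  have "(NI x. enn (cmod (pft K (x, v)))) <= (NI x. NI y. enn (cmod (K (x, y))))"
  proof (rule nn_integral_mono_AE, use AE_integrable_section_fst[OF K] in eventually_elim)
   case (elim x)
   show ?case using integral_norm_bound_ennreal[OF FT_integrable[OF elim, of v]] by (simp add: pft_def FT_def norm_mult)
  qed
  also have "... = (NI p. enn (cmod (K p)))" by (rule nn_integral_prod_fst[symmetric]) measurable
  finally show ?thesis .
 qed
 have "(NI p. enn (norm (flow T m a \<sigma> (pft K) p * \<psi> (snd p))))
   = (NI t. enn (cmod (cor (damp T a \<sigma> t)))) * (NI v. (NI x. enn (cmod (pft K (x, v)))) * enn (cmod (\<psi> v)))"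
  using nn_integral_flow[of "pft K" "%v. enn (cmod (\<psi> v))" "%u. enn (cmod u)" T m a \<sigma>] by (simp add: norm_mult ennreal_mult)
 also have "... <= (NI t. enn (cmod (cor (damp T a \<sigma> t)))) * (NI v. (NI p. enn (cmod (K p))) * enn (cmod (\<psi> v)))" by (intro mult_left_mono nn_integral_mono mult_right_mono b) auto
 also have "... = (NI t. enn (cmod (cor (damp T a \<sigma> t)))) * ((NI p. enn (cmod (K p))) * (NI v. enn (cmod (\<psi> v))))" by (subst nn_integral_cmult) auto
 also have "... < \<infinity>" using K \<psi> damp_integrable(1)[OF a \<sigma>, of T] by (simp add: integrable_iff_bounded ennreal_mult_less_top)
 finally show "(NI p. enn (norm (flow T m a \<sigma> (pft K) p * \<psi> (snd p)))) < \<infinity>" .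
qed

lemma FT_continuation:
 fixes K :: "'a::euclidean_space \<times> 'a => complex"
 assumes K: "L1 K" and \<psi>: "L1 \<psi>" and a: "a > 0" and \<sigma>: "\<sigma>^2 = 1"
 shows "L1 (continuation T m a \<sigma> \<psi> (pft K))"
  and "FT (continuation T m a \<sigma> \<psi> (pft K)) (\<tau>, k)
    = cis (- (\<tau> * (\<sigma> * T))) * (LI v. rmult \<psi> m a \<sigma> \<tau> k v * FT K (k, v))"
proof -
 have [measurable]: "K \<in> BM" "\<psi> \<in> BM" using assms by (auto dest: borel_measurable_integrable)
 note I = flow_pft_integrable[OF assms, of T m]
 show "L1 (continuation T m a \<sigma> \<psi> (pft K))" unfolding continuation_def[abs_def] using integrable_section_integral_fst[OF I] by simp
 define H where "H p = cis (- ((\<tau>, k) \<cdot> fst p)) * (flow T m a \<sigma> (pft K) p * \<psi> (snd p))" for p :: "(real \<times> 'a) \<times> 'a"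
 have H: "L1 H" by (rule Bochner_Integration.integrable_bound[OF I]) (auto simp: H_def[abs_def] norm_mult)
 have H': "L1 (%p. H (snd p, fst p))" using lborel_pair.integrable_product_swap[of H] H by (simp add: lborel_prod case_prod_unfold)
 define d where "d t = (t - \<sigma> * T) / m" for t
 have x_int: "(LI x. cis (- (k \<cdot> x)) * pft K (x - d t *\<^sub>R v, v)) = cis (- (d t * (k \<cdot> v))) * FT K (k, v)" for t v
 proof -
  have "(LI x. cis (- (k \<cdot> x)) * pft K (x - d t *\<^sub>R v, v))
    = (LI x. cis (- (k \<cdot> (d t *\<^sub>R v + x))) * pft K (d t *\<^sub>R v + x - d t *\<^sub>R v, v))" by (rule integral_shift[symmetric]) measurable
  also have "... = (LI x. cis (- (d t * (k \<cdot> v))) * (cis (- (k \<cdot> x)) * pft K (x, v)))" by (simp add: inner_add_right cis_mult mult.assoc[symmetric] add.commute)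
  also have "... = cis (- (d t * (k \<cdot> v))) * (LI x. cis (- (k \<cdot> x)) * pft K (x, v))" by (rule integral_mult_right_zero)
  also have "(LI x. cis (- (k \<cdot> x)) * pft K (x, v)) = (LI x. LI y. cis (- ((k, v) \<cdot> (x, y))) * K (x, y))"
  proof (intro Bochner_Integration.integral_cong refl)
   fix x
   have e: "cis (- ((k, v) \<cdot> (x, y))) * K (x, y) = cis (- (k \<cdot> x)) * (cis (- (v \<cdot> y)) * K (x, y))" for y by (simp add: cis_mult)
   show "cis (- (k \<cdot> x)) * pft K (x, v) = (LI y. cis (- ((k, v) \<cdot> (x, y))) * K (x, y))" by (simp only: e pft_def FT_def fst_conv snd_conv integral_mult_right_zero)
  qed
  also have "... = FT K (k, v)" unfolding FT_def by (rule integral_prod_fst[symmetric, OF FT_integrable[OF K]])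
  finally show ?thesis .
 qed
 have "FT (continuation T m a \<sigma> \<psi> (pft K)) (\<tau>, k) = (LI q. LI v. H (q, v))" by (simp add: FT_def[of "continuation T m a \<sigma> \<psi> (pft K)"] continuation_def H_def)
 also have "... = (LI v. LI q. H (q, v))" by (rule integral_prod_swap[OF H])
 also have "... = (LI v. cis (- (\<tau> * (\<sigma> * T))) * (rmult \<psi> m a \<sigma> \<tau> k v * FT K (k, v)))"
 proof (rule integral_cong_AE)
  show "(%v. LI q. H (q, v)) \<in> borel_measurable lborel" using integrable_section_integral_fst[OF H'] by (auto dest: borel_measurable_integrable)
  show "(%v. cis (- (\<tau> * (\<sigma> * T))) * (rmult \<psi> m a \<sigma> \<tau> k v * FT K (k, v))) \<in> borel_measurable lborel" unfolding rmult_def symb_def by measurable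
  show "AE v in lborel. (LI q. H (q, v)) = cis (- (\<tau> * (\<sigma> * T))) * (rmult \<psi> m a \<sigma> \<tau> k v * FT K (k, v))" using AE_integrable_section_fst[OF H']
  proof eventually_elim
   case (elim v)
   then have "(LI q. H (q, v)) = (LI t. LI x. H ((t, x), v))" by (intro integral_prod_fst) simp
   also have "... = (LI t. (cis (- (\<tau> * t)) * (cor (damp T a \<sigma> t) * cis (- ((t - \<sigma> * T) / m * (k \<cdot> v))))) * (\<psi> v * FT K (k, v)))"
   proof (intro Bochner_Integration.integral_cong refl)
    fix t
    have "H ((t, x), v) = (cis (- (\<tau> * t)) * cor (damp T a \<sigma> t) * \<psi> v) * (cis (- (k \<cdot> x)) * pft K (x - d t *\<^sub>R v, v))" for x
    proof -
     have "cis (- ((\<tau>, k) \<cdot> (t, x))) = cis (- (\<tau> * t)) * cis (- (k \<cdot> x))" by (simp add: cis_mult)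
     then show ?thesis by (simp add: H_def flow_def d_def mult_ac)
    qed
    then have "(LI x. H ((t, x), v)) = (cis (- (\<tau> * t)) * cor (damp T a \<sigma> t) * \<psi> v) * (cis (- (d t * (k \<cdot> v))) * FT K (k, v))" by (simp only: integral_mult_right_zero x_int)
    then show "(LI x. H ((t, x), v)) = (cis (- (\<tau> * t)) * (cor (damp T a \<sigma> t) * cis (- ((t - \<sigma> * T) / m * (k \<cdot> v))))) * (\<psi> v * FT K (k, v))" by (simp add: d_def mult_ac)
   qed
   also have "... = cis (- (\<tau> * (\<sigma> * T))) / symb m a \<sigma> \<tau> k v * (\<psi> v * FT K (k, v))" by (simp only: integral_mult_left_zero damp_transform[OF a \<sigma>])
   finally show ?case by (simp add: rmult_def)
  qed
 qed
 also have "... = cis (- (\<tau> * (\<sigma> * T))) * (LI v. rmult \<psi> m a \<sigma> \<tau> k v * FT K (k, v))" by (rule integral_mult_right_zero)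
 finally show "FT (continuation T m a \<sigma> \<psi> (pft K)) (\<tau>, k) = cis (- (\<tau> * (\<sigma> * T))) * (LI v. rmult \<psi> m a \<sigma> \<tau> k v * FT K (k, v))" .
qed

text \<open>The continuation is bounded in L2 by the kernel at the end point, so it survives the removal of the cutoff.\<close>

lemma continuation_limit:
 fixes K :: "nat => 'a::euclidean_space \<times> 'a => complex"
 assumes K: "!!n. L1 (K n)" "!!n. K n \<in> L2" and lim: "(%n. N2 (%p. K n p - K0 p)) ----> 0" and [measurable]: "K0 \<in> BM"
  and \<psi>: "\<psi> \<in> L2" and a: "a > 0" and \<sigma>: "\<sigma>^2 = 1"
 obtains U where "U \<in> L2" "!!n. continuation T m a \<sigma> \<psi> (pft (K n)) \<in> L2"
  "(%n. N2 (%q. continuation T m a \<sigma> \<psi> (pft (K n)) q - U q)) ----> 0" "!!t x. \<sigma> * t <= T ==> U (t, x) = 0"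
proof -
 have [measurable]: "K n \<in> BM" for n using K(2) by auto
 have fL2: "flow T m a \<sigma> F \<in> L2" if "F \<in> L2" for F using that damp_integrable(2)[OF a \<sigma>, of T] by (auto simp: L2_iff N2_flow ennreal_mult_less_top)
 have "\<exists>F\<in>L2. (%n. N2 (%p. pft (K n) p - F p)) ----> 0"
 proof (rule L2_complete[OF pft_L2[OF K]])
  fix \<epsilon> :: real assume "\<epsilon> > 0"
  then obtain n0 where n0: "\<forall>i\<ge>n0. \<forall>j\<ge>n0. N2 (%p. K i p - K j p) <= enn (\<epsilon> / (2 * pi) ^ DIM('a))"
   using N2_tendsto_imp_Cauchy[of K K0 "\<epsilon> / (2 * pi) ^ DIM('a)"] lim by auto
  have "N2 (%p. pft (K i) p - pft (K j) p) <= enn \<epsilon>" if "i >= n0" "j >= n0" for i j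
  proof -
   have "N2 (%p. pft (K i) p - pft (K j) p) <= enn ((2 * pi) ^ DIM('a)) * enn (\<epsilon> / (2 * pi) ^ DIM('a))"
    using mult_left_mono[of _ _ "enn ((2 * pi) ^ DIM('a))"] n0 that by (intro order_trans[OF N2_pft_diff[OF K(1) K(1)]]) auto
   also have "... = enn \<epsilon>" using \<open>\<epsilon> > 0\<close> by (simp add: ennreal_mult'[symmetric])
   finally show ?thesis .
  qed
  then show "\<exists>N. \<forall>i\<ge>N. \<forall>j\<ge>N. N2 (%p. pft (K i) p - pft (K j) p) <= enn \<epsilon>" by blast
 qed
 then obtain F where F: "F \<in> L2" and Flim: "(%n. N2 (%p. pft (K n) p - F p)) ----> 0" by blast
 have [measurable]: "F \<in> BM" using F by auto
 have "N2 (%p. flow T m a \<sigma> (pft (K n)) p - flow T m a \<sigma> F p) = N2 (%t. cor (damp T a \<sigma> t)) * N2 (%p. pft (K n) p - F p)" for n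
  by (subst N2_flow[symmetric]) (auto simp: flow_def[abs_def] right_diff_distrib)
 then have flim: "(%n. N2 (%p. flow T m a \<sigma> (pft (K n)) p - flow T m a \<sigma> F p)) ----> 0" using ennreal_tendsto_0_cmult[OF Flim damp_integrable(2)[OF a \<sigma>, of T]] by simp
 show ?thesis
 proof (rule that[of "continuation T m a \<sigma> \<psi> F"])
  show "continuation T m a \<sigma> \<psi> F \<in> L2" "continuation T m a \<sigma> \<psi> (pft (K n)) \<in> L2" for n
   unfolding continuation_def[abs_def] by (intro section_pairing_L2 fL2 F pft_L2 K \<psi>)+
  show "(%n. N2 (%q. continuation T m a \<sigma> \<psi> (pft (K n)) q - continuation T m a \<sigma> \<psi> F q)) ----> 0"
   unfolding continuation_def by (intro section_pairing_tendsto fL2 F pft_L2 K \<psi> flim)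
  show "continuation T m a \<sigma> \<psi> F (t, x) = 0" if "\<sigma> * t <= T" for t x using that by (simp add: continuation_def flow_def damp_def)
 qed
qed


section \<open>Bounded potentials\<close>

context averaged_kernel
begin

text \<open>
 With \<open>a = 1 / h\<close> the potential term, of size \<open>V / h\<close>, is comparable to the shift \<open>a\<close>.  The solution is
 localised near the end point \<open>\<sigma> T\<close> by an affine factor that vanishes at the other one.
\<close>

theorem regular_half:
 assumes V_bound: "!!x. \<bar>V x\<bar> <= Kv" and h1: "h <= 1" and \<sigma>: "\<sigma>^2 = 1" and C0: "M / h ^ DIM('a) <= C0" and C: "C > 0"
  and res: "!!\<alpha> \<tau> (\<kappa>::'a). \<alpha> > 0 ==> \<exists>i\<ge>0. resolvent_weight N m \<alpha> \<tau> \<kappa> = enn i \<and>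
    i <= C / \<alpha>^2 \<and> norm \<kappa> * i <= C / \<alpha> \<and> (\<alpha>^2 + \<tau>^2) * i <= C * (1 + norm \<kappa> / \<alpha>)"
 defines "P \<equiv> (2 * pi) ^ (1 + 2 * DIM('a))"
 defines "X1 \<equiv> B * (4 * C) * P * (4 * T * C0)" and "X2 \<equiv> B * (4 * C) * P * ((1 / (2 * T))^2 * (4 * T * C0))"
  and "X3 \<equiv> B * (4 * C) * P * ((2 * Kv)^2 * (4 * T * C0))"
 obtains U where "regular (%q. 1 + \<bar>fst q\<bar> + norm (snd q)) ((2 * X1 + 2 * (2 * X2 + 2 * X3)) / h) U"
  "!!t x. t \<in> {-T<..<T} ==> U (t, x) = cor ((T + \<sigma> * t) / (2 * T)) * vmean \<psi> (%z. k (fst z, wcoord h (snd z))) (t, x)"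
proof -
 define w where "w q = 1 + \<bar>fst q\<bar> + norm (snd q)" for q :: "real \<times> 'a"
 define a where "a q = 1 / h" for q :: "real \<times> 'a"
 define \<theta> where "\<theta> t = (T + \<sigma> * t) / (2 * T)" for t :: real
 define \<theta>' where "\<theta>' t = \<sigma> / (2 * T)" for t :: real
 have \<sigma>c: "\<sigma> = 1 \<or> \<sigma> = -1" using \<sigma> by (simp add: power2_eq_1_iff)
 have [measurable]: "w \<in> BM" "a \<in> BM" unfolding w_def[abs_def] a_def[abs_def] by measurable
 have w: "w q >= 0" for q by (simp add: w_def)
 have a1: "a q >= 1" for q using h h1 by (simp add: a_def)
 have a0: "a q > 0" for q using h by (simp add: a_def)
 have d\<theta>: "(\<theta> has_real_derivative \<theta>' t) (at t)" for t unfolding \<theta>_def[abs_def] \<theta>'_def using T by (auto intro!: derivative_eq_intros)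
 have \<theta>c: "continuous_on UNIV \<theta>" "continuous_on UNIV \<theta>'" unfolding \<theta>_def[abs_def] \<theta>'_def[abs_def] using T by (auto intro!: continuous_intros)
 have \<theta>1: "\<bar>\<theta> t\<bar> <= 1" if "t \<in> {-T..T}" for t using that T \<sigma>c by (auto simp: \<theta>_def abs_le_iff divide_simps)
 have \<theta>'1: "\<bar>\<theta>' t\<bar> <= 1 / (2 * T)" if "t \<in> {-T..T}" for t using T \<sigma>c by (auto simp: \<theta>'_def)
 have C0': "C0 >= 0" using C0 M_nonneg h by (meson order_trans divide_nonneg_nonneg zero_le_power less_imp_le)
 have weight: "enn (w q * (a q)^2) * resolvent_weight N m (a q) (fst q) (snd q) <= enn (4 * C / h)" for q
 proof -
  obtain i where i: "i >= 0" "resolvent_weight N m (a q) (fst q) (snd q) = enn i" "i <= C / (a q)^2" "norm (snd q) * i <= C / a q"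
   "((a q)^2 + (fst q)^2) * i <= C * (1 + norm (snd q) / a q)" using res[OF a0] by metis
  have "w q * ((a q)^2 * i) <= 4 * C * a q" unfolding w_def by (rule half_derivative_arith[OF i(1,3,4,5) a1 norm_ge_zero C])
  then have "enn (w q * (a q)^2 * i) <= enn (4 * C / h)" by (intro ennreal_leI) (simp add: a_def mult.assoc)
  then show ?thesis using w by (simp add: i(2) ennreal_mult'' i(1))
 qed
 have main: "wbound w (B * (4 * C) * P * Y / h) (%q. u * avg (rm \<psi> a \<sigma>) G q)"
  if G: "L1 G" "N2 G <= enn Y" and Y: "Y >= 0" and u: "cmod u <= 1 / h" for G Y u
 proof (rule wbound_mono)
  have [measurable]: "G \<in> BM" using G by (auto dest: borel_measurable_integrable)
  have [measurable]: "avg (rm \<psi> a \<sigma>) G \<in> BM" by (rule avg_measurable) measurable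
  have "wbound (%q. w q * (a q)^2) (B * (4 * C / h) * (2 * pi) ^ (1 + 2 * DIM('a)) * Y) (avg (rm \<psi> a \<sigma>) G)"
  proof (rule avg_wbound[OF G])
   fix q
   have "enn (w q * (a q)^2) * N2 (%v. rm \<psi> a \<sigma> (q, v)) <= enn (w q * (a q)^2) * (enn B * resolvent_weight N m (a q) (fst q) (snd q))" by (intro mult_left_mono N2_rm \<psi> \<sigma>) auto
   also have "... <= enn B * enn (4 * C / h)" using mult_left_mono[OF weight, of "enn B" q] by (simp only: mult_ac zero_le)
   finally show "enn (w q * (a q)^2) * N2 (%v. rm \<psi> a \<sigma> (q, v)) <= enn (B * (4 * C / h))" by (simp only: ennreal_mult'[OF B])
  qed (use w B C h Y in auto)
  then show "wbound w (B * (4 * C / h) * (2 * pi) ^ (1 + 2 * DIM('a)) * Y) (%q. cor (a q) * avg (rm \<psi> a \<sigma>) G q)" by (rule wbound_mult) measurable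
  show "cmod (u * avg (rm \<psi> a \<sigma>) G q) <= cmod (cor (a q) * avg (rm \<psi> a \<sigma>) G q)" for q unfolding norm_mult norm_of_real using u h by (intro mult_right_mono) (auto simp: a_def)
  show "(%q. u * avg (rm \<psi> a \<sigma>) G q) \<in> BM" by measurable
 qed (simp_all add: P_def w)
 define pot where "pot c p = cor (wpot h V p) * wcut h c 0 p" for c and p :: "'a \<times> 'a"
 have pot_le: "cmod (pot c p) <= 2 * Kv" if "c > 0" for c p
 proof -
  have "\<bar>wpot h V p\<bar> <= 2 * Kv" using V_bound[of "fst (wcoord h p)"] V_bound[of "snd (wcoord h p)"] by (auto simp: wpot_def abs_le_iff)
  then have "\<bar>wpot h V p\<bar> * cmod (wcut h c 0 p) <= 2 * Kv * 1" by (intro mult_mono wcut_le_1[OF that]) auto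
  then show ?thesis by (simp add: pot_def norm_mult)
 qed
 have T': "\<sigma> * T \<in> {-T..T}" using T \<sigma>c by auto
 define c where "c n = 1 / real (Suc n)" for n
 have c: "c n > 0" for n by (simp add: c_def)
 note adm = admissible_wcuts[OF c]
 obtain Y where Y: "!!n. wbound (%q. decay 2 (snd q)) (Y * (1 / real (Suc n))) (err \<theta> (1 / real (Suc n)) a \<sigma>)"
  by (rule err_wbound[where a = a and \<sigma> = \<sigma>, OF \<theta>c(1) \<theta>1 a1 _ \<sigma>]) auto
 have slim: "(%n. N2 (%p. slice (\<sigma> * T) (c n) p - integral_kernel (R (\<sigma> * T)) (wcoord h p))) ----> 0" unfolding slice_def c_def by (rule cutoff_tendsto[OF wkernel_L2[OF T'], of "%p. p"]) simp
 have km: "(%p. integral_kernel (R (\<sigma> * T)) (wcoord h p)) \<in> BM" using wkernel_L2[OF T'] by auto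
 obtain E where E: "E \<in> L2" "!!n. continuation T m (1 / h) \<sigma> \<psi> (pft (slice (\<sigma> * T) (c n))) \<in> L2"
  "(%n. N2 (%q. continuation T m (1 / h) \<sigma> \<psi> (pft (slice (\<sigma> * T) (c n))) q - E q)) ----> 0" "!!t x. \<sigma> * t <= T ==> E (t, x) = 0"
  using continuation_limit[OF slice_facts(1)[OF T' c C0] slice_facts(3)[OF T' c C0] slim km \<psi>_L2, of "1 / h" \<sigma> T m] h \<sigma> by auto
 define U0 where "U0 z = cor (\<theta> (fst z)) * k (fst z, wcoord h (snd z))" for z :: "real \<times> ('a \<times> 'a)"
 have \<theta>m [measurable]: "\<theta> \<in> BM" using \<theta>c by (intro borel_measurable_continuous_onI)
 have U0: "U0 \<in> L2" unfolding U0_def[abs_def] by (rule src_cutoff_tendsto(1)[OF \<theta>m \<theta>1])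
 define G where "G n q = vmean \<psi> (src h k \<theta> (wcut h (c n) 0)) q + continuation T m (1 / h) \<sigma> \<psi> (pft (slice (\<sigma> * T) (c n))) q" for n q
 define A where "A n q = cor (1 / h) * avg (rm \<psi> a \<sigma>) (src h k \<theta> (wcut h (c n) 0)) q
   + (cor \<sigma> * avg (rm \<psi> a \<sigma>) (src h k \<theta>' (wcut h (c n) 0)) q
   + (- (\<i> * cor (\<sigma> / h))) * avg (rm \<psi> a \<sigma>) (src h k \<theta> (pot (c n))) q)" for n q
 have A: "wbound w ((2 * X1 + 2 * (2 * X2 + 2 * X3)) / h) (A n)" for n
 proof -
  have 1: "wbound w (X1 / h) (%q. cor (1 / h) * avg (rm \<psi> a \<sigma>) (src h k \<theta> (wcut h (c n) 0)) q)" unfolding X1_def using src_N2'[OF \<theta>1 wcut_le_1[OF c[of n]] _ C0] T C0' h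
   by (intro main src_integrable \<theta>c adm) (auto simp: norm_divide)
  have 2: "wbound w (X2 / h) (%q. cor \<sigma> * avg (rm \<psi> a \<sigma>) (src h k \<theta>' (wcut h (c n) 0)) q)"
   unfolding X2_def using src_N2'[OF \<theta>'1 wcut_le_1[OF c[of n]] _ C0] T C0' h h1 \<sigma>c by (intro main src_integrable \<theta>c adm) (auto simp: norm_divide)
  have 3: "wbound w (X3 / h) (%q. (- (\<i> * cor (\<sigma> / h))) * avg (rm \<psi> a \<sigma>) (src h k \<theta> (pot (c n))) q)" unfolding X3_def
  proof (rule main)
   show "L1 (src h k \<theta> (pot (c n)))" unfolding pot_def[abs_def] by (intro src_integrable \<theta>c adm)
   show "N2 (src h k \<theta> (pot (c n))) <= enn ((2 * Kv)^2 * (4 * T * C0))" using src_N2'[OF \<theta>1 pot_le[OF c[of n]] _ C0] by simp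
   show "cmod (- (\<i> * cor (\<sigma> / h))) <= 1 / h" using \<sigma>c h by (auto simp: norm_mult norm_divide)
  qed (use T C0' in auto)
  have "wbound w (2 * (X1 / h) + 2 * (2 * (X2 / h) + 2 * (X3 / h))) (A n)" unfolding A_def[abs_def] by (intro wbound_add 1 2 3 w) measurable
  then show ?thesis by (simp add: add_divide_distrib)
 qed
 have FT: "FT (G n) q = A n q + err \<theta> (c n) a \<sigma> q" for n q
 proof -
  have int: "L1 (src h k \<theta> (wcut h (c n) 0))" by (intro src_integrable \<theta>c adm)
  have h0: "1 / h > 0" using h by simp
  note FTc = FT_continuation[OF slice_facts(1)[OF T' c[of n] C0] \<psi>(1) h0 \<sigma>, where T = T and m = m]
  have "FT (G n) q = avg (%p. \<psi> (snd p)) (src h k \<theta> (wcut h (c n) 0)) q + cis (- (fst q * (\<sigma> * T))) * avg0 (rm \<psi> a \<sigma>) (slice (\<sigma> * T) (c n)) q"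
   unfolding G_def[abs_def] FT_add[OF vmean_FT(1)[OF int \<psi>(1)] FTc(1)] vmean_FT(2)[OF int \<psi>(1)] using FTc(2)[where \<tau> = "fst q" and k = "snd q"] by (simp add: avg0_def rm_def a_def)
  also have "avg (%p. \<psi> (snd p)) (src h k \<theta> (wcut h (c n) 0)) q = A n q + err \<theta> (c n) a \<sigma> q - cis (- (fst q * (\<sigma> * T))) * avg0 (rm \<psi> a \<sigma>) (slice (\<sigma> * T) (c n)) q"
  proof -
   have b: "cor \<sigma> * (cis (- (fst q * T)) * cor (\<theta> T) * avg0 (rm \<psi> a \<sigma>) (slice T (c n)) q
     - cis (fst q * T) * cor (\<theta> (- T)) * avg0 (rm \<psi> a \<sigma>) (slice (- T) (c n)) q)
     = cis (- (fst q * (\<sigma> * T))) * avg0 (rm \<psi> a \<sigma>) (slice (\<sigma> * T) (c n)) q" using \<sigma>c T by (auto simp: \<theta>_def)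
   show ?thesis using averaged_identity[where a = a and q = q, OF d\<theta> \<theta>c(2) c[of n] a0 \<sigma>] unfolding b by (simp add: A_def a_def pot_def[abs_def])
  qed
  finally show ?thesis by simp
 qed
 have GL: "vmean \<psi> (src h k \<theta> (wcut h (c n) 0)) \<in> L2" for n by (intro vmean_L2 src_L2 \<theta>c adm FT_\<psi>_L2)
 have "regular w ((2 * X1 + 2 * (2 * X2 + 2 * X3)) / h) (%q. vmean \<psi> U0 q + E q)" unfolding regular_def
 proof (intro conjI exI allI)
  show "(%q. vmean \<psi> U0 q + E q) \<in> L2" by (intro L2_add vmean_L2 U0 FT_\<psi>_L2 E)
  show "G n \<in> L2" for n unfolding G_def[abs_def] by (intro L2_add GL E)
  show "L1 (G n)" for n unfolding G_def[abs_def]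
   by (intro Bochner_Integration.integrable_add vmean_FT(1) FT_continuation(1) src_integrable \<theta>c adm \<psi>(1) slice_facts(1)[OF T' c C0] \<sigma>) (use h in simp)
  show "FT (G n) q = A n q + err \<theta> (c n) a \<sigma> q" for n q by (rule FT)
  show "wbound w ((2 * X1 + 2 * (2 * X2 + 2 * X3)) / h) (A n)" for n by (rule A)
  show "wbound (%q. decay 2 (snd q)) (Y * (1 / real (Suc n))) (err \<theta> (c n) a \<sigma>)" for n using Y by (simp add: c_def)
  have "(%n. N2 (%z. src h k \<theta> (wcut h (c n) 0) z - U0 z)) ----> 0" unfolding c_def U0_def by (rule src_cutoff_tendsto(2)[OF \<theta>m \<theta>1])
  then have "(%n. N2 (%q. vmean \<psi> (src h k \<theta> (wcut h (c n) 0)) q - vmean \<psi> U0 q)) ----> 0" by (intro vmean_tendsto U0 src_L2 \<theta>c adm FT_\<psi>_L2)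
  then show "(%n. N2 (%q. G n q - (vmean \<psi> U0 q + E q))) ----> 0" unfolding G_def using E(3) by (intro N2_add_tendsto L2_measurable GL E vmean_L2 U0 FT_\<psi>_L2)
 qed
 then have "regular (%q. 1 + \<bar>fst q\<bar> + norm (snd q)) ((2 * X1 + 2 * (2 * X2 + 2 * X3)) / h) (%q. vmean \<psi> U0 q + E q)" by (simp only: w_def[abs_def])
 moreover have "vmean \<psi> U0 (t, x) + E (t, x) = cor ((T + \<sigma> * t) / (2 * T)) * vmean \<psi> (%z. k (fst z, wcoord h (snd z))) (t, x)"
  if t: "t \<in> {-T<..<T}" for t x
 proof -
  have "\<sigma> * t <= T" using t \<sigma>c by auto
  then have "E (t, x) = 0" by (rule E(4))
  then show ?thesis unfolding vmean_def assoc_def U0_def \<theta>_def by (simp add: mult.assoc del: of_real_divide)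
 qed
 ultimately show ?thesis by (rule that)
qed

lemma vmean_eq_rho:
 "AE t in lborel. t \<in> {-T..T} --> (AE x in lborel.
   vmean \<psi> (%z. k (fst z, wcoord h (snd z))) (t, x) / cor ((2 * pi) ^ DIM('a)) = rho \<psi> h (R t) x)" using k_AE
proof eventually_elim
 case (elim t)
 show ?case
 proof
  assume t: "t \<in> {-T..T}"
  have [measurable]: "integral_kernel (R t) \<in> BM" using kernel_L2[OF t] by auto
  have "AE p in lborel. k (t, wcoord h p) = integral_kernel (R t) (wcoord h p)" by (rule AE_wcoord[OF _ _ h]) (use elim t in auto)
  then have "AE p in lborel \<Otimes>\<^sub>M lborel. k (t, wcoord h p) = integral_kernel (R t) (wcoord h p)" by (subst lborel_prod)
  from lborel_pair.AE_pair[OF this]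
  show "AE x in lborel. vmean \<psi> (%z. k (fst z, wcoord h (snd z))) (t, x) / cor ((2 * pi) ^ DIM('a)) = rho \<psi> h (R t) x" using rho_eq[OF kernel_L2[OF t] h \<psi>_L2 \<psi>(1)]
  proof eventually_elim
   case (elim x)
   have "(LI y. k (t, wcoord h (x, y)) * FT \<psi> y) = (LI y. integral_kernel (R t) (wcoord h (x, y)) * FT \<psi> y)" using elim(1) by (intro integral_cong_AE) (measurable, auto)
   then show ?case using elim(2) by (simp add: vmean_def assoc_def)
  qed
 qed
qed

end

lemma regular_cmult:
 assumes "regular w X U" and [measurable]: "w \<in> BM"
 shows "regular w ((cmod c)^2 * X) (%q. c * U q)"
proof -
 obtain G A E Y where U: "U \<in> L2" and G: "!!n. G n \<in> L2" "!!n. L1 (G n)" "!!n \<zeta>. FT (G n) \<zeta> = A n \<zeta> + E n \<zeta>"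
   "!!n. wbound w X (A n)" "!!n::nat. wbound (%q. decay 2 (snd q)) (Y * (1 / real (Suc n))) (E n)" "(%n. N2 (%q. G n q - U q)) ----> 0" by (rule regularE[OF assms(1)]) blast
 have [measurable]: "G n \<in> BM" "U \<in> BM" for n using G(1)[of n] U by auto
 show ?thesis unfolding regular_def
 proof (intro conjI exI allI)
  show "(%q. c * U q) \<in> L2" "(%q. c * G n q) \<in> L2" "L1 (%q. c * G n q)" for n by (intro L2_cmult U G integrable_mult_right)+
  show "FT (%q. c * G n q) \<zeta> = c * A n \<zeta> + c * E n \<zeta>" for n \<zeta> by (simp add: FT_cmult G(3) distrib_left)
  show "wbound w ((cmod c)^2 * X) (%q. c * A n q)" for n by (rule wbound_cmult[OF G(4)]) measurable
  show "wbound (%q. decay 2 (snd q)) ((cmod c)^2 * Y * (1 / real (Suc n))) (%q. c * E n q)" for n using wbound_cmult[OF G(5), of c n] by (simp add: mult.assoc)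
  have "N2 (%q. c * G n q - c * U q) = enn ((cmod c)^2) * N2 (%q. G n q - U q)" for n by (subst N2_cmult[symmetric]) (auto simp: right_diff_distrib)
  then show "(%n. N2 (%q. c * G n q - c * U q)) ----> 0" using ennreal_tendsto_0_cmult[OF G(6), of "enn ((cmod c)^2)"] by simp
 qed
qed


section \<open>Schwartz weights and the final estimates\<close>

lemma rapidly_decreasing:
 fixes f :: "'a::euclidean_space => complex"
 assumes f: "continuous_on UNIV f" and D: "!!x. (1 + norm x) ^ N * cmod (f x) <= D" and N: "N >= 2 * DIM('a)"
 shows "L1 f" "(cmod (f x))^2 <= D^2 * decay N x"
proof -
 have [measurable]: "f \<in> BM" by (rule borel_measurable_continuous_onI[OF f])
 have le: "cmod (f x) <= D * decay N x" for x using D[of x] by (simp add: decay_def field_simps add_pos_nonneg)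
 have D0: "D >= 0" using order_trans[OF _ D[of 0]] by simp
 show "L1 f"
 proof (rule integrableI_bounded)
  have "(NI x. enn (norm (f x))) <= (NI (x::'a). enn D * enn (decay N x))" using le D0 by (intro nn_integral_mono) (auto simp: ennreal_mult'[symmetric] intro!: ennreal_leI)
  also have "... = enn D * (NI (x::'a). enn (decay N x))" by (rule nn_integral_cmult) measurable
  also have "... <= enn D * enn (4 ^ DIM('a))" by (intro mult_left_mono nn_integral_decay N) auto
  also have "... < \<infinity>" by (simp add: ennreal_mult_less_top)
  finally show "(NI x. enn (norm (f x))) < \<infinity>" .
 qed measurable
 have "decay N x <= 1" using decay_antimono[of 0 N x] by (simp add: decay_def)
 then have "decay N x * decay N x <= 1 * decay N x" by (intro mult_right_mono decay_nonneg)
 then have d: "(decay N x)^2 <= decay N x" by (simp add: power2_eq_square)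
 have "(cmod (f x))^2 <= (D * decay N x)^2" by (intro power_mono le) simp
 also have "... <= D^2 * decay N x" using mult_left_mono[OF d, of "D^2"] by (simp add: power_mult_distrib)
 finally show "(cmod (f x))^2 <= D^2 * decay N x" .
qed

lemma schwartz_weight:
 fixes \<psi> :: "'a::euclidean_space => complex"
 assumes \<psi>: "\<psi> \<in> schwartz" and N: "N >= 2 * DIM('a) + 2"
 obtains B where "velocity_weight \<psi> (%b. pderivs [b] \<psi>) B N"
proof -
 have N2: "N >= 2 * DIM('a)" using N by simp
 have smooth: "smooth \<psi>" using \<psi> by (simp add: schwartz_def)
 have diff: "\<psi> differentiable (at v)" for v using smooth[unfolded smooth_def, rule_format, of "[]"] by (simp add: differentiable_on_def)
 have c0: "continuous_on UNIV \<psi>" using smooth[unfolded smooth_def, rule_format, of "[]"] by (auto intro: differentiable_imp_continuous_on)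
 have c1: "continuous_on UNIV (pderivs [b] \<psi>)" if "b \<in> Basis" for b using smooth[unfolded smooth_def, rule_format, of "[b]"] that by (intro differentiable_imp_continuous_on) simp
 have S: "\<exists>D. \<forall>x. (1 + norm x) ^ j * cmod (pderivs vs \<psi> x) <= D" if "set vs \<subseteq> Basis" for j vs
  using conjunct2[OF \<psi>[unfolded schwartz_def mem_Collect_eq], rule_format, OF that] by blast
 obtain D0 where D0: "!!x. (1 + norm x) ^ Suc N * cmod (\<psi> x) <= D0" using S[of "[]" "Suc N"] by auto
 have "\<exists>D. \<forall>b\<in>Basis. \<forall>x. (1 + norm x) ^ N * cmod (pderivs [b] \<psi> x) <= D"
 proof -
  have "\<forall>b\<in>Basis. \<exists>D. \<forall>x. (1 + norm x) ^ N * cmod (pderivs [b] \<psi> x) <= D" by (intro ballI S) simp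
  then obtain D where D: "\<forall>b\<in>Basis. \<forall>x. (1 + norm x) ^ N * cmod (pderivs [b] \<psi> x) <= D b" by metis
  show ?thesis
  proof (intro exI ballI allI)
   fix b x :: 'a assume b: "b \<in> Basis"
   have "(1 + norm x) ^ N * cmod (pderivs [b] \<psi> x) <= D b" using D b by blast
   also have "... <= Max (D ` Basis)" by (rule Max_ge) (use b in auto)
   finally show "(1 + norm x) ^ N * cmod (pderivs [b] \<psi> x) <= Max (D ` Basis)" .
  qed
 qed
 then obtain D1 where D1: "!!b x. b \<in> Basis ==> (1 + norm x) ^ N * cmod (pderivs [b] \<psi> x) <= D1" by blast
 have D0': "(1 + norm x) ^ N * cmod (\<psi> x) <= D0" for x
 proof -
  have "1 * ((1 + norm x) ^ N * cmod (\<psi> x)) <= (1 + norm x) * ((1 + norm x) ^ N * cmod (\<psi> x))" by (intro mult_right_mono) auto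
  then show ?thesis using D0[of x] by (simp add: mult.assoc)
 qed
 have Dx: "(1 + norm x) ^ N * cmod (cor (x \<cdot> b) * \<psi> x) <= D0" if "b \<in> Basis" for x b
 proof -
  have "\<bar>x \<cdot> b\<bar> <= 1 + norm x" using Basis_le_norm[OF that, of x] by simp
  then have "\<bar>x \<cdot> b\<bar> * ((1 + norm x) ^ N * cmod (\<psi> x)) <= (1 + norm x) * ((1 + norm x) ^ N * cmod (\<psi> x))" by (intro mult_right_mono) auto
  then show ?thesis using D0[of x] by (simp add: norm_mult mult_ac)
 qed
 have m: "D0^2 * decay N v <= (D0^2 + D1^2) * decay N v" "D1^2 * decay N v <= (D0^2 + D1^2) * decay N v" for v :: 'a by (intro mult_right_mono decay_nonneg; simp)+
 have cx: "continuous_on UNIV (%v. cor (v \<cdot> b) * \<psi> v)" for b by (intro continuous_intros c0)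
 show ?thesis
 proof (rule that[of "D0^2 + D1^2"], unfold_locales)
  show "L1 \<psi>" "(cmod (\<psi> v))^2 <= (D0^2 + D1^2) * decay N v" for v using rapidly_decreasing[OF c0 D0' N2] order_trans[OF _ m(1)] by blast+
  show "L1 (pderivs [b] \<psi>)" "(cmod (pderivs [b] \<psi> v))^2 <= (D0^2 + D1^2) * decay N v" if "b \<in> Basis" for b v
   using rapidly_decreasing[OF c1[OF that] D1[OF that] N2] order_trans[OF _ m(2)] by blast+
  show "L1 (%v. cor (v \<cdot> b) * \<psi> v)" "(cmod (cor (v \<cdot> b) * \<psi> v))^2 <= (D0^2 + D1^2) * decay N v" if "b \<in> Basis" for b v
   using rapidly_decreasing[OF cx Dx[OF that] N2] order_trans[OF _ m(1)] by blast+
  show "((%s. \<psi> (v + s *\<^sub>R b)) has_vector_derivative pderivs [b] \<psi> v) (at 0)" for b v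
  proof -
   have "(\<psi> has_derivative frechet_derivative \<psi> (at v)) (at (v + 0 *\<^sub>R b))" using diff[of v] by (simp add: frechet_derivative_works)
   moreover have "((%s. v + s *\<^sub>R b) has_vector_derivative b) (at 0)" by (auto intro!: derivative_eq_intros)
   ultimately show ?thesis using vector_derivative_diff_chain_within[of "%s. v + s *\<^sub>R b" b 0 UNIV \<psi> "frechet_derivative \<psi> (at v)"] by (simp add: o_def has_derivative_at_withinI)
  qed
 qed (use c0 c1 N in auto)
qed

text \<open>The set where the bound holds is closed and has full measure.\<close>

lemma continuous_le_Linf_norm:
 assumes V: "continuous_on UNIV V" and fin: "Linf_norm V < \<infinity>"
 shows "\<bar>V x\<bar> <= enn2real (Linf_norm V)"
proof -
 have "AE x in lborel. enn \<bar>V x\<bar> <= Linf_norm V" unfolding Linf_norm_def by (rule esssup_AE)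
 then have "AE x in lborel. x \<in> {x. \<bar>V x\<bar> <= enn2real (Linf_norm V)}"
 proof eventually_elim
  case (elim x)
  then show ?case using enn2real_mono[OF elim] fin by simp
 qed
 then have "AE x in lebesgue. x \<in> {x. \<bar>V x\<bar> <= enn2real (Linf_norm V)}" by (rule AE_completion)
 moreover have "closed {x. \<bar>V x\<bar> <= enn2real (Linf_norm V)}" by (intro closed_Collect_le continuous_intros V)
 ultimately show ?thesis using mem_closed_if_AE_lebesgue by blast
qed

lemma sobolev_weights:
 fixes \<zeta> :: "real \<times> 'a::euclidean_space"
 shows "(1 + (norm \<zeta>)^2) powr (1 / 2) <= 1 + \<bar>fst \<zeta>\<bar> + norm (snd \<zeta>)"
  and "(1 + (norm \<zeta>)^2) powr (1 / 4) <= sqrt (1 + \<bar>fst \<zeta>\<bar> + norm (snd \<zeta>))"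
proof -
 define u where "u = 1 + \<bar>fst \<zeta>\<bar> + norm (snd \<zeta>)"
 have u: "u > 0" by (simp add: u_def add_pos_nonneg)
 have "(norm \<zeta>)^2 = (fst \<zeta>)^2 + (norm (snd \<zeta>))^2" by (simp add: norm_prod_def)
 moreover have "1 + \<bar>fst \<zeta>\<bar>\<^sup>2 + (norm (snd \<zeta>))^2 <= u^2" by (simp add: u_def power2_eq_square algebra_simps)
 ultimately have le: "1 + (norm \<zeta>)^2 <= u^2" by simp
 have "(1 + (norm \<zeta>)^2) powr s <= u powr (2 * s)" if "s >= 0" for s
 proof -
  have "(1 + (norm \<zeta>)^2) powr s <= (u^2) powr s" using le that by (intro powr_mono2) auto
  also have "u^2 = u powr 2" using u by simp
  finally show ?thesis using u by (simp only: powr_powr)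
 qed
 from this[of "1 / 2"] this[of "1 / 4"]
 show "(1 + (norm \<zeta>)^2) powr (1 / 2) <= 1 + \<bar>fst \<zeta>\<bar> + norm (snd \<zeta>)"
  "(1 + (norm \<zeta>)^2) powr (1 / 4) <= sqrt (1 + \<bar>fst \<zeta>\<bar> + norm (snd \<zeta>))" using u by (simp_all add: u_def powr_half_sqrt)
qed

theorem theorem2:
  fixes m T C :: real
    and V :: "real ^ 'n \<Rightarrow> real"
    and R :: "real \<Rightarrow> real \<Rightarrow> (real ^ 'n) L2_op"
  assumes "m > 0" and "T > 0"
    and "continuous_on UNIV V"
    and "\<And>h. h \<in> {0<..1} \<Longrightarrow> self_adjoint (hamiltonian h m V)"
    and "\<And>h t. h \<in> {0<..1} \<Longrightarrow> t \<in> {-T..T} \<Longrightarrow> density_operator (R h t)"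
    and "\<And>h. h \<in> {0<..1} \<Longrightarrow> wot_continuous_on {-T..T} (R h)"
    and "\<And>h. h \<in> {0<..1} \<Longrightarrow> weak_von_neumann_solution h m V T (R h)"
    and "C > 0"
    and "\<And>h t. h \<in> {0<..1} \<Longrightarrow> t \<in> {-T..T} \<Longrightarrow>
           Re (op_trace (R h t \<circ> R h t)) \<le> C\<^sup>2 * (2 * pi * h) ^ CARD('n)"
  shows "\<forall>\<psi>\<in>schwartz.
    (Linf_norm V < \<infinity> \<and> V \<noteq> (\<lambda>x. 0) \<longrightarrow>
       (\<exists>C'>0. \<forall>h\<in>{0<..1}.
          sobolev_norm (1/2) ({-T<..<T} \<times> UNIV) (\<lambda>t. rho \<psi> h (R h t))
          \<le> ennreal C' * Linf_norm V * ennreal (h powr (-1/2)))) \<and>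
    ((\<exists>L. L-lipschitz_on UNIV V) \<longrightarrow>
       (SUP h\<in>{0<..1}. sobolev_norm (1/4) ({-T<..<T} \<times> UNIV) (\<lambda>t. rho \<psi> h (R h t))) < \<infinity>)"
proof
 fix \<psi> :: "real ^ 'n => complex" assume \<psi>: "\<psi> \<in> schwartz"
 define d where "d = CARD('n)"
 define N where "N = 2 * DIM(real ^ 'n) + 2"
 define C0 where "C0 = C^2 * (2 * pi) ^ d"
 define \<gamma> where "\<gamma> = 1 / cor ((2 * pi) ^ DIM(real ^ 'n))"
 obtain B where vw: "velocity_weight \<psi> (%b. pderivs [b] \<psi>) B N" using schwartz_weight[OF \<psi>, of N] by (auto simp: N_def)
 then have B: "B >= 0" by (rule velocity_weight.B)
 have ex: "\<exists>k. averaged_kernel (R h) T (C^2 * (2 * pi * h) ^ d) h m V k \<psi> (%b. pderivs [b] \<psi>) B N" if h: "h \<in> {0<..1}" for h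
 proof -
  have tr: "Re (op_trace (R h t \<circ> R h t)) <= C^2 * (2 * pi * h) ^ d" if "t \<in> {-T..T}" for t unfolding d_def by (rule assms(9)[OF h that])
  show ?thesis
  proof (rule joint_kernel[OF assms(2) _ assms(6)[OF h]])
   show "density_operator (R h t)" "Re (op_trace (R h t \<circ> R h t)) <= C^2 * (2 * pi * h) ^ d" if "t \<in> {-T..T}" for t using assms(5)[OF h that] tr[OF that] by auto
   fix k assume k: "k \<in> L2" "!!t z. t \<notin> {-T..T} ==> k (t, z) = 0"
    "AE t in lborel. t \<in> {-T..T} --> (AE z in lborel. k (t, z) = integral_kernel (R h t) z)"
  have "kernel_family (R h) T (C^2 * (2 * pi * h) ^ d) h m V k" by (rule kernel_family.intro[OF assms(2) _ assms(1) assms(5)[OF h] assms(6)[OF h] tr assms(7)[OF h] assms(3) k]) (use h in simp)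
   then have "averaged_kernel (R h) T (C^2 * (2 * pi * h) ^ d) h m V k \<psi> (%b. pderivs [b] \<psi>) B N" by (rule averaged_kernel.intro[OF _ vw])
   then show ?thesis by (rule exI[of _ k])
  qed
 qed
 have C0: "C^2 * (2 * pi * h) ^ d / h ^ DIM(real ^ 'n) <= C0" if "h \<in> {0<..1}" for h using that by (simp add: C0_def d_def power_mult_distrib)
 obtain Cr where Cr: "Cr > 0" and res: "!!\<alpha> \<tau> (\<kappa>::real ^ 'n). \<alpha> > 0 ==> \<exists>i\<ge>0. resolvent_weight N m \<alpha> \<tau> \<kappa> = enn i \<and>
    i <= Cr / \<alpha>^2 \<and> norm \<kappa> * i <= Cr / \<alpha> \<and> (\<alpha>^2 + \<tau>^2) * i <= Cr * (1 + norm \<kappa> / \<alpha>)"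
  using resolvent_weight_bounds[OF assms(1), of N, where 'a = "real ^ 'n"] by (auto simp: N_def)
 obtain Cb where Cb: "Cb > 0" and resb: "!!\<kappa>::real ^ 'n. (NI \<tau>. enn (sqrt (1 + \<bar>\<tau>\<bar> + norm \<kappa>)) * resolvent_weight N m (sqrt (max 1 (norm \<kappa>))) \<tau> \<kappa>) <= enn Cb"
  using resolvent_weight_boundary[OF assms(1), of N, where 'a = "real ^ 'n"] by (auto simp: N_def)
 have final: "sobolev_norm s ({-T<..<T} \<times> UNIV) (%t. rho \<psi> h (R h t)) <= enn (sqrt ((cmod \<gamma>)^2 * X))"
  if reg: "regular w X U" and [measurable]: "w \<in> BM" and w: "!!\<zeta>. (1 + (norm \<zeta>)^2) powr s <= w \<zeta>"
   and ak: "averaged_kernel (R h) T (C^2 * (2 * pi * h) ^ d) h m V k \<psi> (%b. pderivs [b] \<psi>) B N"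
   and U: "!!t x. t \<in> {-T<..<T} ==> U (t, x) = vmean \<psi> (%z. k (fst z, wcoord h (snd z))) (t, x)" for s w X U h k
 proof (rule sobolev_norm_regular[OF regular_cmult[OF reg] w])
  show "AE t in lborel. AE x in lborel. (t, x) \<in> {-T<..<T} \<times> UNIV --> \<gamma> * U (t, x) = rho \<psi> h (R h t) x" using averaged_kernel.vmean_eq_rho[OF ak]
  proof eventually_elim
   case (elim t)
   show ?case
   proof (cases "t \<in> {-T<..<T}")
    case True
    then have "AE x in lborel. vmean \<psi> (%z. k (fst z, wcoord h (snd z))) (t, x) / cor ((2 * pi) ^ DIM(real ^ 'n)) = rho \<psi> h (R h t) x" using elim by auto
    then show ?thesis by eventually_elim (simp add: U[OF True] \<gamma>_def)
   qed auto
  qed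
 qed measurable
 show "(Linf_norm V < \<infinity> \<and> V ~= (%x. 0) -->
    (\<exists>C'>0. \<forall>h\<in>{0<..1}.
     sobolev_norm (1/2) ({-T<..<T} \<times> UNIV) (%t. rho \<psi> h (R h t))
     <= enn C' * Linf_norm V * enn (h powr (-1/2)))) \<and>
  ((\<exists>L. L-lipschitz_on UNIV V) -->
    (SUP h\<in>{0<..1}. sobolev_norm (1/4) ({-T<..<T} \<times> UNIV) (%t. rho \<psi> h (R h t))) < \<infinity>)"
 proof (intro conjI impI)
  assume "Linf_norm V < \<infinity> \<and> V ~= (%x. 0)"
  then have fin: "Linf_norm V < \<infinity>" and nz: "V ~= (%x. 0)" by auto
  define Kv where "Kv = enn2real (Linf_norm V)"
  have Kv: "\<bar>V x\<bar> <= Kv" for x unfolding Kv_def by (rule continuous_le_Linf_norm[OF assms(3) fin])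
  obtain x0 where "V x0 ~= 0" using nz by auto
  then have Kv0: "Kv > 0" using Kv[of x0] by auto
  have Linf: "Linf_norm V = enn Kv" using fin by (simp add: Kv_def)
  define P where "P = (2 * pi) ^ (1 + 2 * DIM(real ^ 'n))"
  define X where "X = 2 * (B * (4 * Cr) * P * (4 * T * C0)) + 2 * (2 * (B * (4 * Cr) * P * ((1 / (2 * T))^2 * (4 * T * C0))) + 2 * (B * (4 * Cr) * P * ((2 * Kv)^2 * (4 * T * C0))))"
  have X: "X >= 0" using B Cr assms(2) by (simp add: X_def P_def C0_def)
  define C' where "C' = (sqrt ((cmod \<gamma>)^2 * (4 * X)) + 1) / Kv"
  have C': "C' > 0" using Kv0 X by (simp add: C'_def add_nonneg_pos)
  have "sobolev_norm (1/2) ({-T<..<T} \<times> UNIV) (%t. rho \<psi> h (R h t)) <= enn C' * Linf_norm V * enn (h powr (-1/2))"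
   if h: "h \<in> {0<..1}" for h
  proof -
   obtain k where ak: "averaged_kernel (R h) T (C^2 * (2 * pi * h) ^ d) h m V k \<psi> (%b. pderivs [b] \<psi>) B N" using ex[OF h] by blast
   have h': "h > 0" "h <= 1" using h by auto
   define u where "u = vmean \<psi> (%z. k (fst z, wcoord h (snd z)))"
   have "\<exists>U. regular (%q. 1 + \<bar>fst q\<bar> + norm (snd q)) (X / h) U \<and> (\<forall>t x. t \<in> {-T<..<T} --> U (t, x) = cor ((T + \<sigma> * t) / (2 * T)) * u (t, x))"
    if "\<sigma>^2 = 1" for \<sigma> :: real unfolding X_def P_def u_def by (rule averaged_kernel.regular_half[OF ak Kv h'(2) that C0[OF h] Cr res]) blast+
   from this[of 1] this[of "-1"] obtain U1 U2 where
    U1: "regular (%q. 1 + \<bar>fst q\<bar> + norm (snd q)) (X / h) U1" "!!t x. t \<in> {-T<..<T} ==> U1 (t, x) = cor ((T + 1 * t) / (2 * T)) * u (t, x)"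
    and U2: "regular (%q. 1 + \<bar>fst q\<bar> + norm (snd q)) (X / h) U2" "!!t x. t \<in> {-T<..<T} ==> U2 (t, x) = cor ((T + (-1) * t) / (2 * T)) * u (t, x)" by auto
   have reg: "regular (%q. 1 + \<bar>fst q\<bar> + norm (snd q)) (2 * (X / h) + 2 * (X / h)) (%q. U1 q + U2 q)" by (rule regular_add[OF U1(1) U2(1)]) auto
   have U: "U1 (t, x) + U2 (t, x) = u (t, x)" if "t \<in> {-T<..<T}" for t x
   proof -
    have "(T + 1 * t) / (2 * T) + (T + (-1) * t) / (2 * T) = 1" using assms(2) by (simp add: field_simps)
    then have "cor ((T + 1 * t) / (2 * T)) + cor ((T + (-1) * t) / (2 * T)) = 1" by (simp only: of_real_add[symmetric] of_real_1)
    then show ?thesis unfolding U1(2)[OF that] U2(2)[OF that] by (simp only: distrib_right[symmetric] mult_1)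
   qed
   have "sobolev_norm (1/2) ({-T<..<T} \<times> UNIV) (%t. rho \<psi> h (R h t)) <= enn (sqrt ((cmod \<gamma>)^2 * (2 * (X / h) + 2 * (X / h))))"
    by (rule final[OF reg _ sobolev_weights(1) ak]) (use U in \<open>auto simp: u_def\<close>)
   also have "... <= enn (C' * Kv * h powr (-1/2))"
   proof (rule ennreal_leI)
    have "h powr (-1/2) = 1 / sqrt h" using h' by (simp add: powr_minus powr_half_sqrt divide_simps)
    moreover have "sqrt ((cmod \<gamma>)^2 * (2 * (X / h) + 2 * (X / h))) = sqrt ((cmod \<gamma>)^2 * (4 * X)) * (1 / sqrt h)" by (simp add: real_sqrt_mult real_sqrt_divide)
    moreover have "sqrt ((cmod \<gamma>)^2 * (4 * X)) * (1 / sqrt h) <= (C' * Kv) * (1 / sqrt h)" by (intro mult_right_mono) (use Kv0 h' in \<open>auto simp: C'_def\<close>)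
    ultimately show "sqrt ((cmod \<gamma>)^2 * (2 * (X / h) + 2 * (X / h))) <= C' * Kv * h powr (-1/2)" by simp
   qed
   also have "... = enn C' * Linf_norm V * enn (h powr (-1/2))" unfolding Linf using C' Kv0 by (simp add: ennreal_mult)
   finally show ?thesis .
  qed
  then show "\<exists>C'>0. \<forall>h\<in>{0<..1}. sobolev_norm (1/2) ({-T<..<T} \<times> UNIV) (%t. rho \<psi> h (R h t)) <= enn C' * Linf_norm V * enn (h powr (-1/2))" using C' by blast
 next
  assume "\<exists>L. L-lipschitz_on UNIV V"
  then obtain L where L: "L-lipschitz_on UNIV V" ..
  define P where "P = (2 * pi) ^ (1 + 2 * DIM(real ^ 'n))"
  define X1 where "X1 = B * (4 * Cr) * P * (4 * T * C0)"
  define X2 where "X2 = 2 * B * (1 + 1 / m^2) * (4 * Cr) * P * (L^2 * (4 * T * C0))"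
  define X3 where "X3 = B * Cb * (2 * pi) ^ (2 * DIM(real ^ 'n)) * (2 * C0)"
  define X where "X = 2 * X1 + 2 * (2 * (4 ^ DIM(real ^ 'n) * X2) + 2 * (2 * X3 + 2 * X3))"
  have "sobolev_norm (1/4) ({-T<..<T} \<times> UNIV) (%t. rho \<psi> h (R h t)) <= enn (sqrt ((cmod \<gamma>)^2 * X))" if h: "h \<in> {0<..1}" for h
  proof -
   obtain k where ak: "averaged_kernel (R h) T (C^2 * (2 * pi * h) ^ d) h m V k \<psi> (%b. pderivs [b] \<psi>) B N" using ex[OF h] by blast
   show ?thesis by (rule final[OF averaged_kernel.regular_quarter[OF ak L C0[OF h] Cr Cb res resb, folded P_def, folded X1_def X2_def X3_def, folded X_def] _ sobolev_weights(2) ak]) auto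
  qed
  then have "(SUP h\<in>{0<..1}. sobolev_norm (1/4) ({-T<..<T} \<times> UNIV) (%t. rho \<psi> h (R h t))) <= enn (sqrt ((cmod \<gamma>)^2 * X))" by (rule SUP_least)
  also have "... < \<infinity>" by simp
  finally show "(SUP h\<in>{0<..1}. sobolev_norm (1/4) ({-T<..<T} \<times> UNIV) (%t. rho \<psi> h (R h t))) < \<infinity>" .
 qed
qed

end
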